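(* Let $0\le\gamma\le1$ and let $\Delta_N$ be the spectral gap defined in the context. Let $$A_N=\frac{p(N)+\gamma\,q(N)}{r(N)},$$ $$p(N)=5N^7+31N^6+15N^5+131N^4+256N^3-102N^2,$$ $$q(N)=5N^7-5N^6-87N^5-211N^4-164N^3+78N^2,$$ $$r(N)=(N^2+4N-12)(N-1)^3(N+1)(N-2),$$ and $$C_N=\sqrt{15}\,\frac{1-\gamma}{(N-1)^2}\,N^{5/2}\left[\frac{2}{N-1}+\frac{8N}{(N-2)(N-4)^2}\right]^{1/2}\left(1-\frac{15}{(N+1)(N+3)}\right)^{-1/2}.$$ Then for all $N\ge3$ with $N\neq4$, $$\Delta_N\ \ge\ \left(1-\frac{A_N+C_N}{N^2}\right)\Delta_{N-1}.$$ Moreover, for every integer $N_0\ge5$ such that $A_N+C_N<N^2$ for all $N\ge N_0$ (which is true for all sufficiently large $N_0$), one has for all $N\ge N_0$ $$\Delta_N\ \ge\ 4N_0^{\gamma-1}\left(\prod_{j=3}^{N_0}\left[1-\frac{4j+1}{(j-1)^2(j+1)}\right]\right)\prod_{j=N_0}^{N}\left(1-\frac{A_j+C_j}{j^2}\right)\ >\ 0 .$$ In particular, $\liminf_{N\to\infty}\Delta_N>0$.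
   Context: Fix $\gamma\in[0,1]$. For $N\ge 2$ let $S^{N-1}(\sqrt N)=\{v\in\mathbb R^N:\sum_{j=1}^N v_j^2=N\}$ with the uniform probability measure $\sigma$; inner product $\langle\cdot,\cdot\rangle$ and norm $\|\cdot\|_2$ are those of $L^2(S^{N-1}(\sqrt N),\sigma)$. For $i<j$ and an angle $\theta$ let $R_{i,j,\theta}v$ be the vector with $i$-th coordinate $v_i\cos\theta+v_j\sin\theta$, $j$-th coordinate $-v_i\sin\theta+v_j\cos\theta$, and all other coordinates equal to those of $v$. Put $[f]^{(i,j)}(v)=\frac1{2\pi}\int_{-\pi}^{\pi}f(R_{i,j,\theta}v)\,d\theta$ and $$\mathcal E_N(f,f)=N\binom N2^{-1}\sum_{i<j}\int_{S^{N-1}(\sqrt N)}(v_i^2+v_j^2)^\gamma\,(f-[f]^{(i,j)})^2\,d\sigma .$$ Then $$\Delta_N=\inf\{\mathcal E_N(f,f):\ \|f\|_2=1,\ \langle f,1\rangle=0,\ f\text{ symmetric under permutations of coordinates}\}.$$ *)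

theory Defs
  imports "HOL-Probability.Probability"
begin

text \<open>
  The dimension \<open>N\<close> varies inside the statements below, so a vector of \<open>\<real>\<^sup>N\<close> is an extensional
  function \<open>v :: nat \<Rightarrow> real\<close> on \<open>{1..N}\<close>, that is, a point of \<open>Pi\<^sub>M {1..N} (\<lambda>_. lborel)\<close>.
\<close>

definition vec_norm :: "nat \<Rightarrow> (nat \<Rightarrow> real) \<Rightarrow> real" where
  "vec_norm N v = sqrt (\<Sum>j\<in>{1..N}. (v j)\<^sup>2)"

definition kac_sphere :: "nat \<Rightarrow> (nat \<Rightarrow> real) set" where
  "kac_sphere N = {v \<in> {1..N} \<rightarrow>\<^sub>E UNIV. (\<Sum>j\<in>{1..N}. (v j)\<^sup>2) = real N}"

definition unit_ball_vec :: "nat \<Rightarrow> (nat \<Rightarrow> real) set" where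
  "unit_ball_vec N = {v \<in> {1..N} \<rightarrow>\<^sub>E UNIV. vec_norm N v \<le> 1}"

definition sphere_proj :: "nat \<Rightarrow> (nat \<Rightarrow> real) \<Rightarrow> (nat \<Rightarrow> real)" where
  "sphere_proj N v = (\<lambda>j\<in>{1..N}. sqrt (real N) * v j / vec_norm N v)"

text \<open>
  The uniform probability measure on the sphere, as normalised cone measure: the measure of \<open>A\<close>
  is the proportion of the volume of the unit ball occupied by the cone over \<open>A\<close>. The origin,
  which has no radial projection, is a null set; \<open>sphere_proj\<close> sends it off the sphere.
\<close>
definition sphere_measure :: "nat \<Rightarrow> (nat \<Rightarrow> real) measure" where
  "sphere_measure N =
     restrict_space
       (distr (uniform_measure (Pi\<^sub>M {1..N} (\<lambda>_. lborel)) (unit_ball_vec N))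
              (Pi\<^sub>M {1..N} (\<lambda>_. borel)) (sphere_proj N))
       (kac_sphere N)"

lemma kac_sphere_in_sets: "kac_sphere N \<in> sets (Pi\<^sub>M {1..N} (\<lambda>_. borel))"
proof -
  have "kac_sphere N = {v \<in> space (Pi\<^sub>M {1..N} (\<lambda>_. borel)). (\<Sum>j\<in>{1..N}. (v j)\<^sup>2) = real N}"
    by (auto simp: kac_sphere_def space_PiM)
  also have "\<dots> \<in> sets (Pi\<^sub>M {1..N} (\<lambda>_. borel))"
    by measurable
  finally show ?thesis .
qed

lemma space_sphere_measure: "space (sphere_measure N) = kac_sphere N"
  by (auto simp: sphere_measure_def space_restrict_space space_PiM kac_sphere_def)

lemma prob_space_sphere_measure:
  assumes "N \<ge> 1"
  shows "prob_space (sphere_measure N)"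
proof -
  let ?P = "Pi\<^sub>M {1..N} (\<lambda>_. lborel :: real measure)"
  let ?U = "uniform_measure ?P (unit_ball_vec N)"
  let ?B = "Pi\<^sub>M {1..N} (\<lambda>_. borel :: real measure)"
  let ?D = "distr ?U ?B (sphere_proj N)"
  let ?O = "Pi\<^sub>E {1..N} (\<lambda>_. {0 :: real})"
  interpret product_sigma_finite "\<lambda>_::nat. lborel :: real measure"
    by standard
  have ball: "unit_ball_vec N = {f. sqrt (\<Sum>i\<in>{1..N}. (f i)\<^sup>2) \<le> 1} \<inter> space ?P"
    by (auto simp: unit_ball_vec_def vec_norm_def space_PiM)
  have ball_vol: "emeasure ?P (unit_ball_vec N) = ennreal (unit_ball_vol (real N))"
    using emeasure_cball_aux[of "{1..N}" 1] by (simp add: ball)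
  have "unit_ball_vol (real N) > 0" by simp
  then have ball_pos: "emeasure ?P (unit_ball_vec N) \<noteq> 0"
    unfolding ball_vol by (simp add: ennreal_eq_0_iff del: unit_ball_vol_pos)
  have ball_fin: "emeasure ?P (unit_ball_vec N) \<noteq> \<infinity>"
    unfolding ball_vol by simp
  have ball_sets: "unit_ball_vec N \<in> sets ?P"
    using ball_pos emeasure_notin_sets by blast
  interpret U: prob_space ?U
    by (rule prob_space_uniform_measure[OF ball_pos ball_fin])
  have proj: "sphere_proj N \<in> measurable ?U ?B"
    unfolding sphere_proj_def vec_norm_def by measurable
  interpret D: prob_space ?D
    by (rule U.prob_space_distr[OF proj])
  have "emeasure ?P ?O = 0"
    using assms by (subst emeasure_PiM) (auto simp: prod_zero_iff)
  moreover have "?O \<in> sets ?P" by (rule sets_PiM_I_finite) auto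
  ultimately have "?O \<in> null_sets ?P" by auto
  then have "AE v in ?P. v \<notin> ?O" by (rule AE_not_in)
  then have AE0: "AE v in ?U. v \<notin> ?O"
    using ball_sets by (intro AE_uniform_measureI) auto
  have "AE v in ?U. sphere_proj N v \<in> kac_sphere N"
    using AE0 AE_space
  proof eventually_elim
    case (elim v)
    have v: "v \<in> {1..N} \<rightarrow>\<^sub>E UNIV" using elim(2) by (simp add: space_PiM)
    have "\<exists>j\<in>{1..N}. v j \<noteq> 0"
    proof (rule ccontr)
      assume "\<not> ?thesis"
      then have "v \<in> ?O" using v by (force simp: PiE_iff extensional_def)
      with elim(1) show False by simp
    qed
    then have pos: "(\<Sum>j\<in>{1..N}. (v j)\<^sup>2) > 0"
      by (metis (no_types, lifting) finite_atLeastAtMost sum_pos2 zero_le_power2 zero_less_power2)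
    have "(\<Sum>j\<in>{1..N}. (sphere_proj N v j)\<^sup>2) =
          (\<Sum>j\<in>{1..N}. real N / (\<Sum>j\<in>{1..N}. (v j)\<^sup>2) * (v j)\<^sup>2)"
      using pos by (intro sum.cong)
        (auto simp: sphere_proj_def vec_norm_def power_divide power_mult_distrib)
    also have "\<dots> = real N"
      using pos by (subst sum_distrib_left[symmetric]) simp
    finally show ?case by (auto simp: kac_sphere_def sphere_proj_def)
  qed
  moreover have "{v \<in> space ?B. v \<in> kac_sphere N} \<in> sets ?B"
    using kac_sphere_in_sets[of N] sets.sets_into_space[OF kac_sphere_in_sets[of N]]
    by (simp add: Collect_conj_eq Int_absorb1 del: One_nat_def)
  ultimately have "AE v in ?D. v \<in> kac_sphere N"
    using proj by (simp add: AE_distr_iff del: One_nat_def)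
  then have "emeasure ?D (kac_sphere N) = 1"
    using kac_sphere_in_sets[of N] by (intro D.emeasure_eq_1_AE) auto
  moreover have "kac_sphere N \<inter> space ?D \<in> sets ?D" "kac_sphere N \<subseteq> space ?D"
    using kac_sphere_in_sets[of N] sets.sets_into_space[OF kac_sphere_in_sets[of N]] by auto
  ultimately show ?thesis
    by (intro prob_spaceI)
      (simp add: sphere_measure_def space_restrict_space emeasure_restrict_space Int_absorb2)
qed

text \<open>Elements of \<open>L\<^sup>2\<close> are represented by functions; equality in \<open>L\<^sup>2\<close> is equality almost everywhere.\<close>

definition L2_fun :: "nat \<Rightarrow> ((nat \<Rightarrow> real) \<Rightarrow> real) \<Rightarrow> bool" where
  "L2_fun N f \<longleftrightarrow> f \<in> borel_measurable (sphere_measure N) \<and>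
     integrable (sphere_measure N) (\<lambda>v. (f v)\<^sup>2)"

definition L2_inner :: "nat \<Rightarrow> ((nat \<Rightarrow> real) \<Rightarrow> real) \<Rightarrow> ((nat \<Rightarrow> real) \<Rightarrow> real) \<Rightarrow> real" where
  "L2_inner N f g = (LINT v|sphere_measure N. f v * g v)"

definition L2_nrm :: "nat \<Rightarrow> ((nat \<Rightarrow> real) \<Rightarrow> real) \<Rightarrow> real" where
  "L2_nrm N f = sqrt (L2_inner N f f)"

definition symmetric_fun :: "nat \<Rightarrow> ((nat \<Rightarrow> real) \<Rightarrow> real) \<Rightarrow> bool" where
  "symmetric_fun N f \<longleftrightarrow>
     (\<forall>\<pi>. \<pi> permutes {1..N} \<longrightarrow> (AE v in sphere_measure N. f (v \<circ> \<pi>) = f v))"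

definition rot :: "nat \<Rightarrow> nat \<Rightarrow> real \<Rightarrow> (nat \<Rightarrow> real) \<Rightarrow> (nat \<Rightarrow> real)" where
  "rot i j \<theta> v = v(i := v i * cos \<theta> + v j * sin \<theta>, j := - v i * sin \<theta> + v j * cos \<theta>)"

definition rot_avg :: "nat \<Rightarrow> nat \<Rightarrow> ((nat \<Rightarrow> real) \<Rightarrow> real) \<Rightarrow> (nat \<Rightarrow> real) \<Rightarrow> real" where
  "rot_avg i j f v = 1 / (2 * pi) * (LBINT \<theta>:{-pi..pi}. f (rot i j \<theta> v))"

text \<open>
  Note that \<open>0 powr 0 = 0\<close>; for \<open>\<gamma> = 0\<close> this changes the weight only where \<open>v i = v j = 0\<close>,
  a null set of the sphere.
\<close>
definition dirichlet_form :: "real \<Rightarrow> nat \<Rightarrow> ((nat \<Rightarrow> real) \<Rightarrow> real) \<Rightarrow> real" where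
  "dirichlet_form \<gamma> N f =
     real N * inverse (real (N choose 2)) *
     (\<Sum>(i, j) \<in> {(i, j). i \<in> {1..N} \<and> j \<in> {1..N} \<and> i < j}.
        LINT v|sphere_measure N. ((v i)\<^sup>2 + (v j)\<^sup>2) powr \<gamma> * (f v - rot_avg i j f v)\<^sup>2)"

definition spectral_gap :: "real \<Rightarrow> nat \<Rightarrow> real" where
  "spectral_gap \<gamma> N =
     Inf {dirichlet_form \<gamma> N f | f.
            L2_fun N f \<and> L2_nrm N f = 1 \<and> L2_inner N f (\<lambda>_. 1) = 0 \<and> symmetric_fun N f}"

definition p_poly :: "real \<Rightarrow> real" where
  "p_poly x = 5 * x^7 + 31 * x^6 + 15 * x^5 + 131 * x^4 + 256 * x^3 - 102 * x^2"

definition q_poly :: "real \<Rightarrow> real" where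
  "q_poly x = 5 * x^7 - 5 * x^6 - 87 * x^5 - 211 * x^4 - 164 * x^3 + 78 * x^2"

definition r_poly :: "real \<Rightarrow> real" where
  "r_poly x = (x^2 + 4 * x - 12) * (x - 1)^3 * (x + 1) * (x - 2)"

definition A_const :: "real \<Rightarrow> nat \<Rightarrow> real" where
  "A_const \<gamma> N = (p_poly (real N) + \<gamma> * q_poly (real N)) / r_poly (real N)"

definition C_const :: "real \<Rightarrow> nat \<Rightarrow> real" where
  "C_const \<gamma> N =
     sqrt 15 * ((1 - \<gamma>) / (real N - 1)^2) * real N powr (5/2) *
     (2 / (real N - 1) + 8 * real N / ((real N - 2) * (real N - 4)^2)) powr (1/2) *
     (1 - 15 / ((real N + 1) * (real N + 3))) powr (-1/2)"

end

(*
  Conditioning a symmetric f of mean zero on its last coordinate expresses the Dirichlet form in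
  dimension N through the one in dimension N - 1: on the slice v_N = x the sphere has squared
  radius N - x^2, so the gap on the slice is Delta_{N-1} times w(x)^gamma with
  w(x) = (N - x^2) / (N - 1), and symmetry makes all coordinates equivalent. What has to be shown
  is that the conditional variance, weighted by w^gamma, loses little against the variance of f.
  The loss comes from phi(v_k) = E(f | v_k). The operator "condition a function of v_1 on v_2" is
  self-adjoint and does not raise the degree of polynomials; away from 1 and x^2 - 1 its norm is
  3 / (N^2 - 1). This controls the sum s of the phi(v_k) in L^2, the direction x^2 - 1 being
  harmless because the sum of the v_k^2 is constant. The weight satisfies
  w^gamma >= 1 + gamma (w - 1) - (1 - gamma) (w - 1)^2; its affine part sums to a constant over
  the coordinates, and the quadratic part is estimated by splitting f into s and f - s.
  Iterating the resulting recursion from a fixed dimension gives a convergent positive product; the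
  fixed dimension is reached through the sharper recursion for gamma = 1, starting from the circle.
*)

theory Submission
  imports Defs "HOL-Real_Asymp.Real_Asymp"
begin

text \<open>In the recursion the loss has to be F (1 + O(1/N)), F being the squared norm of f: one
  unit of F turns N into N - 1, and only a further loss of relative order 1/N^2 gives a convergent
  product. For \<gamma> < 1 there are two losses of full size. The variance explained by one
  coordinate costs about t = <f, s>, which may be close to F; the quadratic part of the weight,
  summed over the coordinates, is about 1 and could cost another F. Bounded separately they allow
  2F, and the product would tend to 0. With h = f - s the quadratic part costs about the squared
  norm of h, while its effect on s is of order t/N; and that norm is F - t up to order t/N, so the
  two losses together are about F. The number 3 / (N^2 - 1) is a fourth moment, E w_1^4 / n^2 on the
  slice with n = N - 1. The eigenvalue on x^2 - 1 is -1/n, larger in size but negative, so it cannot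
  increase the norm of s. The loss obtained differs in form from A_N + C_N; a numerical comparison
  for N >= 5 shows that it is no larger. At N = 4 a denominator of C_N vanishes.\<close>

declare One_nat_def [simp del]

section \<open>The uniform measure carried by the whole product space\<close>

abbreviation bor :: "nat \<Rightarrow> (nat \<Rightarrow> real) measure" where
  "bor n \<equiv> Pi\<^sub>M {1..n} (\<lambda>_. borel)"

abbreviation leb :: "nat \<Rightarrow> (nat \<Rightarrow> real) measure" where
  "leb n \<equiv> Pi\<^sub>M {1..n} (\<lambda>_. lborel)"

text \<open>\<open>sphere_measure\<close> before its restriction to the sphere. The sigma-algebra is
  the full product algebra, so measurability, image measures and slicing involve no restricted
  spaces; for n >= 1 the complement of the sphere is null.\<close>

definition sph :: "nat \<Rightarrow> (nat \<Rightarrow> real) measure" where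
  "sph n = distr (uniform_measure (leb n) (unit_ball_vec n)) (bor n) (sphere_proj n)"

lemma sphere_measure_eq: "sphere_measure n = restrict_space (sph n) (kac_sphere n)"
  by (simp add: sphere_measure_def sph_def)

lemma sets_leb: "sets (leb n) = sets (bor n)"
  by (intro sets_PiM_cong) auto

lemma space_leb: "space (leb n) = space (bor n)"
  by (simp add: space_PiM)

lemma meas_leb: "measurable (leb n) M = measurable (bor n) M"
  by (intro measurable_cong_sets sets_leb refl)

lemma meas_unif: "measurable (uniform_measure (leb n) A) M = measurable (bor n) M"
  by (intro measurable_cong_sets) (auto simp: sets_leb)

lemma sets_sph [measurable_cong]: "sets (sph n) = sets (bor n)"
  by (simp add: sph_def)

lemma space_sph: "space (sph n) = space (bor n)"
  by (simp add: sph_def)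

lemma vec_norm_measurable [measurable]: "vec_norm n \<in> borel_measurable (bor n)"
  unfolding vec_norm_def by measurable

lemma sphere_proj_measurable [measurable]: "sphere_proj n \<in> measurable (bor n) (bor n)"
  unfolding sphere_proj_def by measurable

lemma unit_ball_vec_eq: "unit_ball_vec n = {f. sqrt (\<Sum>i\<in>{1..n}. (f i)\<^sup>2) \<le> 1} \<inter> space (leb n)"
  by (auto simp: unit_ball_vec_def vec_norm_def space_PiM)

lemma unit_ball_vec_sets [measurable]: "unit_ball_vec n \<in> sets (bor n)"
proof -
  have "unit_ball_vec n = {v \<in> space (bor n). vec_norm n v \<le> 1}"
    by (auto simp: unit_ball_vec_def space_PiM)
  then show ?thesis by simp
qed

lemma ball_vol: 
  assumes "r > 0"
  shows "emeasure (leb n) {v \<in> space (bor n). vec_norm n v \<le> r} = ennreal (unit_ball_vol (real n) * r ^ n)"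
proof -
  have "{v \<in> space (bor n). vec_norm n v \<le> r} = {f. sqrt (\<Sum>i\<in>{1..n}. (f i)\<^sup>2) \<le> r} \<inter> space (leb n)"
    by (auto simp: vec_norm_def space_PiM)
  then show ?thesis
    using emeasure_cball_aux[of "{1..n}" r] assms by simp
qed

lemma unit_ball_vol_leb: "emeasure (leb n) (unit_ball_vec n) = ennreal (unit_ball_vol (real n))"
  using emeasure_cball_aux[of "{1..n}" 1] by (simp add: unit_ball_vec_eq)

lemma unit_ball_pos: "emeasure (leb n) (unit_ball_vec n) \<noteq> 0"
  unfolding unit_ball_vol_leb by (simp add: ennreal_eq_0_iff not_le)

lemma unit_ball_fin: "emeasure (leb n) (unit_ball_vec n) \<noteq> \<infinity>"
  unfolding unit_ball_vol_leb by simp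

lemma prob_space_sph: "prob_space (sph n)"
proof -
  interpret U: prob_space "uniform_measure (leb n) (unit_ball_vec n)"
    by (rule prob_space_uniform_measure[OF unit_ball_pos unit_ball_fin])
  show ?thesis
    unfolding sph_def by (rule U.prob_space_distr) (simp add: meas_unif)
qed

lemma AE_sph_kac:
  assumes "n \<ge> 1"
  shows "AE v in sph n. v \<in> kac_sphere n"
proof -
  interpret prob_space "sph n" by (rule prob_space_sph)
  interpret S: prob_space "sphere_measure n" by (rule prob_space_sphere_measure[OF assms])
  have k: "kac_sphere n \<in> sets (sph n)" using kac_sphere_in_sets by (simp add: sets_sph)
  have sub: "kac_sphere n \<subseteq> space (sph n)" using sets.sets_into_space[OF k] .
  have "1 = emeasure (sphere_measure n) (kac_sphere n)"
    using S.emeasure_space_1 by (simp add: space_sphere_measure)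
  also have "\<dots> = emeasure (sph n) (kac_sphere n)"
    unfolding sphere_measure_eq using k sub
    by (subst emeasure_restrict_space) (auto simp: Int_absorb2)
  finally have "emeasure (sph n) (kac_sphere n) = 1" ..
  then have "prob (kac_sphere n) = 1" by (simp add: measure_def)
  then show ?thesis using k by (simp add: prob_eq_1)
qed

lemma nn_integral_sph:
  assumes [measurable]: "F \<in> borel_measurable (bor n)"
  shows "(\<integral>\<^sup>+v. F v \<partial>sph n) =
    (\<integral>\<^sup>+y. F (sphere_proj n y) * indicator (unit_ball_vec n) y \<partial>leb n) / ennreal (unit_ball_vol (real n))"
  unfolding sph_def
  by (subst nn_integral_distr, simp add: meas_unif, simp)
     (subst nn_integral_uniform_measure, auto simp: meas_leb sets_leb unit_ball_vol_leb)

lemma AE_leb_norm_pos: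
  assumes "n \<ge> 1"
  shows "AE y in leb n. vec_norm n y > 0"
proof -
  interpret product_sigma_finite "\<lambda>_::nat. lborel :: real measure" by standard
  let ?O = "Pi\<^sub>E {1..n} (\<lambda>_. {0 :: real})"
  have "emeasure (leb n) ?O = 0"
    using assms by (subst emeasure_PiM) (auto simp: prod_zero_iff)
  moreover have "?O \<in> sets (leb n)" by (rule sets_PiM_I_finite) auto
  ultimately have "?O \<in> null_sets (leb n)" by auto
  then have "AE v in leb n. v \<notin> ?O" by (rule AE_not_in)
  then show ?thesis using AE_space
  proof eventually_elim
    case (elim v)
    have v: "v \<in> {1..n} \<rightarrow>\<^sub>E UNIV" using elim(2) by (simp add: space_PiM)
    have "\<exists>j\<in>{1..n}. v j \<noteq> 0"
    proof (rule ccontr)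
      assume "\<not> ?thesis"
      then have "v \<in> ?O" using v by (force simp: PiE_iff extensional_def)
      with elim(1) show False by simp
    qed
    then have "(\<Sum>j\<in>{1..n}. (v j)\<^sup>2) > 0"
      by (metis (no_types, lifting) finite_atLeastAtMost sum_pos2 zero_le_power2 zero_less_power2)
    then show ?case by (simp add: vec_norm_def)
  qed
qed

subsection \<open>Scaling and polar coordinates\<close>

definition scl :: "nat \<Rightarrow> real \<Rightarrow> (nat \<Rightarrow> real) \<Rightarrow> nat \<Rightarrow> real" where
  "scl n c y = (\<lambda>j\<in>{1..n}. c * y j)"

lemma scl_measurable [measurable]: "scl n c \<in> measurable (bor n) (bor n)"
  unfolding scl_def by measurable

lemma vec_norm_scl: "vec_norm n (scl n c y) = \<bar>c\<bar> * vec_norm n y"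
proof -
  have "(\<Sum>j\<in>{1..n}. (scl n c y j)\<^sup>2) = c\<^sup>2 * (\<Sum>j\<in>{1..n}. (y j)\<^sup>2)"
    by (subst sum_distrib_left) (auto intro!: sum.cong simp: scl_def power_mult_distrib)
  then show ?thesis by (simp add: vec_norm_def real_sqrt_mult)
qed

lemma sphere_proj_scl: "c > 0 \<Longrightarrow> sphere_proj n (scl n c y) = sphere_proj n y"
  unfolding sphere_proj_def vec_norm_scl by (auto simp: scl_def fun_eq_iff restrict_def)

text \<open>One-dimensional scaling in each of the n coordinates, checked on boxes.\<close>

lemma emeasure_leb_scl:
  assumes c: "c > 0" and A [measurable]: "A \<in> sets (bor n)"
  shows "emeasure (leb n) A = ennreal (c ^ n) * emeasure (leb n) {y \<in> space (bor n). scl n c y \<in> A}"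
proof -
  interpret product_sigma_finite "\<lambda>_::nat. lborel :: real measure" by standard
  let ?P = "density (distr (leb n) (bor n) (scl n c)) (\<lambda>_. ennreal (c ^ n))"
  have [measurable]: "scl n c \<in> measurable (leb n) (bor n)" by (simp add: meas_leb)
  have 1: "emeasure lborel {x. c * x \<in> B} = ennreal (inverse c) * emeasure lborel B"
    if "B \<in> sets lborel" for B :: "real set"
  proof -
    have "emeasure lborel {x. c * x \<in> B} = emeasure (distr lborel borel ((*) c)) B"
      using that by (subst emeasure_distr) (auto simp: vimage_def)
    also have "\<dots> = ennreal (inverse c) * emeasure lborel B"
      using c that by (subst lborel_distr_mult) (auto simp: emeasure_density_const)
    finally show ?thesis .
  qed
  have "?P = leb n"
  proof (rule PiM_eqI)
    fix B :: "nat \<Rightarrow> real set" assume B: "\<And>i. i \<in> {1..n} \<Longrightarrow> B i \<in> sets lborel"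
    have [measurable]: "Pi\<^sub>E {1..n} B \<in> sets (bor n)"
      using B by (intro sets_PiM_I_finite) auto
    have "scl n c -` Pi\<^sub>E {1..n} B \<inter> space (leb n) = Pi\<^sub>E {1..n} (\<lambda>i. {x. c * x \<in> B i})"
      by (auto simp: space_PiM scl_def PiE_iff)
    then have "emeasure ?P (Pi\<^sub>E {1..n} B) = ennreal (c ^ n) * emeasure (leb n) (Pi\<^sub>E {1..n} (\<lambda>i. {x. c * x \<in> B i}))"
      by (subst emeasure_density_const) (auto simp: emeasure_distr)
    also have "emeasure (leb n) (Pi\<^sub>E {1..n} (\<lambda>i. {x. c * x \<in> B i})) = (\<Prod>i\<in>{1..n}. emeasure lborel {x. c * x \<in> B i})"
    proof (rule emeasure_PiM, simp)
      fix i assume "i \<in> {1..n}"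
      then have [measurable]: "B i \<in> sets borel" using B by simp
      show "{x. c * x \<in> B i} \<in> sets lborel" by simp
    qed
    also have "\<dots> = (\<Prod>i\<in>{1..n}. ennreal (inverse c) * emeasure lborel (B i))"
      using B 1 by (intro prod.cong) auto
    also have "\<dots> = ennreal (inverse c ^ n) * (\<Prod>i\<in>{1..n}. emeasure lborel (B i))"
      using c by (simp add: prod.distrib ennreal_power)
    also have "ennreal (c ^ n) * \<dots> = (\<Prod>i\<in>{1..n}. emeasure lborel (B i))"
      using c by (simp add: mult.assoc[symmetric] ennreal_mult''[symmetric] power_inverse)
    finally show "emeasure ?P (Pi\<^sub>E {1..n} B) = (\<Prod>i\<in>{1..n}. emeasure lborel (B i))" .
  qed (auto simp: sets_leb)
  then have "emeasure (leb n) A = emeasure ?P A" by simp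
  also have "\<dots> = ennreal (c ^ n) * emeasure (leb n) (scl n c -` A \<inter> space (leb n))"
    by (subst emeasure_density_const) (auto simp: emeasure_distr)
  also have "scl n c -` A \<inter> space (leb n) = {y \<in> space (bor n). scl n c y \<in> A}"
    by (auto simp: space_leb)
  finally show ?thesis .
qed

text \<open>Independence of radius and direction, on balls. For r > 0 scaling by r leaves directions
  fixed and reduces to the unit ball, where the ratio of volumes is the definition of
  \<open>sph\<close>.\<close>

lemma emeasure_cone:
  assumes B [measurable]: "B \<in> sets (bor n)" and n: "n \<ge> 1"
  shows "emeasure (leb n) {y \<in> space (bor n). vec_norm n y \<le> r \<and> sphere_proj n y \<in> B}
    = emeasure (leb n) {y \<in> space (bor n). vec_norm n y \<le> r} * emeasure (sph n) B"
proof (cases "r > 0")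
  case True
  let ?V = "ennreal (unit_ball_vol (real n))"
  have V: "?V \<noteq> 0" "?V \<noteq> \<infinity>" using unit_ball_pos[of n] unit_ball_vol_leb[of n] by auto
  have "{y \<in> space (bor n). scl n r y \<in> {y \<in> space (bor n). vec_norm n y \<le> r \<and> sphere_proj n y \<in> B}}
     = {y \<in> space (bor n). vec_norm n y \<le> 1 \<and> sphere_proj n y \<in> B}"
    using True by (auto simp: vec_norm_scl sphere_proj_scl) (auto simp: scl_def space_PiM)
  moreover have "{y \<in> space (bor n). vec_norm n y \<le> r \<and> sphere_proj n y \<in> B} \<in> sets (bor n)"
    by measurable
  ultimately have 1: "emeasure (leb n) {y \<in> space (bor n). vec_norm n y \<le> r \<and> sphere_proj n y \<in> B}
     = ennreal (r ^ n) * emeasure (leb n) {y \<in> space (bor n). vec_norm n y \<le> 1 \<and> sphere_proj n y \<in> B}"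
    using emeasure_leb_scl[OF True, of "{y \<in> space (bor n). vec_norm n y \<le> r \<and> sphere_proj n y \<in> B}"] by simp
  have C: "{y \<in> space (bor n). sphere_proj n y \<in> B} \<in> sets (bor n)" by measurable
  have "sphere_proj n -` B \<inter> space (uniform_measure (leb n) (unit_ball_vec n)) = {y \<in> space (bor n). sphere_proj n y \<in> B}"
    by (auto simp: space_leb)
  then have "emeasure (sph n) B = emeasure (leb n) (unit_ball_vec n \<inter> {y \<in> space (bor n). sphere_proj n y \<in> B}) / ?V"
    unfolding sph_def unit_ball_vol_leb[symmetric] using C
    by (subst emeasure_distr, simp add: meas_unif, simp)
       (subst emeasure_uniform_measure, auto simp: sets_leb)
  also have "unit_ball_vec n \<inter> {y \<in> space (bor n). sphere_proj n y \<in> B} = {y \<in> space (bor n). vec_norm n y \<le> 1 \<and> sphere_proj n y \<in> B}"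
    by (auto simp: unit_ball_vec_def space_PiM)
  finally have fin: "emeasure (sph n) B * ?V = emeasure (leb n) {y \<in> space (bor n). vec_norm n y \<le> 1 \<and> sphere_proj n y \<in> B}"
    using V by (simp add: ennreal_divide_times)
  then show ?thesis
    unfolding 1 ball_vol[OF True] fin[symmetric] using True
    by (simp add: ennreal_mult'' mult_ac)
next
  case False
  \<comment> \<open>For r <= 0 the ball contains at most the origin, so both sides vanish.\<close>
  have null: "{y \<in> space (bor n). vec_norm n y \<le> r} \<in> null_sets (leb n)"
  proof -
    have "AE y in leb n. y \<notin> {y \<in> space (bor n). vec_norm n y \<le> r}"
      using AE_leb_norm_pos[OF n] by eventually_elim (use False in auto)
    then show ?thesis by (subst AE_iff_null_sets) (auto simp: sets_leb)
  qed
  have "{y \<in> space (bor n). vec_norm n y \<le> r \<and> sphere_proj n y \<in> B} \<in> null_sets (leb n)"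
    by (rule null_sets_subset[OF null]) (auto simp: sets_leb)
  then show ?thesis using null by (auto dest: null_setsD1 simp: null_setsD1[OF null])
qed

lemma sigma_finite_norm: 
  assumes "n \<ge> 1"
  shows "sigma_finite_measure (distr (leb n) borel (vec_norm n))"
proof
  have [measurable]: "vec_norm n \<in> borel_measurable (leb n)" by (simp add: meas_leb)
  have "emeasure (distr (leb n) borel (vec_norm n)) {..real (Suc i)} \<noteq> \<infinity>" for i
    using ball_vol[of "real (Suc i)" n]
    by (subst emeasure_distr) (auto simp: space_leb vimage_def Int_def conj_commute)
  then show "\<exists>A. countable A \<and> A \<subseteq> sets (distr (leb n) borel (vec_norm n)) \<and> \<Union> A = space (distr (leb n) borel (vec_norm n)) \<and> (\<forall>a\<in>A. emeasure (distr (leb n) borel (vec_norm n)) a \<noteq> \<infinity>)"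
  proof (intro exI[of _ "range (\<lambda>i. {..real (Suc i)})"] conjI)
    show "\<Union> (range (\<lambda>i. {..real (Suc i)})) = space (distr (leb n) borel (vec_norm n))"
    proof safe
      fix x :: real
      obtain i where "x \<le> real i" using real_arch_simple by blast
      then show "x \<in> \<Union> (range (\<lambda>i. {..real (Suc i)}))" by (auto intro!: exI[of _ i])
    qed auto
  qed auto
qed

text \<open>Polar coordinates without a Jacobian: the radial law remains an abstract image measure,
  and what matters is its independence of the direction. This is \<open>emeasure_cone\<close>,
  extended from balls to all Borel sets of radii.\<close>

lemma polar_measure:
  assumes n: "n \<ge> 1"
  shows "distr (leb n) borel (vec_norm n) \<Otimes>\<^sub>M sph n =
         distr (leb n) (borel \<Otimes>\<^sub>M bor n) (\<lambda>y. (vec_norm n y, sphere_proj n y))"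
proof (rule pair_measure_eqI)
  interpret prob_space "sph n" by (rule prob_space_sph)
  show "sigma_finite_measure (sph n)" by unfold_locales
  show "sigma_finite_measure (distr (leb n) borel (vec_norm n))" by (rule sigma_finite_norm[OF n])
  have [measurable]: "vec_norm n \<in> borel_measurable (leb n)" "sphere_proj n \<in> measurable (leb n) (bor n)"
    by (simp_all add: meas_leb)
  show "sets (distr (leb n) borel (vec_norm n) \<Otimes>\<^sub>M sph n) = sets (distr (leb n) (borel \<Otimes>\<^sub>M bor n) (\<lambda>y. (vec_norm n y, sphere_proj n y)))"
    by (simp add: sets_sph cong: sets_pair_measure_cong)
  fix A B assume A: "A \<in> sets (distr (leb n) borel (vec_norm n))" and B: "B \<in> sets (sph n)"
  have [measurable]: "A \<in> sets borel" "B \<in> sets (bor n)" using A B by (auto simp: sets_sph)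
  let ?B = "{y \<in> space (bor n). sphere_proj n y \<in> B}"
  let ?M = "density (distr (leb n) borel (vec_norm n)) (\<lambda>_. emeasure (sph n) B)"
  let ?N = "distr (density (leb n) (indicator ?B)) borel (vec_norm n)"
  have [measurable]: "?B \<in> sets (leb n)" by (simp add: sets_leb)
  have N: "emeasure ?N C = emeasure (leb n) {y \<in> space (bor n). vec_norm n y \<in> C \<and> sphere_proj n y \<in> B}"
    if [measurable]: "C \<in> sets borel" for C
  proof -
    have "emeasure ?N C = emeasure (density (leb n) (indicator ?B)) (vec_norm n -` C \<inter> space (leb n))"
      by (subst emeasure_distr) auto
    also have "\<dots> = emeasure (leb n) (?B \<inter> (vec_norm n -` C \<inter> space (leb n)))"
      by (subst emeasure_density) (auto simp: nn_integral_indicator[symmetric] indicator_inter_arith[symmetric] simp del: nn_integral_indicator intro!: nn_integral_cong)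
    also have "?B \<inter> (vec_norm n -` C \<inter> space (leb n)) = {y \<in> space (bor n). vec_norm n y \<in> C \<and> sphere_proj n y \<in> B}"
      by (auto simp: space_leb)
    finally show ?thesis .
  qed
  have M: "emeasure ?M C = emeasure (leb n) {y \<in> space (bor n). vec_norm n y \<in> C} * emeasure (sph n) B"
    if [measurable]: "C \<in> sets borel" for C
    by (subst emeasure_density_const)
       (auto simp: emeasure_distr space_leb vimage_def Int_def conj_commute mult.commute)
  \<comment> \<open>For fixed B both are measures in the radius; they agree on half-lines, a
    generating system stable under intersection on which they are finite.\<close>
  have "?M = ?N"
  proof (rule measure_eqI_generator_eq[where E="range (\<lambda>r::real. {..r})" and \<Omega>=UNIV and A="\<lambda>i. {..real (Suc i)}"])
    show "Int_stable (range (\<lambda>r::real. {..r}))" by (auto simp: Int_stable_def)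
    show "sets ?M = sigma_sets UNIV (range (\<lambda>r. {..r}))"
      unfolding borel_eq_atMost by (simp add: sets_measure_of)
    then show "sets ?N = sigma_sets UNIV (range (\<lambda>r. {..r}))" by simp
    show "(\<Union>i. {..real (Suc i)}) = UNIV"
    proof safe
      fix x :: real
      obtain i where "x \<le> real i" using real_arch_simple by blast
      then show "x \<in> \<Union> (range (\<lambda>i. {..real (Suc i)}))" by (auto intro!: exI[of _ i])
    qed auto
    show "emeasure ?M X = emeasure ?N X" if "X \<in> range (\<lambda>r::real. {..r})" for X
      using that emeasure_cone[OF \<open>B \<in> sets (bor n)\<close> n] by (auto simp: M N)
    show "emeasure ?M {..real (Suc i)} \<noteq> \<infinity>" for i
      using ball_vol[of "real (Suc i)" n] emeasure_finite[of B]
      by (auto simp: M ennreal_mult_eq_top_iff)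
  qed auto
  then have "emeasure (leb n) {y \<in> space (bor n). vec_norm n y \<in> A} * emeasure (sph n) B =
      emeasure (leb n) {y \<in> space (bor n). vec_norm n y \<in> A \<and> sphere_proj n y \<in> B}"
    unfolding M[OF \<open>A \<in> sets borel\<close>, symmetric] N[OF \<open>A \<in> sets borel\<close>, symmetric] by simp
  moreover have "vec_norm n -` A \<inter> space (leb n) = {y \<in> space (bor n). vec_norm n y \<in> A}"
    "(\<lambda>y. (vec_norm n y, sphere_proj n y)) -` (A \<times> B) \<inter> space (leb n) = {y \<in> space (bor n). vec_norm n y \<in> A \<and> sphere_proj n y \<in> B}"
    by (auto simp: space_leb)
  ultimately show "emeasure (distr (leb n) borel (vec_norm n)) A * emeasure (sph n) B =
     emeasure (distr (leb n) (borel \<Otimes>\<^sub>M bor n) (\<lambda>y. (vec_norm n y, sphere_proj n y))) (A \<times> B)"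
    by (simp add: emeasure_distr)
qed

lemma polar:
  assumes n: "n \<ge> 1" and [measurable]: "(\<lambda>(r, w). G r w) \<in> borel_measurable (borel \<Otimes>\<^sub>M bor n)"
  shows "(\<integral>\<^sup>+y. G (vec_norm n y) (sphere_proj n y) \<partial>leb n) =
         (\<integral>\<^sup>+z. (\<integral>\<^sup>+w. G (vec_norm n z) w \<partial>sph n) \<partial>leb n)"
proof -
  interpret prob_space "sph n" by (rule prob_space_sph)
  have [measurable]: "vec_norm n \<in> borel_measurable (leb n)" "sphere_proj n \<in> measurable (leb n) (bor n)"
    by (simp_all add: meas_leb)
  have "(\<integral>\<^sup>+y. G (vec_norm n y) (sphere_proj n y) \<partial>leb n) =
     (\<integral>\<^sup>+p. (case p of (r, w) \<Rightarrow> G r w) \<partial>distr (leb n) (borel \<Otimes>\<^sub>M bor n) (\<lambda>y. (vec_norm n y, sphere_proj n y)))"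
    by (subst nn_integral_distr) auto
  also have "\<dots> = (\<integral>\<^sup>+p. (case p of (r, w) \<Rightarrow> G r w) \<partial>(distr (leb n) borel (vec_norm n) \<Otimes>\<^sub>M sph n))"
    by (simp add: polar_measure[OF n])
  also have "\<dots> = (\<integral>\<^sup>+r. (\<integral>\<^sup>+w. G r w \<partial>sph n) \<partial>distr (leb n) borel (vec_norm n))"
    by (subst nn_integral_fst[symmetric]) auto
  also have "\<dots> = (\<integral>\<^sup>+z. (\<integral>\<^sup>+w. G (vec_norm n z) w \<partial>sph n) \<partial>leb n)"
    by (subst nn_integral_distr) auto
  finally show ?thesis .
qed

subsection \<open>Disintegration along the last coordinate\<close>

text \<open>Inserts x as last coordinate and rescales the point w of the sphere of squared radius n
  so that the result has squared norm n + 1. For x^2 > n + 1 the root of a negative number is taken;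
  such x are null for the law of a coordinate.\<close>

definition glue :: "nat \<Rightarrow> real \<Rightarrow> (nat \<Rightarrow> real) \<Rightarrow> nat \<Rightarrow> real" where
  "glue n x w = (\<lambda>j\<in>{1..Suc n}. if j = Suc n then x else sqrt ((real (Suc n) - x\<^sup>2) / real n) * w j)"

lemma glue_measurable [measurable]:
  "(\<lambda>(x, w). glue n x w) \<in> measurable (borel \<Otimes>\<^sub>M bor n) (bor (Suc n))"
  unfolding glue_def case_prod_beta
proof (rule measurable_restrict)
  fix j assume j: "j \<in> {1..Suc n}"
  show "(\<lambda>p. if j = Suc n then fst p else sqrt ((real (Suc n) - (fst p)\<^sup>2) / real n) * snd p j) \<in> borel_measurable (borel \<Otimes>\<^sub>M bor n)"
  proof (cases "j = Suc n")
    case False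
    then have "j \<in> {1..n}" using j by auto
    then have [measurable]: "(\<lambda>w. w j) \<in> borel_measurable (bor n)" by (rule measurable_component_singleton)
    show ?thesis using False by simp
  qed simp
qed

lemma glue_last [simp]: "glue n x w (Suc n) = x"
  by (simp add: glue_def)

lemma glue_init: "j \<in> {1..n} \<Longrightarrow> glue n x w j = sqrt ((real (Suc n) - x\<^sup>2) / real n) * w j"
  by (auto simp: glue_def)

lemma sphere_proj_upd:
  assumes n: "n \<ge> 1" and z: "vec_norm n z > 0"
  shows "sphere_proj (Suc n) (z(Suc n := y)) =
    glue n (sqrt (real (Suc n)) * y / sqrt (y\<^sup>2 + (vec_norm n z)\<^sup>2)) (sphere_proj n z)"
    and "vec_norm (Suc n) (z(Suc n := y)) = sqrt (y\<^sup>2 + (vec_norm n z)\<^sup>2)"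
proof -
  have *: "(\<Sum>j\<in>{1..n}. ((z(Suc n := y)) j)\<^sup>2) = (\<Sum>j\<in>{1..n}. (z j)\<^sup>2)"
    by (intro sum.cong) auto
  have "(vec_norm n z)\<^sup>2 = (\<Sum>j\<in>{1..n}. (z j)\<^sup>2)"
    by (simp add: vec_norm_def sum_nonneg)
  then show 1: "vec_norm (Suc n) (z(Suc n := y)) = sqrt (y\<^sup>2 + (vec_norm n z)\<^sup>2)"
    using * by (simp add: vec_norm_def add.commute)
  let ?r = "vec_norm n z" let ?s = "sqrt (y\<^sup>2 + ?r\<^sup>2)"
  have s: "?s > 0" "?s\<^sup>2 = y\<^sup>2 + ?r\<^sup>2" using z by (auto simp: add_nonneg_pos)
  have "real (Suc n) - (sqrt (real (Suc n)) * y / ?s)\<^sup>2 = real (Suc n) * (?r\<^sup>2 / ?s\<^sup>2)"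
    using s z by (simp add: power_divide power_mult_distrib field_simps del: of_nat_Suc)
  then have "sqrt ((real (Suc n) - (sqrt (real (Suc n)) * y / ?s)\<^sup>2) / real n) = sqrt (real (Suc n)) * ?r / (?s * sqrt (real n))"
    using z s(1) by (simp add: real_sqrt_mult real_sqrt_divide del: of_nat_Suc)
  then show "sphere_proj (Suc n) (z(Suc n := y)) =
    glue n (sqrt (real (Suc n)) * y / sqrt (y\<^sup>2 + (vec_norm n z)\<^sup>2)) (sphere_proj n z)"
    unfolding sphere_proj_def glue_def 1
    using n z by (auto simp: fun_eq_iff restrict_def simp del: of_nat_Suc)
qed

lemma nn_integral_leb_Suc:
  assumes [measurable]: "F \<in> borel_measurable (bor (Suc n))"
  shows "(\<integral>\<^sup>+v. F v \<partial>leb (Suc n)) = (\<integral>\<^sup>+y. (\<integral>\<^sup>+z. F (z(Suc n := y)) \<partial>leb n) \<partial>lborel)"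
proof -
  interpret product_sigma_finite "\<lambda>_::nat. lborel :: real measure" by standard
  have eq: "{1..Suc n} = insert (Suc n) {1..n}" by auto
  have "F \<in> borel_measurable (Pi\<^sub>M (insert (Suc n) {1..n}) (\<lambda>_. lborel))"
    using assms unfolding eq[symmetric] by (simp add: meas_leb)
  then show ?thesis unfolding eq
    by (subst product_nn_integral_insert_rev) auto
qed

text \<open>The outer integral is again over the larger sphere, through its last coordinate, so the
  density of a coordinate never has to be computed. In the cone, the last coordinate of the
  projection of (z, y) depends on z through its norm alone; hence averaging F over the direction of
  z changes nothing.\<close>

lemma nn_integral_sph_Suc:
  assumes n: "n \<ge> 1" and F [measurable]: "F \<in> borel_measurable (bor (Suc n))"
  shows "(\<integral>\<^sup>+v. F v \<partial>sph (Suc n)) = (\<integral>\<^sup>+v. (\<integral>\<^sup>+w. F (glue n (v (Suc n)) w) \<partial>sph n) \<partial>sph (Suc n))"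
proof -
  interpret prob_space "sph n" by (rule prob_space_sph)
  have upd: "(\<lambda>z. z(Suc n := y)) \<in> measurable (bor n) (bor (Suc n))" for y :: real
  proof -
    have "(\<lambda>z. z(Suc n := y)) \<in> measurable (bor n) (Pi\<^sub>M (insert (Suc n) {1..n}) (\<lambda>_. borel))" by measurable
    moreover have "insert (Suc n) {1..n} = {1..Suc n}" by auto
    ultimately show ?thesis by simp
  qed
  define X where "X = (\<lambda>y r. sqrt (real (Suc n)) * y / sqrt (y\<^sup>2 + r\<^sup>2))"
  have [measurable]: "(\<lambda>(y, r). X y r) \<in> borel_measurable (borel \<Otimes>\<^sub>M borel)"
    unfolding X_def by measurable
  have ball: "indicator (unit_ball_vec (Suc n)) (z(Suc n := y)) = indicator {r. y\<^sup>2 + r\<^sup>2 \<le> 1} (vec_norm n z)"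
    if "z \<in> space (leb n)" "vec_norm n z > 0" for z y
    using that sphere_proj_upd(2)[OF n that(2), of y]
    by (auto simp: indicator_def unit_ball_vec_def space_PiM PiE_iff extensional_def)
  define \<Phi> where "\<Phi> x = (\<integral>\<^sup>+w. F (glue n x w) \<partial>sph n)" for x
  have [measurable]: "\<Phi> \<in> borel_measurable borel" unfolding \<Phi>_def by measurable
  have vS [measurable]: "(\<lambda>v. v (Suc n)) \<in> borel_measurable (bor (Suc n))" by (rule measurable_component_singleton) auto
  \<comment> \<open>Stated for all G because it is applied twice: to F, and to the function of the
    last coordinate that arises by averaging F over directions.\<close>
  have inner: "(\<integral>\<^sup>+z. G (sphere_proj (Suc n) (z(Suc n := y))) * indicator (unit_ball_vec (Suc n)) (z(Suc n := y)) \<partial>leb n)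
     = (\<integral>\<^sup>+z. (\<integral>\<^sup>+w. G (glue n (X y (vec_norm n z)) w) \<partial>sph n) * indicator {r. y\<^sup>2 + r\<^sup>2 \<le> 1} (vec_norm n z) \<partial>leb n)"
    if [measurable]: "G \<in> borel_measurable (bor (Suc n))" for G y
  proof -
    have "(\<integral>\<^sup>+z. G (sphere_proj (Suc n) (z(Suc n := y))) * indicator (unit_ball_vec (Suc n)) (z(Suc n := y)) \<partial>leb n)
      = (\<integral>\<^sup>+z. (\<lambda>r w. G (glue n (X y r) w) * indicator {r. y\<^sup>2 + r\<^sup>2 \<le> 1} r) (vec_norm n z) (sphere_proj n z) \<partial>leb n)"
    proof (rule nn_integral_cong_AE)
      show "AE z in leb n. G (sphere_proj (Suc n) (z(Suc n := y))) * indicator (unit_ball_vec (Suc n)) (z(Suc n := y)) =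
        (\<lambda>r w. G (glue n (X y r) w) * indicator {r. y\<^sup>2 + r\<^sup>2 \<le> 1} r) (vec_norm n z) (sphere_proj n z)"
        using AE_leb_norm_pos[OF n] AE_space
        by eventually_elim (simp add: ball sphere_proj_upd(1)[OF n] X_def)
    qed
    also have "\<dots> = (\<integral>\<^sup>+z. (\<integral>\<^sup>+w. G (glue n (X y (vec_norm n z)) w) * indicator {r. y\<^sup>2 + r\<^sup>2 \<le> 1} (vec_norm n z) \<partial>sph n) \<partial>leb n)"
      by (subst polar[OF n]) auto
    also have "\<dots> = (\<integral>\<^sup>+z. (\<integral>\<^sup>+w. G (glue n (X y (vec_norm n z)) w) \<partial>sph n) * indicator {r. y\<^sup>2 + r\<^sup>2 \<le> 1} (vec_norm n z) \<partial>leb n)"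
      by (subst nn_integral_multc) auto
    finally show ?thesis .
  qed
  have "(\<integral>\<^sup>+w. \<Phi> (glue n x w (Suc n)) \<partial>sph n) = \<Phi> x" for x
    using emeasure_space_1 by simp
  then have "(\<integral>\<^sup>+y. (\<integral>\<^sup>+z. F (sphere_proj (Suc n) (z(Suc n := y))) * indicator (unit_ball_vec (Suc n)) (z(Suc n := y)) \<partial>leb n) \<partial>lborel)
     = (\<integral>\<^sup>+y. (\<integral>\<^sup>+z. \<Phi> (sphere_proj (Suc n) (z(Suc n := y)) (Suc n)) * indicator (unit_ball_vec (Suc n)) (z(Suc n := y)) \<partial>leb n) \<partial>lborel)"
    using inner[OF F] inner[of "\<lambda>v. \<Phi> (v (Suc n))"] by (simp add: \<Phi>_def)
  then have "(\<integral>\<^sup>+v. F (sphere_proj (Suc n) v) * indicator (unit_ball_vec (Suc n)) v \<partial>leb (Suc n))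
     = (\<integral>\<^sup>+v. \<Phi> (sphere_proj (Suc n) v (Suc n)) * indicator (unit_ball_vec (Suc n)) v \<partial>leb (Suc n))"
    by (subst nn_integral_leb_Suc, measurable, subst nn_integral_leb_Suc, measurable)
  then have "(\<integral>\<^sup>+v. F v \<partial>sph (Suc n)) = (\<integral>\<^sup>+v. \<Phi> (v (Suc n)) \<partial>sph (Suc n))"
    by (simp add: nn_integral_sph)
  then show ?thesis by (simp add: \<Phi>_def)
qed

subsection \<open>Symmetries\<close>

text \<open>Invariance passes from Lebesgue measure to the cone measure because T preserves the unit
  ball and commutes with the radial projection.\<close>

lemma distr_sph_invariant:
  assumes T [measurable]: "T \<in> measurable (bor n) (bor n)"
    and leb: "\<And>F. F \<in> borel_measurable (bor n) \<Longrightarrow> (\<integral>\<^sup>+v. F (T v) \<partial>leb n) = (\<integral>\<^sup>+v. F v \<partial>leb n)"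
    and norm: "\<And>v. v \<in> space (bor n) \<Longrightarrow> vec_norm n (T v) = vec_norm n v"
    and proj: "\<And>v. v \<in> space (bor n) \<Longrightarrow> sphere_proj n (T v) = T (sphere_proj n v)"
    and F [measurable]: "F \<in> borel_measurable (bor n)"
  shows "(\<integral>\<^sup>+v. F (T v) \<partial>sph n) = (\<integral>\<^sup>+v. F v \<partial>sph n)"
proof -
  have "(\<integral>\<^sup>+v. F (T (sphere_proj n v)) * indicator (unit_ball_vec n) v \<partial>leb n)
      = (\<integral>\<^sup>+v. (\<lambda>v. F (sphere_proj n v) * indicator (unit_ball_vec n) v) (T v) \<partial>leb n)"
    using measurable_space[OF T]
    by (intro nn_integral_cong)
       (auto simp: space_leb proj norm unit_ball_vec_def space_PiM indicator_def)
  also have "\<dots> = (\<integral>\<^sup>+v. F (sphere_proj n v) * indicator (unit_ball_vec n) v \<partial>leb n)"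
    by (rule leb) measurable
  finally show ?thesis by (simp add: nn_integral_sph)
qed

lemma perm_measurable:
  assumes "\<pi> permutes {1..n}"
  shows "(\<lambda>v. v \<circ> \<pi>) \<in> measurable (bor n) (bor n)"
proof -
  have "(\<lambda>v. \<lambda>j\<in>{1..n}. v (\<pi> j)) \<in> measurable (bor n) (bor n)"
    using permutes_in_image[OF assms] by (intro measurable_restrict measurable_component_singleton) auto
  moreover have "v \<circ> \<pi> = (\<lambda>j\<in>{1..n}. v (\<pi> j))" if "v \<in> space (bor n)" for v
    using that permutes_not_in[OF assms] by (auto simp: space_PiM PiE_iff extensional_def fun_eq_iff)
  ultimately show ?thesis by (subst measurable_cong) auto
qed

lemma nn_integral_leb_perm:
  assumes p: "\<pi> permutes {1..n}" and [measurable]: "F \<in> borel_measurable (bor n)"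
  shows "(\<integral>\<^sup>+v. F (v \<circ> \<pi>) \<partial>leb n) = (\<integral>\<^sup>+v. F v \<partial>leb n)"
proof -
  interpret product_sigma_finite "\<lambda>_::nat. lborel :: real measure" by standard
  have [measurable]: "(\<lambda>v. v \<circ> \<pi>) \<in> measurable (leb n) (bor n)"
    using perm_measurable[OF p] by (simp add: meas_leb)
  have "distr (leb n) (bor n) (\<lambda>v. v \<circ> \<pi>) = leb n"
  proof (rule PiM_eqI)
    fix B :: "nat \<Rightarrow> real set" assume B: "\<And>i. i \<in> {1..n} \<Longrightarrow> B i \<in> sets lborel"
    have [measurable]: "Pi\<^sub>E {1..n} B \<in> sets (bor n)"
      using B by (intro sets_PiM_I_finite) auto
    have im: "\<And>i. inv \<pi> i \<in> {1..n} \<longleftrightarrow> i \<in> {1..n}"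
      using permutes_in_image[OF permutes_inv[OF p]] by blast
    have "(\<lambda>v. v \<circ> \<pi>) -` Pi\<^sub>E {1..n} B \<inter> space (leb n) = Pi\<^sub>E {1..n} (\<lambda>i. B (inv \<pi> i))"
    proof (intro set_eqI iffI)
      fix v assume v: "v \<in> (\<lambda>v. v \<circ> \<pi>) -` Pi\<^sub>E {1..n} B \<inter> space (leb n)"
      have "v i \<in> B (inv \<pi> i)" if "i \<in> {1..n}" for i
      proof -
        have "(v \<circ> \<pi>) (inv \<pi> i) \<in> B (inv \<pi> i)" using v that im[of i] by (auto simp: PiE_iff)
        then show ?thesis using permutes_inverses(1)[OF p] by simp
      qed
      then show "v \<in> Pi\<^sub>E {1..n} (\<lambda>i. B (inv \<pi> i))" using v by (auto simp: space_PiM PiE_iff)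
    next
      fix v assume v: "v \<in> Pi\<^sub>E {1..n} (\<lambda>i. B (inv \<pi> i))"
      have "v (\<pi> i) \<in> B i" if "i \<in> {1..n}" for i
      proof -
        have "v (\<pi> i) \<in> B (inv \<pi> (\<pi> i))" using v that permutes_in_image[OF p, of i] by (auto simp: PiE_iff)
        then show ?thesis using permutes_inverses(2)[OF p] by simp
      qed
      then show "v \<in> (\<lambda>v. v \<circ> \<pi>) -` Pi\<^sub>E {1..n} B \<inter> space (leb n)"
        using v permutes_not_in[OF p] by (auto simp: space_PiM PiE_iff extensional_def)
    qed
    then have "emeasure (distr (leb n) (bor n) (\<lambda>v. v \<circ> \<pi>)) (Pi\<^sub>E {1..n} B) = emeasure (leb n) (Pi\<^sub>E {1..n} (\<lambda>i. B (inv \<pi> i)))"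
      by (subst emeasure_distr) auto
    also have "\<dots> = (\<Prod>i\<in>{1..n}. emeasure lborel (B (inv \<pi> i)))"
      using B im by (intro emeasure_PiM) auto
    also have "\<dots> = (\<Prod>i\<in>{1..n}. emeasure lborel (B i))"
      using prod.permute[OF permutes_inv[OF p], of "\<lambda>i. emeasure lborel (B i)"] by (simp add: comp_def)
    finally show "emeasure (distr (leb n) (bor n) (\<lambda>v. v \<circ> \<pi>)) (Pi\<^sub>E {1..n} B) = (\<Prod>i\<in>{1..n}. emeasure lborel (B i))" .
  qed (auto simp: sets_leb)
  then have "(\<integral>\<^sup>+v. F v \<partial>leb n) = (\<integral>\<^sup>+v. F v \<partial>distr (leb n) (bor n) (\<lambda>v. v \<circ> \<pi>))" by simp
  also have "\<dots> = (\<integral>\<^sup>+v. F (v \<circ> \<pi>) \<partial>leb n)" by (subst nn_integral_distr) auto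
  finally show ?thesis ..
qed

lemma nn_integral_sph_perm:
  assumes p: "\<pi> permutes {1..n}" and F: "F \<in> borel_measurable (bor n)"
  shows "(\<integral>\<^sup>+v. F (v \<circ> \<pi>) \<partial>sph n) = (\<integral>\<^sup>+v. F v \<partial>sph n)"
proof (rule distr_sph_invariant[OF perm_measurable[OF p] nn_integral_leb_perm[OF p] _ _ F])
  show n: "vec_norm n (v \<circ> \<pi>) = vec_norm n v" for v
    using sum.permute[OF p, of "\<lambda>i. (v i)\<^sup>2"] by (simp add: vec_norm_def comp_def)
  show "sphere_proj n (v \<circ> \<pi>) = sphere_proj n v \<circ> \<pi>" for v
    unfolding sphere_proj_def n using permutes_in_image[OF p]
    by (auto simp: fun_eq_iff restrict_def)
qed

text \<open>A rotation in a coordinate plane is a product of three shears, and a shear preserves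
  Lebesgue measure by translation invariance in a single coordinate. Rotation invariance thus
  follows from Fubini, without determinants.\<close>

definition shear :: "nat \<Rightarrow> nat \<Rightarrow> real \<Rightarrow> (nat \<Rightarrow> real) \<Rightarrow> nat \<Rightarrow> real" where
  "shear i j c v = v(i := v i + c * v j)"

lemma upd2_measurable:
  assumes "i \<in> {1..n}" and [measurable]: "g \<in> borel_measurable (bor n)"
  shows "(\<lambda>v. v(i := g v)) \<in> measurable (bor n) (bor n)"
proof -
  have "(\<lambda>v. \<lambda>k\<in>{1..n}. if k = i then g v else v k) \<in> measurable (bor n) (bor n)"
  proof (rule measurable_restrict)
    fix k assume "k \<in> {1..n}"
    then have [measurable]: "(\<lambda>v. v k) \<in> borel_measurable (bor n)" by (rule measurable_component_singleton)
    show "(\<lambda>v. if k = i then g v else v k) \<in> borel_measurable (bor n)" by measurable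
  qed
  moreover have "v(i := g v) = (\<lambda>k\<in>{1..n}. if k = i then g v else v k)" if "v \<in> space (bor n)" for v
    using that assms(1) by (auto simp: space_PiM PiE_iff extensional_def fun_eq_iff)
  ultimately show ?thesis by (subst measurable_cong) auto
qed

lemma shear_measurable:
  assumes "i \<in> {1..n}" "j \<in> {1..n}"
  shows "shear i j c \<in> measurable (bor n) (bor n)"
proof -
  have [measurable]: "(\<lambda>v. v i) \<in> borel_measurable (bor n)" "(\<lambda>v. v j) \<in> borel_measurable (bor n)"
    using assms by (auto intro: measurable_component_singleton)
  have "(\<lambda>v. v(i := v i + c * v j)) \<in> measurable (bor n) (bor n)"
    using assms by (intro upd2_measurable) measurable
  then show ?thesis by (simp add: shear_def[abs_def])
qed

lemma nn_integral_leb_shear: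
  assumes ij: "i \<in> {1..n}" "j \<in> {1..n}" "i \<noteq> j" and F: "F \<in> borel_measurable (bor n)"
  shows "(\<integral>\<^sup>+v. F (shear i j c v) \<partial>leb n) = (\<integral>\<^sup>+v. F v \<partial>leb n)"
proof -
  interpret product_sigma_finite "\<lambda>_::nat. lborel :: real measure" by standard
  let ?I = "{1..n} - {i}"
  have eq: "insert i ?I = {1..n}" using ij by auto
  have sh: "F \<circ> shear i j c \<in> borel_measurable (bor n)"
    using shear_measurable[OF ij(1,2)] F by (rule measurable_comp)
  have ins: "(\<integral>\<^sup>+v. G v \<partial>leb n) = (\<integral>\<^sup>+x. (\<integral>\<^sup>+y. G (x(i := y)) \<partial>lborel) \<partial>Pi\<^sub>M ?I (\<lambda>_. lborel))"
    if "G \<in> borel_measurable (bor n)" for G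
  proof -
    have "G \<in> borel_measurable (Pi\<^sub>M (insert i ?I) (\<lambda>_. lborel))"
      using that unfolding eq by (simp add: meas_leb)
    then have "(\<integral>\<^sup>+v. G v \<partial>Pi\<^sub>M (insert i ?I) (\<lambda>_. lborel)) = (\<integral>\<^sup>+x. (\<integral>\<^sup>+y. G (x(i := y)) \<partial>lborel) \<partial>Pi\<^sub>M ?I (\<lambda>_. lborel))"
      by (intro product_nn_integral_insert) auto
    then show ?thesis unfolding eq .
  qed
  have "(\<integral>\<^sup>+v. F (shear i j c v) \<partial>leb n) = (\<integral>\<^sup>+x. (\<integral>\<^sup>+y. F (shear i j c (x(i := y))) \<partial>lborel) \<partial>Pi\<^sub>M ?I (\<lambda>_. lborel))"
    using ins[OF sh] by simp
  also have "\<dots> = (\<integral>\<^sup>+x. (\<integral>\<^sup>+y. F (x(i := y)) \<partial>lborel) \<partial>Pi\<^sub>M ?I (\<lambda>_. lborel))"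
  proof (rule nn_integral_cong)
    fix x assume x: "x \<in> space (Pi\<^sub>M ?I (\<lambda>_. lborel :: real measure))"
    have "(\<lambda>y. x(i := y)) \<in> measurable lborel (Pi\<^sub>M (insert i ?I) (\<lambda>_. lborel))"
      using x by (intro measurable_fun_upd[where J="?I"]) auto
    then have "(\<lambda>y. x(i := y)) \<in> measurable lborel (leb n)" unfolding eq .
    moreover have "F \<in> borel_measurable (leb n)" using F by (simp add: meas_leb)
    ultimately have "(\<lambda>y. F (x(i := y))) \<in> borel_measurable lborel"
      by (rule measurable_compose)
    then have [measurable]: "(\<lambda>y. F (x(i := y))) \<in> borel_measurable borel" by simp
    have "(\<integral>\<^sup>+y. F (x(i := y)) \<partial>lborel) = (\<integral>\<^sup>+y. F (x(i := c * x j + 1 * y)) \<partial>lborel)"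
      by (subst nn_integral_real_affine[where c=1 and t="c * x j"]) auto
    also have "\<dots> = (\<integral>\<^sup>+y. F (shear i j c (x(i := y))) \<partial>lborel)"
      using ij by (simp add: shear_def add.commute)
    finally show "(\<integral>\<^sup>+y. F (shear i j c (x(i := y))) \<partial>lborel) = (\<integral>\<^sup>+y. F (x(i := y)) \<partial>lborel)" ..
  qed
  also have "\<dots> = (\<integral>\<^sup>+v. F v \<partial>leb n)" by (rule ins[OF F, symmetric])
  finally show ?thesis .
qed

lemma rot_measurable:
  assumes "i \<in> {1..n}" "j \<in> {1..n}"
  shows "(\<lambda>(\<theta>, v). rot i j \<theta> v) \<in> measurable (borel \<Otimes>\<^sub>M bor n) (bor n)"
proof -
  have [measurable]: "(\<lambda>v. v i) \<in> borel_measurable (bor n)" "(\<lambda>v. v j) \<in> borel_measurable (bor n)"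
    using assms by (auto intro: measurable_component_singleton)
  define G :: "real \<times> (nat \<Rightarrow> real) \<Rightarrow> nat \<Rightarrow> real" where
    "G p = (\<lambda>k\<in>{1..n}. if k = j then - snd p i * sin (fst p) + snd p j * cos (fst p)
      else if k = i then snd p i * cos (fst p) + snd p j * sin (fst p) else snd p k)" for p
  have G: "G \<in> measurable (borel \<Otimes>\<^sub>M bor n) (bor n)"
    unfolding G_def
  proof (rule measurable_restrict)
    fix k assume "k \<in> {1..n}"
    then have [measurable]: "(\<lambda>v. v k) \<in> borel_measurable (bor n)" by (rule measurable_component_singleton)
    show "(\<lambda>p. if k = j then - snd p i * sin (fst p) + snd p j * cos (fst p)
      else if k = i then snd p i * cos (fst p) + snd p j * sin (fst p) else snd p k) \<in> borel_measurable (borel \<Otimes>\<^sub>M bor n)" by measurable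
  qed
  have eq: "(case p of (\<theta>, v) \<Rightarrow> rot i j \<theta> v) = G p" if p: "p \<in> space (borel \<Otimes>\<^sub>M bor n)" for p
  proof -
    have "snd p \<in> extensional {1..n}"
      using p by (simp add: space_pair_measure mem_Times_iff space_PiM PiE_iff)
    then have u: "snd p k = undefined" if "k \<notin> {1..n}" for k
      using that by (simp add: extensional_def)
    have "rot i j (fst p) (snd p) k = G p k" for k
      unfolding G_def rot_def using assms u[of k] by (cases "k \<in> {1..n}") auto
    then show ?thesis by (simp add: case_prod_beta fun_eq_iff)
  qed
  show ?thesis using G measurable_cong[of "borel \<Otimes>\<^sub>M bor n" "\<lambda>(\<theta>, v). rot i j \<theta> v" G "bor n", OF eq] by blast
qed

lemma rot_measurable':
  assumes "i \<in> {1..n}" "j \<in> {1..n}"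
  shows "rot i j \<theta> \<in> measurable (bor n) (bor n)"
proof -
  have "(\<lambda>v. (case (\<theta>, v) of (\<theta>, v) \<Rightarrow> rot i j \<theta> v)) \<in> measurable (bor n) (bor n)"
    by (rule measurable_compose[OF _ rot_measurable[OF assms]]) measurable
  then show ?thesis by simp
qed

lemma rot_sum_sq:
  assumes ij: "i \<noteq> j" "i \<in> {1..n}" "j \<in> {1..n}"
  shows "(\<Sum>k\<in>{1..n}. (rot i j \<theta> v k)\<^sup>2) = (\<Sum>k\<in>{1..n}. (v k)\<^sup>2)"
proof -
  have *: "(\<Sum>k\<in>{1..n}. g k) = g i + g j + (\<Sum>k\<in>{1..n}-{i}-{j}. g k)" for g :: "nat \<Rightarrow> real"
    using ij by (simp add: sum.remove[of _ i] sum.remove[of _ j] add.assoc)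
  have "(v i * cos \<theta> + v j * sin \<theta>)\<^sup>2 + (- v i * sin \<theta> + v j * cos \<theta>)\<^sup>2
      = ((v i)\<^sup>2 + (v j)\<^sup>2) * ((cos \<theta>)\<^sup>2 + (sin \<theta>)\<^sup>2)"
    by algebra
  moreover have "(\<Sum>k\<in>{1..n}-{i}-{j}. (rot i j \<theta> v k)\<^sup>2) = (\<Sum>k\<in>{1..n}-{i}-{j}. (v k)\<^sup>2)"
    by (intro sum.cong) (auto simp: rot_def)
  ultimately show ?thesis
    unfolding * using ij by (simp add: rot_def)
qed

text \<open>The outer parameter is tan(\<theta>/2), which is why the half turn is excluded;
  \<open>rot_pi\<close> writes that one as two quarter turns.\<close>

lemma rot_shear:
  assumes "i \<noteq> j" "cos \<theta> \<noteq> - 1"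
  shows "rot i j \<theta> v = shear i j (sin \<theta> / (1 + cos \<theta>)) (shear j i (- sin \<theta>) (shear i j (sin \<theta> / (1 + cos \<theta>)) v))"
proof -
  have c: "1 + cos \<theta> \<noteq> 0" using assms(2) by linarith
  define t where "t = sin \<theta> / (1 + cos \<theta>)"
  have "sin \<theta> * sin \<theta> = (1 - cos \<theta>) * (1 + cos \<theta>)"
    using sin_cos_squared_add[of \<theta>] by algebra
  then have 1: "t * sin \<theta> = 1 - cos \<theta>" using c by (simp add: t_def)
  have 2: "t * cos \<theta> = sin \<theta> - t" using c unfolding t_def by (simp add: field_simps)
  have j: "- v i * sin \<theta> + v j * cos \<theta> = v j + - sin \<theta> * (v i + t * v j)"
    using 1 by algebra
  have i: "v i * cos \<theta> + v j * sin \<theta> = v i + t * v j + t * (v j + - sin \<theta> * (v i + t * v j))"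
    using 1 2 by algebra
  show ?thesis
    unfolding t_def[symmetric] rot_def i j using assms(1)
    by (simp add: fun_eq_iff shear_def)
qed

lemma rot_pi: "i \<noteq> j \<Longrightarrow> cos \<theta> = - 1 \<Longrightarrow> rot i j \<theta> v = rot i j (pi / 2) (rot i j (pi / 2) v)"
  using sin_cos_squared_add[of \<theta>] by (auto simp: rot_def fun_eq_iff)

lemma nn_integral_sph_rot:
  assumes ij: "i \<in> {1..n}" "j \<in> {1..n}" "i \<noteq> j" and F: "F \<in> borel_measurable (bor n)"
  shows "(\<integral>\<^sup>+v. F (rot i j \<theta> v) \<partial>sph n) = (\<integral>\<^sup>+v. F v \<partial>sph n)"
proof (rule distr_sph_invariant[OF rot_measurable'[OF ij(1,2)] _ _ _ F])
  note [measurable] = shear_measurable[OF ij(1,2)] shear_measurable[OF ij(2,1)] rot_measurable'[OF ij(1,2)]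
  show n: "vec_norm n (rot i j \<theta> v) = vec_norm n v" for v
    using rot_sum_sq[OF ij(3,1,2)] by (simp add: vec_norm_def)
  show "sphere_proj n (rot i j \<theta> v) = rot i j \<theta> (sphere_proj n v)" for v
    unfolding sphere_proj_def n using ij by (auto simp: rot_def fun_eq_iff add_divide_distrib algebra_simps diff_divide_distrib)
  have nondeg: "(\<integral>\<^sup>+v. G (rot i j \<theta> v) \<partial>leb n) = (\<integral>\<^sup>+v. G v \<partial>leb n)"
    if [measurable]: "G \<in> borel_measurable (bor n)" and c: "cos \<theta> \<noteq> - 1" for G \<theta>
  proof -
    let ?t = "sin \<theta> / (1 + cos \<theta>)"
    have "(\<integral>\<^sup>+v. G (rot i j \<theta> v) \<partial>leb n) = (\<integral>\<^sup>+v. G (shear i j ?t (shear j i (- sin \<theta>) (shear i j ?t v))) \<partial>leb n)"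
      using rot_shear[OF ij(3) c] by simp
    also have "\<dots> = (\<integral>\<^sup>+v. G (shear i j ?t (shear j i (- sin \<theta>) v)) \<partial>leb n)"
      using nn_integral_leb_shear[OF ij, of "\<lambda>v. G (shear i j ?t (shear j i (- sin \<theta>) v))"] by simp
    also have "\<dots> = (\<integral>\<^sup>+v. G (shear i j ?t v) \<partial>leb n)"
      using nn_integral_leb_shear[OF ij(2,1), of "\<lambda>v. G (shear i j ?t v)"] ij by simp
    also have "\<dots> = (\<integral>\<^sup>+v. G v \<partial>leb n)"
      using nn_integral_leb_shear[OF ij, of G] by simp
    finally show ?thesis .
  qed
  show "(\<integral>\<^sup>+v. G (rot i j \<theta> v) \<partial>leb n) = (\<integral>\<^sup>+v. G v \<partial>leb n)"
    if [measurable]: "G \<in> borel_measurable (bor n)" for G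
  proof (cases "cos \<theta> = - 1")
    case True
    show ?thesis
      unfolding rot_pi[OF ij(3) True] using nondeg[of "\<lambda>v. G (rot i j (pi/2) v)" "pi/2"] nondeg[of G "pi/2"] by simp
  qed (use nondeg in simp)
qed

subsection \<open>Integration on the sphere\<close>

lemma meas_sph: "measurable (sph n) M = measurable (bor n) M"
  by (intro measurable_cong_sets sets_sph refl)

lemma sph_distrI:
  assumes [measurable]: "T \<in> measurable (bor n) (bor n)"
    and T: "\<And>F. F \<in> borel_measurable (bor n) \<Longrightarrow> (\<integral>\<^sup>+v. F (T v) \<partial>sph n) = (\<integral>\<^sup>+v. F v \<partial>sph n)"
  shows "distr (sph n) (bor n) T = sph n"
proof (rule measure_eqI)
  fix A assume "A \<in> sets (distr (sph n) (bor n) T)"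
  then have [measurable]: "A \<in> sets (bor n)" by simp
  have "emeasure (distr (sph n) (bor n) T) A = (\<integral>\<^sup>+v. indicator A v \<partial>distr (sph n) (bor n) T)"
    by (subst nn_integral_indicator) auto
  also have "\<dots> = (\<integral>\<^sup>+v. indicator A (T v) \<partial>sph n)"
    by (subst nn_integral_distr) (auto simp: meas_sph)
  also have "\<dots> = emeasure (sph n) A"
    by (subst T) (auto simp: sets_sph)
  finally show "emeasure (distr (sph n) (bor n) T) A = emeasure (sph n) A" .
qed (simp add: sets_sph)

lemma sph_perm: "\<pi> permutes {1..n} \<Longrightarrow> distr (sph n) (bor n) (\<lambda>v. v \<circ> \<pi>) = sph n"
  by (intro sph_distrI perm_measurable nn_integral_sph_perm)

lemma sph_rot: "i \<in> {1..n} \<Longrightarrow> j \<in> {1..n} \<Longrightarrow> i \<noteq> j \<Longrightarrow> distr (sph n) (bor n) (rot i j \<theta>) = sph n"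
  by (intro sph_distrI rot_measurable' nn_integral_sph_rot)

lemma integral_sph_perm:
  fixes f :: "(nat \<Rightarrow> real) \<Rightarrow> real"
  assumes p: "\<pi> permutes {1..n}" and [measurable]: "f \<in> borel_measurable (bor n)"
  shows "(LINT v|sph n. f (v \<circ> \<pi>)) = (LINT v|sph n. f v)"
    and "integrable (sph n) (\<lambda>v. f (v \<circ> \<pi>)) \<longleftrightarrow> integrable (sph n) f"
proof -
  have [measurable]: "(\<lambda>v. v \<circ> \<pi>) \<in> measurable (sph n) (bor n)"
    using perm_measurable[OF p] by (simp add: meas_sph)
  show "(LINT v|sph n. f (v \<circ> \<pi>)) = (LINT v|sph n. f v)"
    by (subst (2) sph_perm[OF p, symmetric], subst integral_distr) auto
  show "integrable (sph n) (\<lambda>v. f (v \<circ> \<pi>)) \<longleftrightarrow> integrable (sph n) f"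
    by (subst (2) sph_perm[OF p, symmetric], subst integrable_distr_eq) auto
qed

lemma AE_sph_perm:
  assumes p: "\<pi> permutes {1..n}" and [measurable]: "Measurable.pred (bor n) P"
  shows "(AE v in sph n. P (v \<circ> \<pi>)) \<longleftrightarrow> (AE v in sph n. P v)"
proof -
  have [measurable]: "(\<lambda>v. v \<circ> \<pi>) \<in> measurable (sph n) (bor n)"
    using perm_measurable[OF p] by (simp add: meas_sph)
  show ?thesis
    by (subst (2) sph_perm[OF p, symmetric], subst AE_distr_iff) auto
qed

lemma integral_sph_rot:
  fixes f :: "(nat \<Rightarrow> real) \<Rightarrow> real"
  assumes ij: "i \<in> {1..n}" "j \<in> {1..n}" "i \<noteq> j" and [measurable]: "f \<in> borel_measurable (bor n)"
  shows "(LINT v|sph n. f (rot i j \<theta> v)) = (LINT v|sph n. f v)"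
proof -
  have [measurable]: "rot i j \<theta> \<in> measurable (sph n) (bor n)"
    using rot_measurable'[OF ij(1,2)] by (simp add: meas_sph)
  show ?thesis
    by (subst (2) sph_rot[OF ij, where \<theta>=\<theta>, symmetric], subst integral_distr) auto
qed

lemma AE_sph_rot:
  assumes ij: "i \<in> {1..n}" "j \<in> {1..n}" "i \<noteq> j" and [measurable]: "Measurable.pred (bor n) P"
  shows "(AE v in sph n. P (rot i j \<theta> v)) \<longleftrightarrow> (AE v in sph n. P v)"
proof -
  have [measurable]: "rot i j \<theta> \<in> measurable (sph n) (bor n)"
    using rot_measurable'[OF ij(1,2)] by (simp add: meas_sph)
  show ?thesis
    by (subst (2) sph_rot[OF ij, where \<theta>=\<theta>, symmetric], subst AE_distr_iff) auto
qed

lemma coord_measurable: "i \<in> {1..n} \<Longrightarrow> (\<lambda>v. v i) \<in> borel_measurable (bor n)"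
  by (rule measurable_component_singleton)

lemma exists_perm1:
  assumes "i \<in> S" "k \<in> S"
  shows "\<exists>\<pi>. \<pi> permutes S \<and> \<pi> i = k"
  using assms permutes_swap_id[of i S k] by (intro exI[of _ "Transposition.transpose i k"]) auto

lemma exists_perm2:
  assumes "i \<in> S" "j \<in> S" "k \<in> S" "l \<in> S" "i \<noteq> j" "k \<noteq> l"
  shows "\<exists>\<pi>. \<pi> permutes S \<and> \<pi> i = k \<and> \<pi> j = l"
proof -
  let ?a = "Transposition.transpose i k"
  let ?b = "Transposition.transpose (?a j) l"
  have a: "?a permutes S" using assms by (intro permutes_swap_id)
  have "?a j \<in> S" using permutes_in_image[OF a] assms by simp
  then have b: "?b permutes S" using assms by (intro permutes_swap_id)
  have "?a j \<noteq> k" using assms by (auto simp: Transposition.transpose_def)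
  then have "(?b \<circ> ?a) i = k" using assms by simp
  moreover have "(?b \<circ> ?a) j = l" by simp
  ultimately show ?thesis using permutes_compose[OF a b] by blast
qed

lemma integral_sph_coord1:
  fixes g :: "real \<Rightarrow> real"
  assumes "i \<in> {1..n}" "k \<in> {1..n}" and [measurable]: "g \<in> borel_measurable borel"
  shows "(LINT v|sph n. g (v i)) = (LINT v|sph n. g (v k))"
    and "integrable (sph n) (\<lambda>v. g (v i)) \<longleftrightarrow> integrable (sph n) (\<lambda>v. g (v k))"
proof -
  obtain \<pi> where p: "\<pi> permutes {1..n}" "\<pi> i = k" using exists_perm1[OF assms(1,2)] by blast
  have [measurable]: "(\<lambda>v. v i) \<in> borel_measurable (bor n)" using assms by (intro coord_measurable)
  have m: "(\<lambda>v. g (v i)) \<in> borel_measurable (bor n)" by measurable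
  show "(LINT v|sph n. g (v i)) = (LINT v|sph n. g (v k))"
    using integral_sph_perm(1)[OF p(1) m] p(2) by simp
  show "integrable (sph n) (\<lambda>v. g (v i)) \<longleftrightarrow> integrable (sph n) (\<lambda>v. g (v k))"
    using integral_sph_perm(2)[OF p(1) m] p(2) by simp
qed

lemma integral_sph_coord2:
  fixes g :: "real \<Rightarrow> real \<Rightarrow> real"
  assumes "i \<in> {1..n}" "j \<in> {1..n}" "k \<in> {1..n}" "l \<in> {1..n}" "i \<noteq> j" "k \<noteq> l"
    and [measurable]: "(\<lambda>(x, y). g x y) \<in> borel_measurable (borel \<Otimes>\<^sub>M borel)"
  shows "(LINT v|sph n. g (v i) (v j)) = (LINT v|sph n. g (v k) (v l))"
    and "integrable (sph n) (\<lambda>v. g (v i) (v j)) \<longleftrightarrow> integrable (sph n) (\<lambda>v. g (v k) (v l))"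
proof -
  obtain \<pi> where p: "\<pi> permutes {1..n}" "\<pi> i = k" "\<pi> j = l" using exists_perm2[OF assms(1-6)] by blast
  have [measurable]: "(\<lambda>v. v i) \<in> borel_measurable (bor n)" "(\<lambda>v. v j) \<in> borel_measurable (bor n)"
    using assms by (auto intro: coord_measurable)
  have m: "(\<lambda>v. g (v i) (v j)) \<in> borel_measurable (bor n)" by measurable
  show "(LINT v|sph n. g (v i) (v j)) = (LINT v|sph n. g (v k) (v l))"
    using integral_sph_perm(1)[OF p(1) m] p(2,3) by simp
  show "integrable (sph n) (\<lambda>v. g (v i) (v j)) \<longleftrightarrow> integrable (sph n) (\<lambda>v. g (v k) (v l))"
    using integral_sph_perm(2)[OF p(1) m] p(2,3) by simp
qed

lemma kac_coord_le:
  assumes "v \<in> kac_sphere n" "i \<in> {1..n}"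
  shows "(v i)\<^sup>2 \<le> real n" "\<bar>v i\<bar> \<le> sqrt (real n)"
proof -
  have "(v i)\<^sup>2 \<le> (\<Sum>j\<in>{1..n}. (v j)\<^sup>2)"
    using assms(2) by (intro member_le_sum) auto
  then show 1: "(v i)\<^sup>2 \<le> real n" using assms(1) by (simp add: kac_sphere_def)
  then show "\<bar>v i\<bar> \<le> sqrt (real n)" using real_le_rsqrt by fastforce
qed

lemma integrable_sph_bounded:
  fixes f :: "(nat \<Rightarrow> real) \<Rightarrow> real"
  assumes "n \<ge> 1" "f \<in> borel_measurable (bor n)" "\<And>v. v \<in> kac_sphere n \<Longrightarrow> \<bar>f v\<bar> \<le> B"
  shows "integrable (sph n) f"
proof -
  interpret prob_space "sph n" by (rule prob_space_sph)
  show ?thesis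
    using AE_sph_kac[OF assms(1)] assms(2,3)
    by (intro integrable_const_bound[where B=B]) (auto simp: meas_sph elim!: eventually_mono)
qed

lemma integrable_sph_monom:
  assumes "i \<in> {1..n}" "j \<in> {1..n}"
  shows "integrable (sph n) (\<lambda>v. v i ^ p * v j ^ q)"
proof (rule integrable_sph_bounded[where B="sqrt (real n) ^ p * sqrt (real n) ^ q"])
  have [measurable]: "(\<lambda>v. v i) \<in> borel_measurable (bor n)" "(\<lambda>v. v j) \<in> borel_measurable (bor n)"
    using assms by (auto intro: coord_measurable)
  show "(\<lambda>v. v i ^ p * v j ^ q) \<in> borel_measurable (bor n)" by measurable
  show "\<bar>v i ^ p * v j ^ q\<bar> \<le> sqrt (real n) ^ p * sqrt (real n) ^ q" if "v \<in> kac_sphere n" for v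
    using kac_coord_le(2)[OF that assms(1)] kac_coord_le(2)[OF that assms(2)]
    by (auto simp: abs_mult power_abs intro!: mult_mono power_mono)
qed (use assms in auto)

lemma integrable_sph_power: "i \<in> {1..n} \<Longrightarrow> integrable (sph n) (\<lambda>v. v i ^ p)"
  using integrable_sph_monom[of i n i p 0] by simp

subsection \<open>Moments of the coordinates\<close>

context
  fixes n i j :: nat
  assumes ij: "i \<in> {1..n}" "j \<in> {1..n}" "i \<noteq> j"
begin

private definition M :: "nat \<Rightarrow> nat \<Rightarrow> real" where
  "M p q = (LINT v|sph n. v i ^ p * v j ^ q)"

private lemma M_sym: "M p q = M q p"
  using integral_sph_coord2(1)[OF ij(1,2) ij(2,1) ij(3) ij(3)[symmetric], of "\<lambda>x y. x ^ p * y ^ q"]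
  by (simp add: M_def mult.commute)

private lemma ij_meas [measurable]:
  "(\<lambda>v. v i) \<in> borel_measurable (bor n)" "(\<lambda>v. v j) \<in> borel_measurable (bor n)"
  using ij by (auto intro: coord_measurable)

text \<open>A quarter turn takes (v_i, v_j) to (v_j, -v_i), so M p q = - M q p for odd q, while
  exchanging the coordinates gives M p q = M q p.\<close>

private lemma M_odd: "odd q \<Longrightarrow> M p q = 0"
proof -
  assume q: "odd q"
  have "M p q = (LINT v|sph n. (\<lambda>v. v i ^ p * v j ^ q) (rot i j (pi / 2) v))"
    unfolding M_def by (subst integral_sph_rot[OF ij]) auto
  also have "\<dots> = (LINT v|sph n. - (v i ^ q * v j ^ p))"
    using ij(3) q by (simp add: rot_def mult.commute)
  also have "\<dots> = - M q p" by (simp add: M_def)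
  finally show ?thesis using M_sym[of p q] by simp
qed

lemma sph_moment_odd: "odd p \<Longrightarrow> (LINT v|sph n. v i ^ p) = 0"
  using M_odd[of p 0] M_sym[of p 0] by (simp add: M_def)

text \<open>Rotation invariance of a moment of v_i, expanded binomially: each angle gives one linear
  relation between the mixed moments of degree p.\<close>

private lemma M_rot:
  "M p 0 = (\<Sum>k\<le>p. real (p choose k) * cos \<theta> ^ k * sin \<theta> ^ (p - k) * M k (p - k))"
proof -
  have "M p 0 = (LINT v|sph n. (\<lambda>v. v i ^ p) (rot i j \<theta> v))"
    unfolding M_def by (subst integral_sph_rot[OF ij]) auto
  also have "\<dots> = (LINT v|sph n. (v i * cos \<theta> + v j * sin \<theta>) ^ p)"
    using ij(3) by (simp add: rot_def)
  also have "\<dots> = (LINT v|sph n. (\<Sum>k\<le>p. (real (p choose k) * cos \<theta> ^ k * sin \<theta> ^ (p - k)) * (v i ^ k * v j ^ (p - k))))"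
    by (simp add: binomial_ring power_mult_distrib mult_ac)
  also have "\<dots> = (\<Sum>k\<le>p. real (p choose k) * cos \<theta> ^ k * sin \<theta> ^ (p - k) * M k (p - k))"
    unfolding M_def using integrable_sph_monom[OF ij(1,2)]
    by (subst Bochner_Integration.integral_sum) auto
  finally show ?thesis .
qed

text \<open>The sphere equation multiplied by v_i^p; by symmetry the n - 1 terms with k different
  from i agree.\<close>

private lemma M_sum: "M p 2 * (real n - 1) + M (p + 2) 0 = real n * M p 0"
proof -
  have n: "n \<ge> 1" using ij by auto
  have "real n * M p 0 = (LINT v|sph n. v i ^ p * real n)"
    by (simp add: M_def)
  also have "\<dots> = (LINT v|sph n. (\<Sum>k\<in>{1..n}. v i ^ p * (v k)\<^sup>2))"
  proof (rule integral_cong_AE)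
    show "AE v in sph n. v i ^ p * real n = (\<Sum>k\<in>{1..n}. v i ^ p * (v k)\<^sup>2)"
      using AE_sph_kac[OF n] by eventually_elim (simp add: kac_sphere_def sum_distrib_left[symmetric])
  qed (auto simp: meas_sph intro!: borel_measurable_sum borel_measurable_times borel_measurable_power coord_measurable)
  also have "\<dots> = (\<Sum>k\<in>{1..n}. (LINT v|sph n. v i ^ p * (v k)\<^sup>2))"
    using ij integrable_sph_monom[of i n _ p 2] by (intro Bochner_Integration.integral_sum) auto
  also have "\<dots> = (\<Sum>k\<in>{1..n}. if k = i then M (p + 2) 0 else M p 2)"
  proof (rule sum.cong)
    fix k assume k: "k \<in> {1..n}"
    show "(LINT v|sph n. v i ^ p * (v k)\<^sup>2) = (if k = i then M (p + 2) 0 else M p 2)"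
      using integral_sph_coord2(1)[OF ij(1) k ij(1,2) _ ij(3), of "\<lambda>x y. x ^ p * y ^ 2"]
      by (auto simp: M_def power_add power2_eq_square mult_ac)
  qed simp
  also have "\<dots> = M (p + 2) 0 + (\<Sum>k\<in>{1..n}-{i}. M p 2)"
    using ij by (subst sum.remove[of _ i]) auto
  also have "\<dots> = M p 2 * (real n - 1) + M (p + 2) 0"
    using ij by (simp add: of_nat_diff)
  finally show ?thesis by simp
qed

private lemma M00: "M 0 0 = 1"
proof -
  interpret prob_space "sph n" by (rule prob_space_sph)
  show ?thesis using prob_space by (simp add: M_def)
qed

private lemma n2: "real n \<ge> 2"
  using ij by auto

private lemma M20: "M 2 0 = 1"
proof -
  have "M 0 2 * (real n - 1) + M 2 0 = real n * M 0 0"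
    using M_sum[of 0] by (simp add: numeral_2_eq_2)
  then have "real n * M 2 0 = real n" using M_sym[of 0 2] M00 by (simp add: algebra_simps)
  then show ?thesis using n2 by simp
qed

private lemma cs: "cos (pi / 4) = sqrt 2 / 2" "sin (pi / 4) = sqrt 2 / 2" "cos (pi / 3) = 1 / 2" "sin (pi / 3) = sqrt 3 / 2"
  by (simp_all add: cos_45 sin_45 cos_60 sin_60)

private lemma pw: "(sqrt 2 / 2) ^ 2 = 1 / 2" "(sqrt 2 / 2) ^ 4 = 1 / 4" "(sqrt 2 / 2) ^ 6 = 1 / 8" "(sqrt 2 / 2) ^ 8 = 1 / 16"
   "(sqrt 3 / 2) ^ 2 = 3 / 4" "(sqrt 3 / 2) ^ 4 = 9 / 16" "(sqrt 3 / 2) ^ 6 = 27 / 64" "(sqrt 3 / 2) ^ 8 = 81 / 256"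
proof -
  have *: "x ^ 4 = (x ^ 2) ^ 2" "x ^ 6 = (x ^ 2) ^ 3" "x ^ 8 = (x ^ 2) ^ 4" for x :: real
    by (simp_all flip: power_mult)
  show 2: "(sqrt 2 / 2) ^ 2 = (1 / 2 :: real)" and 3: "(sqrt 3 / 2) ^ 2 = (3 / 4 :: real)"
    by (simp_all add: power_divide)
  show "(sqrt 2 / 2) ^ 4 = (1 / 4::real)" "(sqrt 2 / 2) ^ 6 = (1 / 8::real)" "(sqrt 2 / 2) ^ 8 = (1 / 16::real)"
   "(sqrt 3 / 2) ^ 4 = (9 / 16::real)" "(sqrt 3 / 2) ^ 6 = (27 / 64::real)" "(sqrt 3 / 2) ^ 8 = (81 / 256::real)"
    unfolding * 2 3 by (simp_all add: power_divide)
qed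

private lemma sum_upto:
  fixes g :: "nat \<Rightarrow> real"
  shows "(\<Sum>k\<le>4. g k) = g 0 + g 1 + g 2 + g 3 + g 4"
    "(\<Sum>k\<le>6. g k) = g 0 + g 1 + g 2 + g 3 + g 4 + g 5 + g 6"
    "(\<Sum>k\<le>8. g k) = g 0 + g 1 + g 2 + g 3 + g 4 + g 5 + g 6 + g 7 + g 8"
proof -
  have "{..4} = set [0,1,2,3,4::nat]" "{..6} = set [0,1,2,3,4,5,6::nat]" "{..8} = set [0,1,2,3,4,5,6,7,8::nat]"
    by auto
  then show "(\<Sum>k\<le>4. g k) = g 0 + g 1 + g 2 + g 3 + g 4"
    "(\<Sum>k\<le>6. g k) = g 0 + g 1 + g 2 + g 3 + g 4 + g 5 + g 6"
    "(\<Sum>k\<le>8. g k) = g 0 + g 1 + g 2 + g 3 + g 4 + g 5 + g 6 + g 7 + g 8"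
    by (simp_all add: add.assoc)
qed

private lemma choose_num:
  "(4 choose 2) = 6" "(6 choose 2) = 15" "(6 choose 4) = 15" "(8 choose 2) = 28" "(8 choose 4) = 70" "(8 choose 6) = 28"
  by code_simp+

private lemma M_rot4:
  "M 4 0 = sin \<theta> ^ 4 * M 4 0 + 6 * cos \<theta> ^ 2 * sin \<theta> ^ 2 * M 2 2 + cos \<theta> ^ 4 * M 4 0"
  using M_rot[of 4 \<theta>] M_odd[of 1 3] M_odd[of 3 1] M_sym[of 0 4]
  unfolding sum_upto by (simp add: choose_num One_nat_def)

private lemma M_rot6:
  "M 6 0 = sin \<theta> ^ 6 * M 6 0 + 15 * cos \<theta> ^ 2 * sin \<theta> ^ 4 * M 4 2 + 15 * cos \<theta> ^ 4 * sin \<theta> ^ 2 * M 4 2 + cos \<theta> ^ 6 * M 6 0"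
  using M_rot[of 6 \<theta>] M_odd[of 1 5] M_odd[of 5 1] M_odd[of 3 3] M_sym[of 0 6] M_sym[of 2 4]
  unfolding sum_upto by (simp add: choose_num One_nat_def)

private lemma M_rot8:
  "M 8 0 = sin \<theta> ^ 8 * M 8 0 + 28 * cos \<theta> ^ 2 * sin \<theta> ^ 6 * M 6 2 + 70 * cos \<theta> ^ 4 * sin \<theta> ^ 4 * M 4 4
     + 28 * cos \<theta> ^ 6 * sin \<theta> ^ 2 * M 6 2 + cos \<theta> ^ 8 * M 8 0"
  using M_rot[of 8 \<theta>] M_odd[of 1 7] M_odd[of 7 1] M_odd[of 3 5] M_odd[of 5 3] M_sym[of 0 8] M_sym[of 2 6]
  unfolding sum_upto by (simp add: choose_num One_nat_def)

text \<open>In degrees 4 and 6 symmetry leaves a single mixed moment, and the angle pi/4 is enough.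
  Degree 8 has the two unknowns M 6 2 and M 4 4, hence the second angle pi/3.\<close>

private lemma M_rel: "3 * M 2 2 = M 4 0" "5 * M 4 2 = M 6 0" "7 * M 6 2 = M 8 0" "35 * M 4 4 = 3 * M 8 0"
proof -
  show "3 * M 2 2 = M 4 0" using M_rot4[of "pi / 4"] by (simp add: cs pw)
  show "5 * M 4 2 = M 6 0" using M_rot6[of "pi / 4"] by (simp add: cs pw)
  have "56 * M 6 2 + 70 * M 4 4 = 14 * M 8 0" using M_rot8[of "pi / 4"] by (simp add: cs pw)
  moreover have "M 8 0 = 81/256 * M 8 0 + 28 * (1/4) * (27/64) * M 6 2 + 70 * (1/16) * (9/16) * M 4 4
     + 28 * (1/64) * (3/4) * M 6 2 + 1/256 * M 8 0"
    using M_rot8[of "pi / 3"] unfolding cs pw by (simp add: power_divide)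
  ultimately show "7 * M 6 2 = M 8 0" "35 * M 4 4 = 3 * M 8 0" by linarith+
qed

text \<open>Eliminating the mixed moments from \<open>M_sum\<close> gives M (2k+2) 0 * (n + 2k) =
  (2k+1) * n * M (2k) 0.\<close>

private lemma M_even: "M 4 0 = 3 * real n / (real n + 2)" "M 6 0 = 15 * real n ^ 2 / ((real n + 2) * (real n + 4))"
  "M 8 0 = 105 * real n ^ 3 / ((real n + 2) * (real n + 4) * (real n + 6))"
proof -
  have "M 2 2 * (real n - 1) + M 4 0 = real n" using M_sum[of 2] M20 by simp
  then have 4: "M 4 0 * (real n + 2) = 3 * real n" unfolding M_rel(1)[symmetric] by (simp add: algebra_simps)
  have "M 4 2 * (real n - 1) + M 6 0 = real n * M 4 0" using M_sum[of 4] by simp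
  then have "M 6 0 * (real n + 4) = 5 * real n * M 4 0" unfolding M_rel(2)[symmetric] by (simp add: algebra_simps)
  then have 6: "M 6 0 * ((real n + 2) * (real n + 4)) = 15 * real n ^ 2" using 4 by algebra
  have "M 6 2 * (real n - 1) + M 8 0 = real n * M 6 0" using M_sum[of 6] by simp
  then have "M 8 0 * (real n + 6) = 7 * real n * M 6 0" unfolding M_rel(3)[symmetric] by (simp add: algebra_simps)
  then have 8: "M 8 0 * ((real n + 2) * (real n + 4) * (real n + 6)) = 105 * real n ^ 3" using 6 by algebra
  have "real n + 2 \<noteq> 0" "real n + 4 \<noteq> 0" "real n + 6 \<noteq> 0" using n2 by auto
  then show "M 4 0 = 3 * real n / (real n + 2)" "M 6 0 = 15 * real n ^ 2 / ((real n + 2) * (real n + 4))"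
    "M 8 0 = 105 * real n ^ 3 / ((real n + 2) * (real n + 4) * (real n + 6))"
    by (simp_all only: nonzero_eq_divide_eq no_zero_divisors 4 6 8 not_False_eq_True)
qed

lemma sph_moments:
  "(LINT v|sph n. (v i)\<^sup>2) = 1"
  "(LINT v|sph n. v i ^ 4) = 3 * real n / (real n + 2)"
  "(LINT v|sph n. v i ^ 8) = 105 * real n ^ 3 / ((real n + 2) * (real n + 4) * (real n + 6))"
  "(LINT v|sph n. (v i)\<^sup>2 * (v j)\<^sup>2) = real n / (real n + 2)"
  "(LINT v|sph n. v i ^ 4 * v j ^ 4) = 9 * real n ^ 3 / ((real n + 2) * (real n + 4) * (real n + 6))"
  using M20 M_even M_rel by (simp_all add: M_def)

end

text \<open>Used twice: for the conditional variance of the fluctuation \<open>Z\<close> of the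
  quadratic weight, and to normalise the test function which shows that the infimum defining the gap
  is over a nonempty set.\<close>

lemma sph_var_fourth:
  assumes n: "n \<ge> 2"
  shows "(LINT v|sph n. ((\<Sum>k\<in>{1..n}. v k ^ 4) - 3 * real n ^ 2 / (real n + 2))\<^sup>2) =
    24 * (real n - 1) * real n ^ 4 / ((real n + 2) ^ 2 * (real n + 4) * (real n + 6))"
proof -
  interpret prob_space "sph n" by (rule prob_space_sph)
  let ?a = "105 * real n ^ 3 / ((real n + 2) * (real n + 4) * (real n + 6)) :: real"
  let ?b = "9 * real n ^ 3 / ((real n + 2) * (real n + 4) * (real n + 6)) :: real"
  let ?c = "3 * real n ^ 2 / (real n + 2) :: real"
  have ij: "1 \<in> {1..n}" "2 \<in> {1..n}" "1 \<noteq> (2::nat)" using n by auto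
  have m8: "(LINT v|sph n. v i ^ 4 * v j ^ 4) = (if i = j then ?a else ?b)" if "i \<in> {1..n}" "j \<in> {1..n}" for i j
  proof (cases "i = j")
    case True
    obtain k where "k \<in> {1..n}" "i \<noteq> k" using ij by metis
    then show ?thesis using sph_moments(3)[of i n k] that True by (simp flip: power_add)
  qed (use sph_moments(5) that in auto)
  have m4: "(LINT v|sph n. v i ^ 4) = 3 * real n / (real n + 2)" if "i \<in> {1..n}" for i
  proof -
    obtain k where "k \<in> {1..n}" "i \<noteq> k" using ij by metis
    then show ?thesis using sph_moments(2)[of i n k] that by simp
  qed
  have int1: "integrable (sph n) (\<lambda>v. \<Sum>k\<in>{1..n}. v k ^ 4)"
    by (intro Bochner_Integration.integrable_sum integrable_sph_power) auto
  have int2: "integrable (sph n) (\<lambda>v. (\<Sum>k\<in>{1..n}. v k ^ 4)\<^sup>2)"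
    unfolding power2_eq_square sum_product
    by (intro Bochner_Integration.integrable_sum integrable_sph_monom) auto
  have e1: "(LINT v|sph n. (\<Sum>k\<in>{1..n}. v k ^ 4)) = ?c"
    by (subst Bochner_Integration.integral_sum) (auto simp: m4 power2_eq_square intro!: integrable_sph_power)
  have "(LINT v|sph n. (\<Sum>k\<in>{1..n}. v k ^ 4)\<^sup>2) = (\<Sum>i\<in>{1..n}. \<Sum>j\<in>{1..n}. (LINT v|sph n. v i ^ 4 * v j ^ 4))"
    unfolding power2_eq_square sum_product
    by (subst Bochner_Integration.integral_sum, intro Bochner_Integration.integrable_sum integrable_sph_monom, simp, simp,
        intro sum.cong refl Bochner_Integration.integral_sum integrable_sph_monom) auto
  also have "\<dots> = (\<Sum>i\<in>{1..n}. ?a + (real n - 1) * ?b)"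
  proof (rule sum.cong)
    fix i assume i: "i \<in> {1..n}"
    have "(\<Sum>j\<in>{1..n}. (LINT v|sph n. v i ^ 4 * v j ^ 4)) = (\<Sum>j\<in>{1..n}. (if i = j then ?a else ?b))"
      using i by (intro sum.cong m8) auto
    also have "\<dots> = ?a + (\<Sum>j\<in>{1..n}-{i}. ?b)"
      using i by (subst sum.remove[of _ i]) (auto intro!: sum.cong)
    finally show "(\<Sum>j\<in>{1..n}. (LINT v|sph n. v i ^ 4 * v j ^ 4)) = ?a + (real n - 1) * ?b"
      using i n by (simp add: of_nat_diff)
  qed simp
  also have "\<dots> = real n * (?a + (real n - 1) * ?b)" by simp
  finally have e2: "(LINT v|sph n. (\<Sum>k\<in>{1..n}. v k ^ 4)\<^sup>2) = real n * (?a + (real n - 1) * ?b)" .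
  have "(LINT v|sph n. ((\<Sum>k\<in>{1..n}. v k ^ 4) - ?c)\<^sup>2) = (LINT v|sph n. (\<Sum>k\<in>{1..n}. v k ^ 4)\<^sup>2 - 2 * ?c * (\<Sum>k\<in>{1..n}. v k ^ 4) + ?c\<^sup>2)"
    by (simp add: power2_diff algebra_simps)
  also have "\<dots> = (LINT v|sph n. (\<Sum>k\<in>{1..n}. v k ^ 4)\<^sup>2) - 2 * ?c * (LINT v|sph n. (\<Sum>k\<in>{1..n}. v k ^ 4)) + ?c\<^sup>2"
    using int1 int2 by (simp add: prob_space)
  also have "\<dots> = real n * (?a + (real n - 1) * ?b) - ?c\<^sup>2"
    unfolding e1 e2 by (simp add: power2_eq_square)
  also have "\<dots> = 24 * (real n - 1) * real n ^ 4 / ((real n + 2) ^ 2 * (real n + 4) * (real n + 6))"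
  proof -
    define x where "x = real n"
    have x: "x + 2 \<noteq> 0" "x + 4 \<noteq> 0" "x + 6 \<noteq> 0" by (simp_all add: x_def)
    have "x * (105 * x ^ 3 / ((x + 2) * (x + 4) * (x + 6)) + (x - 1) * (9 * x ^ 3 / ((x + 2) * (x + 4) * (x + 6)))) - (3 * x ^ 2 / (x + 2))\<^sup>2
       = (x * (96 * x ^ 3 + 9 * x ^ 4) * (x + 2) - 9 * x ^ 4 * (x + 4) * (x + 6)) / ((x + 2) ^ 2 * (x + 4) * (x + 6))"
      using x by (simp add: divide_simps power2_eq_square) algebra
    also have "x * (96 * x ^ 3 + 9 * x ^ 4) * (x + 2) - 9 * x ^ 4 * (x + 4) * (x + 6) = 24 * (x - 1) * x ^ 4"
      by algebra
    finally show ?thesis by (simp add: x_def)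
  qed
  finally show ?thesis .
qed

subsection \<open>Marginal and conditional laws\<close>

text \<open>The law of one coordinate on the sphere with parameter n + 1, indexed by the parameter n
  of its slices.\<close>

definition mrg :: "nat \<Rightarrow> real measure" where
  "mrg n = distr (sph (Suc n)) borel (\<lambda>v. v (Suc n))"

lemma last_measurable [measurable]: "(\<lambda>v. v (Suc n)) \<in> borel_measurable (bor (Suc n))"
  by (rule coord_measurable) auto

lemma prob_space_mrg: "prob_space (mrg n)"
proof -
  interpret prob_space "sph (Suc n)" by (rule prob_space_sph)
  show ?thesis unfolding mrg_def by (rule prob_space_distr) (simp add: meas_sph)
qed

lemma sets_mrg [measurable_cong, simp]: "sets (mrg n) = sets borel"
  by (simp add: mrg_def)

lemma space_mrg [simp]: "space (mrg n) = UNIV"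
  by (simp add: mrg_def)

text \<open>Independence of the last coordinate and the rescaled remaining ones; it turns
  conditioning into Fubini's theorem for a product measure.\<close>

lemma sph_Suc:
  assumes n: "n \<ge> 1"
  shows "sph (Suc n) = distr (mrg n \<Otimes>\<^sub>M sph n) (bor (Suc n)) (\<lambda>(x, w). glue n x w)"
proof (rule measure_eqI)
  interpret prob_space "sph n" by (rule prob_space_sph)
  have [measurable]: "(\<lambda>(x, w). glue n x w) \<in> measurable (mrg n \<Otimes>\<^sub>M sph n) (bor (Suc n))" by measurable
  fix A assume "A \<in> sets (sph (Suc n))"
  then have [measurable]: "A \<in> sets (bor (Suc n))" by (simp add: sets_sph)
  have "emeasure (sph (Suc n)) A = (\<integral>\<^sup>+v. indicator A v \<partial>sph (Suc n))"
    by (simp add: sets_sph)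
  also have "\<dots> = (\<integral>\<^sup>+v. (\<integral>\<^sup>+w. indicator A (glue n (v (Suc n)) w) \<partial>sph n) \<partial>sph (Suc n))"
    by (rule nn_integral_sph_Suc[OF n]) measurable
  also have "\<dots> = (\<integral>\<^sup>+x. (\<integral>\<^sup>+w. indicator A (glue n x w) \<partial>sph n) \<partial>mrg n)"
    unfolding mrg_def by (subst nn_integral_distr) (auto simp: meas_sph)
  also have "\<dots> = (\<integral>\<^sup>+p. indicator A (case p of (x, w) \<Rightarrow> glue n x w) \<partial>(mrg n \<Otimes>\<^sub>M sph n))"
    by (subst nn_integral_fst[symmetric]) auto
  also have "\<dots> = (\<integral>\<^sup>+v. indicator A v \<partial>distr (mrg n \<Otimes>\<^sub>M sph n) (bor (Suc n)) (\<lambda>(x, w). glue n x w))"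
    by (subst nn_integral_distr) auto
  also have "\<dots> = emeasure (distr (mrg n \<Otimes>\<^sub>M sph n) (bor (Suc n)) (\<lambda>(x, w). glue n x w)) A"
    by (subst nn_integral_indicator) auto
  finally show "emeasure (sph (Suc n)) A = emeasure (distr (mrg n \<Otimes>\<^sub>M sph n) (bor (Suc n)) (\<lambda>(x, w). glue n x w)) A" .
qed (simp add: sets_sph)

lemma glue_meas1: "glue n x \<in> measurable (bor n) (bor (Suc n))"
proof -
  have "(\<lambda>w. (case (x, w) of (x, w) \<Rightarrow> glue n x w)) \<in> measurable (bor n) (bor (Suc n))"
    by (rule measurable_compose[OF _ glue_measurable]) measurable
  then show ?thesis by simp
qed

lemma integral_mrg:
  fixes g :: "real \<Rightarrow> real"
  assumes [measurable]: "g \<in> borel_measurable borel"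
  shows "(LINT x|mrg n. g x) = (LINT v|sph (Suc n). g (v (Suc n)))"
    and "integrable (mrg n) g \<longleftrightarrow> integrable (sph (Suc n)) (\<lambda>v. g (v (Suc n)))"
proof -
  have [measurable]: "(\<lambda>v. v (Suc n)) \<in> borel_measurable (sph (Suc n))" by (simp add: meas_sph)
  show "(LINT x|mrg n. g x) = (LINT v|sph (Suc n). g (v (Suc n)))"
    unfolding mrg_def by (subst integral_distr) auto
  show "integrable (mrg n) g \<longleftrightarrow> integrable (sph (Suc n)) (\<lambda>v. g (v (Suc n)))"
    unfolding mrg_def by (subst integrable_distr_eq) auto
qed

lemma AE_mrg_le: "AE x in mrg n. x\<^sup>2 \<le> real (Suc n)"
proof -
  have "AE v in sph (Suc n). (v (Suc n))\<^sup>2 \<le> real (Suc n)"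
    using AE_sph_kac[of "Suc n"] by (auto elim!: eventually_mono dest: kac_coord_le(1)[of _ _ "Suc n"])
  then show ?thesis
    unfolding mrg_def by (subst AE_distr_iff) (auto simp: meas_sph)
qed

lemma sph_disintegrate:
  fixes f :: "(nat \<Rightarrow> real) \<Rightarrow> real"
  assumes n: "n \<ge> 1" and [measurable]: "f \<in> borel_measurable (bor (Suc n))" and int: "integrable (sph (Suc n)) f"
  shows "AE x in mrg n. integrable (sph n) (\<lambda>w. f (glue n x w))"
    and "integrable (mrg n) (\<lambda>x. LINT w|sph n. f (glue n x w))"
    and "(LINT v|sph (Suc n). f v) = (LINT x|mrg n. (LINT w|sph n. f (glue n x w)))"
proof -
  interpret X: prob_space "mrg n" by (rule prob_space_mrg)
  interpret W: prob_space "sph n" by (rule prob_space_sph)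
  interpret pair_sigma_finite "mrg n" "sph n" ..
  have [measurable]: "(\<lambda>(x, w). glue n x w) \<in> measurable (mrg n \<Otimes>\<^sub>M sph n) (bor (Suc n))" by measurable
  have int': "integrable (mrg n \<Otimes>\<^sub>M sph n) (\<lambda>p. f (case p of (x, w) \<Rightarrow> glue n x w))"
    using int unfolding sph_Suc[OF n] by (subst (asm) integrable_distr_eq) auto
  then have int'': "integrable (mrg n \<Otimes>\<^sub>M sph n) (\<lambda>(x, w). f (glue n x w))" by (simp add: split_def)
  show "AE x in mrg n. integrable (sph n) (\<lambda>w. f (glue n x w))" by (rule AE_integrable_fst[OF int''])
  show "integrable (mrg n) (\<lambda>x. LINT w|sph n. f (glue n x w))" by (rule integrable_fst[OF int''])
  have "(LINT v|sph (Suc n). f v) = (LINT p|(mrg n \<Otimes>\<^sub>M sph n). f (case p of (x, w) \<Rightarrow> glue n x w))"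
    unfolding sph_Suc[OF n] by (subst integral_distr) auto
  also have "\<dots> = (LINT x|mrg n. (LINT w|sph n. f (glue n x w)))"
    using integral_fst[OF int''] by (simp add: split_def)
  finally show "(LINT v|sph (Suc n). f v) = (LINT x|mrg n. (LINT w|sph n. f (glue n x w)))" .
qed

lemma AE_sph_Suc:
  assumes n: "n \<ge> 1" and [measurable]: "Measurable.pred (bor (Suc n)) P" and P: "AE v in sph (Suc n). P v"
  shows "AE x in mrg n. AE w in sph n. P (glue n x w)"
proof -
  interpret X: prob_space "mrg n" by (rule prob_space_mrg)
  interpret W: prob_space "sph n" by (rule prob_space_sph)
  interpret pair_sigma_finite "mrg n" "sph n" ..
  have [measurable]: "(\<lambda>(x, w). glue n x w) \<in> measurable (mrg n \<Otimes>\<^sub>M sph n) (bor (Suc n))" by measurable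
  have "AE p in mrg n \<Otimes>\<^sub>M sph n. P (case p of (x, w) \<Rightarrow> glue n x w)"
    using P unfolding sph_Suc[OF n] by (subst (asm) AE_distr_iff) auto
  then have "AE p in mrg n \<Otimes>\<^sub>M sph n. (case p of (x, w) \<Rightarrow> P (glue n x w))" by (simp add: split_def)
  then show ?thesis using AE_pair by fastforce
qed

subsection \<open>Square-integrable functions\<close>

definition sqi :: "'a measure \<Rightarrow> ('a \<Rightarrow> real) \<Rightarrow> bool" where
  "sqi M f \<longleftrightarrow> f \<in> borel_measurable M \<and> integrable M (\<lambda>x. (f x)\<^sup>2)"

definition nr :: "'a measure \<Rightarrow> ('a \<Rightarrow> real) \<Rightarrow> real" where
  "nr M f = sqrt (LINT x|M. (f x)\<^sup>2)"

lemma sqiD: "sqi M f \<Longrightarrow> f \<in> borel_measurable M" "sqi M f \<Longrightarrow> integrable M (\<lambda>x. (f x)\<^sup>2)"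
  by (auto simp: sqi_def)

lemma nr_nonneg [simp]: "nr M f \<ge> 0"
  by (simp add: nr_def)

lemma nr_sq: "(nr M f)\<^sup>2 = (LINT x|M. (f x)\<^sup>2)"
  by (simp add: nr_def)

lemma sqi_mult_integrable:
  assumes "sqi M f" "sqi M g"
  shows "integrable M (\<lambda>x. f x * g x)"
proof (rule Bochner_Integration.integrable_bound)
  show "integrable M (\<lambda>x. (f x)\<^sup>2 + (g x)\<^sup>2)"
    using assms by (auto simp: sqi_def)
  have "\<bar>a * b\<bar> \<le> a\<^sup>2 + b\<^sup>2" for a b :: real
  proof -
    have "2 * (\<bar>a\<bar> * \<bar>b\<bar>) \<le> a\<^sup>2 + b\<^sup>2"
      using sum_squares_bound[of "\<bar>a\<bar>" "\<bar>b\<bar>"] by simp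
    moreover have "0 \<le> \<bar>a\<bar> * \<bar>b\<bar>" by simp
    ultimately show ?thesis unfolding abs_mult by linarith
  qed
  then show "AE x in M. norm (f x * g x) \<le> norm ((f x)\<^sup>2 + (g x)\<^sup>2)" by simp
qed (use assms in \<open>auto simp: sqi_def\<close>)

lemma sqi_cmult: "sqi M f \<Longrightarrow> sqi M (\<lambda>x. c * f x)"
  by (auto simp: sqi_def power_mult_distrib)

lemma sqi_add:
  assumes "sqi M f" "sqi M g"
  shows "sqi M (\<lambda>x. f x + g x)"
  using assms sqi_mult_integrable[OF assms]
  by (auto simp: sqi_def power2_sum mult.assoc)

lemma sqi_uminus: "sqi M f \<Longrightarrow> sqi M (\<lambda>x. - f x)"
  by (auto simp: sqi_def)

lemma sqi_diff: "sqi M f \<Longrightarrow> sqi M g \<Longrightarrow> sqi M (\<lambda>x. f x - g x)"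
  using sqi_add[of M f "\<lambda>x. - g x"] sqi_uminus[of M g] by simp

lemma sqi_zero: "sqi M (\<lambda>x. 0)"
  by (simp add: sqi_def)

lemma sqi_sum: "(\<And>i. i \<in> I \<Longrightarrow> sqi M (f i)) \<Longrightarrow> sqi M (\<lambda>x. \<Sum>i\<in>I. f i x)"
  by (induction I rule: infinite_finite_induct) (auto intro: sqi_add sqi_zero)

lemma (in finite_measure) sqi_const: "sqi M (\<lambda>x. c)"
  by (simp add: sqi_def)

lemma sqi_bounded_mult:
  assumes f: "sqi M f" and g: "g \<in> borel_measurable M" "AE x in M. \<bar>g x\<bar> \<le> B"
  shows "sqi M (\<lambda>x. g x * f x)"
  unfolding sqi_def
proof
  show "integrable M (\<lambda>x. (g x * f x)\<^sup>2)"
  proof (rule Bochner_Integration.integrable_bound)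
    show "integrable M (\<lambda>x. B\<^sup>2 * (f x)\<^sup>2)" using f by (auto simp: sqi_def)
    show "AE x in M. norm ((g x * f x)\<^sup>2) \<le> norm (B\<^sup>2 * (f x)\<^sup>2)"
      using g(2) by eventually_elim (auto simp: power_mult_distrib intro!: mult_right_mono abs_le_square_iff[THEN iffD1])
  qed (use f g in \<open>auto simp: sqi_def\<close>)
qed (use f g in \<open>auto simp: sqi_def\<close>)

lemma (in finite_measure) sqi_bounded:
  assumes "g \<in> borel_measurable M" "AE x in M. \<bar>g x\<bar> \<le> B"
  shows "sqi M g"
  using sqi_bounded_mult[OF sqi_const[of 1] assms] by simp

lemma (in finite_measure) sqi_integrable: "sqi M f \<Longrightarrow> integrable M f"
  using sqi_mult_integrable[of M f "\<lambda>_. 1"] sqi_const by simp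

lemma psd_determinant:
  fixes a b c :: real
  assumes q: "\<And>s t. s\<^sup>2 * a + 2 * s * t * b + t\<^sup>2 * c \<ge> 0" and a: "a \<ge> 0" and c: "c \<ge> 0"
  shows "b\<^sup>2 \<le> a * c"
proof (cases "c = 0")
  case True
  have "b = 0"
  proof (rule ccontr)
    assume "b \<noteq> 0"
    \<comment> \<open>For c = 0 the form is affine in t, and this t brings it down to -1.\<close>
    then have "(1::real)\<^sup>2 * a + 2 * 1 * (- (a + 1) / (2 * b)) * b + (- (a + 1) / (2 * b))\<^sup>2 * c = - 1"
      using True by (simp add: field_simps)
    then show False using q[of 1 "- (a + 1) / (2 * b)"] by simp
  qed
  then show ?thesis using a c by simp
next
  case False
  then have c: "c > 0" using c by linarith
  have "c * (a * c - b\<^sup>2) \<ge> 0" using q[of c "- b"] by (simp add: power2_eq_square algebra_simps)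
  then show ?thesis using c by (simp add: zero_le_mult_iff)
qed

lemma nr_cauchy_schwarz:
  assumes f: "sqi M f" and g: "sqi M g"
  shows "\<bar>LINT x|M. f x * g x\<bar> \<le> nr M f * nr M g"
proof -
  let ?a = "LINT x|M. (f x)\<^sup>2" let ?b = "LINT x|M. f x * g x" let ?c = "LINT x|M. (g x)\<^sup>2"
  note int = sqiD(2)[OF f] sqiD(2)[OF g] sqi_mult_integrable[OF f g]
  have q: "s\<^sup>2 * ?a + 2 * s * t * ?b + t\<^sup>2 * ?c \<ge> 0" for s t
  proof -
    have "0 \<le> (LINT x|M. (s * f x + t * g x)\<^sup>2)" by simp
    also have "\<dots> = (LINT x|M. s\<^sup>2 * (f x)\<^sup>2 + (2 * s * t) * (f x * g x) + t\<^sup>2 * (g x)\<^sup>2)"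
      by (intro Bochner_Integration.integral_cong refl) (simp add: power2_eq_square algebra_simps)
    also have "\<dots> = s\<^sup>2 * ?a + 2 * s * t * ?b + t\<^sup>2 * ?c"
      using int by simp
    finally show ?thesis .
  qed
  have "?b\<^sup>2 \<le> ?a * ?c" by (rule psd_determinant[OF q]) simp_all
  then have "sqrt (?b\<^sup>2) \<le> sqrt (?a * ?c)" by (rule real_sqrt_le_mono)
  then show ?thesis unfolding nr_def real_sqrt_mult real_sqrt_abs .
qed

lemma nr_add_sq:
  assumes "sqi M f" "sqi M g"
  shows "(nr M (\<lambda>x. f x + g x))\<^sup>2 = (nr M f)\<^sup>2 + 2 * (LINT x|M. f x * g x) + (nr M g)\<^sup>2"
  using assms sqi_mult_integrable[OF assms]
  by (simp add: nr_sq power2_sum sqi_def mult.assoc)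

lemma nr_triangle:
  assumes "sqi M f" "sqi M g"
  shows "nr M (\<lambda>x. f x + g x) \<le> nr M f + nr M g"
proof (rule power2_le_imp_le)
  show "(nr M (\<lambda>x. f x + g x))\<^sup>2 \<le> (nr M f + nr M g)\<^sup>2"
    using nr_cauchy_schwarz[OF assms] unfolding nr_add_sq[OF assms]
    by (simp add: power2_sum)
qed simp

lemma nr_uminus: "nr M (\<lambda>x. - f x) = nr M f"
  by (simp add: nr_def)

lemma nr_cmult: "nr M (\<lambda>x. c * f x) = \<bar>c\<bar> * nr M f"
  by (simp add: nr_def power_mult_distrib real_sqrt_mult)

lemma nr_diff_triangle:
  assumes "sqi M f" "sqi M g" "sqi M h"
  shows "nr M (\<lambda>x. f x - h x) \<le> nr M (\<lambda>x. f x - g x) + nr M (\<lambda>x. g x - h x)"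
  using nr_triangle[OF sqi_diff[OF assms(1,2)] sqi_diff[OF assms(2,3)]] by simp

lemma (in prob_space) expectation_sq_le:
  assumes "sqi M f"
  shows "(expectation f)\<^sup>2 \<le> expectation (\<lambda>x. (f x)\<^sup>2)"
proof -
  have "\<bar>expectation f\<bar> \<le> nr M f"
    using nr_cauchy_schwarz[OF assms sqi_const[of 1]] prob_space by (simp add: nr_def)
  then have "(expectation f)\<^sup>2 \<le> (nr M f)\<^sup>2" by (intro abs_le_square_iff[THEN iffD1]) simp
  then show ?thesis by (simp add: nr_sq)
qed

subsection \<open>Density of polynomials\<close>

locale bounded_law = prob_space \<nu> for \<nu> :: "real measure" +
  fixes R :: real
  assumes sets_law [measurable_cong, simp]: "sets \<nu> = sets borel"
    and bounded_law: "AE x in \<nu>. \<bar>x\<bar> \<le> R"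
begin

lemma space_law [simp]: "space \<nu> = UNIV"
  using sets_eq_imp_space_eq[OF sets_law] by simp

lemma meas_law: "measurable \<nu> M = measurable borel M"
  by (rule measurable_cong_sets) simp_all

lemma sqi_continuous:
  assumes "continuous_on UNIV f"
  shows "sqi \<nu> f"
proof -
  have "compact (f ` {-R..R})"
    using assms by (intro compact_continuous_image) (auto intro: continuous_on_subset)
  then obtain B where "\<forall>y\<in>f ` {-R..R}. norm y \<le> B"
    using compact_imp_bounded bounded_iff by metis
  then have B: "\<bar>f x\<bar> \<le> B" if "x \<in> {-R..R}" for x using that by simp
  show ?thesis
  proof (rule sqi_bounded)
    show "f \<in> borel_measurable \<nu>" using borel_measurable_continuous_onI[OF assms] by (simp add: meas_law)
    show "AE x in \<nu>. \<bar>f x\<bar> \<le> B" using bounded_law by eventually_elim (auto intro!: B)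
  qed
qed

lemma sqi_poly: "sqi \<nu> (poly p)"
  by (rule sqi_continuous) (auto intro!: continuous_intros)

text \<open>The L^2 closure of the polynomials. It is shown to contain continuous functions by
  Weierstrass, half-lines by ramps, Borel sets by complements and disjoint unions, and finally
  simple functions and their limits.\<close>

definition apx :: "(real \<Rightarrow> real) \<Rightarrow> bool" where
  "apx f \<longleftrightarrow> sqi \<nu> f \<and> (\<forall>e>0. \<exists>p. nr \<nu> (\<lambda>x. f x - poly p x) < e)"

lemma apx_lim:
  assumes "sqi \<nu> f" "\<And>e. e > 0 \<Longrightarrow> \<exists>g. apx g \<and> nr \<nu> (\<lambda>x. f x - g x) < e"
  shows "apx f"
  unfolding apx_def
proof (intro conjI allI impI)
  fix e :: real assume "e > 0"
  then obtain g where g: "apx g" "nr \<nu> (\<lambda>x. f x - g x) < e / 2" using assms(2)[of "e/2"] by auto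
  then obtain p where p: "nr \<nu> (\<lambda>x. g x - poly p x) < e / 2" using \<open>e > 0\<close> by (auto simp: apx_def dest: spec[of _ "e/2"])
  have "nr \<nu> (\<lambda>x. f x - poly p x) \<le> nr \<nu> (\<lambda>x. f x - g x) + nr \<nu> (\<lambda>x. g x - poly p x)"
    using assms(1) g(1) by (intro nr_diff_triangle sqi_poly) (auto simp: apx_def)
  then show "\<exists>p. nr \<nu> (\<lambda>x. f x - poly p x) < e" using g(2) p by (intro exI[of _ p]) linarith
qed fact

lemma apx_lim_seq:
  assumes f: "sqi \<nu> f" and g: "\<And>i. apx (g i)" and lim: "\<And>x. (\<lambda>i. g i x) \<longlonglongrightarrow> f x"
    and w: "integrable \<nu> w" "\<And>i x. (f x - g i x)\<^sup>2 \<le> w x"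
  shows "apx f"
proof (rule apx_lim[OF f])
  fix e :: real assume e: "e > 0"
  have [measurable]: "f \<in> borel_measurable \<nu>" "\<And>i. g i \<in> borel_measurable \<nu>"
    using f g by (auto simp: sqi_def apx_def)
  have "(\<lambda>i. LINT x|\<nu>. (f x - g i x)\<^sup>2) \<longlonglongrightarrow> (LINT x|\<nu>. 0)"
  proof (rule integral_dominated_convergence[OF _ _ w(1)])
    show "AE x in \<nu>. (\<lambda>i. (f x - g i x)\<^sup>2) \<longlonglongrightarrow> 0"
    proof (rule AE_I2)
      fix x
      have "(\<lambda>i. (f x - g i x)\<^sup>2) \<longlonglongrightarrow> (f x - f x)\<^sup>2" by (intro tendsto_intros lim)
      then show "(\<lambda>i. (f x - g i x)\<^sup>2) \<longlonglongrightarrow> 0" by simp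
    qed
    show "AE x in \<nu>. norm ((f x - g i x)\<^sup>2) \<le> w x" for i using w(2) by simp
  qed auto
  then have "(\<lambda>i. nr \<nu> (\<lambda>x. f x - g i x)) \<longlonglongrightarrow> 0"
    unfolding nr_def by (auto intro!: tendsto_eq_intros)
  then have "\<forall>\<^sub>F i in sequentially. nr \<nu> (\<lambda>x. f x - g i x) < e"
    using e by (rule order_tendstoD)
  then obtain i where "nr \<nu> (\<lambda>x. f x - g i x) < e" by (auto simp: eventually_sequentially)
  then show "\<exists>g. apx g \<and> nr \<nu> (\<lambda>x. f x - g x) < e" using g by blast
qed

lemma apx_poly: "apx (poly p)"
  unfolding apx_def using sqi_poly by (auto intro!: exI[of _ p] simp: nr_def)

lemma apx_zero: "apx (\<lambda>x. 0)"
proof -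
  have "poly (0 :: real poly) = (\<lambda>x. 0)" by auto
  then show ?thesis using apx_poly[of 0] by simp
qed

lemma apx_add:
  assumes f: "apx f" and g: "apx g"
  shows "apx (\<lambda>x. f x + g x)"
  unfolding apx_def
proof (intro conjI allI impI)
  show "sqi \<nu> (\<lambda>x. f x + g x)" using f g by (auto simp: apx_def intro: sqi_add)
  fix e :: real assume "e > 0"
  then obtain p q where p: "nr \<nu> (\<lambda>x. f x - poly p x) < e / 2" and q: "nr \<nu> (\<lambda>x. g x - poly q x) < e / 2"
    using f g by (auto simp: apx_def dest!: spec[of _ "e/2"])
  have "nr \<nu> (\<lambda>x. (f x - poly p x) + (g x - poly q x)) \<le> nr \<nu> (\<lambda>x. f x - poly p x) + nr \<nu> (\<lambda>x. g x - poly q x)"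
    using f g by (intro nr_triangle sqi_diff sqi_poly) (auto simp: apx_def)
  moreover have "(\<lambda>x. (f x - poly p x) + (g x - poly q x)) = (\<lambda>x. f x + g x - poly (p + q) x)"
    by (simp add: algebra_simps)
  ultimately show "\<exists>p. nr \<nu> (\<lambda>x. f x + g x - poly p x) < e"
    using p q by (intro exI[of _ "p + q"]) simp
qed

lemma apx_cmult:
  assumes f: "apx f"
  shows "apx (\<lambda>x. c * f x)"
proof (cases "c = 0")
  case True
  then show ?thesis using apx_zero by simp
next
  case False
  show ?thesis
    unfolding apx_def
  proof (intro conjI allI impI)
    show "sqi \<nu> (\<lambda>x. c * f x)" using f by (auto simp: apx_def intro: sqi_cmult)
    fix e :: real assume "e > 0"
    then obtain p where p: "nr \<nu> (\<lambda>x. f x - poly p x) < e / \<bar>c\<bar>"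
      using f False by (auto simp: apx_def dest!: spec[of _ "e/\<bar>c\<bar>"])
    have "nr \<nu> (\<lambda>x. c * f x - poly (smult c p) x) = \<bar>c\<bar> * nr \<nu> (\<lambda>x. f x - poly p x)"
      by (subst nr_cmult[symmetric]) (simp add: algebra_simps)
    then show "\<exists>p. nr \<nu> (\<lambda>x. c * f x - poly p x) < e"
      using p False by (intro exI[of _ "smult c p"]) (simp add: field_simps)
  qed
qed

lemma apx_sum: "(\<And>i. i \<in> I \<Longrightarrow> apx (f i)) \<Longrightarrow> apx (\<lambda>x. \<Sum>i\<in>I. f i x)"
  by (induction I rule: infinite_finite_induct) (auto intro: apx_add apx_zero)

lemma apx_continuous:
  assumes f: "continuous_on UNIV f"
  shows "apx f"
  unfolding apx_def
proof (intro conjI allI impI)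
  show "sqi \<nu> f" by (rule sqi_continuous[OF f])
  fix e :: real assume e: "e > 0"
  have "continuous_on {-R..R} f" using f by (rule continuous_on_subset) simp
  then obtain g where g: "real_polynomial_function g" "\<And>x. x \<in> {-R..R} \<Longrightarrow> \<bar>f x - g x\<bar> < e / 2"
    using Stone_Weierstrass_real_polynomial_function[of "{-R..R}" f "e/2"] e by auto
  then obtain a n where an: "g = (\<lambda>x. \<Sum>i\<le>n. a i * x ^ i)"
    using real_polynomial_function_iff_sum by blast
  define p where "p = (\<Sum>i\<le>n. monom (a i) i)"
  have p: "poly p x = g x" for x by (simp add: p_def an poly_sum poly_monom)
  have "nr \<nu> (\<lambda>x. f x - poly p x) \<le> sqrt (LINT x|\<nu>. (e / 2)\<^sup>2)"
    unfolding nr_def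
  proof (intro real_sqrt_le_mono integral_mono_AE)
    show "integrable \<nu> (\<lambda>x. (f x - poly p x)\<^sup>2)"
      using sqi_diff[OF sqi_continuous[OF f] sqi_poly] by (simp add: sqi_def)
    show "AE x in \<nu>. (f x - poly p x)\<^sup>2 \<le> (e / 2)\<^sup>2"
      using bounded_law
    proof eventually_elim
      case (elim x)
      then have "x \<in> {-R..R}" by auto
      then have "\<bar>f x - poly p x\<bar> \<le> \<bar>e / 2\<bar>" using g(2)[of x] p by simp
      then show ?case by (rule abs_le_square_iff[THEN iffD1])
    qed
  qed simp
  also have "\<dots> < e" using e prob_space by (simp add: real_sqrt_mult)
  finally show "\<exists>p. nr \<nu> (\<lambda>x. f x - poly p x) < e" by blast
qed

lemma apx_half_line: "apx (indicator {..a})"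
\<comment> \<open>For i > 0 these are ramps falling from 1 to 0 on [a, a + 1/i]; being 1 at a
  itself, they converge to the indicator of the closed half-line.\<close>
proof (rule apx_lim_seq[where g="\<lambda>i x. max 0 (min 1 (1 - real i * (x - a)))" and w="\<lambda>_. 1"])
  show "sqi \<nu> (indicator {..a})"
    by (rule sqi_bounded[where B=1]) (simp_all add: meas_law indicator_def)
  show "apx (\<lambda>x. max 0 (min 1 (1 - real i * (x - a))))" for i
    by (rule apx_continuous) (intro continuous_intros)
  show "(\<lambda>i. max 0 (min 1 (1 - real i * (x - a)))) \<longlonglongrightarrow> indicator {..a} x" for x
  proof (cases "x \<le> a")
    case True
    then have "max 0 (min 1 (1 - real i * (x - a))) = 1" for i
      using mult_nonneg_nonpos[of "real i" "x - a"] by auto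
    then show ?thesis using True by simp
  next
    case False
    then have d: "x - a > 0" by simp
    then obtain k where k: "1 \<le> real k * (x - a)"
      using reals_Archimedean3[OF d] by (metis less_imp_le)
    have "\<forall>\<^sub>F i in sequentially. max 0 (min 1 (1 - real i * (x - a))) = 0"
      using eventually_ge_at_top[of k]
    proof eventually_elim
      case (elim i)
      then have "real k * (x - a) \<le> real i * (x - a)" using d by (intro mult_right_mono) auto
      then show ?case using k by auto
    qed
    then show ?thesis using False by (auto intro: tendsto_eventually)
  qed
  show "(indicator {..a} x - max 0 (min 1 (1 - real i * (x - a))))\<^sup>2 \<le> 1" for i x
    by (rule abs_le_square_iff[THEN iffD1, of _ 1, simplified]) (auto simp: indicator_def)
qed simp

lemma apx_indicator:
  assumes "A \<in> sets borel"
  shows "apx (indicator A)"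
proof -
  have sq: "sqi \<nu> (indicator A)" if "A \<in> sets borel" for A
    using that by (intro sqi_bounded[where B=1]) (simp_all add: meas_law indicator_def)
  have "Int_stable (range (\<lambda>a::real. {..a}))" by (auto simp: Int_stable_def)
  moreover have "range (\<lambda>a::real. {..a}) \<subseteq> Pow UNIV" by simp
  moreover have "A \<in> sigma_sets UNIV (range (\<lambda>a::real. {..a}))"
    using assms unfolding borel_eq_atMost by (simp add: sets_measure_of)
  ultimately show ?thesis
  proof (induction rule: sigma_sets_induct_disjoint)
    case (basic A)
    then show ?case by (auto intro: apx_half_line)
  next
    case empty
    then show ?case using apx_zero by (simp add: indicator_def)
  next
    case (compl A)
    have "(indicator (UNIV - A) :: real \<Rightarrow> real) = (\<lambda>x. poly 1 x + - 1 * indicator A x)"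
      by (auto simp: indicator_def)
    then show ?case using compl apx_add[OF apx_poly[of 1] apx_cmult[of "indicator A" "-1"]] by simp
  next
    case (union A)
    have m: "A i \<in> sets borel" for i
      using union(2) unfolding borel_eq_atMost by (auto simp: sets_measure_of)
    show ?case
    proof (rule apx_lim_seq[where g="\<lambda>k x. \<Sum>i<k. indicator (A i) x" and w="\<lambda>_. 1"])
      show "sqi \<nu> (indicator (\<Union> (range A)))" using m by (intro sq) auto
      show "apx (\<lambda>x. \<Sum>i<k. indicator (A i) x)" for k using union(3) by (intro apx_sum) auto
      show "(\<lambda>k. \<Sum>i<k. indicator (A i) x) \<longlonglongrightarrow> (indicator (\<Union> (range A)) x :: real)" for x
        proof -
        have "(\<Sum>i<k. indicator (A i) x) = (indicator (\<Union>i<k. A i) x :: real)" for k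
          using union(1) by (subst indicator_UN_disjoint) (auto simp: disjoint_family_on_def)
        then show ?thesis using LIMSEQ_indicator_UN[of A x] by simp
      qed
      show "(indicator (\<Union> (range A)) x - (\<Sum>i<k. indicator (A i) x))\<^sup>2 \<le> (1::real)" for k x
      proof -
        have "(\<Sum>i<k. indicator (A i) x) = (indicator (\<Union>i<k. A i) x :: real)"
          using union(1) by (subst indicator_UN_disjoint) (auto simp: disjoint_family_on_def)
        then show ?thesis by (auto simp: indicator_def)
      qed
    qed simp
  qed
qed

lemma apx_sqi:
  assumes f: "sqi \<nu> f"
  shows "apx f"
proof -
  have "f \<in> borel_measurable \<nu>" using f by (simp add: sqi_def)
  from borel_measurable_implies_sequence_metric[OF this, of 0] obtain s where
    s: "\<And>i. simple_function \<nu> (s i)" and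
    lim: "\<And>x. (\<lambda>i. s i x) \<longlonglongrightarrow> f x" and
    bound: "\<And>i x. \<bar>s i x\<bar> \<le> 2 * \<bar>f x\<bar>"
    by (auto simp: dist_norm)
  show ?thesis
  \<comment> \<open>The simple functions satisfy |s_i| <= 2 |f|, so |f - s_i| <= 3 |f|.\<close>
  proof (rule apx_lim_seq[OF f _ lim, where w="\<lambda>x. 9 * (f x)\<^sup>2"])
    show "apx (s i)" for i
    proof -
      have eq: "s i = (\<lambda>x. \<Sum>y\<in>range (s i). y * indicator (s i -` {y}) x)"
      proof
        fix x
        have fin: "finite (range (s i))" using simple_functionD(1)[OF s[of i]] by simp
        have "(\<Sum>y\<in>range (s i). y * indicator (s i -` {y}) x) = (\<Sum>y\<in>range (s i). if y = s i x then y else 0)"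
          by (intro sum.cong) (auto simp: indicator_def)
        then show "s i x = (\<Sum>y\<in>range (s i). y * indicator (s i -` {y}) x)"
          using fin by simp
      qed
      have "s i -` {y} \<in> sets borel" for y
        using simple_functionD(2)[OF s[of i], of "{y}"] by simp
      then show ?thesis by (subst eq) (intro apx_sum apx_cmult apx_indicator)
    qed
    show "integrable \<nu> (\<lambda>x. 9 * (f x)\<^sup>2)" using f by (simp add: sqi_def)
    show "(f x - s i x)\<^sup>2 \<le> 9 * (f x)\<^sup>2" for i x
    proof -
      have "\<bar>f x - s i x\<bar> \<le> \<bar>3 * f x\<bar>" using bound[of i x] by (simp add: abs_mult)
      then have "(f x - s i x)\<^sup>2 \<le> (3 * f x)\<^sup>2" by (rule abs_le_square_iff[THEN iffD1])
      then show ?thesis by (simp add: power_mult_distrib)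
    qed
  qed
qed

lemma poly_dense:
  assumes "sqi \<nu> f" "e > 0"
  obtains p where "nr \<nu> (\<lambda>x. f x - poly p x) < e"
  using apx_sqi[OF assms(1)] assms(2) by (auto simp: apx_def)

end

subsection \<open>The correlation operator\<close>

lemma bounded_law_mrg: "bounded_law (mrg n) (sqrt (real (Suc n)))"
proof -
  interpret prob_space "mrg n" by (rule prob_space_mrg)
  show ?thesis
  proof
    show "AE x in mrg n. \<bar>x\<bar> \<le> sqrt (real (Suc n))"
      using AE_mrg_le[of n]
    proof eventually_elim
      case (elim x)
      then show ?case by (intro real_le_rsqrt) simp
    qed
  qed simp
qed

lemma meas_mrg: "measurable (mrg n) M = measurable borel M"
  by (rule measurable_cong_sets) simp_all

lemma sqi_coord:
  assumes f: "sqi (mrg n) f" and k: "k \<in> {1..Suc n}"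
  shows "sqi (sph (Suc n)) (\<lambda>v. f (v k))" "nr (sph (Suc n)) (\<lambda>v. f (v k)) = nr (mrg n) f"
    "(LINT v|sph (Suc n). f (v k)) = (LINT x|mrg n. f x)"
proof -
  have [measurable]: "f \<in> borel_measurable borel" using f by (simp add: sqi_def meas_mrg)
  have [measurable]: "(\<lambda>v. v k) \<in> borel_measurable (bor (Suc n))" using k by (rule coord_measurable)
  have l: "Suc n \<in> {1..Suc n}" by simp
  show "sqi (sph (Suc n)) (\<lambda>v. f (v k))"
    using f integral_sph_coord1(2)[OF k l, of "\<lambda>x. (f x)\<^sup>2"] integral_mrg(2)[of "\<lambda>x. (f x)\<^sup>2" n]
    by (auto simp: sqi_def meas_sph)
  show "nr (sph (Suc n)) (\<lambda>v. f (v k)) = nr (mrg n) f"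
    using integral_sph_coord1(1)[OF k l, of "\<lambda>x. (f x)\<^sup>2"] integral_mrg(1)[of "\<lambda>x. (f x)\<^sup>2" n]
    by (simp add: nr_def)
  show "(LINT v|sph (Suc n). f (v k)) = (LINT x|mrg n. f x)"
    using integral_sph_coord1(1)[OF k l, of f] integral_mrg(1)[of f n] by simp
qed

text \<open>The bilinear form, in L^2 of \<open>mrg n\<close>, of the operator that conditions a
  function of one coordinate on another coordinate.\<close>

definition bil :: "nat \<Rightarrow> (real \<Rightarrow> real) \<Rightarrow> (real \<Rightarrow> real) \<Rightarrow> real" where
  "bil n f g = (LINT v|sph (Suc n). f (v 1) * g (v (Suc n)))"

lemma bil_coord:
  assumes f: "sqi (mrg n) f" and g: "sqi (mrg n) g" and ij: "i \<in> {1..Suc n}" "j \<in> {1..Suc n}" "i \<noteq> j"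
  shows "(LINT v|sph (Suc n). f (v i) * g (v j)) = bil n f g"
proof -
  have [measurable]: "f \<in> borel_measurable borel" "g \<in> borel_measurable borel"
    using f g by (auto simp: sqi_def meas_mrg)
  show ?thesis unfolding bil_def
    using ij by (intro integral_sph_coord2(1)[where g="\<lambda>x y. f x * g y"]) auto
qed

lemma bil_integrable:
  assumes f: "sqi (mrg n) f" and g: "sqi (mrg n) g" and ij: "i \<in> {1..Suc n}" "j \<in> {1..Suc n}"
  shows "integrable (sph (Suc n)) (\<lambda>v. f (v i) * g (v j))"
  by (intro sqi_mult_integrable sqi_coord(1) assms)

context
  fixes n :: nat
  assumes n: "n \<ge> 2"
begin

interpretation bounded_law "mrg n" "sqrt (real (Suc n))" by (rule bounded_law_mrg)

private lemma one_N: "1 \<in> {1..Suc n}" "Suc n \<in> {1..Suc n}" "1 \<noteq> Suc n" "1 \<in> {1..n}"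
  using n by auto

lemma bil_sym: "sqi (mrg n) f \<Longrightarrow> sqi (mrg n) g \<Longrightarrow> bil n f g = bil n g f"
  using bil_coord[of n g f "Suc n" 1] one_N by (simp add: bil_def mult.commute)

lemma bil_add: "sqi (mrg n) f \<Longrightarrow> sqi (mrg n) f' \<Longrightarrow> sqi (mrg n) g \<Longrightarrow> bil n (\<lambda>x. f x + f' x) g = bil n f g + bil n f' g"
  using bil_integrable[of n _ g 1 "Suc n"] one_N by (simp add: bil_def distrib_right)

lemma bil_diff: "sqi (mrg n) f \<Longrightarrow> sqi (mrg n) f' \<Longrightarrow> sqi (mrg n) g \<Longrightarrow> bil n (\<lambda>x. f x - f' x) g = bil n f g - bil n f' g"
  using bil_integrable[of n _ g 1 "Suc n"] one_N by (simp add: bil_def left_diff_distrib)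

lemma bil_cmult: "bil n (\<lambda>x. c * f x) g = c * bil n f g"
  by (simp add: bil_def mult.assoc)

lemma bil_cmult_right: "bil n f (\<lambda>x. c * g x) = c * bil n f g"
  by (simp add: bil_def mult.left_commute)

lemma bil_le: "sqi (mrg n) f \<Longrightarrow> sqi (mrg n) g \<Longrightarrow> \<bar>bil n f g\<bar> \<le> nr (mrg n) f * nr (mrg n) g"
  using nr_cauchy_schwarz[of "sph (Suc n)" "\<lambda>v. f (v 1)" "\<lambda>v. g (v (Suc n))"]
    sqi_coord[of n f 1] sqi_coord[of n g "Suc n"] one_N by (simp add: bil_def)

section \<open>Conditional moments as polynomials\<close>

private definition \<mu> :: "nat \<Rightarrow> real" where "\<mu> k = (LINT w|sph n. w 1 ^ k)"

text \<open>E(v_1^k | v_N = x) as a polynomial in x. On the slice v_1 is a rescaled coordinate w_1;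
  odd moments vanish, and in even degree the square root in the scaling factor disappears.\<close>

private definition Kp :: "nat \<Rightarrow> real poly" where
  "Kp k = (if odd k then 0 else smult (\<mu> k / real n ^ (k div 2)) ([:real (Suc n), 0, -1:] ^ (k div 2)))"

text \<open>The operator is triangular on monomials, so this diagonal entry is its eigenvalue in
  degree k.\<close>

private definition \<kappa> :: "nat \<Rightarrow> real" where "\<kappa> k = coeff (Kp k) k"

private lemma \<mu>_odd: "odd k \<Longrightarrow> \<mu> k = 0"
  using sph_moment_odd[of 1 n 2 k] n by (simp add: \<mu>_def)

private lemma poly_Kp:
  assumes "x\<^sup>2 \<le> real (Suc n)"
  shows "poly (Kp k) x = sqrt ((real (Suc n) - x\<^sup>2) / real n) ^ k * \<mu> k"
proof (cases "odd k")
  case False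
  then obtain l where k: "k = 2 * l" by (auto elim: evenE)
  have "sqrt ((real (Suc n) - x\<^sup>2) / real n) ^ k = ((real (Suc n) - x\<^sup>2) / real n) ^ l"
    using assms unfolding k power_mult by simp
  then show ?thesis
    by (simp add: Kp_def k power_divide power2_eq_square)
qed (simp add: Kp_def \<mu>_odd)

private lemma degree_q: "degree [:real (Suc n), 0, -1:] = 2"
  by simp

private lemma Kp_coeff:
  assumes "k < m"
  shows "coeff (Kp k) m = 0"
proof (cases "odd k")
  case False
  have "degree ([:real (Suc n), 0, -1:] ^ (k div 2)) \<le> 2 * (k div 2)"
    using degree_power_le[of "[:real (Suc n), 0, -1:]" "k div 2"] unfolding degree_q .
  then have "degree ([:real (Suc n), 0, -1:] ^ (k div 2)) < m" using assms False by simp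
  then show ?thesis using False by (simp add: Kp_def coeff_eq_0)
qed (simp add: Kp_def)

private lemma \<kappa>_even: "\<kappa> (2 * l) = \<mu> (2 * l) / real n ^ l * (-1) ^ l"
proof -
  have "degree ([:real (Suc n), 0, -1:] ^ l) = l * 2"
    by (subst degree_power_eq) auto
  then have "coeff ([:real (Suc n), 0, -1:] ^ l) (2 * l) = lead_coeff ([:real (Suc n), 0, -1:] ^ l)"
    by (simp add: mult.commute)
  also have "\<dots> = (-1) ^ l" by (subst lead_coeff_power) simp
  finally show ?thesis by (simp add: \<kappa>_def Kp_def)
qed

private lemma \<kappa>_odd: "odd k \<Longrightarrow> \<kappa> k = 0"
  by (simp add: \<kappa>_def Kp_def)

private definition c :: real where "c = 3 / (real n * (real n + 2))"

text \<open>On the sphere w_1^2 <= n, so E w_1^(2l) / n^l decreases in l; its value at l = 2 is the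
  constant c.\<close>

private lemma \<kappa>_le:
  assumes "k \<ge> 3"
  shows "\<bar>\<kappa> k\<bar> \<le> c"
proof (cases "odd k")
  case True
  then show ?thesis using n by (simp add: \<kappa>_odd c_def)
next
  case False
  then obtain l where k: "k = 2 * l" by (auto elim: evenE)
  then have l: "l \<ge> 2" using assms by simp
  have \<mu>4: "\<mu> 4 = 3 * real n / (real n + 2)"
    using sph_moments(2)[of 1 n 2] n by (simp add: \<mu>_def)
  have nn: "n \<ge> 1" using n by simp
  have "0 \<le> \<mu> (2 * l)" unfolding \<mu>_def by (intro integral_nonneg_AE) simp
  have "\<mu> (2 * l) \<le> (LINT w|sph n. real n ^ (l - 2) * w 1 ^ 4)"
    unfolding \<mu>_def
  proof (rule integral_mono_AE)
    show "AE w in sph n. w 1 ^ (2 * l) \<le> real n ^ (l - 2) * w 1 ^ 4"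
      using AE_sph_kac[OF nn]
    proof eventually_elim
      case (elim w)
      then have "(w 1)\<^sup>2 \<le> real n" using one_N by (intro kac_coord_le) auto
      then have "((w 1)\<^sup>2) ^ (l - 2) \<le> real n ^ (l - 2)" by (intro power_mono) auto
      then have "((w 1)\<^sup>2) ^ (l - 2) * w 1 ^ 4 \<le> real n ^ (l - 2) * w 1 ^ 4" by (intro mult_right_mono) auto
      moreover have "((w 1)\<^sup>2) ^ (l - 2) * w 1 ^ 4 = w 1 ^ (2 * l)"
      proof -
        have "2 * (l - 2) + 4 = 2 * l" using l by simp
        then show ?thesis by (simp only: power_mult[symmetric] power_add[symmetric])
      qed
      ultimately show ?case by simp
    qed
  qed (auto intro!: integrable_sph_power one_N)
  also have "\<dots> = real n ^ (l - 2) * \<mu> 4" by (simp add: \<mu>_def)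
  finally have "\<mu> (2 * l) / real n ^ l \<le> real n ^ (l - 2) * \<mu> 4 / real n ^ l"
    by (intro divide_right_mono) auto
  also have "\<dots> = \<mu> 4 / real n ^ 2"
  proof -
    have "l - 2 + 2 = l" using l by simp
    then have "real n ^ l = real n ^ (l - 2) * real n ^ 2" by (simp only: power_add[symmetric])
    then show ?thesis using n by simp
  qed
  also have "\<dots> = c" using n by (simp add: \<mu>4 c_def power2_eq_square)
  finally have "\<mu> (2 * l) / real n ^ l \<le> c" .
  then show ?thesis
    using \<open>0 \<le> \<mu> (2 * l)\<close> by (simp add: k \<kappa>_even abs_mult power_abs)
qed

private lemma bil_monom:
  assumes g: "sqi (mrg n) g"
  shows "bil n (\<lambda>x. x ^ k) g = (LINT x|mrg n. poly (Kp k) x * g x)"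
proof -
  have [measurable]: "g \<in> borel_measurable borel" using g by (auto simp: sqi_def meas_mrg)
  have [measurable]: "(\<lambda>v. v 1) \<in> borel_measurable (bor (Suc n))" using one_N by (intro coord_measurable) auto
  have [measurable]: "poly (Kp k) \<in> borel_measurable borel"
    by (intro borel_measurable_continuous_onI continuous_intros)
  have pk: "sqi (mrg n) (\<lambda>x. x ^ k)" by (intro sqi_continuous continuous_intros)
  have "bil n (\<lambda>x. x ^ k) g = (LINT x|mrg n. (LINT w|sph n. (\<lambda>v. v 1 ^ k * g (v (Suc n))) (glue n x w)))"
    unfolding bil_def using n bil_integrable[OF pk g one_N(1,2)]
    by (intro sph_disintegrate(3)) auto
  also have "\<dots> = (LINT x|mrg n. sqrt ((real (Suc n) - x\<^sup>2) / real n) ^ k * \<mu> k * g x)"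
    using one_N by (simp add: glue_init \<mu>_def power_mult_distrib mult_ac)
  also have "\<dots> = (LINT x|mrg n. poly (Kp k) x * g x)"
  proof (rule integral_cong_AE)
    show "AE x in mrg n. sqrt ((real (Suc n) - x\<^sup>2) / real n) ^ k * \<mu> k * g x = poly (Kp k) x * g x"
      using AE_mrg_le[of n] by eventually_elim (simp add: poly_Kp)
  qed (simp_all add: meas_mrg)
  finally show ?thesis .
qed

private definition KP :: "nat \<Rightarrow> real poly \<Rightarrow> real poly" where
  "KP d p = (\<Sum>k\<le>d. smult (coeff p k) (Kp k))"

text \<open>Degree below d. For d = 0 it forces the zero polynomial, which a bound on
  \<open>degree\<close> cannot express.\<close>

private definition lowdeg :: "nat \<Rightarrow> real poly \<Rightarrow> bool" where
  "lowdeg d p \<longleftrightarrow> (\<forall>k\<ge>d. coeff p k = 0)"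

private lemma KP_coeff: "coeff (KP d p) d = \<kappa> d * coeff p d"
proof -
  have "coeff (KP d p) d = (\<Sum>k\<le>d. coeff p k * coeff (Kp k) d)"
    by (simp add: KP_def coeff_sum)
  also have "\<dots> = (\<Sum>k\<in>{d}. coeff p k * coeff (Kp k) d)"
    using Kp_coeff by (intro sum.mono_neutral_right) auto
  finally show ?thesis by (simp add: \<kappa>_def)
qed

private lemma KP_low: "lowdeg (Suc d) (KP d p)"
  unfolding lowdeg_def KP_def by (auto simp: coeff_sum Kp_coeff intro!: sum.neutral)

private lemma bil_KP:
  assumes p: "lowdeg (Suc d) p" and g: "sqi (mrg n) g"
  shows "bil n (poly p) g = (LINT x|mrg n. poly (KP d p) x * g x)"
proof -
  have pk: "sqi (mrg n) (\<lambda>x. x ^ k)" for k by (intro sqi_continuous continuous_intros)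
  have deg: "degree p \<le> d" using p by (intro degree_le) (auto simp: lowdeg_def)
  have "poly p x = (\<Sum>k\<le>d. coeff p k * x ^ k)" for x
    using poly_as_sum_of_monoms'[OF deg] by (metis (no_types, lifting) poly_monom poly_sum sum.cong)
  then have "bil n (poly p) g = (LINT v|sph (Suc n). (\<Sum>k\<le>d. coeff p k * (v 1 ^ k * g (v (Suc n)))))"
    by (simp add: bil_def sum_distrib_right mult.assoc)
  also have "\<dots> = (\<Sum>k\<le>d. coeff p k * bil n (\<lambda>x. x ^ k) g)"
    using bil_integrable[OF pk g one_N(1,2)] by (subst Bochner_Integration.integral_sum) (auto simp: bil_def)
  also have "\<dots> = (\<Sum>k\<le>d. coeff p k * (LINT x|mrg n. poly (Kp k) x * g x))"
    by (simp add: bil_monom[OF g])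
  also have "\<dots> = (LINT x|mrg n. (\<Sum>k\<le>d. coeff p k * (poly (Kp k) x * g x)))"
    using sqi_mult_integrable[OF sqi_poly g] by (subst Bochner_Integration.integral_sum) auto
  also have "\<dots> = (LINT x|mrg n. poly (KP d p) x * g x)"
    by (simp add: KP_def poly_sum sum_distrib_right mult.assoc)
  finally show ?thesis .
qed

section \<open>Orthogonal polynomials of the marginal law\<close>

private definition ip :: "real poly \<Rightarrow> real poly \<Rightarrow> real" where
  "ip p q = (LINT x|mrg n. poly p x * poly q x)"

private lemma ip_int: "integrable (mrg n) (\<lambda>x. poly p x * poly q x)"
  by (intro sqi_mult_integrable sqi_poly)

private lemma ip_commute: "ip p q = ip q p"
  by (simp add: ip_def mult.commute)

private lemma ip_diff: "ip (p - q) r = ip p r - ip q r"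
  using ip_int by (simp add: ip_def left_diff_distrib)

private lemma ip_add: "ip (p + q) r = ip p r + ip q r"
  using ip_int by (simp add: ip_def distrib_right)

private lemma ip_smult: "ip (smult a p) q = a * ip p q"
  by (simp add: ip_def mult.assoc)

private lemma ip_sum: "ip (\<Sum>i\<in>I. f i) q = (\<Sum>i\<in>I. ip (f i) q)"
  unfolding ip_def poly_sum sum_distrib_right using ip_int by (intro Bochner_Integration.integral_sum) auto

private lemma ip_nonneg: "ip p p \<ge> 0"
  unfolding ip_def by (intro integral_nonneg_AE) auto

private lemma nr_ip: "nr (mrg n) (poly p) = sqrt (ip p p)"
  by (simp add: nr_def ip_def power2_eq_square)

text \<open>Replaces a proof that nonzero polynomials have positive norm: a basis vector of norm
  zero would have inner product zero with everything, so the orthogonalisation survives it.\<close>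

private lemma ip_null: "ip p p = 0 \<Longrightarrow> ip q p = 0"
  using nr_cauchy_schwarz[OF sqi_poly sqi_poly, of q p] by (simp add: nr_ip) (simp add: ip_def)

private lemma span:
  assumes e: "\<And>i. i < D \<Longrightarrow> lowdeg (Suc i) (e i) \<and> coeff (e i) i = 1"
    and d: "d \<le> D" and p: "lowdeg d p"
  shows "\<exists>a. p = (\<Sum>i<d. smult (a i) (e i))"
  using d p
proof (induction d arbitrary: p)
  case 0
  then have "p = 0" by (intro poly_eqI) (auto simp: lowdeg_def)
  then show ?case by simp
next
  case (Suc d)
  let ?q = "p - smult (coeff p d) (e d)"
  have "lowdeg d ?q"
    unfolding lowdeg_def
  proof (intro allI impI)
    fix k assume "d \<le> k"
    then show "coeff ?q k = 0"
      using e[of d] Suc.prems by (cases "k = d") (auto simp: lowdeg_def)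
  qed
  then obtain a where a: "?q = (\<Sum>i<d. smult (a i) (e i))" using Suc by force
  have "p = (\<Sum>i<d. smult (a i) (e i)) + smult (coeff p d) (e d)" by (simp flip: a)
  also have "\<dots> = (\<Sum>i<Suc d. smult ((a(d := coeff p d)) i) (e i))" by simp
  finally show ?case by blast
qed

private definition ortho :: "nat \<Rightarrow> (nat \<Rightarrow> real poly) \<Rightarrow> bool" where
  "ortho D e \<longleftrightarrow> (\<forall>i<D. lowdeg (Suc i) (e i) \<and> coeff (e i) i = 1) \<and> (\<forall>i<D. \<forall>j<D. i \<noteq> j \<longrightarrow> ip (e i) (e j) = 0)"

private lemma ortho_exists: "\<exists>e. ortho D e"
proof (induction D)
  case 0
  then show ?case by (auto simp: ortho_def)
next
  case (Suc D)
  then obtain e where e: "ortho D e" ..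
  define s where "s = (\<Sum>i<D. smult (ip (monom 1 D) (e i) / ip (e i) (e i)) (e i))"
  define f where "f = e(D := monom 1 D - s)"
  have s: "lowdeg D s"
    using e by (auto simp: s_def lowdeg_def ortho_def coeff_sum intro!: sum.neutral)
  have or: "ip (monom 1 D - s) (e j) = 0" if "j < D" for j
  proof -
    have "ip s (e j) = (\<Sum>i<D. ip (monom 1 D) (e i) / ip (e i) (e i) * ip (e i) (e j))"
      by (simp add: s_def ip_sum ip_smult)
    also have "\<dots> = (\<Sum>i\<in>{j}. ip (monom 1 D) (e i) / ip (e i) (e i) * ip (e i) (e j))"
      using that e by (intro sum.mono_neutral_right) (auto simp: ortho_def)
    \<comment> \<open>If e_j has norm zero, the quotient is 0 by convention, and by
      \<open>ip_null\<close> the numerator is 0 as well.\<close>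
    also have "\<dots> = ip (monom 1 D) (e j)"
      using ip_null[of "e j" "monom 1 D"] by auto
    finally show ?thesis by (simp add: ip_diff)
  qed
  have "ortho (Suc D) f"
    unfolding ortho_def
  proof (intro conjI allI impI)
    fix i assume "i < Suc D"
    then show "lowdeg (Suc i) (f i)" "coeff (f i) i = 1"
      using e s by (auto simp: f_def ortho_def lowdeg_def less_Suc_eq)
  next
    fix i j assume "i < Suc D" "j < Suc D" "i \<noteq> j"
    then show "ip (f i) (f j) = 0"
      using e or ip_commute[of _ "monom 1 D - s"] by (auto simp: f_def ortho_def less_Suc_eq)
  qed
  then show ?case by blast
qed

private lemma ortho_low:
  assumes e: "ortho D e" and d: "d < D" and p: "lowdeg d p"
  shows "ip p (e d) = 0"
proof -
  obtain a where "p = (\<Sum>i<d. smult (a i) (e i))"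
    using span[of D e d p] e d p by (auto simp: ortho_def)
  then show ?thesis using e d by (auto simp: ip_sum ip_smult ortho_def intro!: sum.neutral)
qed

text \<open>The image of e_i has degree at most i and is orthogonal to e_j for j > i; symmetry of
  \<open>bil\<close> settles j < i. On the diagonal, the image differs from
  \<open>\<kappa> i\<close> times e_i by a polynomial of lower degree.\<close>

private lemma bil_ortho:
  assumes e: "ortho D e" and ij: "i < D" "j < D"
  shows "bil n (poly (e i)) (poly (e j)) = (if i = j then \<kappa> i * ip (e i) (e i) else 0)"
proof -
  have K: "bil n (poly (e i)) (poly (e j)) = ip (KP i (e i)) (e j)" if "i < D" for i j
    using bil_KP[of i "e i" "poly (e j)"] e that sqi_poly by (auto simp: ortho_def ip_def)
  have lt: "bil n (poly (e i)) (poly (e j)) = 0" if "i < j" "j < D" for i j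
  proof -
    have "lowdeg j (KP i (e i))" using KP_low[of i "e i"] that by (auto simp: lowdeg_def)
    then show ?thesis using K[of i j] ortho_low[OF e] that by auto
  qed
  consider "i < j" | "j < i" | "i = j" by linarith
  then show ?thesis
  proof cases
    case 1 then show ?thesis using lt ij by auto
  next
    case 2 then show ?thesis using lt[of j i] ij bil_sym[OF sqi_poly sqi_poly] by auto
  next
    case 3
    have "lowdeg i (KP i (e i) - smult (\<kappa> i) (e i))"
      unfolding lowdeg_def
    proof (intro allI impI)
      fix k assume "i \<le> k"
      then show "coeff (KP i (e i) - smult (\<kappa> i) (e i)) k = 0"
        using KP_low[of i "e i"] KP_coeff[of i "e i"] e ij by (cases "k = i") (auto simp: lowdeg_def ortho_def)
    qed
    then have "ip (KP i (e i) - smult (\<kappa> i) (e i)) (e i) = 0" using ortho_low[OF e ij(1)] by simp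
    then show ?thesis using K[of i i] ij 3 by (simp add: ip_diff ip_smult)
  qed
qed

private lemma mrg_moments: "(LINT x|mrg n. x) = 0" "(LINT x|mrg n. x\<^sup>2) = 1" "(LINT x|mrg n. x ^ 3) = 0"
  "(LINT x|mrg n. x ^ 4) = 3 * (real n + 1) / (real n + 3)"
proof -
  have *: "(LINT x|mrg n. x ^ k) = (LINT v|sph (Suc n). v (Suc n) ^ k)" for k
    by (rule integral_mrg(1)) measurable
  show "(LINT x|mrg n. x) = 0" using *[of 1] sph_moment_odd[of "Suc n" "Suc n" 1 1] n by simp
  show "(LINT x|mrg n. x ^ 3) = 0" using *[of 3] sph_moment_odd[of "Suc n" "Suc n" 1 3] n by simp
  show "(LINT x|mrg n. x\<^sup>2) = 1" using *[of 2] sph_moments(1)[of "Suc n" "Suc n" 1] n by simp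
  show "(LINT x|mrg n. x ^ 4) = 3 * (real n + 1) / (real n + 3)"
    using *[of 4] sph_moments(2)[of "Suc n" "Suc n" 1] n by (simp add: add_ac)
qed

text \<open>Vanishing odd moments remove the linear term of e_2, so e_0 and e_2 span the same space
  as 1 and x^2, the two directions excluded in \<open>bil_poly_le\<close>.\<close>

private lemma ortho_e2:
  assumes e: "ortho D e" and D: "D \<ge> 3"
  shows "\<exists>b. e 0 = 1 \<and> e 2 = [:b, 0, 1:]"
proof -
  have D': "0 < D" "2 < D" using D by auto
  have e0: "e 0 = 1"
  proof (rule poly_eqI)
    fix k show "coeff (e 0) k = coeff 1 k"
      using e D'(1) by (cases "k = 0") (auto simp: ortho_def lowdeg_def)
  qed
  have e2: "e 2 = [:coeff (e 2) 0, coeff (e 2) 1, 1:]"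
  proof (rule poly_eqI)
    fix k show "coeff (e 2) k = coeff [:coeff (e 2) 0, coeff (e 2) 1, 1:] k"
      using e D'(2) by (cases "k \<ge> 3") (auto simp: ortho_def lowdeg_def numeral_eq_Suc coeff_pCons One_nat_def split: nat.splits)
  qed
  have "lowdeg 2 [:0, 1:]" by (auto simp: lowdeg_def coeff_pCons split: nat.splits)
  then have "0 = ip [:0, 1:] (e 2)" using ortho_low[OF e D'(2)] by simp
  also have "\<dots> = (LINT x|mrg n. coeff (e 2) 0 * x + coeff (e 2) 1 * x\<^sup>2 + x ^ 3)"
    unfolding ip_def by (subst e2) (simp add: power2_eq_square power3_eq_cube algebra_simps)
  also have "\<dots> = coeff (e 2) 1"
  proof -
    have "integrable (mrg n) (\<lambda>x. x ^ k)" for k :: nat by (intro sqi_integrable sqi_continuous continuous_intros)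
    from this[of 1] this[of 2] this[of 3] show ?thesis by (simp add: mrg_moments)
  qed
  finally show ?thesis using e0 e2 by metis
qed

text \<open>In the orthogonal basis the form is diagonal. Degrees 0 and 2 drop out by the
  assumptions, degree 1 because its eigenvalue is 0, and from degree 3 on the eigenvalues are at
  most c in size; Cauchy-Schwarz for finite sums does the rest.\<close>

private lemma bil_poly_le:
  assumes p: "ip p 1 = 0" "ip p (monom 1 2) = 0"
  shows "\<bar>bil n (poly p) (poly q)\<bar> \<le> c * (nr (mrg n) (poly p) * nr (mrg n) (poly q))"
proof -
  define D where "D = max 3 (Suc (max (degree p) (degree q)))"
  have low: "lowdeg D p" "lowdeg D q" by (auto simp: lowdeg_def D_def intro!: coeff_eq_0)
  obtain e where e: "ortho D e" using ortho_exists ..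
  obtain a b where a: "p = (\<Sum>i<D. smult (a i) (e i))" and b: "q = (\<Sum>i<D. smult (b i) (e i))"
    using span[of D e D p] span[of D e D q] e low by (auto simp: ortho_def)
  define N where "N i = ip (e i) (e i)" for i
  have N: "N i \<ge> 0" for i by (simp add: N_def ip_nonneg)
  have ipe: "ip p (e j) = a j * N j" if "j < D" for j
  proof -
    have "ip p (e j) = (\<Sum>i<D. a i * ip (e i) (e j))" by (subst a) (simp add: ip_sum ip_smult)
    also have "\<dots> = (\<Sum>i\<in>{j}. a i * ip (e i) (e j))"
      using that e by (intro sum.mono_neutral_right) (auto simp: ortho_def)
    finally show ?thesis by (simp add: N_def)
  qed
  have norm: "ip r r = (\<Sum>i<D. (z i)\<^sup>2 * N i)" if r: "r = (\<Sum>i<D. smult (z i) (e i))" for r z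
  proof -
    have "ip r r = (\<Sum>i<D. z i * ip r (e i))"
      by (subst r) (simp add: ip_sum ip_smult ip_commute[of r])
    also have "\<dots> = (\<Sum>i<D. (z i)\<^sup>2 * N i)"
    proof (rule sum.cong)
      fix j assume j: "j \<in> {..<D}"
      have "ip r (e j) = (\<Sum>i<D. z i * ip (e i) (e j))" by (subst r) (simp add: ip_sum ip_smult)
      also have "\<dots> = (\<Sum>i\<in>{j}. z i * ip (e i) (e j))"
        using j e by (intro sum.mono_neutral_right) (auto simp: ortho_def)
      finally show "z j * ip r (e j) = (z j)\<^sup>2 * N j" by (simp add: N_def power2_eq_square)
    qed simp
    finally show ?thesis .
  qed
  obtain b2 where e02: "e 0 = 1" "e 2 = [:b2, 0, 1:]" using ortho_e2[OF e] by (auto simp: D_def)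
  have "ip (e 2) p = b2 * ip 1 p + ip (monom 1 2) p"
  proof -
    have "e 2 = smult b2 1 + monom 1 2"
      unfolding e02(2) by (simp add: monom_altdef numeral_2_eq_2)
    then show ?thesis by (simp only: ip_add ip_smult)
  qed
  then have "ip p (e 2) = 0" using p by (simp add: ip_commute[of p])
  then have a0: "a 0 * N 0 = 0" "a 2 * N 2 = 0" using ipe[of 0] ipe[of 2] p(1) e02(1) by (auto simp: D_def)
  have bq: "bil n (poly (e i)) (poly q) = b i * (\<kappa> i * N i)" if i: "i < D" for i
  proof -
    have "bil n (poly (e i)) (poly q) = (LINT v|sph (Suc n). (\<Sum>j<D. b j * (poly (e i) (v 1) * poly (e j) (v (Suc n)))))"
      unfolding bil_def by (subst b) (simp add: poly_sum sum_distrib_left mult_ac)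
    also have "\<dots> = (\<Sum>j<D. b j * bil n (poly (e i)) (poly (e j)))"
      using bil_integrable[OF sqi_poly sqi_poly one_N(1,2)]
      by (subst Bochner_Integration.integral_sum) (auto simp: bil_def)
    also have "\<dots> = (\<Sum>j\<in>{i}. b j * bil n (poly (e i)) (poly (e j)))"
      using i bil_ortho[OF e i] by (intro sum.mono_neutral_right) auto
    finally show ?thesis using bil_ortho[OF e i i] by (simp add: N_def)
  qed
  have "bil n (poly p) (poly q) = (LINT v|sph (Suc n). (\<Sum>i<D. a i * (poly (e i) (v 1) * poly q (v (Suc n)))))"
    unfolding bil_def by (subst a) (simp add: poly_sum sum_distrib_right mult.assoc)
  also have "\<dots> = (\<Sum>i<D. a i * bil n (poly (e i)) (poly q))"
    using bil_integrable[OF sqi_poly sqi_poly one_N(1,2)]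
    by (subst Bochner_Integration.integral_sum) (auto simp: bil_def)
  also have "\<dots> = (\<Sum>i<D. a i * (b i * (\<kappa> i * N i)))" using bq by simp
  finally have "\<bar>bil n (poly p) (poly q)\<bar> \<le> (\<Sum>i<D. \<bar>a i * (b i * (\<kappa> i * N i))\<bar>)"
    by (simp add: sum_abs)
  also have "\<dots> \<le> (\<Sum>i<D. c * (\<bar>a i * sqrt (N i)\<bar> * \<bar>b i * sqrt (N i)\<bar>))"
  proof (rule sum_mono)
    fix i
    have eq: "\<bar>a i * sqrt (N i)\<bar> * \<bar>b i * sqrt (N i)\<bar> = \<bar>a i * N i\<bar> * \<bar>b i\<bar>"
      using N[of i] by (simp add: abs_mult)
    have "\<bar>\<kappa> i\<bar> * (\<bar>a i * N i\<bar> * \<bar>b i\<bar>) \<le> c * (\<bar>a i * N i\<bar> * \<bar>b i\<bar>)"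
    proof -
      consider "i = 0" | "i = 1" | "i = 2" | "i \<ge> 3" by linarith
      then show ?thesis
      proof cases
        case 2 then show ?thesis using \<kappa>_odd[of 1] n by (simp add: c_def)
      next
        case 4 then show ?thesis using \<kappa>_le by (intro mult_right_mono) auto
      qed (use a0 in auto)
    qed
    then show "\<bar>a i * (b i * (\<kappa> i * N i))\<bar> \<le> c * (\<bar>a i * sqrt (N i)\<bar> * \<bar>b i * sqrt (N i)\<bar>)"
      unfolding eq by (simp add: abs_mult mult_ac)
  qed
  also have "\<dots> = c * (\<Sum>i<D. \<bar>a i * sqrt (N i)\<bar> * \<bar>b i * sqrt (N i)\<bar>)" by (simp add: sum_distrib_left)
  also have "\<dots> \<le> c * (L2_set (\<lambda>i. a i * sqrt (N i)) {..<D} * L2_set (\<lambda>i. b i * sqrt (N i)) {..<D})"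
    using n by (intro mult_left_mono L2_set_mult_ineq) (simp add: c_def)
  also have "L2_set (\<lambda>i. a i * sqrt (N i)) {..<D} = nr (mrg n) (poly p)"
    unfolding nr_ip norm[OF a] using N by (simp add: L2_set_def power_mult_distrib)
  also have "L2_set (\<lambda>i. b i * sqrt (N i)) {..<D} = nr (mrg n) (poly q)"
    unfolding nr_ip norm[OF b] using N by (simp add: L2_set_def power_mult_distrib)
  finally show ?thesis .
qed

section \<open>Square-integrable functions and the direction x^2 - 1\<close>

private definition u :: "real \<Rightarrow> real" where "u x = x\<^sup>2 - 1"

private lemma sqi_u: "sqi (mrg n) u"
  unfolding u_def by (intro sqi_continuous continuous_intros)

private lemma sqi_pow: "sqi (mrg n) (\<lambda>x. x ^ k)"
  by (intro sqi_continuous continuous_intros)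

private lemma u_sq: "(LINT x|mrg n. (u x)\<^sup>2) = 2 * real n / (real n + 3)"
proof -
  have "(LINT x|mrg n. (u x)\<^sup>2) = (LINT x|mrg n. x ^ 4 - 2 * x\<^sup>2 + 1)"
    by (intro Bochner_Integration.integral_cong refl) (simp add: u_def power2_eq_square power4_eq_xxxx algebra_simps)
  also have "\<dots> = 3 * (real n + 1) / (real n + 3) - 1"
    using sqi_integrable[OF sqi_pow[of 4]] sqi_integrable[OF sqi_pow[of 2]] by (simp add: mrg_moments prob_space[simplified])
  also have "\<dots> = 2 * real n / (real n + 3)" by (simp add: field_simps)
  finally show ?thesis .
qed

private lemma u_mean: "(LINT x|mrg n. u x) = 0"
  using sqi_integrable[OF sqi_pow[of 2]] by (simp add: u_def mrg_moments prob_space[simplified])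

text \<open>Removing the component along \<open>x\<^sup>2 - 1\<close>.\<close>

private lemma decompose:
  assumes f: "sqi (mrg n) f" and f0: "(LINT x|mrg n. f x) = 0"
  obtains g t where "sqi (mrg n) g" "(LINT x|mrg n. g x) = 0" "(LINT x|mrg n. g x * x\<^sup>2) = 0"
    "f = (\<lambda>x. g x + t * u x)" "(nr (mrg n) f)\<^sup>2 = (nr (mrg n) g)\<^sup>2 + t\<^sup>2 * (nr (mrg n) u)\<^sup>2"
proof -
  define s where "s = (LINT x|mrg n. (u x)\<^sup>2)"
  have s: "s > 0" using n by (simp add: s_def u_sq)
  define t where "t = (LINT x|mrg n. f x * u x) / s"
  define g where "g x = f x - t * u x" for x
  have g: "sqi (mrg n) g" unfolding g_def by (intro sqi_diff f sqi_cmult sqi_u)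
  have fu: "integrable (mrg n) (\<lambda>x. f x * u x)" "integrable (mrg n) (\<lambda>x. (u x)\<^sup>2)" "integrable (mrg n) f" "integrable (mrg n) u"
    using sqi_mult_integrable[OF f sqi_u] sqi_u f by (auto simp: sqi_def intro: sqi_integrable f sqi_u)
  have g0: "(LINT x|mrg n. g x) = 0" using fu by (simp add: g_def f0 u_mean)
  have "(LINT x|mrg n. g x * u x) = (LINT x|mrg n. f x * u x - t * (u x)\<^sup>2)"
    by (simp add: g_def power2_eq_square algebra_simps)
  also have "\<dots> = 0" using fu s by (simp add: t_def flip: s_def)
  finally have gu: "(LINT x|mrg n. g x * u x) = 0" .
  have "(LINT x|mrg n. g x * x\<^sup>2) = (LINT x|mrg n. g x * u x + g x)"
    by (simp add: u_def algebra_simps)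
  also have "\<dots> = 0" using sqi_mult_integrable[OF g sqi_u] sqi_integrable[OF g] by (simp add: gu g0)
  finally have g2: "(LINT x|mrg n. g x * x\<^sup>2) = 0" .
  have f_eq: "f x = g x + t * u x" for x by (simp add: g_def)
  have fe: "f = (\<lambda>x. g x + t * u x)" by (rule ext) (rule f_eq)
  then have "(nr (mrg n) f)\<^sup>2 = (nr (mrg n) (\<lambda>x. g x + t * u x))\<^sup>2" by (rule arg_cong)
  also have "\<dots> = (nr (mrg n) g)\<^sup>2 + t\<^sup>2 * (nr (mrg n) u)\<^sup>2"
    using gu by (subst nr_add_sq[OF g sqi_cmult[OF sqi_u]]) (simp add: nr_cmult power_mult_distrib mult.left_commute)
  finally show ?thesis by (rule that[OF g g0 g2 fe])
qed

text \<open>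
  The operator \<open>\<phi> \<mapsto> E[\<phi>(v\<^sub>1) | v\<^sub>N]\<close> maps polynomials to polynomials without raising the degree, and
  it is self-adjoint; so its eigenvalues are the leading coefficients of the images of monomials.
\<close>

lemma bil_bound:
  assumes f: "sqi (mrg n) f" and g: "sqi (mrg n) g"
    and f0: "(LINT x|mrg n. f x) = 0" and f2: "(LINT x|mrg n. f x * x\<^sup>2) = 0"
  shows "\<bar>bil n f g\<bar> \<le> 3 / (real n * (real n + 2)) * (nr (mrg n) f * nr (mrg n) g)"
proof -
  let ?A = "nr (mrg n) f" and ?B = "nr (mrg n) g"
  \<comment> \<open>K collects what an error d <= 1 in the approximants of f and g adds to the
    bound.\<close>
  define K where "K = c * (?A + ?B + 1) + ?B + ?A + 1"
  have c: "c > 0" using n by (simp add: c_def)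
  have K: "K > 0" using c by (simp add: K_def add_nonneg_pos)
  have step: "\<bar>bil n f g\<bar> \<le> c * (?A * ?B) + d * K" if d: "0 < d" "d \<le> 1" for d
  proof -
    obtain p where p: "nr (mrg n) (\<lambda>x. f x - poly p x) < d" using poly_dense[OF f d(1)] .
    obtain q where q: "nr (mrg n) (\<lambda>x. g x - poly q x) < d" using poly_dense[OF g d(1)] .
    define m where "m = (LINT x|mrg n. poly p x)"
    have pm: "sqi (mrg n) (\<lambda>x. poly p x - m)" by (intro sqi_diff sqi_poly sqi_const)
    have pm0: "(LINT x|mrg n. poly p x - m) = 0"
      using sqi_integrable[OF sqi_poly[of p]] by (simp add: m_def prob_space[simplified])
    obtain h t where h: "sqi (mrg n) h" "(LINT x|mrg n. h x) = 0" "(LINT x|mrg n. h x * x\<^sup>2) = 0" "(\<lambda>x. poly p x - m) = (\<lambda>x. h x + t * u x)"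
      "(nr (mrg n) (\<lambda>x. poly p x - m))\<^sup>2 = (nr (mrg n) h)\<^sup>2 + t\<^sup>2 * (nr (mrg n) u)\<^sup>2"
      using decompose[OF pm pm0] .
    \<comment> \<open>The approximant p is freed of its components along 1 and x^2 - 1. Since f has
      no such components, this is an orthogonal projection fixing f and does not increase the
      distance to f.\<close>
    define r where "r = p - [:m:] - smult t [:-1, 0, 1:]"
    have r: "poly r = h"
    proof
      fix x show "poly r x = h x" using fun_cong[OF h(4), of x] by (simp add: r_def u_def power2_eq_square algebra_simps)
    qed
    have fr: "nr (mrg n) (\<lambda>x. f x - poly r x) < d"
    proof -
      let ?e = "\<lambda>x. m + t * u x"
      have e: "sqi (mrg n) ?e" by (intro sqi_add sqi_const sqi_cmult sqi_u)
      have fh: "sqi (mrg n) (\<lambda>x. f x - h x)" by (intro sqi_diff f h)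
      have fh0: "(LINT x|mrg n. f x - h x) = 0"
        using sqi_integrable[OF f] sqi_integrable[OF h(1)] by (simp add: f0 h)
      have fh2: "(LINT x|mrg n. (f x - h x) * x\<^sup>2) = 0"
        using sqi_mult_integrable[OF f sqi_pow[of 2]] sqi_mult_integrable[OF h(1) sqi_pow[of 2]]
        by (simp add: f2 h left_diff_distrib)
      have "(LINT x|mrg n. (f x - h x) * ?e x) = (LINT x|mrg n. (m - t) * (f x - h x) + t * ((f x - h x) * x\<^sup>2))"
        by (simp add: u_def algebra_simps)
      also have "\<dots> = 0"
        using sqi_integrable[OF fh] sqi_mult_integrable[OF fh sqi_pow[of 2]] by (simp add: fh0 fh2)
      finally have orth: "(LINT x|mrg n. (f x - h x) * ?e x) = 0" .
      have "(\<lambda>x. f x - poly p x) = (\<lambda>x. (f x - h x) + - ?e x)"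
      proof
        fix x show "f x - poly p x = (f x - h x) + - ?e x" using fun_cong[OF h(4), of x] by simp
      qed
      then have "(nr (mrg n) (\<lambda>x. f x - poly p x))\<^sup>2 = (nr (mrg n) (\<lambda>x. (f x - h x) + - ?e x))\<^sup>2" by (simp only:)
      also have "\<dots> = (nr (mrg n) (\<lambda>x. f x - h x))\<^sup>2 + (nr (mrg n) ?e)\<^sup>2"
        unfolding nr_add_sq[OF fh sqi_uminus[OF e]] nr_uminus mult_minus_right Bochner_Integration.integral_minus orth
        by simp
      finally have "(nr (mrg n) (\<lambda>x. f x - h x))\<^sup>2 \<le> (nr (mrg n) (\<lambda>x. f x - poly p x))\<^sup>2" by simp
      then have "nr (mrg n) (\<lambda>x. f x - h x) \<le> nr (mrg n) (\<lambda>x. f x - poly p x)"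
        by (rule power2_le_imp_le) simp
      then show ?thesis using p r by simp
    qed
    have "bil n (poly r) (poly q) = bil n h (poly q)" by (simp add: r)
    have rb: "\<bar>bil n (poly r) (poly q)\<bar> \<le> c * (nr (mrg n) (poly r) * nr (mrg n) (poly q))"
      using h by (intro bil_poly_le) (simp_all add: ip_def r poly_monom)
    have nA: "nr (mrg n) (poly r) \<le> ?A + d"
    proof -
      have "nr (mrg n) (\<lambda>x. f x + - (f x - poly r x)) \<le> ?A + nr (mrg n) (\<lambda>x. - (f x - poly r x))"
        by (intro nr_triangle f sqi_uminus sqi_diff sqi_poly)
      then show ?thesis using fr unfolding nr_uminus by simp
    qed
    have nB: "nr (mrg n) (poly q) \<le> ?B + d"
    proof -
      have "nr (mrg n) (\<lambda>x. g x + - (g x - poly q x)) \<le> ?B + nr (mrg n) (\<lambda>x. - (g x - poly q x))"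
        by (intro nr_triangle g sqi_uminus sqi_diff sqi_poly)
      then show ?thesis using q unfolding nr_uminus by simp
    qed
    have 1: "\<bar>bil n (\<lambda>x. f x - poly r x) g\<bar> \<le> d * ?B"
      using bil_le[OF sqi_diff[OF f sqi_poly] g, of r] fr
      by (meson mult_right_mono less_imp_le nr_nonneg order_trans)
    have 2: "\<bar>bil n (\<lambda>x. g x - poly q x) (poly r)\<bar> \<le> d * (?A + d)"
      using bil_le[OF sqi_diff[OF g sqi_poly] sqi_poly, of q r] q nA
        mult_mono[of "nr (mrg n) (\<lambda>x. g x - poly q x)" d "nr (mrg n) (poly r)" "?A + d"] d by force
    have 3: "nr (mrg n) (poly r) * nr (mrg n) (poly q) \<le> (?A + d) * (?B + d)"
      using nA nB d by (intro mult_mono) auto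
    have eq: "bil n f g = bil n (\<lambda>x. f x - poly r x) g + (bil n (\<lambda>x. g x - poly q x) (poly r) + bil n (poly r) (poly q))"
      using bil_diff[OF f sqi_poly g, of r] bil_diff[OF g sqi_poly sqi_poly, of q r]
        bil_sym[OF g sqi_poly, of r] bil_sym[OF sqi_poly sqi_poly, of q r] by simp
    have "\<bar>bil n f g\<bar> \<le> d * ?B + d * (?A + d) + c * ((?A + d) * (?B + d))"
    proof -
      have "c * (nr (mrg n) (poly r) * nr (mrg n) (poly q)) \<le> c * ((?A + d) * (?B + d))"
        using 3 c by (intro mult_left_mono) auto
      then show ?thesis using eq rb 1 2 by linarith
    qed
    also have "\<dots> \<le> c * (?A * ?B) + d * K"
    proof -
      have "d * d \<le> d * 1" using d by (intro mult_left_mono) auto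
      moreover have "c * (d * d) \<le> c * (d * 1)" using d c by (intro mult_left_mono) auto
      ultimately show ?thesis by (simp add: K_def algebra_simps)
    qed
    finally show ?thesis .
  qed
  have "\<bar>bil n f g\<bar> \<le> c * (?A * ?B)"
  proof (rule field_le_epsilon)
    fix e :: real assume e: "e > 0"
    define d where "d = min 1 (e / K)"
    have d: "0 < d" "d \<le> 1" using e K by (auto simp: d_def)
    have "d * K \<le> e / K * K" using K by (intro mult_right_mono) (auto simp: d_def)
    then have "d * K \<le> e" using K by simp
    then show "\<bar>bil n f g\<bar> \<le> c * (?A * ?B) + e" using step[OF d] by linarith
  qed
  then show ?thesis by (simp add: c_def)
qed

private lemma bil_one: "sqi (mrg n) g \<Longrightarrow> bil n (\<lambda>x. 1) g = (LINT x|mrg n. g x)"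
  using sqi_coord(3)[of n g "Suc n"] by (simp add: bil_def)

text \<open>The component along x^2 - 1 does not interact with the rest, as
  \<open>bil n u g = 0\<close>, and its own contribution is not positive. An upper bound thus covers
  functions with such a component, which is what occurs on slices.\<close>

lemma bil_self_le:
  assumes f: "sqi (mrg n) f" and f0: "(LINT x|mrg n. f x) = 0"
  shows "bil n f f \<le> 3 / (real n * (real n + 2)) * (nr (mrg n) f)\<^sup>2"
proof -
  obtain g t where g: "sqi (mrg n) g" "(LINT x|mrg n. g x) = 0" "(LINT x|mrg n. g x * x\<^sup>2) = 0"
    "f = (\<lambda>x. g x + t * u x)" "(nr (mrg n) f)\<^sup>2 = (nr (mrg n) g)\<^sup>2 + t\<^sup>2 * (nr (mrg n) u)\<^sup>2"
    using decompose[OF f f0] .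
  have "bil n (\<lambda>x. x\<^sup>2) g = (LINT x|mrg n. poly (Kp 2) x * g x)" by (rule bil_monom[OF g(1)])
  also have "\<dots> = (LINT x|mrg n. (\<mu> 2 / real n * real (Suc n)) * g x - \<mu> 2 / real n * (g x * x\<^sup>2))"
    by (simp add: Kp_def power2_eq_square algebra_simps del: of_nat_Suc)
  also have "\<dots> = 0"
    using sqi_integrable[OF g(1)] sqi_mult_integrable[OF g(1) sqi_pow[of 2]] by (simp add: g)
  finally have "bil n (\<lambda>x. x\<^sup>2) g = 0" .
  then have ug: "bil n u g = 0"
    using bil_diff[OF sqi_pow[of 2] sqi_const[of 1] g(1)] bil_one[OF g(1)] g(2) by (simp add: u_def[abs_def])
  have "bil n u u = (LINT v|sph (Suc n). (v 1)\<^sup>2 * (v (Suc n))\<^sup>2 - (v 1)\<^sup>2 - (v (Suc n))\<^sup>2 + 1)"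
    by (simp add: bil_def u_def algebra_simps)
  also have "\<dots> = (real n + 1) / (real n + 3) - 1"
  proof -
    interpret S: prob_space "sph (Suc n)" by (rule prob_space_sph)
    show ?thesis
      using integrable_sph_monom[OF one_N(1,2), of 2 2] integrable_sph_power[OF one_N(1), of 2] integrable_sph_power[OF one_N(2), of 2]
        sph_moments(1)[OF one_N(1,2,3)] sph_moments(1)[OF one_N(2,1) one_N(3)[symmetric]] sph_moments(4)[OF one_N(1,2,3)]
      by (simp add: S.prob_space add_ac)
  qed
  also have "\<dots> \<le> 0" by (simp add: field_simps)
  finally have uu: "bil n u u \<le> 0" .
  have tu: "sqi (mrg n) (\<lambda>x. t * u x)" by (intro sqi_cmult sqi_u)
  have "bil n f f = bil n g (\<lambda>x. g x + t * u x) + bil n (\<lambda>x. t * u x) (\<lambda>x. g x + t * u x)"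
    using bil_add[OF g(1) tu sqi_add[OF g(1) tu]] by (simp only: g(4)[symmetric])
  also have "\<dots> = bil n g g + t\<^sup>2 * bil n u u"
    using bil_sym[OF g(1) sqi_add[OF g(1) tu]] bil_sym[OF tu sqi_add[OF g(1) tu]]
      bil_add[OF g(1) tu g(1)] bil_add[OF g(1) tu tu] bil_sym[OF g(1) sqi_u] ug
    by (cases "t = 0") (auto simp: bil_cmult bil_cmult_right power2_eq_square)
  also have "\<dots> \<le> bil n g g" using uu by (simp add: mult_nonneg_nonpos)
  also have "\<dots> \<le> 3 / (real n * (real n + 2)) * (nr (mrg n) g)\<^sup>2"
    using bil_bound[OF g(1) g(1) g(2,3)] by (simp add: power2_eq_square)
  also have "\<dots> \<le> 3 / (real n * (real n + 2)) * (nr (mrg n) f)\<^sup>2"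
    by (intro mult_left_mono) (simp_all add: g(5))
  finally show ?thesis .
qed

text \<open>For uncorrelated coordinates the value would be n + 1 times the squared norm of f; the n
  off-diagonal terms in each row add at most n * 3 / (n (n + 2)) relative to the diagonal
  one.\<close>

lemma sum_coord_sq_le:
  assumes f: "sqi (mrg n) f" and f0: "(LINT x|mrg n. f x) = 0"
  shows "(LINT v|sph (Suc n). (\<Sum>k\<in>{1..Suc n}. f (v k))\<^sup>2) \<le> (real n + 1) * (1 + 3 / (real n + 2)) * (nr (mrg n) f)\<^sup>2"
proof -
  have "(LINT v|sph (Suc n). (\<Sum>k\<in>{1..Suc n}. f (v k))\<^sup>2)
      = (\<Sum>i\<in>{1..Suc n}. \<Sum>j\<in>{1..Suc n}. (LINT v|sph (Suc n). f (v i) * f (v j)))"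
  proof -
    have "(LINT v|sph (Suc n). (\<Sum>i\<in>{1..Suc n}. \<Sum>j\<in>{1..Suc n}. f (v i) * f (v j)))
        = (\<Sum>i\<in>{1..Suc n}. (LINT v|sph (Suc n). (\<Sum>j\<in>{1..Suc n}. f (v i) * f (v j))))"
      by (intro Bochner_Integration.integral_sum Bochner_Integration.integrable_sum bil_integrable f)
    also have "\<dots> = (\<Sum>i\<in>{1..Suc n}. \<Sum>j\<in>{1..Suc n}. (LINT v|sph (Suc n). f (v i) * f (v j)))"
      by (intro sum.cong refl Bochner_Integration.integral_sum bil_integrable f)
    finally show ?thesis unfolding power2_eq_square sum_product .
  qed
  also have "\<dots> = (\<Sum>i\<in>{1..Suc n}. \<Sum>j\<in>{1..Suc n}. if i = j then (nr (mrg n) f)\<^sup>2 else bil n f f)"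
  proof (intro sum.cong refl)
    fix i j assume ij: "i \<in> {1..Suc n}" "j \<in> {1..Suc n}"
    show "(LINT v|sph (Suc n). f (v i) * f (v j)) = (if i = j then (nr (mrg n) f)\<^sup>2 else bil n f f)"
    proof (cases "i = j")
      case True
      show ?thesis using True sqi_coord(2)[OF f ij(1)] nr_sq[of "sph (Suc n)" "\<lambda>v. f (v i)"]
        by (simp add: power2_eq_square)
    qed (use bil_coord[OF f f ij] in simp)
  qed
  also have "\<dots> = (\<Sum>i\<in>{1..Suc n}. (nr (mrg n) f)\<^sup>2 + real n * bil n f f)"
  proof (rule sum.cong)
    fix i assume i: "i \<in> {1..Suc n}"
    have "(\<Sum>j\<in>{1..Suc n}. if i = j then (nr (mrg n) f)\<^sup>2 else bil n f f) = (nr (mrg n) f)\<^sup>2 + (\<Sum>j\<in>{1..Suc n}-{i}. bil n f f)"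
      using i by (subst sum.remove[of _ i]) (auto intro!: sum.cong)
    also have "(\<Sum>j\<in>{1..Suc n}-{i}. bil n f f) = real n * bil n f f" using i by simp
    finally show "(\<Sum>j\<in>{1..Suc n}. if i = j then (nr (mrg n) f)\<^sup>2 else bil n f f) = (nr (mrg n) f)\<^sup>2 + real n * bil n f f" .
  qed simp
  also have "\<dots> = (real n + 1) * ((nr (mrg n) f)\<^sup>2 + real n * bil n f f)" by simp
  also have "\<dots> \<le> (real n + 1) * ((nr (mrg n) f)\<^sup>2 + real n * (3 / (real n * (real n + 2)) * (nr (mrg n) f)\<^sup>2))"
    using bil_self_le[OF f f0] by (intro mult_left_mono add_left_mono) auto
  also have "\<dots> = (real n + 1) * (1 + 3 / (real n + 2)) * (nr (mrg n) f)\<^sup>2"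
  proof -
    have "real n * (3 / (real n * (real n + 2)) * (nr (mrg n) f)\<^sup>2) = 3 / (real n + 2) * (nr (mrg n) f)\<^sup>2"
      using n by simp
    then show ?thesis by (simp only: distrib_right mult.assoc mult_1_left)
  qed
  finally show ?thesis .
qed

end

subsection \<open>Averages over rotations\<close>

lemma pred_eq_real:
  fixes f g :: "'a \<Rightarrow> real"
  assumes [measurable]: "f \<in> borel_measurable M" "g \<in> borel_measurable M"
  shows "Measurable.pred M (\<lambda>v. f v = g v)"
proof -
  have "Measurable.pred M (\<lambda>v. f v - g v = 0)" by measurable
  then show ?thesis by simp
qed

lemma rot_avg_eq: "rot_avg i j f v = 1 / (2 * pi) * (LINT \<theta>|lborel. indicator {-pi..pi} \<theta> * f (rot i j \<theta> v))"
  by (simp add: rot_avg_def set_lebesgue_integral_def)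

context
  fixes N i j :: nat
  assumes ij: "i \<in> {1..N}" "j \<in> {1..N}" "i \<noteq> j"
begin

private lemma rot_swap [measurable]: "(\<lambda>p. rot i j (snd p) (fst p)) \<in> measurable (bor N \<Otimes>\<^sub>M lborel) (bor N)"
proof -
  have "(\<lambda>p. (snd p, fst p)) \<in> measurable (bor N \<Otimes>\<^sub>M lborel) (borel \<Otimes>\<^sub>M bor N)" by measurable
  from measurable_compose[OF this rot_measurable[OF ij(1,2)]] show ?thesis by simp
qed

lemma rot_avg_measurable:
  assumes [measurable]: "f \<in> borel_measurable (bor N)"
  shows "rot_avg i j f \<in> borel_measurable (bor N)"
proof -
  have [measurable]: "(\<lambda>p. f (rot i j (snd p) (fst p))) \<in> borel_measurable (bor N \<Otimes>\<^sub>M lborel)"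
    using measurable_compose[OF rot_swap] assms by auto
  have "(\<lambda>v. LINT \<theta>|lborel. indicator {-pi..pi} \<theta> * f (rot i j \<theta> v)) \<in> borel_measurable (bor N)"
    by (intro lborel.borel_measurable_lebesgue_integral) (simp add: case_prod_beta)
  then have "(\<lambda>v. 1 / (2 * pi) * (LINT \<theta>|lborel. indicator {-pi..pi} \<theta> * f (rot i j \<theta> v))) \<in> borel_measurable (bor N)" by measurable
  then show ?thesis by (simp add: rot_avg_eq[abs_def])
qed

private lemma rot_pair_integrable:
  fixes f :: "(nat \<Rightarrow> real) \<Rightarrow> real"
  assumes [measurable]: "f \<in> borel_measurable (bor N)" and f: "integrable (sph N) f" and pos: "\<And>v. f v \<ge> 0"
  shows "integrable (sph N \<Otimes>\<^sub>M lborel) (\<lambda>(v, \<theta>). indicator {-pi..pi} \<theta> * f (rot i j \<theta> v))"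
proof -
  interpret S: prob_space "sph N" by (rule prob_space_sph)
  interpret pair_sigma_finite "sph N" lborel ..
  have rm: "(\<lambda>p. rot i j (snd p) (fst p)) \<in> measurable (sph N \<Otimes>\<^sub>M lborel) (bor N)"
    using rot_swap by (simp cong: measurable_cong_sets sets_pair_measure_cong add: sets_sph)
  have [measurable]: "(\<lambda>p. f (rot i j (snd p) (fst p))) \<in> borel_measurable (sph N \<Otimes>\<^sub>M lborel)"
    using measurable_compose[OF rm] assms(1) by auto
  have m: "(\<lambda>(v, \<theta>). indicator {-pi..pi} \<theta> * f (rot i j \<theta> v)) \<in> borel_measurable (sph N \<Otimes>\<^sub>M lborel)"
    unfolding split_def
    by (intro borel_measurable_times measurable_compose[OF rm assms(1)]) measurable
  have [measurable]: "rot i j \<theta> \<in> measurable (bor N) (bor N)" for \<theta> by (rule rot_measurable'[OF ij(1,2)])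
  have "(\<integral>\<^sup>+p. ennreal (case p of (v, \<theta>) \<Rightarrow> indicator {-pi..pi} \<theta> * f (rot i j \<theta> v)) \<partial>(sph N \<Otimes>\<^sub>M lborel))
      = (\<integral>\<^sup>+\<theta>. (\<integral>\<^sup>+v. ennreal (indicator {-pi..pi} \<theta> * f (rot i j \<theta> v)) \<partial>sph N) \<partial>lborel)"
    using m by (subst nn_integral_snd[symmetric]) auto
  also have "\<dots> = (\<integral>\<^sup>+\<theta>. indicator {-pi..pi} \<theta> * (\<integral>\<^sup>+v. ennreal (f v) \<partial>sph N) \<partial>lborel)"
  proof (rule nn_integral_cong)
    fix \<theta>
    have "(\<integral>\<^sup>+v. ennreal (indicator {-pi..pi} \<theta> * f (rot i j \<theta> v)) \<partial>sph N)
        = (\<integral>\<^sup>+v. indicator {-pi..pi} \<theta> * ennreal (f (rot i j \<theta> v)) \<partial>sph N)"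
      by (intro nn_integral_cong) (auto simp: indicator_def)
    also have "\<dots> = indicator {-pi..pi} \<theta> * (\<integral>\<^sup>+v. ennreal (f (rot i j \<theta> v)) \<partial>sph N)"
      by (rule nn_integral_cmult) (simp add: meas_sph)
    also have "(\<integral>\<^sup>+v. ennreal (f (rot i j \<theta> v)) \<partial>sph N) = (\<integral>\<^sup>+v. ennreal (f v) \<partial>sph N)"
      by (rule nn_integral_sph_rot[OF ij]) measurable
    finally show "(\<integral>\<^sup>+v. ennreal (indicator {-pi..pi} \<theta> * f (rot i j \<theta> v)) \<partial>sph N) = indicator {-pi..pi} \<theta> * (\<integral>\<^sup>+v. ennreal (f v) \<partial>sph N)" .
  qed
  also have "\<dots> = ennreal (2 * pi) * ennreal (LINT v|sph N. f v)"
    using f pos by (simp add: nn_integral_multc nn_integral_eq_integral)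
  also have "\<dots> < \<infinity>" by (simp add: ennreal_mult_less_top)
  finally show ?thesis
    using m pos by (intro integrableI_bounded) (auto simp: case_prod_beta abs_mult)
qed

text \<open>Cauchy-Schwarz in the angle bounds the square of the average by the average of the
  squares, which is integrable by Fubini because every rotation preserves the measure.\<close>

lemma rot_avg_sqi:
  assumes [measurable]: "f \<in> borel_measurable (bor N)" and f: "sqi (sph N) f"
  shows "sqi (sph N) (rot_avg i j f)"
    and "AE v in sph N. integrable lborel (\<lambda>\<theta>. indicator {-pi..pi} \<theta> * f (rot i j \<theta> v))"
proof -
  interpret S: prob_space "sph N" by (rule prob_space_sph)
  interpret pair_sigma_finite "sph N" lborel ..
  have int: "integrable (sph N \<Otimes>\<^sub>M lborel) (\<lambda>(v, \<theta>). indicator {-pi..pi} \<theta> * (f (rot i j \<theta> v))\<^sup>2)"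
    using f by (intro rot_pair_integrable[where f="\<lambda>v. (f v)\<^sup>2"]) (auto simp: sqi_def)
  define F where "F v \<theta> = indicator {-pi..pi} \<theta> * f (rot i j \<theta> v)" for v \<theta>
  have F2: "(F v \<theta>)\<^sup>2 = indicator {-pi..pi} \<theta> * (f (rot i j \<theta> v))\<^sup>2" for v \<theta>
    by (auto simp: F_def indicator_def)
  have Fm: "F v \<in> borel_measurable borel" if v: "v \<in> space (sph N)" for v
  proof -
    have "(\<lambda>\<theta>. (\<theta>, v)) \<in> measurable borel (borel \<Otimes>\<^sub>M bor N)" using v by (auto simp: space_sph)
    from measurable_compose[OF this rot_measurable[OF ij(1,2)]]
    have "(\<lambda>\<theta>. rot i j \<theta> v) \<in> measurable borel (bor N)" by simp
    from measurable_compose[OF this assms(1)] have [measurable]: "(\<lambda>\<theta>. f (rot i j \<theta> v)) \<in> borel_measurable borel" .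
    show ?thesis unfolding F_def by simp
  qed
  define G :: "real \<Rightarrow> real" where "G = indicator {-pi..pi}"
  have G: "sqi lborel G" "(LINT \<theta>|lborel. (G \<theta>)\<^sup>2) = 2 * pi"
  proof -
    have "(G \<theta>)\<^sup>2 = indicator {-pi..pi} \<theta>" for \<theta> by (simp add: G_def indicator_def)
    then show "sqi lborel G" "(LINT \<theta>|lborel. (G \<theta>)\<^sup>2) = 2 * pi" by (simp_all add: sqi_def G_def)
  qed
  have AEF: "AE v in sph N. sqi lborel (F v)"
    using AE_integrable_fst[OF int] AE_space
    by eventually_elim (auto simp: sqi_def F2 Fm)
  have FG: "F v \<theta> * G \<theta> = indicator {-pi..pi} \<theta> * f (rot i j \<theta> v)" for v \<theta> by (auto simp: F_def G_def indicator_def)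
  show "AE v in sph N. integrable lborel (\<lambda>\<theta>. indicator {-pi..pi} \<theta> * f (rot i j \<theta> v))"
    using AEF
  proof eventually_elim
    case (elim v)
    show ?case using sqi_mult_integrable[OF elim G(1)] unfolding FG .
  qed
  have "integrable (sph N) (\<lambda>v. LINT \<theta>|lborel. indicator {-pi..pi} \<theta> * (f (rot i j \<theta> v))\<^sup>2)"
    by (rule integrable_fst[OF int])
  then have int2: "integrable (sph N) (\<lambda>v. LINT \<theta>|lborel. (F v \<theta>)\<^sup>2)" by (simp add: F2)
  have bound: "AE v in sph N. (rot_avg i j f v)\<^sup>2 \<le> 1 / (2 * pi) * (LINT \<theta>|lborel. (F v \<theta>)\<^sup>2)"
    using AEF
  proof eventually_elim
    case (elim v)
    have "rot_avg i j f v = 1 / (2 * pi) * (LINT \<theta>|lborel. F v \<theta> * G \<theta>)"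
      unfolding rot_avg_eq FG ..
    then have "(rot_avg i j f v)\<^sup>2 = (1 / (2 * pi))\<^sup>2 * \<bar>LINT \<theta>|lborel. F v \<theta> * G \<theta>\<bar>\<^sup>2"
      by (simp add: power_mult_distrib power_divide)
    also have "\<dots> \<le> (1 / (2 * pi))\<^sup>2 * (nr lborel (F v) * nr lborel G)\<^sup>2"
      by (intro mult_left_mono power_mono nr_cauchy_schwarz elim G) auto
    also have "\<dots> = 1 / (2 * pi) * (LINT \<theta>|lborel. (F v \<theta>)\<^sup>2)"
      unfolding power_mult_distrib nr_sq G(2) by (simp add: power2_eq_square)
    finally show ?case .
  qed
  have rm: "rot_avg i j f \<in> borel_measurable (sph N)"
    using rot_avg_measurable[OF assms(1)] by (simp add: meas_sph)
  show "sqi (sph N) (rot_avg i j f)"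
    unfolding sqi_def
  proof
    show "integrable (sph N) (\<lambda>v. (rot_avg i j f v)\<^sup>2)"
    proof (rule Bochner_Integration.integrable_bound)
      show "integrable (sph N) (\<lambda>v. 1 / (2 * pi) * (LINT \<theta>|lborel. (F v \<theta>)\<^sup>2))" using int2 by simp
      show "AE v in sph N. norm ((rot_avg i j f v)\<^sup>2) \<le> norm (1 / (2 * pi) * (LINT \<theta>|lborel. (F v \<theta>)\<^sup>2))"
        using bound by eventually_elim (simp add: abs_mult)
    qed (use rm in measurable)
  qed (rule rm)
qed

text \<open>An orbit of rotations may be a null set, so changing f on a null set can alter single
  averages. For each angle the rotated functions agree almost everywhere, and Fubini exchanges the
  two quantifiers.\<close>

lemma rot_avg_cong_AE:
  assumes [measurable]: "f \<in> borel_measurable (bor N)" "g \<in> borel_measurable (bor N)"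
    and eq: "AE v in sph N. f v = g v"
  shows "AE v in sph N. rot_avg i j f v = rot_avg i j g v"
proof -
  interpret S: prob_space "sph N" by (rule prob_space_sph)
  interpret pair_sigma_finite "sph N" lborel ..
  have rm [measurable]: "(\<lambda>p. rot i j (snd p) (fst p)) \<in> measurable (sph N \<Otimes>\<^sub>M lborel) (bor N)"
    using rot_swap by (simp cong: measurable_cong_sets sets_pair_measure_cong add: sets_sph)
  have [measurable]: "(\<lambda>p. f (rot i j (snd p) (fst p))) \<in> borel_measurable (sph N \<Otimes>\<^sub>M lborel)"
    "(\<lambda>p. g (rot i j (snd p) (fst p))) \<in> borel_measurable (sph N \<Otimes>\<^sub>M lborel)"
    using measurable_compose[OF rm] assms(1,2) by auto
  have pred: "Measurable.pred (bor N) (\<lambda>v. f v = g v)" by (rule pred_eq_real) measurable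
  have "AE v in sph N. f (rot i j \<theta> v) = g (rot i j \<theta> v)" for \<theta>
    using AE_sph_rot[OF ij pred, of \<theta>] eq by simp
  then have "AE \<theta> in lborel. AE v in sph N. f (rot i j \<theta> v) = g (rot i j \<theta> v)" by simp
  moreover have "Measurable.pred (sph N \<Otimes>\<^sub>M lborel) (\<lambda>p. f (rot i j (snd p) (fst p)) = g (rot i j (snd p) (fst p)))"
    using measurable_compose[OF rm assms(1)] measurable_compose[OF rm assms(2)] by (rule pred_eq_real)
  ultimately have "AE v in sph N. AE \<theta> in lborel. f (rot i j \<theta> v) = g (rot i j \<theta> v)"
    by (subst AE_commute) (auto simp: pred_def)
  then show ?thesis using AE_space
  proof eventually_elim
    case (elim v)
    have m: "(\<lambda>\<theta>. h (rot i j \<theta> v)) \<in> borel_measurable borel" if "h \<in> borel_measurable (bor N)" for h :: "(nat \<Rightarrow> real) \<Rightarrow> real"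
    proof -
      have "(\<lambda>\<theta>. (\<theta>, v)) \<in> measurable borel (borel \<Otimes>\<^sub>M bor N)" using elim(2) by (auto simp: space_sph)
      from measurable_compose[OF this rot_measurable[OF ij(1,2)]]
      have "(\<lambda>\<theta>. rot i j \<theta> v) \<in> measurable borel (bor N)" by simp
      from measurable_compose[OF this that] show ?thesis .
    qed
    note [measurable] = m[OF assms(1)] m[OF assms(2)]
    have "(LINT \<theta>|lborel. indicator {-pi..pi} \<theta> * f (rot i j \<theta> v)) = (LINT \<theta>|lborel. indicator {-pi..pi} \<theta> * g (rot i j \<theta> v))"
      using elim(1) by (intro integral_cong_AE) auto
    then show ?case by (simp add: rot_avg_eq)
  qed
qed

end

subsection \<open>The Dirichlet form of a symmetric function\<close>

text \<open>Symmetry holds almost everywhere, as is appropriate in L^2, but measurability refers to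
  the whole product space, so that every slice of f is a measurable function.\<close>

definition adm :: "nat \<Rightarrow> ((nat \<Rightarrow> real) \<Rightarrow> real) \<Rightarrow> bool" where
  "adm N f \<longleftrightarrow> f \<in> borel_measurable (bor N) \<and> sqi (sph N) f \<and>
     (\<forall>\<pi>. \<pi> permutes {1..N} \<longrightarrow> (AE v in sph N. f (v \<circ> \<pi>) = f v))"

definition pair_term :: "real \<Rightarrow> nat \<Rightarrow> nat \<Rightarrow> ((nat \<Rightarrow> real) \<Rightarrow> real) \<Rightarrow> (nat \<Rightarrow> real) \<Rightarrow> real" where
  "pair_term \<gamma> i j f v = ((v i)\<^sup>2 + (v j)\<^sup>2) powr \<gamma> * (f v - rot_avg i j f v)\<^sup>2"

lemma pair_term_measurable:
  assumes "i \<in> {1..N}" "j \<in> {1..N}" "i \<noteq> j" and [measurable]: "f \<in> borel_measurable (bor N)"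
  shows "pair_term \<gamma> i j f \<in> borel_measurable (bor N)"
proof -
  note [measurable] = coord_measurable[OF assms(1)] coord_measurable[OF assms(2)] rot_avg_measurable[OF assms]
  show ?thesis unfolding pair_term_def[abs_def] by measurable
qed

lemma pair_term_integrable:
  assumes ij: "i \<in> {1..N}" "j \<in> {1..N}" "i \<noteq> j" and f: "f \<in> borel_measurable (bor N)" "sqi (sph N) f" and \<gamma>: "\<gamma> \<ge> 0"
  shows "integrable (sph N) (pair_term \<gamma> i j f)"
proof (rule Bochner_Integration.integrable_bound)
  have N: "N \<ge> 1" using ij by auto
  have "sqi (sph N) (\<lambda>v. f v - rot_avg i j f v)"
    by (intro sqi_diff f(2) rot_avg_sqi(1) ij f)
  then show "integrable (sph N) (\<lambda>v. (2 * real N) powr \<gamma> * (f v - rot_avg i j f v)\<^sup>2)" by (simp add: sqi_def)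
  show "pair_term \<gamma> i j f \<in> borel_measurable (sph N)"
    using pair_term_measurable[OF ij f(1)] by (simp add: meas_sph)
  show "AE v in sph N. norm (pair_term \<gamma> i j f v) \<le> norm ((2 * real N) powr \<gamma> * (f v - rot_avg i j f v)\<^sup>2)"
    using AE_sph_kac[OF N]
  proof eventually_elim
    case (elim v)
    have "((v i)\<^sup>2 + (v j)\<^sup>2) powr \<gamma> \<le> (2 * real N) powr \<gamma>"
      using kac_coord_le(1)[OF elim ij(1)] kac_coord_le(1)[OF elim ij(2)] \<gamma> by (intro powr_mono2) auto
    then show ?case by (simp add: pair_term_def abs_mult mult_right_mono)
  qed
qed

lemma rot_perm:
  assumes "\<pi> permutes S" "\<pi> k = i" "\<pi> l = j"
  shows "rot k l \<theta> (v \<circ> \<pi>) = rot i j \<theta> v \<circ> \<pi>"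
  using permutes_inj[OF assms(1)] assms(2,3) by (auto simp: rot_def fun_eq_iff inj_def)

text \<open>A permutation taking (1, 2) to (i, j) conjugates the corresponding rotations. The pair
  (1, 2) is chosen as representative because, for N >= 3, it avoids the last coordinate, on which f
  will be conditioned.\<close>

lemma pair_term_sym:
  assumes f: "adm N f" and ij: "i \<in> {1..N}" "j \<in> {1..N}" "i \<noteq> j" and N: "N \<ge> 2"
  shows "(LINT v|sph N. pair_term \<gamma> i j f v) = (LINT v|sph N. pair_term \<gamma> 1 2 f v)"
proof -
  have kl: "1 \<in> {1..N}" "2 \<in> {1..N}" "1 \<noteq> (2::nat)" using N by auto
  obtain \<pi> where p: "\<pi> permutes {1..N}" "\<pi> 1 = i" "\<pi> 2 = j"
    using exists_perm2[OF kl(1,2) ij(1,2) kl(3) ij(3)] by blast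
  have fm [measurable]: "f \<in> borel_measurable (bor N)" using f by (simp add: adm_def)
  have pm: "(\<lambda>v. v \<circ> \<pi>) \<in> measurable (bor N) (bor N)" by (rule perm_measurable[OF p(1)])
  have fp: "(\<lambda>v. f (v \<circ> \<pi>)) \<in> borel_measurable (bor N)" by (rule measurable_compose[OF pm fm])
  have eq: "AE v in sph N. f (v \<circ> \<pi>) = f v" using f p by (simp add: adm_def)
  have "AE v in sph N. pair_term \<gamma> i j f v = pair_term \<gamma> 1 2 f (v \<circ> \<pi>)"
    using eq rot_avg_cong_AE[OF ij fp fm eq]
  proof eventually_elim
    case (elim v)
    have "rot_avg 1 2 f (v \<circ> \<pi>) = rot_avg i j (\<lambda>v. f (v \<circ> \<pi>)) v"
      unfolding rot_avg_eq rot_perm[OF p] ..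
    then show ?case using elim p by (simp add: pair_term_def)
  qed
  then have "(LINT v|sph N. pair_term \<gamma> i j f v) = (LINT v|sph N. pair_term \<gamma> 1 2 f (v \<circ> \<pi>))"
    using pair_term_measurable[OF ij fm, of \<gamma>] measurable_compose[OF pm pair_term_measurable[OF kl fm, of \<gamma>]]
    by (intro integral_cong_AE) (simp_all add: meas_sph)
  also have "\<dots> = (LINT v|sph N. pair_term \<gamma> 1 2 f v)"
    by (rule integral_sph_perm(1)[OF p(1) pair_term_measurable[OF kl fm]])
  finally show ?thesis .
qed

lemma integral_sphere_measure:
  fixes f :: "(nat \<Rightarrow> real) \<Rightarrow> real"
  assumes N: "N \<ge> 1" and [measurable]: "f \<in> borel_measurable (bor N)"
  shows "(LINT v|sphere_measure N. f v) = (LINT v|sph N. f v)"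
    and "integrable (sphere_measure N) f \<longleftrightarrow> integrable (sph N) f"
    and "f \<in> borel_measurable (sphere_measure N)"
proof -
  have k [measurable]: "kac_sphere N \<in> sets (sph N)" using kac_sphere_in_sets by (simp add: sets_sph)
  have k': "kac_sphere N \<inter> space (sph N) \<in> sets (sph N)" by measurable
  have [measurable]: "f \<in> borel_measurable (sph N)" using assms by (simp add: meas_sph)
  have ae: "AE v in sph N. indicator (kac_sphere N) v *\<^sub>R f v = f v"
    using AE_sph_kac[OF N] by eventually_elim simp
  show "(LINT v|sphere_measure N. f v) = (LINT v|sph N. f v)"
    unfolding sphere_measure_eq integral_restrict_space[OF k'] using ae
    by (intro integral_cong_AE) auto
  show "integrable (sphere_measure N) f \<longleftrightarrow> integrable (sph N) f"
    unfolding sphere_measure_eq integrable_restrict_space[OF k'] set_integrable_def using ae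
    by (intro integrable_cong_AE) auto
  show "f \<in> borel_measurable (sphere_measure N)"
    unfolding sphere_measure_eq by (intro measurable_restrict_space1) simp
qed

lemma AE_sphere_measure:
  assumes N: "N \<ge> 1"
  shows "(AE v in sphere_measure N. P v) \<longleftrightarrow> (AE v in sph N. P v)"
proof -
  have k [measurable]: "kac_sphere N \<in> sets (sph N)" using kac_sphere_in_sets by (simp add: sets_sph)
  have k': "kac_sphere N \<inter> space (sph N) \<in> sets (sph N)" by measurable
  show ?thesis
    unfolding sphere_measure_eq AE_restrict_space_iff[OF k']
    using AE_sph_kac[OF N] by (auto elim: eventually_elim2)
qed

lemma card_pairs: "card {(i, j). i \<in> {1..N} \<and> j \<in> {1..N} \<and> i < j} = N choose 2"
proof -
  have "{(i, j). i \<in> {1..N} \<and> j \<in> {1..N} \<and> i < j} = prod.swap ` (SIGMA j:{1..N}. {1..<j})"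
    by (force simp: image_iff)
  then have "card {(i, j). i \<in> {1..N} \<and> j \<in> {1..N} \<and> i < j} = card (SIGMA j:{1..N}. {1..<j})"
    by (simp add: card_image)
  also have "\<dots> = (\<Sum>j\<in>{1..N}. j - 1)" by simp
  also have "\<dots> = N choose 2"
    by (induction N) (auto simp: choose_two One_nat_def binomial_Suc_Suc numeral_2_eq_2)
  finally show ?thesis .
qed

lemma dirichlet_form_sym:
  assumes f: "adm N f" and N: "N \<ge> 2"
  shows "dirichlet_form \<gamma> N f = real N * (LINT v|sph N. pair_term \<gamma> 1 2 f v)"
proof -
  let ?S = "{(i, j). i \<in> {1..N} \<and> j \<in> {1..N} \<and> i < j}"
  have fm [measurable]: "f \<in> borel_measurable (bor N)" using f by (simp add: adm_def)
  have "(\<Sum>(i, j)\<in>?S. LINT v|sphere_measure N. ((v i)\<^sup>2 + (v j)\<^sup>2) powr \<gamma> * (f v - rot_avg i j f v)\<^sup>2)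
     = (\<Sum>p\<in>?S. LINT v|sph N. pair_term \<gamma> 1 2 f v)"
  proof (rule sum.cong)
    fix p assume "p \<in> ?S"
    then obtain i j where p: "p = (i, j)" and ij: "i \<in> {1..N}" "j \<in> {1..N}" "i \<noteq> j" by auto
    have "(LINT v|sphere_measure N. pair_term \<gamma> i j f v) = (LINT v|sph N. pair_term \<gamma> i j f v)"
      using N pair_term_measurable[OF ij fm] by (intro integral_sphere_measure(1)) auto
    then show "(case p of (i, j) \<Rightarrow> LINT v|sphere_measure N. ((v i)\<^sup>2 + (v j)\<^sup>2) powr \<gamma> * (f v - rot_avg i j f v)\<^sup>2) = (LINT v|sph N. pair_term \<gamma> 1 2 f v)"
      using pair_term_sym[OF f ij N] by (simp add: p pair_term_def)
  qed simp
  also have "\<dots> = real (N choose 2) * (LINT v|sph N. pair_term \<gamma> 1 2 f v)"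
    by (simp only: sum_constant card_pairs)
  finally have "dirichlet_form \<gamma> N f = real N * inverse (real (N choose 2)) * (real (N choose 2) * (LINT v|sph N. pair_term \<gamma> 1 2 f v))"
    by (simp add: dirichlet_form_def)
  moreover have "N choose 2 \<noteq> 0" using N by (simp add: not_less)
  ultimately show ?thesis by simp
qed

lemma dirichlet_form_nonneg: "dirichlet_form \<gamma> N f \<ge> 0"
  unfolding dirichlet_form_def
  by (intro mult_nonneg_nonneg sum_nonneg) (auto intro!: integral_nonneg_AE)

lemma spectral_gap_le:
  assumes "L2_fun N f" "L2_nrm N f = 1" "L2_inner N f (\<lambda>_. 1) = 0" "symmetric_fun N f"
  shows "spectral_gap \<gamma> N \<le> dirichlet_form \<gamma> N f"
  unfolding spectral_gap_def
  using assms by (intro cInf_lower bdd_belowI[of _ 0]) (auto simp: dirichlet_form_nonneg)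

lemma pair_term_affine:
  assumes ij: "i \<in> {1..N}" "j \<in> {1..N}" "i \<noteq> j" and f: "f \<in> borel_measurable (bor N)" "sqi (sph N) f"
  shows "AE v in sph N. pair_term \<gamma> i j (\<lambda>v. a * (f v - b)) v = a\<^sup>2 * pair_term \<gamma> i j f v"
  using rot_avg_sqi(2)[OF ij f]
proof eventually_elim
  case (elim v)
  have ind: "integrable lborel (indicator {-pi..pi} :: real \<Rightarrow> real)" "(LINT \<theta>|lborel. indicator {-pi..pi} \<theta>) = 2 * pi" by simp_all
  have "rot_avg i j (\<lambda>v. a * (f v - b)) v = 1 / (2 * pi) * (LINT \<theta>|lborel. a * (indicator {-pi..pi} \<theta> * f (rot i j \<theta> v) - b * indicator {-pi..pi} \<theta>))"
    unfolding rot_avg_eq by (simp add: algebra_simps)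
  also have "\<dots> = a * (rot_avg i j f v - b)"
    using elim ind unfolding rot_avg_eq by (simp add: algebra_simps)
  finally show ?case by (simp add: pair_term_def power_mult_distrib algebra_simps flip: power_mult_distrib)
qed

text \<open>The form is invariant under adding constants and homogeneous of degree 2, so the infimum
  over normalised functions amounts to a Poincare inequality. If the variance is 0, the claim is
  nonnegativity of the form.\<close>

lemma spectral_gap_variance:
  assumes f: "adm N f" and N: "N \<ge> 2" and \<gamma>: "\<gamma> \<ge> 0"
  shows "spectral_gap \<gamma> N * ((LINT v|sph N. (f v)\<^sup>2) - (LINT v|sph N. f v)\<^sup>2) \<le> dirichlet_form \<gamma> N f"
proof -
  interpret S: prob_space "sph N" by (rule prob_space_sph)
  have N1: "N \<ge> 1" using N by simp
  have fm [measurable]: "f \<in> borel_measurable (bor N)" and fs: "sqi (sph N) f" using f by (auto simp: adm_def)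
  define m where "m = (LINT v|sph N. f v)"
  define V where "V = (LINT v|sph N. (f v)\<^sup>2) - m\<^sup>2"
  have fi: "integrable (sph N) f" "integrable (sph N) (\<lambda>v. (f v)\<^sup>2)"
    using S.sqi_integrable[OF fs] fs by (auto simp: sqi_def)
  have V: "V = (LINT v|sph N. (f v - m)\<^sup>2)"
  proof -
    have "(LINT v|sph N. (f v - m)\<^sup>2) = (LINT v|sph N. (f v)\<^sup>2 - 2 * m * f v + m\<^sup>2)"
      by (intro Bochner_Integration.integral_cong refl) (simp add: power2_diff)
    also have "\<dots> = V" using fi by (simp add: V_def S.prob_space m_def[symmetric] power2_eq_square)
    finally show ?thesis ..
  qed
  then have "V \<ge> 0" by simp
  show ?thesis
  proof (cases "V = 0")
    case True
    then show ?thesis using dirichlet_form_nonneg[of \<gamma> N f] by (simp add: V_def m_def)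
  next
    case False
    then have Vp: "V > 0" using \<open>V \<ge> 0\<close> by simp
    define a where "a = 1 / sqrt V"
    have a2: "a\<^sup>2 = 1 / V" using Vp by (simp add: a_def power_divide)
    define g where "g v = a * (f v - m)" for v
    have gm [measurable]: "g \<in> borel_measurable (bor N)" unfolding g_def by measurable
    have gs: "sqi (sph N) g" unfolding g_def by (intro sqi_cmult sqi_diff fs S.sqi_const)
    have g: "adm N g"
      unfolding adm_def
    proof (intro conjI allI impI gm gs)
      fix \<pi> assume "\<pi> permutes {1..N}"
      then have "AE v in sph N. f (v \<circ> \<pi>) = f v" using f by (simp add: adm_def)
      then show "AE v in sph N. g (v \<circ> \<pi>) = g v" by eventually_elim (simp add: g_def)
    qed
    have g2: "(LINT v|sph N. (g v)\<^sup>2) = 1"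
      using V Vp by (simp add: g_def power_mult_distrib a2)
    have g1: "(LINT v|sph N. g v) = 0"
      using fi by (simp add: g_def m_def S.prob_space)
    have g2m: "(\<lambda>v. (g v)\<^sup>2) \<in> borel_measurable (bor N)" by measurable
    have "spectral_gap \<gamma> N \<le> dirichlet_form \<gamma> N g"
    proof (rule spectral_gap_le)
      show "L2_fun N g"
        unfolding L2_fun_def integral_sphere_measure(2)[OF N1 g2m]
        using integral_sphere_measure(3)[OF N1 gm] gs by (simp add: sqi_def)
      show "L2_nrm N g = 1"
        unfolding L2_nrm_def L2_inner_def power2_eq_square[symmetric] integral_sphere_measure(1)[OF N1 g2m] g2 by simp
      show "L2_inner N g (\<lambda>_. 1) = 0"
        unfolding L2_inner_def mult_1_right integral_sphere_measure(1)[OF N1 gm] g1 ..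
      show "symmetric_fun N g" using g by (simp add: symmetric_fun_def adm_def AE_sphere_measure[OF N1])
    qed
    also have "\<dots> = real N * (LINT v|sph N. pair_term \<gamma> 1 2 g v)" by (rule dirichlet_form_sym[OF g N])
    also have "(LINT v|sph N. pair_term \<gamma> 1 2 g v) = (LINT v|sph N. a\<^sup>2 * pair_term \<gamma> 1 2 f v)"
    proof (rule integral_cong_AE)
      show "AE v in sph N. pair_term \<gamma> 1 2 g v = a\<^sup>2 * pair_term \<gamma> 1 2 f v"
        unfolding g_def using N by (intro pair_term_affine fm fs) auto
      show "pair_term \<gamma> 1 2 g \<in> borel_measurable (sph N)" "(\<lambda>v. a\<^sup>2 * pair_term \<gamma> 1 2 f v) \<in> borel_measurable (sph N)"
        using N pair_term_measurable[of 1 N 2 g \<gamma>] pair_term_measurable[of 1 N 2 f \<gamma>] by (auto simp: meas_sph)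
    qed
    also have "real N * \<dots> = dirichlet_form \<gamma> N f / V"
      by (simp add: dirichlet_form_sym[OF f N] a2)
    finally show ?thesis using Vp by (simp add: field_simps V_def m_def)
  qed
qed

subsection \<open>Conditioning on the last coordinate\<close>

definition cnd :: "nat \<Rightarrow> ((nat \<Rightarrow> real) \<Rightarrow> real) \<Rightarrow> real \<Rightarrow> real" where
  "cnd n f x = (LINT w|sph n. f (glue n x w))"

definition wt :: "nat \<Rightarrow> real \<Rightarrow> real" where
  "wt n x = (real (Suc n) - x\<^sup>2) / real n"

lemma glue_init': "j \<in> {1..n} \<Longrightarrow> glue n x w j = sqrt (wt n x) * w j"
  by (simp add: glue_init wt_def)

lemma cnd_measurable:
  assumes [measurable]: "f \<in> borel_measurable (bor (Suc n))"
  shows "cnd n f \<in> borel_measurable borel"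
proof -
  interpret S: prob_space "sph n" by (rule prob_space_sph)
  show ?thesis unfolding cnd_def[abs_def]
    by (intro S.borel_measurable_lebesgue_integral) measurable
qed

lemma glue_rot:
  assumes "n \<ge> 2"
  shows "rot 1 2 \<theta> (glue n x w) = glue n x (rot 1 2 \<theta> w)"
proof
  fix k
  show "rot 1 2 \<theta> (glue n x w) k = glue n x (rot 1 2 \<theta> w) k"
    using assms by (auto simp: rot_def glue_def algebra_simps)
qed

text \<open>Gluing commutes with rotations of the first two coordinates, and it multiplies the
  squares of these coordinates by \<open>wt n x\<close>, in which the weight is homogeneous.\<close>

lemma pair_term_glue:
  assumes n: "n \<ge> 2" and x: "x\<^sup>2 \<le> real (Suc n)"
  shows "pair_term \<gamma> 1 2 f (glue n x w) = wt n x powr \<gamma> * pair_term \<gamma> 1 2 (\<lambda>w. f (glue n x w)) w"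
proof -
  have a: "wt n x \<ge> 0" using x by (simp add: wt_def)
  have "(glue n x w 1)\<^sup>2 + (glue n x w 2)\<^sup>2 = wt n x * ((w 1)\<^sup>2 + (w 2)\<^sup>2)"
    using n a by (simp add: glue_init' power_mult_distrib distrib_left)
  then have "((glue n x w 1)\<^sup>2 + (glue n x w 2)\<^sup>2) powr \<gamma> = wt n x powr \<gamma> * ((w 1)\<^sup>2 + (w 2)\<^sup>2) powr \<gamma>"
    using a by (simp add: powr_mult)
  then show ?thesis
    by (simp add: pair_term_def rot_avg_eq glue_rot[OF n] mult.assoc)
qed

lemma adm_glue:
  assumes f: "adm (Suc n) f" and n: "n \<ge> 1"
  shows "AE x in mrg n. adm n (\<lambda>w. f (glue n x w))"
proof -
  have fm [measurable]: "f \<in> borel_measurable (bor (Suc n))" using f by (simp add: adm_def)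
  have m: "(\<lambda>w. f (glue n x w)) \<in> borel_measurable (bor n)" for x
    by (rule measurable_compose[OF glue_meas1 fm])
  have "AE x in mrg n. integrable (sph n) (\<lambda>w. (f (glue n x w))\<^sup>2)"
    using f n by (intro sph_disintegrate(1)) (auto simp: adm_def sqi_def)
  \<comment> \<open>There are finitely many permutations, so a common null set of slices can be
    discarded.\<close>
  moreover have "AE x in mrg n. \<forall>\<pi>\<in>{\<pi>. \<pi> permutes {1..n}}. AE w in sph n. f (glue n x (w \<circ> \<pi>)) = f (glue n x w)"
  proof (rule AE_finite_allI)
    show "finite {\<pi>. \<pi> permutes {1..n}}" by (rule finite_permutations) simp
    fix \<pi> assume "\<pi> \<in> {\<pi>. \<pi> permutes {1..n}}"
    then have p: "\<pi> permutes {1..n}" by simp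
    then have p': "\<pi> permutes {1..Suc n}" by (rule permutes_subset) auto
    have [measurable]: "(\<lambda>v. v \<circ> \<pi>) \<in> measurable (bor (Suc n)) (bor (Suc n))" by (rule perm_measurable[OF p'])
    have "AE v in sph (Suc n). f (v \<circ> \<pi>) = f v" using f p' by (simp add: adm_def)
    then have "AE x in mrg n. AE w in sph n. f (glue n x w \<circ> \<pi>) = f (glue n x w)"
      by (intro AE_sph_Suc n pred_eq_real) measurable
    moreover have "glue n x w \<circ> \<pi> = glue n x (w \<circ> \<pi>)" for x w
    proof
      fix k
      show "(glue n x w \<circ> \<pi>) k = glue n x (w \<circ> \<pi>) k"
      proof (cases "k \<in> {1..n}")
        case True
        then have "\<pi> k \<in> {1..n}" using permutes_in_image[OF p] by simp
        then show ?thesis using True by (simp add: glue_init)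
      next
        case False
        then have "\<pi> k = k" using permutes_not_in[OF p] by simp
        then show ?thesis using False by (auto simp: glue_def)
      qed
    qed
    ultimately show "AE x in mrg n. AE w in sph n. f (glue n x (w \<circ> \<pi>)) = f (glue n x w)" by simp
  qed
  ultimately show ?thesis
    by eventually_elim (auto simp: adm_def sqi_def m meas_sph)
qed

lemma cnd_sqi:
  assumes [measurable]: "f \<in> borel_measurable (bor (Suc n))" and f: "sqi (sph (Suc n)) f" and n: "n \<ge> 1"
  shows "sqi (mrg n) (cnd n f)" "AE x in mrg n. (cnd n f x)\<^sup>2 \<le> (LINT w|sph n. (f (glue n x w))\<^sup>2)"
proof -
  interpret S: prob_space "sph n" by (rule prob_space_sph)
  have f2: "integrable (sph (Suc n)) (\<lambda>v. (f v)\<^sup>2)" "(\<lambda>v. (f v)\<^sup>2) \<in> borel_measurable (bor (Suc n))"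
    using f by (auto simp: sqi_def)
  note d = sph_disintegrate[OF n f2(2,1)]
  have m: "(\<lambda>w. f (glue n x w)) \<in> borel_measurable (sph n)" for x
    using measurable_compose[OF glue_meas1 assms(1)] by (simp add: meas_sph)
  show b: "AE x in mrg n. (cnd n f x)\<^sup>2 \<le> (LINT w|sph n. (f (glue n x w))\<^sup>2)"
    using d(1) by eventually_elim (auto simp: cnd_def sqi_def m intro!: S.expectation_sq_le)
  have c: "cnd n f \<in> borel_measurable (mrg n)" using cnd_measurable[OF assms(1)] by (simp add: meas_mrg)
  show "sqi (mrg n) (cnd n f)"
    unfolding sqi_def
  proof
    show "integrable (mrg n) (\<lambda>x. (cnd n f x)\<^sup>2)"
    proof (rule Bochner_Integration.integrable_bound[OF d(2)])
      show "AE x in mrg n. norm ((cnd n f x)\<^sup>2) \<le> norm (LINT w|sph n. (f (glue n x w))\<^sup>2)"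
        using b by eventually_elim simp
    qed (use c in measurable)
  qed (rule c)
qed

lemma cnd_eq:
  assumes f: "f \<in> borel_measurable (bor (Suc n))" "sqi (sph (Suc n)) f" and n: "n \<ge> 1" and g: "sqi (mrg n) g"
  shows "(LINT v|sph (Suc n). g (v (Suc n)) * f v) = (LINT x|mrg n. g x * cnd n f x)"
proof -
  have [measurable]: "g \<in> borel_measurable borel" using g by (auto simp: sqi_def meas_mrg)
  note [measurable] = f(1)
  have "(LINT v|sph (Suc n). g (v (Suc n)) * f v) = (LINT x|mrg n. (LINT w|sph n. (\<lambda>v. g (v (Suc n)) * f v) (glue n x w)))"
    by (intro sph_disintegrate(3) n sqi_mult_integrable f(2) sqi_coord(1)[OF g]) auto
  then show ?thesis by (simp add: cnd_def)
qed

lemma wt_bounds: "n \<ge> 1 \<Longrightarrow> x\<^sup>2 \<le> real (Suc n) \<Longrightarrow> 0 \<le> wt n x \<and> wt n x \<le> real (Suc n) / real n"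
  by (auto simp: wt_def intro!: divide_right_mono)

lemma wt_powr_bound:
  assumes "n \<ge> 1" "x\<^sup>2 \<le> real (Suc n)" "\<gamma> \<ge> 0"
  shows "\<bar>wt n x powr \<gamma>\<bar> \<le> (real (Suc n) / real n) powr \<gamma>"
  using wt_bounds[OF assms(1,2)] assms(3) by (auto intro!: powr_mono2)

lemma wt_measurable [measurable]: "wt n \<in> borel_measurable borel"
  unfolding wt_def[abs_def] by measurable

lemma sqi_last_mult:
  assumes f: "sqi (sph (Suc n)) f" and [measurable]: "g \<in> borel_measurable borel"
    and b: "\<And>x. x\<^sup>2 \<le> real (Suc n) \<Longrightarrow> \<bar>g x\<bar> \<le> B"
  shows "sqi (sph (Suc n)) (\<lambda>v. g (v (Suc n)) * f v)"
proof (rule sqi_bounded_mult[OF f])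
  show "(\<lambda>v. g (v (Suc n))) \<in> borel_measurable (sph (Suc n))" by (simp add: meas_sph)
  have N: "Suc n \<ge> 1" "Suc n \<in> {1..Suc n}" by auto
  show "AE v in sph (Suc n). \<bar>g (v (Suc n))\<bar> \<le> B"
    using AE_sph_kac[OF N(1)] by eventually_elim (intro b kac_coord_le(1) N(2))
qed

text \<open>By symmetry the form is N times the term of the pair (1, 2), and on a slice that term is
  1/n times the n-dimensional form of the slice function, up to the factor from the weight. The gap
  in dimension n bounds this below by the conditional variance; N / n is the quotient of the two
  prefactors.\<close>

lemma dirichlet_form_conditional:
  assumes f: "adm (Suc n) f" and n: "n \<ge> 2" and \<gamma>: "\<gamma> \<ge> 0"
  shows "dirichlet_form \<gamma> (Suc n) f \<ge> real (Suc n) / real n * spectral_gap \<gamma> n *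
    (LINT v|sph (Suc n). wt n (v (Suc n)) powr \<gamma> * (f v - cnd n f (v (Suc n)))\<^sup>2)"
proof -
  interpret S: prob_space "sph n" by (rule prob_space_sph)
  have n1: "n \<ge> 1" and N2: "Suc n \<ge> 2" using n by auto
  have ij: "1 \<in> {1..Suc n}" "2 \<in> {1..Suc n}" "1 \<noteq> (2::nat)" using n by auto
  have fm [measurable]: "f \<in> borel_measurable (bor (Suc n))" and fs: "sqi (sph (Suc n)) f" using f by (auto simp: adm_def)
  note [measurable] = cnd_measurable[OF fm]
  let ?P = "pair_term \<gamma> 1 2"
  note dP = sph_disintegrate[OF n1 pair_term_measurable[OF ij fm, of \<gamma>] pair_term_integrable[OF ij fm fs \<gamma>]]
  have cs: "sqi (sph (Suc n)) (\<lambda>v. cnd n f (v (Suc n)))"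
    by (intro sqi_coord(1) cnd_sqi(1) fm fs n1) simp
  let ?G = "\<lambda>v. wt n (v (Suc n)) powr \<gamma> * (f v - cnd n f (v (Suc n)))\<^sup>2"
  have Gm: "?G \<in> borel_measurable (bor (Suc n))" by measurable
  have Gi: "integrable (sph (Suc n)) ?G"
  proof -
    have d: "sqi (sph (Suc n)) (\<lambda>v. f v - cnd n f (v (Suc n)))" by (intro sqi_diff fs cs)
    have "sqi (sph (Suc n)) (\<lambda>v. wt n (v (Suc n)) powr \<gamma> * (f v - cnd n f (v (Suc n))))"
      by (rule sqi_last_mult[OF d]) (use wt_powr_bound[OF n1 _ \<gamma>] in auto)
    from sqi_mult_integrable[OF this d] show ?thesis by (simp add: power2_eq_square mult.assoc)
  qed
  note dG = sph_disintegrate[OF n1 Gm Gi]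
  have "AE x in mrg n. spectral_gap \<gamma> n / real n * (LINT w|sph n. ?G (glue n x w)) \<le> (LINT w|sph n. ?P f (glue n x w))"
    using adm_glue[OF f n1] AE_mrg_le[of n]
  proof eventually_elim
    case (elim x)
    let ?f = "\<lambda>w. f (glue n x w)"
    have "sqi (sph n) ?f" using elim(1) unfolding adm_def by blast
    then have fi: "integrable (sph n) ?f" "integrable (sph n) (\<lambda>w. (?f w)\<^sup>2)"
      by (auto intro: S.sqi_integrable sqiD)
    have "(?f w - cnd n f x)\<^sup>2 = (?f w)\<^sup>2 - 2 * cnd n f x * ?f w + (cnd n f x)\<^sup>2" for w
      by (simp add: power2_diff)
    then have "(LINT w|sph n. ?G (glue n x w)) = wt n x powr \<gamma> * (LINT w|sph n. (?f w)\<^sup>2 - 2 * cnd n f x * ?f w + (cnd n f x)\<^sup>2)"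
      by simp
    also have "(LINT w|sph n. (?f w)\<^sup>2 - 2 * cnd n f x * ?f w + (cnd n f x)\<^sup>2) = (LINT w|sph n. (?f w)\<^sup>2) - 2 * cnd n f x * cnd n f x + (cnd n f x)\<^sup>2"
      using fi by (simp add: S.prob_space cnd_def)
    finally have G: "(LINT w|sph n. ?G (glue n x w)) = wt n x powr \<gamma> * ((LINT w|sph n. (?f w)\<^sup>2) - (LINT w|sph n. ?f w)\<^sup>2)"
      by (simp add: cnd_def power2_eq_square)
    have "spectral_gap \<gamma> n * ((LINT w|sph n. (?f w)\<^sup>2) - (LINT w|sph n. ?f w)\<^sup>2) \<le> real n * (LINT w|sph n. ?P ?f w)"
      using spectral_gap_variance[OF elim(1) n \<gamma>] dirichlet_form_sym[OF elim(1) n] by simp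
    then have "spectral_gap \<gamma> n / real n * ((LINT w|sph n. (?f w)\<^sup>2) - (LINT w|sph n. ?f w)\<^sup>2) \<le> (LINT w|sph n. ?P ?f w)"
      using n by (simp add: field_simps)
    then have "wt n x powr \<gamma> * (spectral_gap \<gamma> n / real n * ((LINT w|sph n. (?f w)\<^sup>2) - (LINT w|sph n. ?f w)\<^sup>2)) \<le> wt n x powr \<gamma> * (LINT w|sph n. ?P ?f w)"
      by (intro mult_left_mono) auto
    also have "\<dots> = (LINT w|sph n. ?P f (glue n x w))"
      by (simp add: pair_term_glue[OF n elim(2)])
    finally show ?case unfolding G by (simp add: mult_ac)
  qed
  then have "(LINT x|mrg n. spectral_gap \<gamma> n / real n * (LINT w|sph n. ?G (glue n x w))) \<le> (LINT x|mrg n. (LINT w|sph n. ?P f (glue n x w)))"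
    using dG(2) dP(2) by (intro integral_mono_AE) auto
  then have "spectral_gap \<gamma> n / real n * (LINT v|sph (Suc n). ?G v) \<le> (LINT v|sph (Suc n). ?P f v)"
    unfolding dG(3) dP(3) by simp
  then have "real (Suc n) * (spectral_gap \<gamma> n / real n * (LINT v|sph (Suc n). ?G v)) \<le> real (Suc n) * (LINT v|sph (Suc n). ?P f v)"
    by (intro mult_left_mono) auto
  then show ?thesis
    unfolding dirichlet_form_sym[OF f N2] by (simp only: times_divide_eq_left times_divide_eq_right mult.assoc)
qed

subsection \<open>The conditional variance inequality\<close>

text \<open>Makes the last coordinate representative of all of them: N times an integral weighted by
  the last coordinate becomes an integral weighted by a symmetric sum over all coordinates.\<close>

lemma exchange:
  fixes F :: "nat \<Rightarrow> (nat \<Rightarrow> real) \<Rightarrow> real"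
  assumes F: "\<And>k. k \<in> {1..N} \<Longrightarrow> F k \<in> borel_measurable (bor N)"
    and sym: "\<And>\<pi>. \<pi> permutes {1..N} \<Longrightarrow> (AE v in sph N. F N (v \<circ> \<pi>) = F (\<pi> N) v)"
    and k: "k \<in> {1..N}"
  shows "(LINT v|sph N. F k v) = (LINT v|sph N. F N v)"
proof -
  have N: "N \<in> {1..N}" using k by auto
  obtain \<pi> where p: "\<pi> permutes {1..N}" "\<pi> N = k" using exists_perm1[OF N k] by blast
  have "(LINT v|sph N. F N v) = (LINT v|sph N. F N (v \<circ> \<pi>))"
    by (rule integral_sph_perm(1)[OF p(1) F[OF N], symmetric])
  also have "\<dots> = (LINT v|sph N. F k v)"
    using sym[OF p(1)] p(2) measurable_compose[OF perm_measurable[OF p(1)] F[OF N]] F[OF k]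
    by (intro integral_cong_AE) (auto simp: meas_sph)
  finally show ?thesis ..
qed

lemma sqi_mrg_iff:
  assumes [measurable]: "g \<in> borel_measurable borel" and k: "k \<in> {1..Suc p}"
  shows "sqi (sph (Suc p)) (\<lambda>w. g (w k)) \<longleftrightarrow> sqi (mrg p) g"
proof
  assume "sqi (sph (Suc p)) (\<lambda>w. g (w k))"
  then have "integrable (sph (Suc p)) (\<lambda>w. (g (w k))\<^sup>2)" by (rule sqiD)
  then have "integrable (mrg p) (\<lambda>x. (g x)\<^sup>2)"
    using integral_sph_coord1(2)[OF k, of "Suc p" "\<lambda>x. (g x)\<^sup>2"] integral_mrg(2)[of "\<lambda>x. (g x)\<^sup>2" p] by simp
  then show "sqi (mrg p) g" by (simp add: sqi_def meas_mrg)
qed (rule sqi_coord(1)[OF _ k])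

text \<open>The version for functions with a mean. On a slice, \<phi> of a coordinate has a
  conditional mean that need not vanish.\<close>

lemma sum_coord_sq_le':
  assumes p: "p \<ge> 2" and g: "sqi (mrg p) g"
  shows "(LINT v|sph (Suc p). (\<Sum>k\<in>{1..Suc p}. g (v k))\<^sup>2)
    \<le> (real p + 1) * (1 + 3 / (real p + 2)) * (LINT x|mrg p. (g x)\<^sup>2) + (real p + 1)\<^sup>2 * (LINT x|mrg p. g x)\<^sup>2"
proof -
  interpret bounded_law "mrg p" "sqrt (real (Suc p))" by (rule bounded_law_mrg)
  interpret S: prob_space "sph (Suc p)" by (rule prob_space_sph)
  define m where "m = (LINT x|mrg p. g x)"
  define g' where "g' x = g x - m" for x
  have g': "sqi (mrg p) g'" unfolding g'_def[abs_def] by (intro sqi_diff g sqi_const)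
  have g'0: "(LINT x|mrg p. g' x) = 0"
    using sqi_integrable[OF g] by (simp add: g'_def m_def prob_space[simplified])
  have g'2: "(nr (mrg p) g')\<^sup>2 = (LINT x|mrg p. (g x)\<^sup>2) - m\<^sup>2"
  proof -
    have "(nr (mrg p) g')\<^sup>2 = (LINT x|mrg p. (g x)\<^sup>2 - 2 * m * g x + m\<^sup>2)"
      unfolding nr_sq g'_def by (intro Bochner_Integration.integral_cong refl) (simp add: power2_diff)
    also have "\<dots> = (LINT x|mrg p. (g x)\<^sup>2) - m\<^sup>2"
      using sqi_integrable[OF g] sqiD(2)[OF g] by (simp add: prob_space[simplified] flip: m_def) (simp add: power2_eq_square)
    finally show ?thesis .
  qed
  define T where "T v = (\<Sum>k\<in>{1..Suc p}. g' (v k))" for v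
  have T: "sqi (sph (Suc p)) T" unfolding T_def[abs_def] by (intro sqi_sum sqi_coord(1)[OF g'])
  have T0: "(LINT v|sph (Suc p). T v) = 0"
    unfolding T_def
    by (subst Bochner_Integration.integral_sum) (auto simp: sqi_coord(3)[OF g'] g'0 intro!: S.sqi_integrable sqi_coord(1)[OF g'])
  have "(\<Sum>k\<in>{1..Suc p}. g (v k)) = T v + (real p + 1) * m" for v
    by (simp only: T_def g'_def sum_subtractf sum_constant card_atLeastAtMost) (simp add: add.commute)
  then have "(\<Sum>k\<in>{1..Suc p}. g (v k))\<^sup>2 = (T v)\<^sup>2 + 2 * ((real p + 1) * m) * T v + ((real p + 1) * m)\<^sup>2" for v
    by (simp only: power2_sum mult_ac add_ac)
  then have "(LINT v|sph (Suc p). (\<Sum>k\<in>{1..Suc p}. g (v k))\<^sup>2) = (LINT v|sph (Suc p). (T v)\<^sup>2 + 2 * ((real p + 1) * m) * T v + ((real p + 1) * m)\<^sup>2)"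
    by (simp only:)
  also have "\<dots> = (LINT v|sph (Suc p). (T v)\<^sup>2) + ((real p + 1) * m)\<^sup>2"
    using sqiD(2)[OF T] S.sqi_integrable[OF T] by (simp add: T0 S.prob_space)
  also have "(LINT v|sph (Suc p). (T v)\<^sup>2) \<le> (real p + 1) * (1 + 3 / (real p + 2)) * (nr (mrg p) g')\<^sup>2"
    unfolding T_def by (rule sum_coord_sq_le[OF p g' g'0])
  also have "\<dots> \<le> (real p + 1) * (1 + 3 / (real p + 2)) * (LINT x|mrg p. (g x)\<^sup>2)"
    by (intro mult_left_mono) (auto simp: g'2)
  finally show ?thesis by (simp add: m_def power_mult_distrib)
qed

text \<open>Write y^\<gamma> as y exp(-(1 - \<gamma>) ln y) and use exp z >= 1 + z and ln y <= y -
  1. The resulting y (1 - (1 - \<gamma>) (y - 1)) is exactly the right-hand side. At y = 0 both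
  sides are 0.\<close>

lemma powr_ge_quadratic:
  fixes y :: real
  assumes y: "y \<ge> 0" and \<gamma>: "0 \<le> \<gamma>" "\<gamma> \<le> 1"
  shows "y powr \<gamma> \<ge> 1 + \<gamma> * (y - 1) - (1 - \<gamma>) * (y - 1)\<^sup>2"
proof (cases "y = 0")
  case False
  then have yp: "y > 0" using y by simp
  have "1 - (1 - \<gamma>) * (y - 1) \<le> 1 - (1 - \<gamma>) * ln y"
    using ln_le_minus_one[OF yp] \<gamma> by (intro diff_left_mono mult_left_mono) auto
  also have "\<dots> \<le> exp (- (1 - \<gamma>) * ln y)"
    using exp_ge_add_one_self[of "- (1 - \<gamma>) * ln y"] by (simp add: algebra_simps)
  finally have "y * (1 - (1 - \<gamma>) * (y - 1)) \<le> y * exp (- (1 - \<gamma>) * ln y)"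
    using yp by (intro mult_left_mono) auto
  also have "\<dots> = y powr 1 * y powr (- (1 - \<gamma>))" using yp by (simp add: powr_def)
  also have "\<dots> = y powr \<gamma>" by (subst powr_add[symmetric]) simp
  finally show ?thesis by (simp add: power2_eq_square algebra_simps)
qed (use \<gamma> in simp)

section \<open>A symmetric function of mean zero and its one-coordinate part\<close>

locale mean_zero =
  fixes n :: nat and f :: "(nat \<Rightarrow> real) \<Rightarrow> real"
  assumes n: "n \<ge> 2" and f: "adm (Suc n) f" and f_mean: "(LINT v|sph (Suc n). f v) = 0"
begin

sublocale S: prob_space "sph (Suc n)" by (rule prob_space_sph)
sublocale W: prob_space "sph n" by (rule prob_space_sph)
sublocale mrg: bounded_law "mrg n" "sqrt (real (Suc n))" by (rule bounded_law_mrg)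

definition \<phi> :: "real \<Rightarrow> real" where "\<phi> = cnd n f"
definition s :: "(nat \<Rightarrow> real) \<Rightarrow> real" where "s v = (\<Sum>k\<in>{1..Suc n}. \<phi> (v k))"
definition h :: "(nat \<Rightarrow> real) \<Rightarrow> real" where "h v = f v - s v"
text \<open>By \<open>fs_eq\<close> this is the inner product of f and s, that is, the part of F
  explained by single coordinates up to relative order 1/N.\<close>

definition t :: real where "t = real (Suc n) * (nr (mrg n) \<phi>)\<^sup>2"
definition F :: real where "F = (LINT v|sph (Suc n). (f v)\<^sup>2)"

lemma n1: "n \<ge> 1" using n by simp
lemma last_in: "Suc n \<in> {1..Suc n}" "1 \<in> {1..Suc n}" "1 \<noteq> Suc n" "1 \<in> {1..n}" using n by auto

lemma fm [measurable]: "f \<in> borel_measurable (bor (Suc n))" and fs: "sqi (sph (Suc n)) f"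
  using f by (auto simp: adm_def)

lemma f_sym: "\<pi> permutes {1..Suc n} \<Longrightarrow> AE v in sph (Suc n). f (v \<circ> \<pi>) = f v"
  using f by (auto simp: adm_def)

lemma \<phi>m [measurable]: "\<phi> \<in> borel_measurable borel"
  unfolding \<phi>_def by (rule cnd_measurable) measurable

lemma \<phi>s: "sqi (mrg n) \<phi>"
  unfolding \<phi>_def by (rule cnd_sqi(1)[OF fm fs n1])

lemma cm [measurable]: "k \<in> {1..Suc n} \<Longrightarrow> (\<lambda>v. v k) \<in> borel_measurable (bor (Suc n))"
  by (rule coord_measurable)

lemma \<phi>k: "k \<in> {1..Suc n} \<Longrightarrow> sqi (sph (Suc n)) (\<lambda>v. \<phi> (v k))"
  by (rule sqi_coord(1)[OF \<phi>s])

lemma sm [measurable]: "s \<in> borel_measurable (bor (Suc n))"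
  unfolding s_def by (intro borel_measurable_sum measurable_compose[OF cm \<phi>m]) 

lemma ss: "sqi (sph (Suc n)) s"
  unfolding s_def[abs_def] by (intro sqi_sum \<phi>k)

lemma hm [measurable]: "h \<in> borel_measurable (bor (Suc n))"
  unfolding h_def[abs_def] by measurable

lemma hs: "sqi (sph (Suc n)) h"
  unfolding h_def[abs_def] by (intro sqi_diff fs ss)

lemma s_sym: "\<pi> permutes {1..Suc n} \<Longrightarrow> s (v \<circ> \<pi>) = s v"
  using sum.permute[of \<pi> "{1..Suc n}" "\<lambda>k. \<phi> (v k)"] by (simp add: s_def comp_def)

lemma h_sym: "\<pi> permutes {1..Suc n} \<Longrightarrow> AE v in sph (Suc n). h (v \<circ> \<pi>) = h v"
  using f_sym[of \<pi>] by (auto simp: h_def s_sym elim!: eventually_mono)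

text \<open>By symmetry \<phi> is the conditional expectation of f on every coordinate, not just on
  the last one.\<close>

lemma f_coord:
  assumes g: "sqi (mrg n) g" and k: "k \<in> {1..Suc n}"
  shows "(LINT v|sph (Suc n). g (v k) * f v) = (LINT x|mrg n. g x * \<phi> x)"
proof -
  have [measurable]: "g \<in> borel_measurable borel" using g by (auto simp: sqi_def meas_mrg)
  have "(LINT v|sph (Suc n). g (v k) * f v) = (LINT v|sph (Suc n). g (v (Suc n)) * f v)"
  proof (rule exchange[where F="\<lambda>k v. g (v k) * f v", OF _ _ k])
    show "AE v in sph (Suc n). g ((v \<circ> \<pi>) (Suc n)) * f (v \<circ> \<pi>) = g (v (\<pi> (Suc n))) * f v" if "\<pi> permutes {1..Suc n}" for \<pi>
      using f_sym[OF that] by eventually_elim simp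
  qed measurable
  also have "\<dots> = (LINT x|mrg n. g x * \<phi> x)"
    unfolding \<phi>_def by (rule cnd_eq[OF fm fs n1 g])
  finally show ?thesis .
qed

lemma sqi_x2: "sqi (mrg n) (\<lambda>x. x\<^sup>2)"
  by (intro mrg.sqi_continuous continuous_intros)

lemma \<phi>_mean: "(LINT x|mrg n. \<phi> x) = 0"
  using f_coord[OF mrg.sqi_const[of 1] last_in(1)] f_mean by simp

lemma kac_AE: "AE v in sph (Suc n). v \<in> kac_sphere (Suc n)"
  by (rule AE_sph_kac) simp

lemma sum_sq_AE: "AE v in sph (Suc n). (\<Sum>k\<in>{1..Suc n}. (v k)\<^sup>2) = real (Suc n)"
  using kac_AE by eventually_elim (simp only: kac_sphere_def mem_Collect_eq)

lemma \<phi>_x2: "(LINT x|mrg n. \<phi> x * x\<^sup>2) = 0"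
proof -
  have i: "integrable (sph (Suc n)) (\<lambda>v. (v k)\<^sup>2 * f v)" if "k \<in> {1..Suc n}" for k
    by (intro sqi_mult_integrable sqi_coord(1)[OF sqi_x2 that] fs)
  have "real (Suc n) * (LINT x|mrg n. x\<^sup>2 * \<phi> x) = (\<Sum>k\<in>{1..Suc n}. (LINT v|sph (Suc n). (v k)\<^sup>2 * f v))"
    by (simp only: f_coord[OF sqi_x2] cong: sum.cong) simp
  also have "\<dots> = (LINT v|sph (Suc n). (\<Sum>k\<in>{1..Suc n}. (v k)\<^sup>2 * f v))"
    by (rule Bochner_Integration.integral_sum[symmetric]) (rule i)
  also have "\<dots> = (LINT v|sph (Suc n). real (Suc n) * f v)"
  proof (rule integral_cong_AE)
    show "AE v in sph (Suc n). (\<Sum>k\<in>{1..Suc n}. (v k)\<^sup>2 * f v) = real (Suc n) * f v"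
      using sum_sq_AE by eventually_elim (simp only: sum_distrib_right[symmetric])
    show "(\<lambda>v. \<Sum>k\<in>{1..Suc n}. (v k)\<^sup>2 * f v) \<in> borel_measurable (sph (Suc n))"
      by (intro borel_measurable_sum borel_measurable_integrable i)
  qed (simp add: meas_sph)
  also have "\<dots> = 0" by (simp add: f_mean)
  finally show ?thesis by (simp add: mult.commute)
qed

lemma fs_eq: "(LINT v|sph (Suc n). f v * s v) = t"
proof -
  have "(LINT v|sph (Suc n). f v * s v) = (LINT v|sph (Suc n). (\<Sum>k\<in>{1..Suc n}. \<phi> (v k) * f v))"
    by (simp only: s_def sum_distrib_left mult.commute)
  also have "\<dots> = (\<Sum>k\<in>{1..Suc n}. (LINT v|sph (Suc n). \<phi> (v k) * f v))"
    by (intro Bochner_Integration.integral_sum sqi_mult_integrable \<phi>k fs)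
  also have "\<dots> = (\<Sum>k\<in>{1..Suc n}. (nr (mrg n) \<phi>)\<^sup>2)"
    by (intro sum.cong refl) (simp only: f_coord[OF \<phi>s] nr_sq, simp only: power2_eq_square)
  finally show ?thesis by (simp only: t_def sum_constant card_atLeastAtMost) simp
qed

lemma s_norm: "(nr (sph (Suc n)) s)\<^sup>2 \<le> (1 + 3 / (real n + 2)) * t"
proof -
  have "(nr (sph (Suc n)) s)\<^sup>2 = (LINT v|sph (Suc n). (\<Sum>k\<in>{1..Suc n}. \<phi> (v k))\<^sup>2)"
    by (simp only: nr_sq s_def)
  also have "\<dots> \<le> (real n + 1) * (1 + 3 / (real n + 2)) * (nr (mrg n) \<phi>)\<^sup>2"
    by (rule sum_coord_sq_le[OF n \<phi>s \<phi>_mean])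
  finally show ?thesis by (simp add: t_def mult_ac add.commute)
qed

lemma F_nr: "F = (nr (sph (Suc n)) f)\<^sup>2"
  by (simp add: F_def nr_sq)

lemma F_nonneg: "F \<ge> 0" by (simp add: F_nr)
lemma t_nonneg: "t \<ge> 0" by (simp add: t_def)

text \<open>Cauchy-Schwarz for t = <f, s> together with \<open>s_norm\<close>; one factor t
  cancels.\<close>

lemma t_le: "t \<le> (1 + 3 / (real n + 2)) * F"
proof (cases "t = 0")
  case False
  then have tp: "t > 0" using t_nonneg by simp
  have "t\<^sup>2 \<le> (nr (sph (Suc n)) f * nr (sph (Suc n)) s)\<^sup>2"
    using nr_cauchy_schwarz[OF fs ss] t_nonneg unfolding fs_eq by (intro power_mono) auto
  also have "\<dots> = F * (nr (sph (Suc n)) s)\<^sup>2" by (simp add: power_mult_distrib F_nr)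
  also have "\<dots> \<le> F * ((1 + 3 / (real n + 2)) * t)" by (intro mult_left_mono s_norm F_nonneg)
  finally have "t * t \<le> ((1 + 3 / (real n + 2)) * F) * t" by (simp add: power2_eq_square mult_ac)
  then show ?thesis using tp by simp
qed (use F_nonneg in simp)

text \<open>The squared norm of f - s is F - 2t plus that of s, and the latter is t up to the factor
  in \<open>s_norm\<close>. A large t, which hurts in \<open>linear_weight\<close>, thus forces h to
  be small.\<close>

lemma h_norm: "(nr (sph (Suc n)) h)\<^sup>2 \<le> F - t + 3 / (real n + 2) * t"
proof -
  have "(nr (sph (Suc n)) h)\<^sup>2 = (nr (sph (Suc n)) (\<lambda>v. f v + - s v))\<^sup>2" by (simp add: h_def[abs_def])
  also have "\<dots> = F - 2 * t + (nr (sph (Suc n)) s)\<^sup>2"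
    unfolding nr_add_sq[OF fs sqi_uminus[OF ss]] nr_uminus mult_minus_right Bochner_Integration.integral_minus fs_eq F_nr by simp
  also have "\<dots> \<le> F - 2 * t + (1 + 3 / (real n + 2)) * t" using s_norm by simp
  finally show ?thesis by (simp add: algebra_simps)
qed

lemma wt_cont: "continuous_on UNIV (wt n)"
  unfolding wt_def[abs_def] using n by (intro continuous_intros) auto

lemma wt_AE: "AE v in sph (Suc n). 0 \<le> wt n (v (Suc n)) \<and> wt n (v (Suc n)) \<le> real (Suc n) / real n"
  using kac_AE by eventually_elim (intro wt_bounds n1 kac_coord_le(1) last_in)

text \<open>Only a weight depending on the last coordinate is involved, so the cross terms collapse.\<close>

lemma weighted_variance:
  assumes g: "continuous_on UNIV g"
  shows "(LINT v|sph (Suc n). g (v (Suc n)) * (f v - \<phi> (v (Suc n)))\<^sup>2)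
     = (LINT v|sph (Suc n). g (v (Suc n)) * (f v)\<^sup>2) - (LINT x|mrg n. g x * (\<phi> x)\<^sup>2)"
    and "integrable (sph (Suc n)) (\<lambda>v. g (v (Suc n)) * (f v)\<^sup>2)"
    and "integrable (mrg n) (\<lambda>x. g x * (\<phi> x)\<^sup>2)"
    and "integrable (sph (Suc n)) (\<lambda>v. g (v (Suc n)) * (f v - \<phi> (v (Suc n)))\<^sup>2)"
proof -
  have gm [measurable]: "g \<in> borel_measurable borel" by (rule borel_measurable_continuous_onI[OF g])
  have "compact (g ` {-sqrt (real (Suc n))..sqrt (real (Suc n))})"
    using g by (intro compact_continuous_image) (auto intro: continuous_on_subset)
  then obtain B where "\<forall>y\<in>g ` {-sqrt (real (Suc n))..sqrt (real (Suc n))}. norm y \<le> B"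
    using compact_imp_bounded bounded_iff by metis
  then have B: "\<bar>g x\<bar> \<le> B" if "x\<^sup>2 \<le> real (Suc n)" for x
    using real_le_rsqrt[of x "real (Suc n)"] real_le_rsqrt[of "-x" "real (Suc n)"] that by auto
  have gf: "sqi (sph (Suc n)) (\<lambda>v. g (v (Suc n)) * f v)" by (rule sqi_last_mult[OF fs gm B])
  have g\<phi>: "sqi (mrg n) (\<lambda>x. g x * \<phi> x)"
  proof (rule sqi_bounded_mult[OF \<phi>s])
    show "AE x in mrg n. \<bar>g x\<bar> \<le> B" using AE_mrg_le[of n] by eventually_elim (rule B)
  qed (simp add: meas_mrg)
  have g\<phi>N: "sqi (sph (Suc n)) (\<lambda>v. g (v (Suc n)) * \<phi> (v (Suc n)))"
    using sqi_coord(1)[OF g\<phi> last_in(1)] .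
  have i1: "integrable (sph (Suc n)) (\<lambda>v. g (v (Suc n)) * (f v)\<^sup>2)"
    using sqi_mult_integrable[OF gf fs] by (simp add: power2_eq_square mult.assoc)
  have i2: "integrable (sph (Suc n)) (\<lambda>v. (g (v (Suc n)) * \<phi> (v (Suc n))) * f v)"
    by (rule sqi_mult_integrable[OF g\<phi>N fs])
  have i3: "integrable (sph (Suc n)) (\<lambda>v. g (v (Suc n)) * (\<phi> (v (Suc n)))\<^sup>2)"
    using sqi_mult_integrable[OF g\<phi>N \<phi>k[OF last_in(1)]] by (simp add: power2_eq_square mult.assoc)
  show "integrable (sph (Suc n)) (\<lambda>v. g (v (Suc n)) * (f v)\<^sup>2)" by (rule i1)
  show i4: "integrable (mrg n) (\<lambda>x. g x * (\<phi> x)\<^sup>2)"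
    using sqi_mult_integrable[OF g\<phi> \<phi>s] by (simp add: power2_eq_square mult.assoc)
  have eq: "g (v (Suc n)) * (f v - \<phi> (v (Suc n)))\<^sup>2 = g (v (Suc n)) * (f v)\<^sup>2
      - 2 * ((g (v (Suc n)) * \<phi> (v (Suc n))) * f v) + g (v (Suc n)) * (\<phi> (v (Suc n)))\<^sup>2" for v
    by (simp add: power2_diff algebra_simps)
  show "integrable (sph (Suc n)) (\<lambda>v. g (v (Suc n)) * (f v - \<phi> (v (Suc n)))\<^sup>2)"
    unfolding eq using i1 i2 i3 by (intro Bochner_Integration.integrable_add Bochner_Integration.integrable_diff integrable_mult_right)
  have "(LINT v|sph (Suc n). g (v (Suc n)) * (\<phi> (v (Suc n)))\<^sup>2) = (LINT x|mrg n. g x * (\<phi> x)\<^sup>2)"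
    by (rule integral_mrg(1)[symmetric]) measurable
  moreover have "(LINT v|sph (Suc n). (g (v (Suc n)) * \<phi> (v (Suc n))) * f v) = (LINT x|mrg n. g x * (\<phi> x)\<^sup>2)"
    using f_coord[OF g\<phi> last_in(1)] by (simp add: power2_eq_square mult.assoc)
  ultimately show "(LINT v|sph (Suc n). g (v (Suc n)) * (f v - \<phi> (v (Suc n)))\<^sup>2)
     = (LINT v|sph (Suc n). g (v (Suc n)) * (f v)\<^sup>2) - (LINT x|mrg n. g x * (\<phi> x)\<^sup>2)"
    unfolding eq using i1 i2 i3 by simp
qed

text \<open>Here \<open>g = 1 + \<gamma> (wt - 1)\<close>, whose sum over the coordinates is constant on the sphere.\<close>

lemma linear_weight:
  assumes \<gamma>: "0 \<le> \<gamma>" "\<gamma> \<le> 1"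
  shows "real (Suc n) * (LINT v|sph (Suc n). (1 + \<gamma> * (wt n (v (Suc n)) - 1)) * (f v - \<phi> (v (Suc n)))\<^sup>2)
     \<ge> real (Suc n) * F - (1 + \<gamma> / real n) * t"
proof -
  let ?g = "\<lambda>x. 1 + \<gamma> * (wt n x - 1)"
  have g: "continuous_on UNIV ?g" by (intro continuous_intros wt_cont)
  note wv = weighted_variance[OF g]
  have [measurable]: "k \<in> {1..Suc n} \<Longrightarrow> (\<lambda>v. ?g (v k) * (f v)\<^sup>2) \<in> borel_measurable (bor (Suc n))" for k
    by measurable
  have ex: "(LINT v|sph (Suc n). ?g (v k) * (f v)\<^sup>2) = (LINT v|sph (Suc n). ?g (v (Suc n)) * (f v)\<^sup>2)"
    "integrable (sph (Suc n)) (\<lambda>v. ?g (v k) * (f v)\<^sup>2)" if k: "k \<in> {1..Suc n}" for k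
  proof -
    show "(LINT v|sph (Suc n). ?g (v k) * (f v)\<^sup>2) = (LINT v|sph (Suc n). ?g (v (Suc n)) * (f v)\<^sup>2)"
    proof (rule exchange[where F="\<lambda>k v. ?g (v k) * (f v)\<^sup>2", OF _ _ k])
      show "AE v in sph (Suc n). ?g ((v \<circ> \<pi>) (Suc n)) * (f (v \<circ> \<pi>))\<^sup>2 = ?g (v (\<pi> (Suc n))) * (f v)\<^sup>2" if "\<pi> permutes {1..Suc n}" for \<pi>
        using f_sym[OF that] by eventually_elim simp
    qed measurable
    have "sqi (sph (Suc n)) (\<lambda>v. ?g (v k) * f v)"
    proof (rule sqi_bounded_mult[OF fs, where B="1 + \<gamma> * (real (Suc n) / real n + 1)"])
      show "(\<lambda>v. ?g (v k)) \<in> borel_measurable (sph (Suc n))" using k by (simp add: meas_sph)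
      show "AE v in sph (Suc n). \<bar>?g (v k)\<bar> \<le> 1 + \<gamma> * (real (Suc n) / real n + 1)"
        using kac_AE
      proof eventually_elim
        case (elim v)
        have "0 \<le> wt n (v k) \<and> wt n (v k) \<le> real (Suc n) / real n"
          by (intro wt_bounds n1 kac_coord_le(1)[OF elim k])
        then have "\<bar>\<gamma> * (wt n (v k) - 1)\<bar> \<le> \<gamma> * (real (Suc n) / real n + 1)"
          using \<gamma> by (subst abs_mult) (intro mult_mono, auto)
        then show ?case by linarith
      qed
    qed
    from sqi_mult_integrable[OF this fs] show "integrable (sph (Suc n)) (\<lambda>v. ?g (v k) * (f v)\<^sup>2)"
      by (simp add: power2_eq_square mult.assoc)
  qed
  have sum_g: "AE v in sph (Suc n). (\<Sum>k\<in>{1..Suc n}. ?g (v k)) = real (Suc n)"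
    using sum_sq_AE
  proof eventually_elim
    case (elim v)
    have "(\<Sum>k\<in>{1..Suc n}. wt n (v k) - 1) = (\<Sum>k\<in>{1..Suc n}. (1 - (v k)\<^sup>2) / real n)"
      using n by (intro sum.cong) (auto simp: wt_def field_simps)
    also have "\<dots> = ((\<Sum>k\<in>{1..Suc n}. 1) - (\<Sum>k\<in>{1..Suc n}. (v k)\<^sup>2)) / real n"
      by (simp only: sum_divide_distrib[symmetric] sum_subtractf)
    also have "\<dots> = 0" unfolding elim by simp
    finally have "(\<Sum>k\<in>{1..Suc n}. \<gamma> * (wt n (v k) - 1)) = 0" by (simp only: sum_distrib_left[symmetric] mult_zero_right)
    then show ?case by (simp only: sum.distrib) simp
  qed
  have "real (Suc n) * (LINT v|sph (Suc n). ?g (v (Suc n)) * (f v)\<^sup>2) = (\<Sum>k\<in>{1..Suc n}. (LINT v|sph (Suc n). ?g (v k) * (f v)\<^sup>2))"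
    by (simp only: ex(1) cong: sum.cong) simp
  also have "\<dots> = (LINT v|sph (Suc n). (\<Sum>k\<in>{1..Suc n}. ?g (v k) * (f v)\<^sup>2))"
    by (rule Bochner_Integration.integral_sum[symmetric]) (rule ex(2))
  also have "\<dots> = (LINT v|sph (Suc n). real (Suc n) * (f v)\<^sup>2)"
  proof (rule integral_cong_AE)
    show "AE v in sph (Suc n). (\<Sum>k\<in>{1..Suc n}. ?g (v k) * (f v)\<^sup>2) = real (Suc n) * (f v)\<^sup>2"
      using sum_g by eventually_elim (simp only: sum_distrib_right[symmetric])
    show "(\<lambda>v. \<Sum>k\<in>{1..Suc n}. ?g (v k) * (f v)\<^sup>2) \<in> borel_measurable (sph (Suc n))"
      by (intro borel_measurable_sum borel_measurable_integrable ex(2))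
  qed (simp add: meas_sph)
  also have "\<dots> = real (Suc n) * F" by (simp add: F_def)
  finally have 1: "real (Suc n) * (LINT v|sph (Suc n). ?g (v (Suc n)) * (f v)\<^sup>2) = real (Suc n) * F" .
  \<comment> \<open>The weight \<open>wt n x\<close> is at most 1 + 1/n, its value at x = 0; this is
    where \<gamma> / n comes from.\<close>
  have "(LINT x|mrg n. ?g x * (\<phi> x)\<^sup>2) \<le> (LINT x|mrg n. (1 + \<gamma> / real n) * (\<phi> x)\<^sup>2)"
  proof (rule integral_mono_AE[OF wv(3)])
    show "integrable (mrg n) (\<lambda>x. (1 + \<gamma> / real n) * (\<phi> x)\<^sup>2)" using sqiD(2)[OF \<phi>s] by simp
    show "AE x in mrg n. ?g x * (\<phi> x)\<^sup>2 \<le> (1 + \<gamma> / real n) * (\<phi> x)\<^sup>2"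
      using AE_mrg_le[of n]
    proof eventually_elim
      case (elim x)
      have "wt n x - 1 \<le> 1 / real n" using wt_bounds[OF n1 elim] n by (simp add: field_simps)
      then have "\<gamma> * (wt n x - 1) \<le> \<gamma> * (1 / real n)" using \<gamma> by (intro mult_left_mono) auto
      then show ?case by (intro mult_right_mono) auto
    qed
  qed
  also have "\<dots> = (1 + \<gamma> / real n) * (nr (mrg n) \<phi>)\<^sup>2" by (simp add: nr_sq)
  finally have "real (Suc n) * (LINT x|mrg n. ?g x * (\<phi> x)\<^sup>2) \<le> real (Suc n) * ((1 + \<gamma> / real n) * (nr (mrg n) \<phi>)\<^sup>2)"
    by (intro mult_left_mono) auto
  then have 2: "real (Suc n) * (LINT x|mrg n. ?g x * (\<phi> x)\<^sup>2) \<le> (1 + \<gamma> / real n) * t"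
    by (simp only: t_def mult.left_commute)
  show ?thesis unfolding wv(1) right_diff_distrib[of "real (Suc n)" "LINT v|sph (Suc n). ?g (v (Suc n)) * (f v)\<^sup>2"] 1 using 2 by linarith
qed

section \<open>The quadratic part of the weight\<close>

definition B :: "real \<Rightarrow> real" where "B x = (1 - x\<^sup>2)\<^sup>2 / (real n)\<^sup>2"
text \<open>As \<open>B\<close> is the square of \<open>wt n x - 1\<close>, this is the quadratic
  correction summed over all coordinates.\<close>

definition D :: "(nat \<Rightarrow> real) \<Rightarrow> real" where "D v = (\<Sum>k\<in>{1..Suc n}. B (v k))"
definition G :: "(nat \<Rightarrow> real) \<Rightarrow> real" where "G v = (\<Sum>k\<in>{1..n}. \<phi> (v k))"
definition \<kappa> :: "real \<Rightarrow> real" where "\<kappa> = cnd n (\<lambda>v. \<phi> (v 1))"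
text \<open>The mean of \<open>B (v 1)\<close> over the slice at x, computed from the second and
  fourth moments 1 and 3n/(n + 2) of a coordinate.\<close>

definition mB :: "real \<Rightarrow> real" where
  "mB x = (1 - 2 * wt n x + 3 * real n / (real n + 2) * (wt n x)\<^sup>2) / (real n)\<^sup>2"
text \<open>The deviation of the sum of \<open>B (v k)\<close> over k <= n from its mean on the
  slice. The sum of squares is constant there, so only fourth powers fluctuate.\<close>

definition Z :: "(nat \<Rightarrow> real) \<Rightarrow> real" where
  "Z v = ((\<Sum>k\<in>{1..n}. v k ^ 4) - 3 * (real n)\<^sup>2 / (real n + 2) * (wt n (v (Suc n)))\<^sup>2) / (real n)\<^sup>2"

lemma B_cont: "continuous_on UNIV B"
  unfolding B_def[abs_def] using n by (intro continuous_intros) auto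

lemma Bm [measurable]: "B \<in> borel_measurable borel"
  by (rule borel_measurable_continuous_onI[OF B_cont])

lemma B_nonneg: "B x \<ge> 0" by (simp add: B_def)

lemma B_le: "x\<^sup>2 \<le> real (Suc n) \<Longrightarrow> B x \<le> 1"
proof -
  assume "x\<^sup>2 \<le> real (Suc n)"
  moreover have "0 \<le> x\<^sup>2" "2 \<le> real n" using n by simp_all
  ultimately have "\<bar>1 - x\<^sup>2\<bar> \<le> real n" unfolding of_nat_Suc by (intro abs_leI) linarith+
  then have "(1 - x\<^sup>2)\<^sup>2 \<le> (real n)\<^sup>2" by (intro abs_le_square_iff[THEN iffD1]) simp
  then show ?thesis using n by (simp add: B_def divide_le_eq)
qed

lemma B_abs: "x\<^sup>2 \<le> real (Suc n) \<Longrightarrow> \<bar>B x\<bar> \<le> 1"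
  using B_le B_nonneg by simp

lemma Bk_sqi:
  assumes g: "sqi (sph (Suc n)) g" and k: "k \<in> {1..Suc n}"
  shows "sqi (sph (Suc n)) (\<lambda>v. B (v k) * g v)"
proof (rule sqi_bounded_mult[OF g])
  show "(\<lambda>v. B (v k)) \<in> borel_measurable (sph (Suc n))" using k by (simp add: meas_sph)
  show "AE v in sph (Suc n). \<bar>B (v k)\<bar> \<le> 1"
    using kac_AE by eventually_elim (intro B_abs kac_coord_le(1) k)
qed

lemma sum_last: "(\<Sum>k\<in>{1..Suc n}. a k) = (\<Sum>k\<in>{1..n}. a k) + (a (Suc n) :: real)"
  by simp

lemma s_G: "s v = G v + \<phi> (v (Suc n))"
  unfolding s_def G_def by (rule sum_last)

lemma Gs: "sqi (sph (Suc n)) G"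
  unfolding G_def[abs_def] by (intro sqi_sum \<phi>k) auto

lemma Gm [measurable]: "G \<in> borel_measurable (bor (Suc n))"
  using Gs by (simp add: sqi_def meas_sph)

lemma Dm [measurable]: "D \<in> borel_measurable (bor (Suc n))"
  unfolding D_def by (intro borel_measurable_sum measurable_compose[OF cm Bm])

lemma D_sym: "\<pi> permutes {1..Suc n} \<Longrightarrow> D (v \<circ> \<pi>) = D v"
  using sum.permute[of \<pi> "{1..Suc n}" "\<lambda>k. B (v k)"] by (simp add: D_def comp_def)

text \<open>By v_k^4 <= N v_k^2 the fourth powers are controlled by the constant sum of squares. A
  single \<open>B (v k)\<close> can already reach 1, yet the whole sum stays below N / n; this
  leading constant 1 is what the recursion requires.\<close>

lemma D_bounds: 
  assumes v: "v \<in> kac_sphere (Suc n)"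
  shows "0 \<le> D v" "D v \<le> real (Suc n) / real n"
proof -
  show "0 \<le> D v" unfolding D_def by (intro sum_nonneg B_nonneg)
  have sq: "(\<Sum>k\<in>{1..Suc n}. (v k)\<^sup>2) = real (Suc n)" using v by (simp only: kac_sphere_def mem_Collect_eq)
  have "D v = (\<Sum>k\<in>{1..Suc n}. 1 - 2 * (v k)\<^sup>2 + (v k)\<^sup>2 * (v k)\<^sup>2) / (real n)\<^sup>2"
    unfolding D_def B_def sum_divide_distrib by (intro sum.cong refl) (simp add: power2_eq_square algebra_simps)
  also have "\<dots> \<le> (\<Sum>k\<in>{1..Suc n}. 1 - 2 * (v k)\<^sup>2 + real (Suc n) * (v k)\<^sup>2) / (real n)\<^sup>2"
    by (intro divide_right_mono sum_mono add_left_mono mult_right_mono kac_coord_le(1)[OF v]) auto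
  also have "(\<Sum>k\<in>{1..Suc n}. 1 - 2 * (v k)\<^sup>2 + real (Suc n) * (v k)\<^sup>2) = real (Suc n) * real n"
    by (simp only: sum.distrib sum_subtractf sum_distrib_left[symmetric] sq sum_constant card_atLeastAtMost) (simp add: algebra_simps)
  also have "real (Suc n) * real n / (real n)\<^sup>2 = real (Suc n) / real n"
    using n by (simp add: power2_eq_square)
  finally show "D v \<le> real (Suc n) / real n" .
qed

lemma \<phi>1: "(\<lambda>v. \<phi> (v 1)) \<in> borel_measurable (bor (Suc n))" "sqi (sph (Suc n)) (\<lambda>v. \<phi> (v 1))"
  using \<phi>k[OF last_in(2)] by (auto simp: sqi_def meas_sph)

lemma \<kappa>s: "sqi (mrg n) \<kappa>"
  unfolding \<kappa>_def by (rule cnd_sqi(1)[OF \<phi>1 n1])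

lemma \<kappa>_eq: "sqi (mrg n) g \<Longrightarrow> (LINT x|mrg n. g x * \<kappa> x) = bil n \<phi> g"
  unfolding \<kappa>_def by (subst cnd_eq[OF \<phi>1 n1, symmetric]) (auto simp: bil_def mult.commute)

definition c :: real where "c = 3 / (real n * (real n + 2))"

lemma c_nonneg: "c \<ge> 0" by (simp add: c_def)

lemma bil_le_c: "sqi (mrg n) g \<Longrightarrow> \<bar>bil n \<phi> g\<bar> \<le> c * (nr (mrg n) \<phi> * nr (mrg n) g)"
  unfolding c_def by (rule bil_bound[OF n \<phi>s _ \<phi>_mean \<phi>_x2])

text \<open>Duality: the form tested against \<kappa> itself is the squared norm of \<kappa>, and
  \<open>bil_le_c\<close> applies.\<close>

lemma \<kappa>_le: "(LINT x|mrg n. (\<kappa> x)\<^sup>2) \<le> c\<^sup>2 * (nr (mrg n) \<phi>)\<^sup>2"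
proof -
  have "nr (mrg n) \<kappa> \<le> c * nr (mrg n) \<phi>"
  proof (cases "nr (mrg n) \<kappa> = 0")
    case False
    then have p: "nr (mrg n) \<kappa> > 0" using nr_nonneg[of "mrg n" \<kappa>] by linarith
    have "nr (mrg n) \<kappa> * nr (mrg n) \<kappa> = bil n \<phi> \<kappa>"
      using \<kappa>_eq[OF \<kappa>s] nr_sq[of "mrg n" \<kappa>] by (simp add: power2_eq_square)
    also have "\<dots> \<le> c * nr (mrg n) \<phi> * nr (mrg n) \<kappa>"
      using bil_le_c[OF \<kappa>s] by (simp add: mult.assoc)
    finally show ?thesis using p by simp
  qed (simp add: c_nonneg)
  then have "(nr (mrg n) \<kappa>)\<^sup>2 \<le> (c * nr (mrg n) \<phi>)\<^sup>2" by (intro power_mono) auto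
  then show ?thesis by (simp add: nr_sq power_mult_distrib)
qed

text \<open>Below, 3n/(n + 2) >= 1 leaves a perfect square. Above, one factor of the squared term is
  replaced by its maximum (n + 1)/n, and the resulting increasing affine function is evaluated at
  that maximum.\<close>

lemma mB_bounds:
  assumes "x\<^sup>2 \<le> real (Suc n)"
  shows "0 \<le> mB x" "mB x \<le> 2 / (real n)\<^sup>2"
proof -
  let ?y = "wt n x"
  have y: "0 \<le> ?y" "?y \<le> (real n + 1) / real n" using wt_bounds[OF n1 assms] by (auto simp: add.commute)
  have a: "1 \<le> 3 * real n / (real n + 2)" using n by (simp add: field_simps)
  have "0 \<le> (1 - ?y)\<^sup>2" by simp
  also have "\<dots> \<le> 1 - 2 * ?y + 3 * real n / (real n + 2) * ?y\<^sup>2"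
    using mult_right_mono[OF a, of "?y\<^sup>2"] by (simp add: power2_diff)
  finally show "0 \<le> mB x" by (simp add: mB_def)
  have "?y * ?y \<le> ?y * ((real n + 1) / real n)" by (intro mult_left_mono y)
  then have "3 * real n / (real n + 2) * ?y\<^sup>2 \<le> 3 * real n / (real n + 2) * (?y * ((real n + 1) / real n))"
    by (intro mult_left_mono) (auto simp: power2_eq_square)
  also have "\<dots> = 3 * (real n + 1) / (real n + 2) * ?y" using n by simp
  finally have "1 - 2 * ?y + 3 * real n / (real n + 2) * ?y\<^sup>2 \<le> 1 + (3 * (real n + 1) / (real n + 2) - 2) * ?y"
    by (simp add: algebra_simps)
  also have "\<dots> \<le> 1 + (3 * (real n + 1) / (real n + 2) - 2) * ((real n + 1) / real n)"
    using n y by (intro add_left_mono mult_left_mono) (auto simp: field_simps)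
  also have "\<dots> \<le> 2" using n by (simp add: divide_simps) (simp add: algebra_simps)
  finally show "mB x \<le> 2 / (real n)\<^sup>2" by (simp add: mB_def divide_right_mono)
qed

lemma B_mean: 
  assumes "x\<^sup>2 \<le> real (Suc n)"
  shows "(LINT w|sph n. B (glue n x w 1)) = mB x"
proof -
  have y: "wt n x \<ge> 0" using wt_bounds[OF n1 assms] by simp
  have w: "1 \<in> {1..n}" "2 \<in> {1..n}" "1 \<noteq> (2::nat)" using n by auto
  have sq4: "sqrt (wt n x) ^ 4 = (wt n x)\<^sup>2" using y by (simp add: power4_eq_xxxx power2_eq_square mult.assoc)
  have "B (glue n x w 1) = (1 - 2 * wt n x * (w 1)\<^sup>2 + (wt n x)\<^sup>2 * w 1 ^ 4) / (real n)\<^sup>2" for w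
  proof -
    have "B (sqrt (wt n x) * w 1) = (1 - wt n x * (w 1)\<^sup>2)\<^sup>2 / (real n)\<^sup>2"
      using y by (simp add: B_def power_mult_distrib)
    also have "(1 - wt n x * (w 1)\<^sup>2)\<^sup>2 = 1 - 2 * wt n x * (w 1)\<^sup>2 + (wt n x)\<^sup>2 * w 1 ^ 4"
      by (simp add: power2_eq_square power4_eq_xxxx algebra_simps)
    finally show ?thesis using w by (simp add: glue_init')
  qed
  then have "(LINT w|sph n. B (glue n x w 1)) = (LINT w|sph n. (1 - 2 * wt n x * (w 1)\<^sup>2 + (wt n x)\<^sup>2 * w 1 ^ 4) / (real n)\<^sup>2)"
    by simp
  also have "\<dots> = mB x"
    using integrable_sph_power[OF w(1), of 2] integrable_sph_power[OF w(1), of 4] sph_moments(1,2)[OF w]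
    by (simp add: W.prob_space mB_def)
  finally show ?thesis .
qed

lemma mB_cont: "continuous_on UNIV mB"
  unfolding mB_def[abs_def] using n by (intro continuous_intros wt_cont) auto

text \<open>On a slice \<open>G\<close> is a sum of one function over n coordinates, so its second
  moment is controlled by the second moment and the squared mean \<kappa> of a summand. The first
  contribution is of order 1/n, the second of order 1/n^2.\<close>

lemma third_term:
  assumes n3: "n \<ge> 3"
  shows "(LINT v|sph (Suc n). B (v (Suc n)) * (G v)\<^sup>2)
    \<le> (real n * (1 + 3 / (real n + 1)) * (2 / (real n)\<^sup>2) + (real n)\<^sup>2 * c\<^sup>2) * (nr (mrg n) \<phi>)\<^sup>2"
proof -
  \<comment> \<open>The correlation bound is applied one dimension lower, on the slice, where it
    needs p >= 2.\<close>
  obtain p where p: "n = Suc p" "p \<ge> 2" using n3 by (cases n) auto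
  let ?K = "real n * (1 + 3 / (real n + 1))"
  define A where "A x = (LINT w|sph n. (\<phi> (glue n x w 1))\<^sup>2)" for x
  have i1: "integrable (sph (Suc n)) (\<lambda>v. B (v (Suc n)) * (G v)\<^sup>2)"
    using sqi_mult_integrable[OF Bk_sqi[OF Gs last_in(1)] Gs] by (simp add: power2_eq_square mult.assoc)
  have i2: "integrable (sph (Suc n)) (\<lambda>v. B (v (Suc n)) * (\<phi> (v 1))\<^sup>2)"
    using sqi_mult_integrable[OF Bk_sqi[OF \<phi>1(2) last_in(1)] \<phi>1(2)] by (simp add: power2_eq_square mult.assoc)
  have v1 [measurable]: "(\<lambda>v. v 1) \<in> borel_measurable (bor (Suc n))" using cm last_in(2) .
  have m1: "(\<lambda>v. B (v (Suc n)) * (G v)\<^sup>2) \<in> borel_measurable (bor (Suc n))" by measurable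
  have m2: "(\<lambda>v. B (v (Suc n)) * (\<phi> (v 1))\<^sup>2) \<in> borel_measurable (bor (Suc n))" by measurable
  have m3: "(\<lambda>v. (\<phi> (v 1))\<^sup>2) \<in> borel_measurable (bor (Suc n))" by measurable
  note d1 = sph_disintegrate[OF n1 m1 i1]
  note d2 = sph_disintegrate[OF n1 m2 i2]
  note d3 = sph_disintegrate[OF n1 m3 sqiD(2)[OF \<phi>1(2)]]
  have inner: "AE x in mrg n. (LINT w|sph n. (G (glue n x w))\<^sup>2) \<le> ?K * A x + (real n)\<^sup>2 * (\<kappa> x)\<^sup>2"
    using d3(1)
  proof eventually_elim
    case (elim x)
    define \<psi> where "\<psi> y = \<phi> (sqrt (wt n x) * y)" for y
    have \<psi>m [measurable]: "\<psi> \<in> borel_measurable borel" unfolding \<psi>_def by measurable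
    have gl: "\<phi> (glue n x w k) = \<psi> (w k)" if "k \<in> {1..n}" for w k
      using that by (simp add: \<psi>_def glue_init')
    have "integrable (sph n) (\<lambda>w. (\<psi> (w 1))\<^sup>2)" using elim gl[OF last_in(4)] by simp
    moreover have "(\<lambda>w. \<psi> (w 1)) \<in> borel_measurable (sph n)"
      using measurable_compose[OF coord_measurable[OF last_in(4)] \<psi>m] by (simp add: meas_sph)
    ultimately have "sqi (sph n) (\<lambda>w. \<psi> (w 1))" by (simp add: sqi_def)
    then have \<psi>s: "sqi (mrg p) \<psi>" using sqi_mrg_iff[OF \<psi>m, of 1 p] by (simp add: p)
    have in1: "1 \<in> {1..Suc p}" by simp
    have A: "A x = (LINT y|mrg p. (\<psi> y)\<^sup>2)"
      using sqi_coord(2)[OF \<psi>s in1] nr_sq[of "mrg p" \<psi>] nr_sq[of "sph (Suc p)" "\<lambda>w. \<psi> (w 1)"] gl[OF last_in(4)]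
      by (simp add: A_def p)
    have K: "\<kappa> x = (LINT y|mrg p. \<psi> y)"
      using sqi_coord(3)[OF \<psi>s in1, folded p(1)] gl[OF last_in(4)] by (simp add: \<kappa>_def cnd_def)
    have "(LINT w|sph n. (G (glue n x w))\<^sup>2) = (LINT w|sph (Suc p). (\<Sum>k\<in>{1..Suc p}. \<psi> (w k))\<^sup>2)"
      unfolding G_def p(1)[symmetric] by (simp only: gl cong: sum.cong)
    also have "\<dots> \<le> (real p + 1) * (1 + 3 / (real p + 2)) * (LINT x|mrg p. (\<psi> x)\<^sup>2) + (real p + 1)\<^sup>2 * (LINT x|mrg p. \<psi> x)\<^sup>2"
      by (rule sum_coord_sq_le'[OF p(2) \<psi>s])
    also have "\<dots> = ?K * A x + (real n)\<^sup>2 * (\<kappa> x)\<^sup>2"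
      unfolding A K by (simp add: p(1) add.commute)
    finally show ?case .
  qed
  have i3: "integrable (mrg n) (\<lambda>x. B x * A x)" using d2(2) by (simp add: A_def)
  have i4: "integrable (mrg n) (\<lambda>x. B x * (\<kappa> x)\<^sup>2)"
  proof -
    have "sqi (mrg n) (\<lambda>x. B x * \<kappa> x)"
      by (rule sqi_bounded_mult[OF \<kappa>s, where B=1]) (use AE_mrg_le[of n] in \<open>auto simp: meas_mrg elim!: eventually_mono intro!: B_abs\<close>)
    from sqi_mult_integrable[OF this \<kappa>s] show ?thesis by (simp add: power2_eq_square mult.assoc)
  qed
  have "(LINT v|sph (Suc n). B (v (Suc n)) * (G v)\<^sup>2) = (LINT x|mrg n. (LINT w|sph n. B x * (G (glue n x w))\<^sup>2))"
    using d1(3) by simp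
  also have "\<dots> \<le> (LINT x|mrg n. ?K * (B x * A x) + (real n)\<^sup>2 * (B x * (\<kappa> x)\<^sup>2))"
  proof (rule integral_mono_AE)
    show "integrable (mrg n) (\<lambda>x. LINT w|sph n. B x * (G (glue n x w))\<^sup>2)" using d1(2) by simp
    show "integrable (mrg n) (\<lambda>x. ?K * (B x * A x) + (real n)\<^sup>2 * (B x * (\<kappa> x)\<^sup>2))" using i3 i4 by simp
    show "AE x in mrg n. (LINT w|sph n. B x * (G (glue n x w))\<^sup>2) \<le> ?K * (B x * A x) + (real n)\<^sup>2 * (B x * (\<kappa> x)\<^sup>2)"
      using inner
    proof eventually_elim
      case (elim x)
      have "(LINT w|sph n. B x * (G (glue n x w))\<^sup>2) = B x * (LINT w|sph n. (G (glue n x w))\<^sup>2)" by simp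
      also have "\<dots> \<le> B x * (?K * A x + (real n)\<^sup>2 * (\<kappa> x)\<^sup>2)" by (intro mult_left_mono elim B_nonneg)
      finally show ?case by (simp only: distrib_left mult.left_commute)
    qed
  qed
  also have "\<dots> = ?K * (LINT x|mrg n. B x * A x) + (real n)\<^sup>2 * (LINT x|mrg n. B x * (\<kappa> x)\<^sup>2)"
    using i3 i4 by simp
  also have "\<dots> \<le> ?K * (2 / (real n)\<^sup>2 * (nr (mrg n) \<phi>)\<^sup>2) + (real n)\<^sup>2 * (c\<^sup>2 * (nr (mrg n) \<phi>)\<^sup>2)"
  proof (intro add_mono mult_left_mono)
    have "(LINT x|mrg n. B x * A x) = (LINT v|sph (Suc n). B (v (Suc n)) * (\<phi> (v 1))\<^sup>2)"
      using d2(3) by (simp add: A_def)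
    \<comment> \<open>Exchanging the two coordinates lets \<open>B\<close> be averaged instead of
      \<phi>: its mean over a slice is of order 1/n^2, whereas pointwise it is only bounded by
      1.\<close>
    also have "\<dots> = (LINT v|sph (Suc n). B (v 1) * (\<phi> (v (Suc n)))\<^sup>2)"
      using last_in by (intro integral_sph_coord2(1)[where g="\<lambda>x y. B x * (\<phi> y)\<^sup>2"]) auto
    also have "\<dots> = (LINT x|mrg n. (LINT w|sph n. B (glue n x w 1) * (\<phi> x)\<^sup>2))"
    proof -
      have "integrable (sph (Suc n)) (\<lambda>v. B (v 1) * (\<phi> (v (Suc n)))\<^sup>2)"
        using sqi_mult_integrable[OF Bk_sqi[OF \<phi>k[OF last_in(1)] last_in(2)] \<phi>k[OF last_in(1)]] by (simp add: power2_eq_square mult.assoc)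
      from sph_disintegrate(3)[OF n1 _ this] show ?thesis by simp
    qed
    also have "\<dots> = (LINT x|mrg n. mB x * (\<phi> x)\<^sup>2)"
    proof (rule integral_cong_AE)
      show "AE x in mrg n. (LINT w|sph n. B (glue n x w 1) * (\<phi> x)\<^sup>2) = mB x * (\<phi> x)\<^sup>2"
        using AE_mrg_le[of n] by eventually_elim (simp add: B_mean)
      show "(\<lambda>x. LINT w|sph n. B (glue n x w 1) * (\<phi> x)\<^sup>2) \<in> borel_measurable (mrg n)"
      proof -
        have "(\<lambda>p. B (glue n (fst p) (snd p) 1) * (\<phi> (fst p))\<^sup>2) \<in> borel_measurable (borel \<Otimes>\<^sub>M bor n)"
        proof -
          have "(\<lambda>p. (case p of (x, w) \<Rightarrow> glue n x w) 1) \<in> borel_measurable (borel \<Otimes>\<^sub>M bor n)"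
            by (rule measurable_compose[OF glue_measurable v1])
          then have [measurable]: "(\<lambda>p. glue n (fst p) (snd p) 1) \<in> borel_measurable (borel \<Otimes>\<^sub>M bor n)" by (simp add: split_def)
          show ?thesis by measurable
        qed
        then show ?thesis unfolding meas_mrg
          by (intro W.borel_measurable_lebesgue_integral) (simp add: split_def sets_sph cong: measurable_cong_sets sets_pair_measure_cong)
      qed
      show "(\<lambda>x. mB x * (\<phi> x)\<^sup>2) \<in> borel_measurable (mrg n)"
        using borel_measurable_continuous_onI[OF mB_cont] by (simp add: meas_mrg)
    qed
    also have "\<dots> \<le> (LINT x|mrg n. 2 / (real n)\<^sup>2 * (\<phi> x)\<^sup>2)"
    proof (rule integral_mono_AE[OF weighted_variance(3)[OF mB_cont]])
      show "AE x in mrg n. mB x * (\<phi> x)\<^sup>2 \<le> 2 / (real n)\<^sup>2 * (\<phi> x)\<^sup>2"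
        using AE_mrg_le[of n] by eventually_elim (intro mult_right_mono mB_bounds(2), auto)
    qed (use sqiD(2)[OF \<phi>s] in simp)
    also have "\<dots> = 2 / (real n)\<^sup>2 * (nr (mrg n) \<phi>)\<^sup>2" by (simp add: nr_sq)
    finally show "(LINT x|mrg n. B x * A x) \<le> 2 / (real n)\<^sup>2 * (nr (mrg n) \<phi>)\<^sup>2" .
    have "(LINT x|mrg n. B x * (\<kappa> x)\<^sup>2) \<le> (LINT x|mrg n. (\<kappa> x)\<^sup>2)"
    proof (rule integral_mono_AE[OF i4 sqiD(2)[OF \<kappa>s]])
      show "AE x in mrg n. B x * (\<kappa> x)\<^sup>2 \<le> (\<kappa> x)\<^sup>2"
        using AE_mrg_le[of n] by eventually_elim (simp add: B_le mult_left_le_one_le B_nonneg)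
    qed
    then show "(LINT x|mrg n. B x * (\<kappa> x)\<^sup>2) \<le> c\<^sup>2 * (nr (mrg n) \<phi>)\<^sup>2" using \<kappa>_le by linarith
  qed auto
  finally show ?thesis by (simp only: distrib_right mult.assoc)
qed

lemma kac_init_sq:
  assumes v: "v \<in> kac_sphere (Suc n)"
  shows "(\<Sum>k\<in>{1..n}. (v k)\<^sup>2) = real n * wt n (v (Suc n))"
proof -
  have "(\<Sum>k\<in>{1..n}. (v k)\<^sup>2) + (v (Suc n))\<^sup>2 = real (Suc n)"
    using v unfolding kac_sphere_def mem_Collect_eq sum_last by blast
  then show ?thesis using n by (simp add: wt_def)
qed

lemma D_split:
  assumes v: "v \<in> kac_sphere (Suc n)"
  shows "D v - B (v (Suc n)) = real n * mB (v (Suc n)) + Z v"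
proof -
  let ?y = "wt n (v (Suc n))" and ?S = "\<Sum>k\<in>{1..n}. v k ^ 4"
  have "D v - B (v (Suc n)) = (\<Sum>k\<in>{1..n}. B (v k))" unfolding D_def sum_last by simp
  also have "\<dots> = (\<Sum>k\<in>{1..n}. 1 - 2 * (v k)\<^sup>2 + v k ^ 4) / (real n)\<^sup>2"
    unfolding B_def sum_divide_distrib by (intro sum.cong refl) (simp add: power2_eq_square power4_eq_xxxx algebra_simps)
  also have "(\<Sum>k\<in>{1..n}. 1 - 2 * (v k)\<^sup>2 + v k ^ 4) = real n - 2 * (real n * ?y) + ?S"
    by (simp only: sum.distrib sum_subtractf sum_distrib_left[symmetric] kac_init_sq[OF v]) simp
  also have "(real n - 2 * (real n * ?y) + ?S) / (real n)\<^sup>2 = real n * mB (v (Suc n)) + Z v"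
    by (simp add: mB_def Z_def add_divide_distrib diff_divide_distrib power2_eq_square algebra_simps)
  finally show ?thesis .
qed

lemma Zm [measurable]: "Z \<in> borel_measurable (bor (Suc n))"
proof -
  have [measurable]: "(\<lambda>v. \<Sum>k\<in>{1..n}. v k ^ 4) \<in> borel_measurable (bor (Suc n))"
    by (intro borel_measurable_sum borel_measurable_power cm) auto
  show ?thesis unfolding Z_def[abs_def] by measurable
qed

lemma Z_bound: "AE v in sph (Suc n). \<bar>Z v\<bar> \<le> (real n * (real (Suc n))\<^sup>2 + 3 * (real n)\<^sup>2 / (real n + 2) * (real (Suc n) / real n)\<^sup>2) / (real n)\<^sup>2"
  using kac_AE
proof eventually_elim
  case (elim v)
  have y: "0 \<le> wt n (v (Suc n))" "wt n (v (Suc n)) \<le> real (Suc n) / real n"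
    using wt_bounds[OF n1 kac_coord_le(1)[OF elim last_in(1)]] by auto
  have "(\<Sum>k\<in>{1..n}. v k ^ 4) \<le> (\<Sum>k\<in>{1..n}. (real (Suc n))\<^sup>2)"
  proof (rule sum_mono)
    fix k assume "k \<in> {1..n}"
    then have "(v k)\<^sup>2 \<le> real (Suc n)" by (intro kac_coord_le(1)[OF elim]) auto
    then have "((v k)\<^sup>2)\<^sup>2 \<le> (real (Suc n))\<^sup>2" by (intro power_mono) auto
    then show "v k ^ 4 \<le> (real (Suc n))\<^sup>2" by (simp flip: power_mult)
  qed
  then have 1: "(\<Sum>k\<in>{1..n}. v k ^ 4) \<le> real n * (real (Suc n))\<^sup>2" by simp
  have 2: "0 \<le> (\<Sum>k\<in>{1..n}. v k ^ 4)" by (intro sum_nonneg) simp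
  have 3: "3 * (real n)\<^sup>2 / (real n + 2) * (wt n (v (Suc n)))\<^sup>2 \<le> 3 * (real n)\<^sup>2 / (real n + 2) * (real (Suc n) / real n)\<^sup>2"
    using y by (intro mult_left_mono power_mono) auto
  have 4: "0 \<le> 3 * (real n)\<^sup>2 / (real n + 2) * (wt n (v (Suc n)))\<^sup>2" by simp
  have "\<bar>(\<Sum>k\<in>{1..n}. v k ^ 4) - 3 * (real n)\<^sup>2 / (real n + 2) * (wt n (v (Suc n)))\<^sup>2\<bar>
     \<le> real n * (real (Suc n))\<^sup>2 + 3 * (real n)\<^sup>2 / (real n + 2) * (real (Suc n) / real n)\<^sup>2"
    using 1 2 3 4 by linarith
  then show ?case unfolding Z_def abs_divide by (simp add: divide_right_mono)
qed

text \<open>The ratio of the polynomials tends to 24; 25 leaves room down to x = 2 and has a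
  rational root. The difference has nonnegative coefficients in u = x - 2.\<close>

lemma variance_bound:
  fixes x :: real
  assumes "x \<ge> 2"
  shows "24 * (x - 1) * (x + 1) ^ 7 \<le> 25 * (x ^ 4 * ((x + 2)\<^sup>2 * (x + 4) * (x + 6)))"
proof -
  define u where "u = x - 2"
  have u: "u \<ge> 0" "x = u + 2" using assms by (simp_all add: u_def)
  have "25 * (x ^ 4 * ((x + 2)\<^sup>2 * (x + 4) * (x + 6))) - 24 * (x - 1) * (x + 1) ^ 7 = 254712 * u ^ 0 + 682640 * u ^ 1 + 772656 * u ^ 2 + 477488 * u ^ 3 + 173680 * u ^ 4 + 37184 * u ^ 5 + 4360 * u ^ 6 + 222 * u ^ 7 + 1 * u ^ 8"
    unfolding u(2) by algebra
  also have "\<dots> \<ge> 0" using u(1) by simp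
  finally show ?thesis by simp
qed

text \<open>On the slice \<open>Z\<close> is the centred sum of fourth powers times
  \<open>(wt n x)^2 / n^2\<close>, so \<open>sph_var_fourth\<close> applies.\<close>

lemma Z_second_moment:
  assumes x: "x\<^sup>2 \<le> real (Suc n)"
  shows "(LINT w|sph n. (Z (glue n x w))\<^sup>2) \<le> 25 / (real n + 1) ^ 3"
proof -
  let ?y = "wt n x" and ?c = "3 * (real n)\<^sup>2 / (real n + 2)"
  have y: "0 \<le> ?y" "?y \<le> (real n + 1) / real n" using wt_bounds[OF n1 x] by (auto simp: add.commute)
  have sq4: "sqrt ?y ^ 4 = ?y\<^sup>2" using y by (simp add: power4_eq_xxxx power2_eq_square mult.assoc)
  have "(\<Sum>k\<in>{1..n}. glue n x w k ^ 4) = ?y\<^sup>2 * (\<Sum>k\<in>{1..n}. w k ^ 4)" for w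
    unfolding sum_distrib_left by (intro sum.cong refl) (simp add: glue_init' power_mult_distrib sq4)
  then have "Z (glue n x w) = ?y\<^sup>2 / (real n)\<^sup>2 * ((\<Sum>k\<in>{1..n}. w k ^ 4) - ?c)" for w
    by (simp add: Z_def right_diff_distrib diff_divide_distrib mult.commute)
  then have "(Z (glue n x w))\<^sup>2 = (?y\<^sup>2 / (real n)\<^sup>2)\<^sup>2 * ((\<Sum>k\<in>{1..n}. w k ^ 4) - ?c)\<^sup>2" for w
    by (simp only: power_mult_distrib)
  then have "(LINT w|sph n. (Z (glue n x w))\<^sup>2) = (?y\<^sup>2 / (real n)\<^sup>2)\<^sup>2 * (24 * (real n - 1) * real n ^ 4 / ((real n + 2) ^ 2 * (real n + 4) * (real n + 6)))"
    using sph_var_fourth[OF n] by simp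
  also have "\<dots> = ?y ^ 4 * (24 * (real n - 1) / ((real n + 2) ^ 2 * (real n + 4) * (real n + 6)))"
    using n by (simp add: power_divide flip: power_mult)
  also have "\<dots> \<le> ((real n + 1) / real n) ^ 4 * (24 * (real n - 1) / ((real n + 2) ^ 2 * (real n + 4) * (real n + 6)))"
    using n by (intro mult_right_mono power_mono y) auto
  also have "\<dots> = 24 * (real n - 1) * (real n + 1) ^ 7 / (real n ^ 4 * ((real n + 2) ^ 2 * (real n + 4) * (real n + 6))) / (real n + 1) ^ 3"
  proof -
    have 7: "(real n + 1) ^ 7 = (real n + 1) ^ 4 * (real n + 1) ^ 3" by (simp flip: power_add)
    have q: "p / r * (k / d) = k * (p * q) / (r * d) / q" if "q \<noteq> 0" for p q r k d :: real
      using that by simp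
    show ?thesis unfolding 7 power_divide by (rule q) (use n in simp)
  qed
  also have "\<dots> \<le> 25 / (real n + 1) ^ 3"
    using variance_bound[of "real n"] n by (intro divide_right_mono) (auto simp: divide_le_eq)
  finally show ?thesis .
qed

lemma \<phi>Z: "sqi (sph (Suc n)) (\<lambda>v. Z v * \<phi> (v (Suc n)))"
  "(nr (sph (Suc n)) (\<lambda>v. Z v * \<phi> (v (Suc n))))\<^sup>2 \<le> 25 / (real n + 1) ^ 3 * (nr (mrg n) \<phi>)\<^sup>2"
proof -
  show s: "sqi (sph (Suc n)) (\<lambda>v. Z v * \<phi> (v (Suc n)))"
    by (rule sqi_bounded_mult[OF \<phi>k[OF last_in(1)] _ Z_bound]) (simp add: meas_sph)
  have m: "(\<lambda>v. (Z v * \<phi> (v (Suc n)))\<^sup>2) \<in> borel_measurable (bor (Suc n))" by measurable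
  note d = sph_disintegrate[OF n1 m sqiD(2)[OF s]]
  have "(nr (sph (Suc n)) (\<lambda>v. Z v * \<phi> (v (Suc n))))\<^sup>2 = (LINT x|mrg n. (LINT w|sph n. (Z (glue n x w) * \<phi> x)\<^sup>2))"
    unfolding nr_sq using d(3) by simp
  also have "\<dots> \<le> (LINT x|mrg n. 25 / (real n + 1) ^ 3 * (\<phi> x)\<^sup>2)"
  proof (rule integral_mono_AE)
    show "integrable (mrg n) (\<lambda>x. LINT w|sph n. (Z (glue n x w) * \<phi> x)\<^sup>2)" using d(2) by simp
    show "integrable (mrg n) (\<lambda>x. 25 / (real n + 1) ^ 3 * (\<phi> x)\<^sup>2)" using sqiD(2)[OF \<phi>s] by simp
    show "AE x in mrg n. (LINT w|sph n. (Z (glue n x w) * \<phi> x)\<^sup>2) \<le> 25 / (real n + 1) ^ 3 * (\<phi> x)\<^sup>2"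
      using AE_mrg_le[of n]
    proof eventually_elim
      case (elim x)
      have "(LINT w|sph n. (Z (glue n x w) * \<phi> x)\<^sup>2) = (LINT w|sph n. (Z (glue n x w))\<^sup>2) * (\<phi> x)\<^sup>2"
        by (simp add: power_mult_distrib)
      also have "\<dots> \<le> 25 / (real n + 1) ^ 3 * (\<phi> x)\<^sup>2"
        by (intro mult_right_mono Z_second_moment elim) simp
      finally show ?case .
    qed
  qed
  also have "\<dots> = 25 / (real n + 1) ^ 3 * (nr (mrg n) \<phi>)\<^sup>2" by (simp add: nr_sq)
  finally show "(nr (sph (Suc n)) (\<lambda>v. Z v * \<phi> (v (Suc n))))\<^sup>2 \<le> 25 / (real n + 1) ^ 3 * (nr (mrg n) \<phi>)\<^sup>2" .
qed

text \<open>The weight of the other coordinates is n times \<open>mB\<close> plus the fluctuation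
  \<open>Z\<close>. Against the first part, h meets a function of one coordinate, to which it is
  almost orthogonal; the second part is small in L^2, and Cauchy-Schwarz suffices.\<close>

lemma cross_term:
  "(LINT v|sph (Suc n). h v * \<phi> (v (Suc n)) * (D v - B (v (Suc n))))
    \<le> 2 * c * (nr (mrg n) \<phi>)\<^sup>2 + nr (sph (Suc n)) h * sqrt (25 / (real n + 1) ^ 3 * (nr (mrg n) \<phi>)\<^sup>2)"
proof -
  define g where "g x = mB x * \<phi> x" for x
  have mBm [measurable]: "mB \<in> borel_measurable borel" by (rule borel_measurable_continuous_onI[OF mB_cont])
  have mB_abs: "AE x in mrg n. \<bar>mB x\<bar> \<le> 2 / (real n)\<^sup>2"
    using AE_mrg_le[of n] by eventually_elim (use mB_bounds in auto)
  have g: "sqi (mrg n) g"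
    unfolding g_def by (rule sqi_bounded_mult[OF \<phi>s _ mB_abs]) (simp add: meas_mrg)
  have gn: "nr (mrg n) g \<le> 2 / (real n)\<^sup>2 * nr (mrg n) \<phi>"
  proof (rule power2_le_imp_le)
    have "(nr (mrg n) g)\<^sup>2 \<le> (LINT x|mrg n. (2 / (real n)\<^sup>2)\<^sup>2 * (\<phi> x)\<^sup>2)"
      unfolding nr_sq
    proof (rule integral_mono_AE)
      show "AE x in mrg n. (g x)\<^sup>2 \<le> (2 / (real n)\<^sup>2)\<^sup>2 * (\<phi> x)\<^sup>2"
        using mB_abs
      proof eventually_elim
        case (elim x)
        have "(mB x)\<^sup>2 \<le> (2 / (real n)\<^sup>2)\<^sup>2" using elim by (intro abs_le_square_iff[THEN iffD1]) simp
        then show ?case by (simp add: g_def power_mult_distrib mult_right_mono)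
      qed
    qed (use sqiD(2)[OF g] sqiD(2)[OF \<phi>s] in auto)
    then show "(nr (mrg n) g)\<^sup>2 \<le> (2 / (real n)\<^sup>2 * nr (mrg n) \<phi>)\<^sup>2"
      unfolding power_mult_distrib[of "2 / (real n)\<^sup>2"] nr_sq by simp
  qed simp
  have gN: "sqi (sph (Suc n)) (\<lambda>v. g (v (Suc n)))" by (rule sqi_coord(1)[OF g last_in(1)])
  have sg: "(LINT v|sph (Suc n). s v * g (v (Suc n))) = (LINT x|mrg n. g x * \<phi> x) + real n * bil n \<phi> g"
  proof -
    have "(LINT v|sph (Suc n). s v * g (v (Suc n))) = (LINT v|sph (Suc n). (\<Sum>k\<in>{1..Suc n}. \<phi> (v k) * g (v (Suc n))))"
      by (simp only: s_def sum_distrib_right)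
    also have "\<dots> = (\<Sum>k\<in>{1..Suc n}. (LINT v|sph (Suc n). \<phi> (v k) * g (v (Suc n))))"
      by (intro Bochner_Integration.integral_sum bil_integrable \<phi>s g last_in)
    also have "\<dots> = (\<Sum>k\<in>{1..n}. (LINT v|sph (Suc n). \<phi> (v k) * g (v (Suc n)))) + (LINT v|sph (Suc n). \<phi> (v (Suc n)) * g (v (Suc n)))"
      by (rule sum_last)
    also have "(\<Sum>k\<in>{1..n}. (LINT v|sph (Suc n). \<phi> (v k) * g (v (Suc n)))) = (\<Sum>k\<in>{1..n}. bil n \<phi> g)"
      by (intro sum.cong refl bil_coord \<phi>s g) auto
    also have "(LINT v|sph (Suc n). \<phi> (v (Suc n)) * g (v (Suc n))) = (LINT x|mrg n. \<phi> x * g x)"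
      unfolding g_def by (rule integral_mrg(1)[symmetric]) measurable
    finally show ?thesis by (simp add: mult.commute)
  qed
  \<comment> \<open>f and s have the same diagonal contribution on the last coordinate; what remains
    are the n correlations with the other coordinates.\<close>
  have hg: "(LINT v|sph (Suc n). h v * g (v (Suc n))) = - real n * bil n \<phi> g"
  proof -
    have "h v * g (v (Suc n)) = g (v (Suc n)) * f v - s v * g (v (Suc n))" for v
      by (simp add: h_def algebra_simps)
    then have "(LINT v|sph (Suc n). h v * g (v (Suc n))) = (LINT v|sph (Suc n). g (v (Suc n)) * f v - s v * g (v (Suc n)))"
      by (simp only:)
    also have "\<dots> = (LINT x|mrg n. g x * \<phi> x) - (LINT v|sph (Suc n). s v * g (v (Suc n)))"
      using sqi_mult_integrable[OF gN fs] sqi_mult_integrable[OF ss gN] f_coord[OF g last_in(1)] by simp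
    finally show ?thesis by (simp add: sg)
  qed
  have 1: "real n * (LINT v|sph (Suc n). h v * g (v (Suc n))) \<le> 2 * c * (nr (mrg n) \<phi>)\<^sup>2"
  proof -
    have "real n * (LINT v|sph (Suc n). h v * g (v (Suc n))) \<le> (real n)\<^sup>2 * \<bar>bil n \<phi> g\<bar>"
    proof -
      have "real n * (LINT v|sph (Suc n). h v * g (v (Suc n))) = (real n)\<^sup>2 * (- bil n \<phi> g)"
        unfolding hg by (simp add: power2_eq_square)
      also have "\<dots> \<le> (real n)\<^sup>2 * \<bar>bil n \<phi> g\<bar>" by (intro mult_left_mono) auto
      finally show ?thesis .
    qed
    also have "\<dots> \<le> (real n)\<^sup>2 * (c * (nr (mrg n) \<phi> * (2 / (real n)\<^sup>2 * nr (mrg n) \<phi>)))"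
    proof (rule mult_left_mono)
      have "c * (nr (mrg n) \<phi> * nr (mrg n) g) \<le> c * (nr (mrg n) \<phi> * (2 / (real n)\<^sup>2 * nr (mrg n) \<phi>))"
        by (intro mult_left_mono gn c_nonneg) simp
      then show "\<bar>bil n \<phi> g\<bar> \<le> c * (nr (mrg n) \<phi> * (2 / (real n)\<^sup>2 * nr (mrg n) \<phi>))"
        using bil_le_c[OF g] by linarith
    qed simp
    also have "\<dots> = 2 * c * (nr (mrg n) \<phi>)\<^sup>2" using n by (simp add: power2_eq_square)
    finally show ?thesis .
  qed
  have 2: "(LINT v|sph (Suc n). h v * (Z v * \<phi> (v (Suc n)))) \<le> nr (sph (Suc n)) h * sqrt (25 / (real n + 1) ^ 3 * (nr (mrg n) \<phi>)\<^sup>2)"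
  proof -
    have "nr (sph (Suc n)) (\<lambda>v. Z v * \<phi> (v (Suc n))) \<le> sqrt (25 / (real n + 1) ^ 3 * (nr (mrg n) \<phi>)\<^sup>2)"
      using \<phi>Z(2) by (rule real_le_rsqrt)
    then have "nr (sph (Suc n)) h * nr (sph (Suc n)) (\<lambda>v. Z v * \<phi> (v (Suc n))) \<le> nr (sph (Suc n)) h * sqrt (25 / (real n + 1) ^ 3 * (nr (mrg n) \<phi>)\<^sup>2)"
      by (intro mult_left_mono) simp_all
    then show ?thesis using nr_cauchy_schwarz[OF hs \<phi>Z(1)] by linarith
  qed
  have "(LINT v|sph (Suc n). h v * \<phi> (v (Suc n)) * (D v - B (v (Suc n))))
      = (LINT v|sph (Suc n). real n * (h v * g (v (Suc n))) + h v * (Z v * \<phi> (v (Suc n))))"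
  proof (rule integral_cong_AE)
    show "AE v in sph (Suc n). h v * \<phi> (v (Suc n)) * (D v - B (v (Suc n))) = real n * (h v * g (v (Suc n))) + h v * (Z v * \<phi> (v (Suc n)))"
      using kac_AE
    proof eventually_elim
      case (elim v)
      show ?case unfolding D_split[OF elim] g_def by (simp add: algebra_simps)
    qed
  qed (simp_all add: meas_sph g_def)
  also have "\<dots> = real n * (LINT v|sph (Suc n). h v * g (v (Suc n))) + (LINT v|sph (Suc n). h v * (Z v * \<phi> (v (Suc n))))"
    using sqi_mult_integrable[OF hs gN] sqi_mult_integrable[OF hs \<phi>Z(1)] by simp
  finally show ?thesis using 1 2 by linarith
qed

text \<open>After symmetrisation, f - \<phi>_k is expanded as h + (s - \<phi>_k). In the cross term
  the sum over k of B_k (s - \<phi>_k) equals the sum over k of \<phi>_k (D - B_k), so each \<phi>_k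
  meets a weight built from the other coordinates only.\<close>

lemma quadratic_term:
  "real (Suc n) * (LINT v|sph (Suc n). B (v (Suc n)) * (f v - \<phi> (v (Suc n)))\<^sup>2)
    = (LINT v|sph (Suc n). D v * (h v)\<^sup>2)
      + 2 * real (Suc n) * (LINT v|sph (Suc n). h v * \<phi> (v (Suc n)) * (D v - B (v (Suc n))))
      + real (Suc n) * (LINT v|sph (Suc n). B (v (Suc n)) * (G v)\<^sup>2)"
proof -
  let ?I = "{1..Suc n}"
  have D_abs: "AE v in sph (Suc n). \<bar>D v\<bar> \<le> real (Suc n) / real n"
    using kac_AE by eventually_elim (use D_bounds in auto)
  have Dh: "sqi (sph (Suc n)) (\<lambda>v. D v * h v)"
    by (rule sqi_bounded_mult[OF hs _ D_abs]) (simp add: meas_sph)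
  have i1: "integrable (sph (Suc n)) (\<lambda>v. D v * (h v)\<^sup>2)"
    using sqi_mult_integrable[OF Dh hs] by (simp add: power2_eq_square mult.assoc)
  have i2: "integrable (sph (Suc n)) (\<lambda>v. h v * \<phi> (v k) * (D v - B (v k)))" if k: "k \<in> ?I" for k
  proof -
    have "integrable (sph (Suc n)) (\<lambda>v. (D v * h v) * \<phi> (v k) - (B (v k) * h v) * \<phi> (v k))"
      by (intro Bochner_Integration.integrable_diff sqi_mult_integrable Dh Bk_sqi hs \<phi>k k)
    then show ?thesis by (simp add: right_diff_distrib mult_ac)
  qed
  have i3: "integrable (sph (Suc n)) (\<lambda>v. B (v k) * (s v - \<phi> (v k))\<^sup>2)" if k: "k \<in> ?I" for k
  proof -
    have d: "sqi (sph (Suc n)) (\<lambda>v. s v - \<phi> (v k))" by (intro sqi_diff ss \<phi>k k)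
    from sqi_mult_integrable[OF Bk_sqi[OF d k] d] show ?thesis by (simp add: power2_eq_square mult.assoc)
  qed
  have i4: "integrable (sph (Suc n)) (\<lambda>v. B (v k) * (f v - \<phi> (v k))\<^sup>2)" if k: "k \<in> ?I" for k
  proof -
    have d: "sqi (sph (Suc n)) (\<lambda>v. f v - \<phi> (v k))" by (intro sqi_diff fs \<phi>k k)
    from sqi_mult_integrable[OF Bk_sqi[OF d k] d] show ?thesis by (simp add: power2_eq_square mult.assoc)
  qed
  note [measurable] = measurable_compose[OF cm \<phi>m] measurable_compose[OF cm Bm]
  have e2: "(LINT v|sph (Suc n). h v * \<phi> (v k) * (D v - B (v k))) = (LINT v|sph (Suc n). h v * \<phi> (v (Suc n)) * (D v - B (v (Suc n))))" if k: "k \<in> ?I" for k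
  proof (rule exchange[where F="\<lambda>k v. h v * \<phi> (v k) * (D v - B (v k))", OF _ _ k])
    show "AE v in sph (Suc n). h (v \<circ> \<pi>) * \<phi> ((v \<circ> \<pi>) (Suc n)) * (D (v \<circ> \<pi>) - B ((v \<circ> \<pi>) (Suc n))) = h v * \<phi> (v (\<pi> (Suc n))) * (D v - B (v (\<pi> (Suc n))))" if "\<pi> permutes ?I" for \<pi>
      using h_sym[OF that] by eventually_elim (simp add: D_sym[OF that])
  qed measurable
  have e3: "(LINT v|sph (Suc n). B (v k) * (s v - \<phi> (v k))\<^sup>2) = (LINT v|sph (Suc n). B (v (Suc n)) * (s v - \<phi> (v (Suc n)))\<^sup>2)" if k: "k \<in> ?I" for k
  proof (rule exchange[where F="\<lambda>k v. B (v k) * (s v - \<phi> (v k))\<^sup>2", OF _ _ k])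
    show "AE v in sph (Suc n). B ((v \<circ> \<pi>) (Suc n)) * (s (v \<circ> \<pi>) - \<phi> ((v \<circ> \<pi>) (Suc n)))\<^sup>2 = B (v (\<pi> (Suc n))) * (s v - \<phi> (v (\<pi> (Suc n))))\<^sup>2" if "\<pi> permutes ?I" for \<pi>
      by (simp add: s_sym[OF that])
  qed measurable
  have e4: "(LINT v|sph (Suc n). B (v k) * (f v - \<phi> (v k))\<^sup>2) = (LINT v|sph (Suc n). B (v (Suc n)) * (f v - \<phi> (v (Suc n)))\<^sup>2)" if k: "k \<in> ?I" for k
  proof (rule exchange[where F="\<lambda>k v. B (v k) * (f v - \<phi> (v k))\<^sup>2", OF _ _ k])
    show "AE v in sph (Suc n). B ((v \<circ> \<pi>) (Suc n)) * (f (v \<circ> \<pi>) - \<phi> ((v \<circ> \<pi>) (Suc n)))\<^sup>2 = B (v (\<pi> (Suc n))) * (f v - \<phi> (v (\<pi> (Suc n))))\<^sup>2" if "\<pi> permutes ?I" for \<pi>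
      using f_sym[OF that] by eventually_elim simp
  qed measurable
  have pw: "(\<Sum>k\<in>?I. B (v k) * (f v - \<phi> (v k))\<^sup>2)
      = D v * (h v)\<^sup>2 + 2 * (\<Sum>k\<in>?I. h v * \<phi> (v k) * (D v - B (v k))) + (\<Sum>k\<in>?I. B (v k) * (s v - \<phi> (v k))\<^sup>2)" for v
  proof -
    have "(\<Sum>k\<in>?I. B (v k) * (f v - \<phi> (v k))\<^sup>2)
       = (\<Sum>k\<in>?I. B (v k) * (h v)\<^sup>2 + 2 * h v * s v * B (v k) - 2 * (h v * \<phi> (v k) * B (v k)) + B (v k) * (s v - \<phi> (v k))\<^sup>2)"
      by (intro sum.cong refl) (simp add: h_def power2_eq_square algebra_simps)
    also have "\<dots> = D v * (h v)\<^sup>2 + 2 * h v * s v * D v - 2 * (\<Sum>k\<in>?I. h v * \<phi> (v k) * B (v k)) + (\<Sum>k\<in>?I. B (v k) * (s v - \<phi> (v k))\<^sup>2)"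
      by (simp only: sum.distrib sum_subtractf sum_distrib_left[symmetric] sum_distrib_right[symmetric] D_def[symmetric])
    finally have 1: "(\<Sum>k\<in>?I. B (v k) * (f v - \<phi> (v k))\<^sup>2) = D v * (h v)\<^sup>2 + 2 * h v * s v * D v - 2 * (\<Sum>k\<in>?I. h v * \<phi> (v k) * B (v k)) + (\<Sum>k\<in>?I. B (v k) * (s v - \<phi> (v k))\<^sup>2)" .
    have 2: "(\<Sum>k\<in>?I. h v * \<phi> (v k) * (D v - B (v k))) = h v * s v * D v - (\<Sum>k\<in>?I. h v * \<phi> (v k) * B (v k))"
      by (simp only: s_def sum_distrib_left sum_distrib_right right_diff_distrib sum_subtractf)
    show ?thesis unfolding 1 2 by (simp only: right_diff_distrib mult.assoc)
  qed
  have "real (Suc n) * (LINT v|sph (Suc n). B (v (Suc n)) * (f v - \<phi> (v (Suc n)))\<^sup>2)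
      = (\<Sum>k\<in>?I. (LINT v|sph (Suc n). B (v k) * (f v - \<phi> (v k))\<^sup>2))"
    by (simp only: e4 cong: sum.cong) simp
  also have "\<dots> = (LINT v|sph (Suc n). (\<Sum>k\<in>?I. B (v k) * (f v - \<phi> (v k))\<^sup>2))"
    by (rule Bochner_Integration.integral_sum[symmetric]) (rule i4)
  also have "\<dots> = (LINT v|sph (Suc n). D v * (h v)\<^sup>2) + 2 * (LINT v|sph (Suc n). (\<Sum>k\<in>?I. h v * \<phi> (v k) * (D v - B (v k)))) + (LINT v|sph (Suc n). (\<Sum>k\<in>?I. B (v k) * (s v - \<phi> (v k))\<^sup>2))"
  proof -
    have "integrable (sph (Suc n)) (\<lambda>v. \<Sum>k\<in>?I. h v * \<phi> (v k) * (D v - B (v k)))"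
      "integrable (sph (Suc n)) (\<lambda>v. \<Sum>k\<in>?I. B (v k) * (s v - \<phi> (v k))\<^sup>2)"
      by (rule Bochner_Integration.integrable_sum, erule i2, rule Bochner_Integration.integrable_sum, erule i3)
    moreover have "(LINT v|sph (Suc n). a v + 2 * b v + e v) = (LINT v|sph (Suc n). a v) + 2 * (LINT v|sph (Suc n). b v) + (LINT v|sph (Suc n). e v)"
      if "integrable (sph (Suc n)) a" "integrable (sph (Suc n)) b" "integrable (sph (Suc n)) e" for a b e :: "(nat \<Rightarrow> real) \<Rightarrow> real"
      using that by simp
    ultimately show ?thesis unfolding pw using i1 by blast
  qed
  also have "(LINT v|sph (Suc n). (\<Sum>k\<in>?I. h v * \<phi> (v k) * (D v - B (v k)))) = (\<Sum>k\<in>?I. (LINT v|sph (Suc n). h v * \<phi> (v k) * (D v - B (v k))))"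
    by (rule Bochner_Integration.integral_sum) (rule i2)
  also have "\<dots> = real (Suc n) * (LINT v|sph (Suc n). h v * \<phi> (v (Suc n)) * (D v - B (v (Suc n))))"
    by (simp only: e2 cong: sum.cong) simp
  also have "(LINT v|sph (Suc n). (\<Sum>k\<in>?I. B (v k) * (s v - \<phi> (v k))\<^sup>2)) = (\<Sum>k\<in>?I. (LINT v|sph (Suc n). B (v k) * (s v - \<phi> (v k))\<^sup>2))"
    by (rule Bochner_Integration.integral_sum) (rule i3)
  also have "\<dots> = real (Suc n) * (LINT v|sph (Suc n). B (v (Suc n)) * (s v - \<phi> (v (Suc n)))\<^sup>2)"
    by (simp only: e3 cong: sum.cong) simp
  also have "\<dots> = real (Suc n) * (LINT v|sph (Suc n). B (v (Suc n)) * (G v)\<^sup>2)"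
    by (simp add: s_G)
  finally show ?thesis by (simp only: mult.assoc)
qed

text \<open>The coefficient of the squared norm of h is close to 1, while everything multiplying t
  is of order 1/N: this is the gain from splitting f.\<close>

lemma quadratic_term_le:
  assumes n3: "n \<ge> 3"
  defines "N \<equiv> real n + 1" and "a \<equiv> (nr (sph (Suc n)) h)\<^sup>2"
  shows "real (Suc n) * (LINT v|sph (Suc n). B (v (Suc n)) * (f v - \<phi> (v (Suc n)))\<^sup>2)
    \<le> (N / real n + 7 / N) * a + (12 / (real n * (real n + 2)) + 4 / N + 2 / real n * (1 + 3 / N) + 9 / (real n + 2)\<^sup>2) * t"
proof -
  have N: "N > 0" "real (Suc n) = N" by (simp_all add: N_def)
  let ?P = "(nr (mrg n) \<phi>)\<^sup>2" and ?H = "nr (sph (Suc n)) h"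
  have t: "t = N * ?P" by (simp add: t_def N_def add.commute)
  have T1: "(LINT v|sph (Suc n). D v * (h v)\<^sup>2) \<le> N / real n * a"
  proof -
    have "(LINT v|sph (Suc n). D v * (h v)\<^sup>2) \<le> (LINT v|sph (Suc n). N / real n * (h v)\<^sup>2)"
    proof (rule integral_mono_AE)
      have D_abs: "AE v in sph (Suc n). \<bar>D v\<bar> \<le> real (Suc n) / real n"
        using kac_AE by eventually_elim (use D_bounds in auto)
      have Dh: "sqi (sph (Suc n)) (\<lambda>v. D v * h v)"
        by (rule sqi_bounded_mult[OF hs _ D_abs]) (simp add: meas_sph)
      show "integrable (sph (Suc n)) (\<lambda>v. D v * (h v)\<^sup>2)"
        using sqi_mult_integrable[OF Dh hs] by (simp add: power2_eq_square mult.assoc)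
      show "AE v in sph (Suc n). D v * (h v)\<^sup>2 \<le> N / real n * (h v)\<^sup>2"
        using kac_AE by eventually_elim (intro mult_right_mono, use D_bounds(2) N in auto)
    qed (use sqiD(2)[OF hs] in simp)
    then show ?thesis by (simp add: a_def nr_sq)
  qed
  have T2: "2 * N * (LINT v|sph (Suc n). h v * \<phi> (v (Suc n)) * (D v - B (v (Suc n)))) \<le> 12 / (real n * (real n + 2)) * t + (4 * t + 7 * a) / N"
  proof -
    have sq: "sqrt (25 / N ^ 3 * ?P) = 5 / N\<^sup>2 * sqrt t"
    proof -
      have "25 / N ^ 3 * ?P = (5 / N\<^sup>2)\<^sup>2 * t"
        using N by (simp add: t power2_eq_square power3_eq_cube)
      then show ?thesis using N by (simp add: real_sqrt_mult)
    qed
    have "2 * N * (LINT v|sph (Suc n). h v * \<phi> (v (Suc n)) * (D v - B (v (Suc n)))) \<le> 2 * N * (2 * c * ?P + ?H * (5 / N\<^sup>2 * sqrt t))"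
      using cross_term N unfolding N_def[symmetric] sq by (intro mult_left_mono) auto
    also have "\<dots> = 4 * c * t + 10 * (?H * sqrt t) / N"
      using N by (simp add: t power2_eq_square field_simps)
    also have "4 * c = 12 / (real n * (real n + 2))" by (simp add: c_def)
    also have "10 * (?H * sqrt t) / N \<le> (4 * t + 7 * a) / N"
    proof (rule divide_right_mono)
      \<comment> \<open>Arithmetic-geometric mean with weights 4 and 25/4, the latter rounded up to
        7.\<close>
      have "0 \<le> (2 * sqrt t - 5 / 2 * ?H)\<^sup>2" by simp
      also have "\<dots> = 4 * t - 10 * (?H * sqrt t) + 25 / 4 * a"
        using t_nonneg by (simp add: power2_diff power_mult_distrib power_divide a_def)
      finally show "10 * (?H * sqrt t) \<le> 4 * t + 7 * a" 
        unfolding a_def using zero_le_power2[of ?H] by linarith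
    qed (use N in simp)
    finally show ?thesis by simp
  qed
  have T3: "N * (LINT v|sph (Suc n). B (v (Suc n)) * (G v)\<^sup>2) \<le> (2 / real n * (1 + 3 / N) + 9 / (real n + 2)\<^sup>2) * t"
  proof -
    have "N * (LINT v|sph (Suc n). B (v (Suc n)) * (G v)\<^sup>2)
       \<le> N * ((real n * (1 + 3 / N) * (2 / (real n)\<^sup>2) + (real n)\<^sup>2 * c\<^sup>2) * ?P)"
      using third_term[OF n3] N unfolding N_def[symmetric] by (intro mult_left_mono) auto
    also have "\<dots> = (real n * (1 + 3 / N) * (2 / (real n)\<^sup>2) + (real n)\<^sup>2 * c\<^sup>2) * t" by (simp add: t)
    also have "real n * (1 + 3 / N) * (2 / (real n)\<^sup>2) = 2 / real n * (1 + 3 / N)"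
      using n by (simp add: power2_eq_square)
    also have "(real n)\<^sup>2 * c\<^sup>2 = 9 / (real n + 2)\<^sup>2"
      using n by (simp add: c_def power_divide power_mult_distrib)
    finally show ?thesis .
  qed
  have "real (Suc n) * (LINT v|sph (Suc n). B (v (Suc n)) * (f v - \<phi> (v (Suc n)))\<^sup>2)
    \<le> N / real n * a + (12 / (real n * (real n + 2)) * t + (4 * t + 7 * a) / N) + (2 / real n * (1 + 3 / N) + 9 / (real n + 2)\<^sup>2) * t"
    unfolding N(2) quadratic_term[unfolded N(2)] using T1 T2 T3 by linarith
  also have "\<dots> = (N / real n + 7 / N) * a + (12 / (real n * (real n + 2)) + 4 / N + 2 / real n * (1 + 3 / N) + 9 / (real n + 2)\<^sup>2) * t"
    by (simp only: distrib_right add_divide_distrib times_divide_eq_left)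
  finally show ?thesis .
qed

section \<open>The lower bound for the weighted conditional variance\<close>

lemma weighted_integrable:
  assumes "\<gamma> \<ge> 0"
  shows "integrable (sph (Suc n)) (\<lambda>v. wt n (v (Suc n)) powr \<gamma> * (f v - \<phi> (v (Suc n)))\<^sup>2)"
proof -
  have d: "sqi (sph (Suc n)) (\<lambda>v. f v - \<phi> (v (Suc n)))" by (intro sqi_diff fs \<phi>k last_in)
  have "sqi (sph (Suc n)) (\<lambda>v. wt n (v (Suc n)) powr \<gamma> * (f v - \<phi> (v (Suc n))))"
    by (rule sqi_last_mult[OF d]) (use wt_powr_bound[OF n1 _ assms] in auto)
  from sqi_mult_integrable[OF this d] show ?thesis by (simp add: power2_eq_square mult.assoc)
qed

text \<open>\<open>powr_ge_quadratic\<close> at y = \<open>wt n x\<close>: its affine part is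
  treated by \<open>linear_weight\<close>, and its quadratic part by
  \<open>quadratic_term_le\<close> with the nonnegative coefficient 1 - \<gamma>.\<close>

lemma conditional_bound:
  assumes n3: "n \<ge> 3" and \<gamma>: "0 \<le> \<gamma>" "\<gamma> \<le> 1"
  defines "N \<equiv> real n + 1" and "a \<equiv> (nr (sph (Suc n)) h)\<^sup>2"
  shows "N * (LINT v|sph (Suc n). wt n (v (Suc n)) powr \<gamma> * (f v - \<phi> (v (Suc n)))\<^sup>2)
    \<ge> N * F - (1 + \<gamma> / real n) * t - (1 - \<gamma>) * ((N / real n + 7 / N) * a
       + (12 / (real n * (real n + 2)) + 4 / N + 2 / real n * (1 + 3 / N) + 9 / (real n + 2)\<^sup>2) * t)"
proof -
  have N: "N > 0" "real (Suc n) = N" by (simp_all add: N_def)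
  let ?g = "\<lambda>x. 1 + \<gamma> * (wt n x - 1)"
  have g: "continuous_on UNIV ?g" by (intro continuous_intros wt_cont)
  note i1 = weighted_variance(4)[OF g] and i2 = weighted_variance(4)[OF B_cont]
  let ?d = "\<lambda>v. (f v - \<phi> (v (Suc n)))\<^sup>2"
  have "(LINT v|sph (Suc n). ?g (v (Suc n)) * ?d v) - (1 - \<gamma>) * (LINT v|sph (Suc n). B (v (Suc n)) * ?d v)
      = (LINT v|sph (Suc n). ?g (v (Suc n)) * ?d v - (1 - \<gamma>) * (B (v (Suc n)) * ?d v))"
    using i1 i2 by simp
  also have "\<dots> \<le> (LINT v|sph (Suc n). wt n (v (Suc n)) powr \<gamma> * ?d v)"
  proof (rule integral_mono_AE)
    show "integrable (sph (Suc n)) (\<lambda>v. ?g (v (Suc n)) * ?d v - (1 - \<gamma>) * (B (v (Suc n)) * ?d v))"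
      using i1 i2 by simp
    show "AE v in sph (Suc n). ?g (v (Suc n)) * ?d v - (1 - \<gamma>) * (B (v (Suc n)) * ?d v) \<le> wt n (v (Suc n)) powr \<gamma> * ?d v"
      using wt_AE
    proof eventually_elim
      case (elim v)
      have "B (v (Suc n)) = (wt n (v (Suc n)) - 1)\<^sup>2"
      proof -
        have "wt n (v (Suc n)) - 1 = (1 - (v (Suc n))\<^sup>2) / real n" using n by (simp add: wt_def field_simps)
        then show ?thesis by (simp add: B_def power_divide)
      qed
      then have "(?g (v (Suc n)) - (1 - \<gamma>) * B (v (Suc n))) * ?d v \<le> wt n (v (Suc n)) powr \<gamma> * ?d v"
        using powr_ge_quadratic[of "wt n (v (Suc n))" \<gamma>] elim \<gamma> by (intro mult_right_mono) auto
      then show ?case by (simp only: left_diff_distrib mult.assoc)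
    qed
  qed (rule weighted_integrable[OF \<gamma>(1)])
  finally have "N * ((LINT v|sph (Suc n). ?g (v (Suc n)) * ?d v) - (1 - \<gamma>) * (LINT v|sph (Suc n). B (v (Suc n)) * ?d v))
      \<le> N * (LINT v|sph (Suc n). wt n (v (Suc n)) powr \<gamma> * ?d v)"
    using N by (intro mult_left_mono) auto
  moreover have "N * ((LINT v|sph (Suc n). ?g (v (Suc n)) * ?d v) - (1 - \<gamma>) * (LINT v|sph (Suc n). B (v (Suc n)) * ?d v))
     = N * (LINT v|sph (Suc n). ?g (v (Suc n)) * ?d v) - (1 - \<gamma>) * (N * (LINT v|sph (Suc n). B (v (Suc n)) * ?d v))"
    by (simp only: right_diff_distrib mult.left_commute)
  moreover have "(1 - \<gamma>) * (N * (LINT v|sph (Suc n). B (v (Suc n)) * ?d v)) \<le> (1 - \<gamma>) * ((N / real n + 7 / N) * a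
       + (12 / (real n * (real n + 2)) + 4 / N + 2 / real n * (1 + 3 / N) + 9 / (real n + 2)\<^sup>2) * t)"
    using quadratic_term_le[OF n3] \<gamma> unfolding N(2) N_def[symmetric] a_def[symmetric] by (intro mult_left_mono) auto
  moreover have "N * F - (1 + \<gamma> / real n) * t \<le> N * (LINT v|sph (Suc n). ?g (v (Suc n)) * ?d v)"
    using linear_weight[OF \<gamma>] unfolding N(2) .
  ultimately show ?thesis by linarith
qed

text \<open>For \<gamma> = 1 the weight is affine and the quadratic loss disappears. The bound then
  holds from n = 2 on, which lets the recursion start from the circle.\<close>

lemma conditional_bound_one:
  "(real n + 1) * (LINT v|sph (Suc n). wt n (v (Suc n)) powr 1 * (f v - \<phi> (v (Suc n)))\<^sup>2)
    \<ge> (real n + 1) * F - (1 + 1 / real n) * t"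
proof -
  have "(LINT v|sph (Suc n). wt n (v (Suc n)) powr 1 * (f v - \<phi> (v (Suc n)))\<^sup>2)
     = (LINT v|sph (Suc n). (1 + 1 * (wt n (v (Suc n)) - 1)) * (f v - \<phi> (v (Suc n)))\<^sup>2)"
  proof (rule integral_cong_AE)
    show "AE v in sph (Suc n). wt n (v (Suc n)) powr 1 * (f v - \<phi> (v (Suc n)))\<^sup>2 = (1 + 1 * (wt n (v (Suc n)) - 1)) * (f v - \<phi> (v (Suc n)))\<^sup>2"
      using wt_AE by eventually_elim simp
  qed (simp_all add: meas_sph)
  then show ?thesis using linear_weight[of 1] by (simp only: of_nat_Suc) (simp add: add.commute)
qed

end

subsection \<open>From functions on the sphere to the spectral gap\<close>

lemma rot_kac:
  assumes "v \<in> kac_sphere N" "i \<in> {1..N}" "j \<in> {1..N}" "i \<noteq> j"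
  shows "rot i j \<theta> v \<in> kac_sphere N"
proof -
  have "rot i j \<theta> v \<in> {1..N} \<rightarrow>\<^sub>E UNIV"
    using assms by (auto simp: kac_sphere_def rot_def PiE_iff extensional_def)
  then show ?thesis using assms rot_sum_sq[OF assms(4,2,3)] by (simp add: kac_sphere_def)
qed

text \<open>The gap is defined through functions measurable on the sphere alone. Extending by zero
  is invisible, since the sphere is invariant under permutations and rotations and carries all the
  mass.\<close>

lemma extend_from_sphere:
  assumes N: "N \<ge> 1" and f: "L2_fun N f" "symmetric_fun N f"
  shows "\<exists>g. adm N g \<and> dirichlet_form \<gamma> N f = dirichlet_form \<gamma> N g
     \<and> L2_inner N f f = (LINT v|sph N. (g v)\<^sup>2) \<and> L2_inner N f (\<lambda>_. 1) = (LINT v|sph N. g v)"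
proof -
  define g where "g v = indicator (kac_sphere N) v * f v" for v
  have k: "kac_sphere N \<inter> space (sph N) \<in> sets (sph N)" using kac_sphere_in_sets by (auto simp: sets_sph)
  have eq: "g v = f v" if "v \<in> kac_sphere N" for v using that by (simp add: g_def)
  have gm [measurable]: "g \<in> borel_measurable (bor N)"
  proof -
    have "f \<in> borel_measurable (restrict_space (sph N) (kac_sphere N))"
      using f by (simp add: L2_fun_def sphere_measure_eq)
    then have "(\<lambda>x. indicator (kac_sphere N) x *\<^sub>R f x) \<in> borel_measurable (sph N)"
      using borel_measurable_restrict_space_iff[OF k, of f] by simp
    then show ?thesis by (simp add: g_def[abs_def] meas_sph)
  qed
  have intg: "(LINT v|sphere_measure N. F (f v) v) = (LINT v|sphere_measure N. F (g v) v)" for F :: "real \<Rightarrow> (nat \<Rightarrow> real) \<Rightarrow> real"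
    by (intro Bochner_Integration.integral_cong refl) (simp add: space_sphere_measure eq)
  have g2: "integrable (sph N) (\<lambda>v. (g v)\<^sup>2)"
  proof -
    have "integrable (sphere_measure N) (\<lambda>v. (g v)\<^sup>2)"
      using f(1) unfolding L2_fun_def by (subst Bochner_Integration.integrable_cong[OF refl, of _ _ "\<lambda>v. (f v)\<^sup>2"]) (auto simp: space_sphere_measure eq)
    then show ?thesis using integral_sphere_measure(2)[OF N, of "\<lambda>v. (g v)\<^sup>2"] by simp
  qed
  have adm: "adm N g"
    unfolding adm_def
  proof (intro conjI allI impI gm)
    show "sqi (sph N) g" using g2 gm by (simp add: sqi_def meas_sph)
    fix \<pi> assume p: "\<pi> permutes {1..N}"
    have "AE v in sph N. f (v \<circ> \<pi>) = f v"
      using f(2) p by (simp add: symmetric_fun_def AE_sphere_measure[OF N])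
    then show "AE v in sph N. g (v \<circ> \<pi>) = g v"
      using AE_sph_kac[OF N] AE_sph_perm[OF p, of "\<lambda>v. v \<in> kac_sphere N"] kac_sphere_in_sets[of N]
    proof -
      have "Measurable.pred (bor N) (\<lambda>v. v \<in> kac_sphere N)" using kac_sphere_in_sets[of N] by simp
      from AE_sph_perm[OF p this] AE_sph_kac[OF N] have "AE v in sph N. v \<circ> \<pi> \<in> kac_sphere N" by simp
      then show ?thesis using \<open>AE v in sph N. f (v \<circ> \<pi>) = f v\<close> AE_sph_kac[OF N] by eventually_elim (simp add: eq)
    qed
  qed
  have "dirichlet_form \<gamma> N f = dirichlet_form \<gamma> N g"
    unfolding dirichlet_form_def
  proof (intro arg_cong[where f="\<lambda>x. real N * inverse (real (N choose 2)) * x"] sum.cong refl)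
    fix p assume "p \<in> {(i, j). i \<in> {1..N} \<and> j \<in> {1..N} \<and> i < j}"
    then obtain i j where p: "p = (i, j)" "i \<in> {1..N}" "j \<in> {1..N}" "i \<noteq> j" by auto
    have "rot_avg i j f v = rot_avg i j g v" if "v \<in> kac_sphere N" for v
      unfolding rot_avg_eq using rot_kac[OF that p(2-4)] by (simp add: eq)
    then have "(LINT v|sphere_measure N. ((v i)\<^sup>2 + (v j)\<^sup>2) powr \<gamma> * (f v - rot_avg i j f v)\<^sup>2)
        = (LINT v|sphere_measure N. ((v i)\<^sup>2 + (v j)\<^sup>2) powr \<gamma> * (g v - rot_avg i j g v)\<^sup>2)"
      by (intro Bochner_Integration.integral_cong refl) (simp add: space_sphere_measure eq)
    then show "(case p of (i, j) \<Rightarrow> LINT v|sphere_measure N. ((v i)\<^sup>2 + (v j)\<^sup>2) powr \<gamma> * (f v - rot_avg i j f v)\<^sup>2)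
        = (case p of (i, j) \<Rightarrow> LINT v|sphere_measure N. ((v i)\<^sup>2 + (v j)\<^sup>2) powr \<gamma> * (g v - rot_avg i j g v)\<^sup>2)"
      by (simp add: p)
  qed
  moreover have "L2_inner N f f = (LINT v|sph N. (g v)\<^sup>2)"
    using intg[of "\<lambda>x v. x * x"] integral_sphere_measure(1)[OF N, of "\<lambda>v. (g v)\<^sup>2"] by (simp add: L2_inner_def power2_eq_square)
  moreover have "L2_inner N f (\<lambda>_. 1) = (LINT v|sph N. g v)"
    using intg[of "\<lambda>x v. x"] integral_sphere_measure(1)[OF N gm] by (simp add: L2_inner_def)
  ultimately show ?thesis using adm by blast
qed

text \<open>The infimum of the empty set of reals is unspecified, so a lower bound for the gap
  requires a test function. The sum of squares is constant on the sphere; the centred sum of fourth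
  powers has positive variance.\<close>

lemma gap_set_nonempty:
  assumes N: "N \<ge> 2"
  shows "\<exists>f. L2_fun N f \<and> L2_nrm N f = 1 \<and> L2_inner N f (\<lambda>_. 1) = 0 \<and> symmetric_fun N f"
proof -
  have N1: "N \<ge> 1" using N by simp
  interpret S: prob_space "sph N" by (rule prob_space_sph)
  let ?c = "3 * real N ^ 2 / (real N + 2)"
  define V where "V = 24 * (real N - 1) * real N ^ 4 / ((real N + 2) ^ 2 * (real N + 4) * (real N + 6))"
  have V: "V > 0" using N unfolding V_def by (intro divide_pos_pos mult_pos_pos) auto
  define q where "q v = (\<Sum>k\<in>{1..N}. v k ^ 4) - ?c" for v :: "nat \<Rightarrow> real"
  define g where "g v = q v / sqrt V" for v
  have qm: "q \<in> borel_measurable (bor N)"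
    unfolding q_def by (intro borel_measurable_diff borel_measurable_sum borel_measurable_power coord_measurable) auto
  have gm: "g \<in> borel_measurable (bor N)" unfolding g_def using qm by measurable
  have q2: "(LINT v|sph N. (q v)\<^sup>2) = V" unfolding q_def V_def by (rule sph_var_fourth[OF N])
  have q1: "(LINT v|sph N. q v) = 0"
  proof -
    have m4: "(LINT v|sph N. v i ^ 4) = 3 * real N / (real N + 2)" if "i \<in> {1..N}" for i
    proof -
      have "1 \<in> {1..N}" "2 \<in> {1..N}" "1 \<noteq> (2::nat)" using N by auto
      then obtain k where "k \<in> {1..N}" "i \<noteq> k" by metis
      then show ?thesis using sph_moments(2)[of i N k] that by simp
    qed
    have "(LINT v|sph N. (\<Sum>k\<in>{1..N}. v k ^ 4)) = ?c"
      by (subst Bochner_Integration.integral_sum) (auto simp: m4 power2_eq_square intro!: integrable_sph_power)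
    moreover have "integrable (sph N) (\<lambda>v. \<Sum>k\<in>{1..N}. v k ^ 4)"
      by (intro Bochner_Integration.integrable_sum integrable_sph_power) auto
    ultimately show ?thesis by (simp add: q_def S.prob_space)
  qed
  have gi: "integrable (sph N) (\<lambda>v. (g v)\<^sup>2)"
  proof -
    \<comment> \<open>A nonzero value of the integral yields integrability, because non-integrable
      functions have integral 0 by convention.\<close>
    have "(LINT v|sph N. (q v)\<^sup>2) \<noteq> 0" using q2 V by simp
    then have "integrable (sph N) (\<lambda>v. (q v)\<^sup>2)" using not_integrable_integral_eq by blast
    then show ?thesis by (simp add: g_def power_divide)
  qed
  have g2m: "(\<lambda>v. (g v)\<^sup>2) \<in> borel_measurable (bor N)" using gm by measurable
  have g2: "(LINT v|sph N. (g v)\<^sup>2) = 1" using q2 V by (simp add: g_def power_divide)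
  have g1: "(LINT v|sph N. g v) = 0" using q1 by (simp add: g_def)
  have "symmetric_fun N g"
    unfolding symmetric_fun_def
  proof (intro allI impI AE_I2)
    fix \<pi> v assume p: "\<pi> permutes {1..N}"
    show "g (v \<circ> \<pi>) = g v"
      using sum.permute[OF p, of "\<lambda>k. v k ^ 4"] by (simp add: g_def q_def comp_def)
  qed
  moreover have "L2_fun N g"
    unfolding L2_fun_def integral_sphere_measure(2)[OF N1 g2m] using integral_sphere_measure(3)[OF N1 gm] gi by simp
  moreover have "L2_nrm N g = 1"
    unfolding L2_nrm_def L2_inner_def power2_eq_square[symmetric] integral_sphere_measure(1)[OF N1 g2m] g2 by simp
  moreover have "L2_inner N g (\<lambda>_. 1) = 0"
    unfolding L2_inner_def mult_1_right integral_sphere_measure(1)[OF N1 gm] g1 ..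
  ultimately show ?thesis by blast
qed

text \<open>Reduces lower bounds for the gap to functions measurable on the whole product space,
  with the normalisation replaced by homogeneity.\<close>

lemma spectral_gap_geI:
  assumes N: "N \<ge> 2"
    and bound: "\<And>f. adm N f \<Longrightarrow> (LINT v|sph N. f v) = 0 \<Longrightarrow> c * (LINT v|sph N. (f v)\<^sup>2) \<le> dirichlet_form \<gamma> N f"
  shows "c \<le> spectral_gap \<gamma> N"
  unfolding spectral_gap_def
proof (rule cInf_greatest)
  show "{dirichlet_form \<gamma> N f |f. L2_fun N f \<and> L2_nrm N f = 1 \<and> L2_inner N f (\<lambda>_. 1) = 0 \<and> symmetric_fun N f} \<noteq> {}"
    using gap_set_nonempty[OF N] by blast
  fix y assume "y \<in> {dirichlet_form \<gamma> N f |f. L2_fun N f \<and> L2_nrm N f = 1 \<and> L2_inner N f (\<lambda>_. 1) = 0 \<and> symmetric_fun N f}"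
  then obtain f where f: "y = dirichlet_form \<gamma> N f" "L2_fun N f" "L2_nrm N f = 1" "L2_inner N f (\<lambda>_. 1) = 0" "symmetric_fun N f"
    by blast
  have N1: "N \<ge> 1" using N by simp
  obtain g where g: "adm N g" "dirichlet_form \<gamma> N f = dirichlet_form \<gamma> N g"
    "L2_inner N f f = (LINT v|sph N. (g v)\<^sup>2)" "L2_inner N f (\<lambda>_. 1) = (LINT v|sph N. g v)"
    using extend_from_sphere[OF N1 f(2,5)] by blast
  have "L2_inner N f f = 1" using f(3) by (simp add: L2_nrm_def)
  then show "c \<le> y" using bound[OF g(1)] g f by simp
qed

lemma spectral_gap_nonneg: "N \<ge> 2 \<Longrightarrow> 0 \<le> spectral_gap \<gamma> N"
  by (rule spectral_gap_geI) (simp_all add: dirichlet_form_nonneg)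

text \<open>For y = v_1^2 + v_2^2 <= N and \<gamma> <= 1, the factor y^(\<gamma>-1) is at least
  N^(\<gamma>-1). This supplies the starting value of the recursion for general \<gamma>.\<close>

lemma spectral_gap_compare_one:
  assumes N: "N \<ge> 2" and \<gamma>: "0 \<le> \<gamma>" "\<gamma> \<le> 1"
  shows "real N powr (\<gamma> - 1) * spectral_gap 1 N \<le> spectral_gap \<gamma> N"
proof (rule spectral_gap_geI[OF N])
  fix f assume f: "adm N f" and f0: "(LINT v|sph N. f v) = 0"
  have fm: "f \<in> borel_measurable (bor N)" "sqi (sph N) f" using f by (auto simp: adm_def)
  have ij: "1 \<in> {1..N}" "2 \<in> {1..N}" "1 \<noteq> (2::nat)" and N1: "N \<ge> 1" using N by auto
  have "(LINT v|sph N. real N powr (\<gamma> - 1) * pair_term 1 1 2 f v) \<le> (LINT v|sph N. pair_term \<gamma> 1 2 f v)"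
  proof (rule integral_mono_AE)
    show "integrable (sph N) (\<lambda>v. real N powr (\<gamma> - 1) * pair_term 1 1 2 f v)"
      by (intro integrable_mult_right pair_term_integrable[OF ij fm]) simp
    show "integrable (sph N) (pair_term \<gamma> 1 2 f)" by (rule pair_term_integrable[OF ij fm \<gamma>(1)])
    show "AE v in sph N. real N powr (\<gamma> - 1) * pair_term 1 1 2 f v \<le> pair_term \<gamma> 1 2 f v"
      using AE_sph_kac[OF N1]
    proof eventually_elim
      case (elim v)
      let ?y = "(v 1)\<^sup>2 + (v 2)\<^sup>2"
      have "(\<Sum>k\<in>{1,2}. (v k)\<^sup>2) \<le> (\<Sum>k\<in>{1..N}. (v k)\<^sup>2)" using ij by (intro sum_mono2) auto
      then have y: "?y \<le> real N" using elim by (simp add: kac_sphere_def)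
      have "real N powr (\<gamma> - 1) * ?y powr 1 \<le> ?y powr \<gamma>"
      \<comment> \<open>At 0 both sides vanish, since 0 raised by \<open>powr\<close> to any
        exponent is 0.\<close>
      proof (cases "?y = 0")
        case False
        then have yp: "?y > 0" by (simp add: less_le)
        have "real N powr (\<gamma> - 1) * ?y powr 1 \<le> ?y powr (\<gamma> - 1) * ?y powr 1"
          using y yp \<gamma> by (intro mult_right_mono powr_mono2') auto
        also have "\<dots> = ?y powr \<gamma>" by (subst powr_add[symmetric]) simp
        finally show ?thesis .
      qed (simp only: powr_zero_eq_one powr_0 mult_zero_right order_refl)
      then show ?case unfolding pair_term_def by (simp only: mult.assoc[symmetric]) (rule mult_right_mono, auto)
    qed
  qed
  then have D: "real N powr (\<gamma> - 1) * dirichlet_form 1 N f \<le> dirichlet_form \<gamma> N f"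
    unfolding dirichlet_form_sym[OF f N] by (simp add: mult.left_commute mult_left_mono)
  have "spectral_gap 1 N * (LINT v|sph N. (f v)\<^sup>2) \<le> dirichlet_form 1 N f"
    using spectral_gap_variance[OF f N, of 1] f0 by simp
  then have "real N powr (\<gamma> - 1) * (spectral_gap 1 N * (LINT v|sph N. (f v)\<^sup>2)) \<le> real N powr (\<gamma> - 1) * dirichlet_form 1 N f"
    by (intro mult_left_mono) auto
  then show "real N powr (\<gamma> - 1) * spectral_gap 1 N * (LINT v|sph N. (f v)\<^sup>2) \<le> dirichlet_form \<gamma> N f"
    using D by (simp add: mult.assoc)
qed

subsection \<open>The recursion for \<open>\<gamma> = 1\<close>\<close>

text \<open>With \<open>t_le\<close> inserted into \<open>conditional_bound_one\<close>, the
  coefficient of F is N - (1 + 1/n) (1 + 3/(n + 2)), which equals n (1 - (4N + 1) / ((N - 1)^2 (N +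
  1))): the origin of the factors in the finite product.\<close>

lemma gap_recursion_one:
  assumes n: "n \<ge> 2"
  shows "(1 - (4 * real (Suc n) + 1) / ((real (Suc n) - 1)\<^sup>2 * (real (Suc n) + 1))) * spectral_gap 1 n \<le> spectral_gap 1 (Suc n)"
proof (rule spectral_gap_geI)
  show "Suc n \<ge> 2" using n by simp
  fix f assume f: "adm (Suc n) f" and f0: "(LINT v|sph (Suc n). f v) = 0"
  interpret mean_zero n f by unfold_locales (rule n f f0)+
  let ?E = "LINT v|sph (Suc n). wt n (v (Suc n)) powr 1 * (f v - \<phi> (v (Suc n)))\<^sup>2"
  have gap: "0 \<le> spectral_gap 1 n" by (rule spectral_gap_nonneg[OF n])
  let ?n = "real n"
  have np: "?n > 0" using n by simp
  have "(1 + 1 / ?n) * t \<le> (1 + 1 / ?n) * ((1 + 3 / (?n + 2)) * F)" using np by (intro mult_left_mono t_le) auto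
  then have "(?n + 1) * ?E \<ge> (?n + 1) * F - (1 + 1 / ?n) * ((1 + 3 / (?n + 2)) * F)"
    using conditional_bound_one by linarith
  also have "(?n + 1) * F - (1 + 1 / ?n) * ((1 + 3 / (?n + 2)) * F) = ?n * (1 - (4 * real (Suc n) + 1) / ((real (Suc n) - 1)\<^sup>2 * (real (Suc n) + 1))) * F"
  proof -
    have "x + 1 - (1 + 1 / x) * (1 + 3 / (x + 2)) = x * (1 - (4 * (x + 1) + 1) / (x\<^sup>2 * (x + 2)))" if "x > 0" for x :: real
    proof -
      have 1: "(1 + 1 / x) * (1 + 3 / (x + 2)) = 1 + (4 * x + 5) / (x * (x + 2))"
        using that by (simp add: divide_simps) (simp add: algebra_simps)
      have 2: "x * ((4 * (x + 1) + 1) / (x\<^sup>2 * (x + 2))) = (4 * x + 5) / (x * (x + 2))"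
        using that by (simp add: power2_eq_square add.commute)
      show ?thesis unfolding 1 right_diff_distrib 2 by simp
    qed
    from this[OF np] have "(?n + 1 - (1 + 1 / ?n) * (1 + 3 / (?n + 2))) * F = ?n * (1 - (4 * (?n + 1) + 1) / (?n\<^sup>2 * (?n + 2))) * F" by simp
    moreover have "real (Suc n) = ?n + 1" "?n + 1 - 1 = ?n" "?n + 1 + 1 = ?n + 2" by simp_all
    ultimately show ?thesis by (simp only: left_diff_distrib mult.assoc)
  qed
  finally have E: "?n * (1 - (4 * real (Suc n) + 1) / ((real (Suc n) - 1)\<^sup>2 * (real (Suc n) + 1))) * F \<le> (?n + 1) * ?E" .
  have "(1 - (4 * real (Suc n) + 1) / ((real (Suc n) - 1)\<^sup>2 * (real (Suc n) + 1))) * spectral_gap 1 n * F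
     = spectral_gap 1 n / ?n * (?n * (1 - (4 * real (Suc n) + 1) / ((real (Suc n) - 1)\<^sup>2 * (real (Suc n) + 1))) * F)"
    using np by (simp del: of_nat_Suc)
  also have "\<dots> \<le> spectral_gap 1 n / ?n * ((?n + 1) * ?E)"
    using gap np by (intro mult_left_mono E) auto
  also have "\<dots> = real (Suc n) / ?n * spectral_gap 1 n * ?E" by (simp add: add.commute)
  also have "\<dots> \<le> dirichlet_form 1 (Suc n) f"
    using dirichlet_form_conditional[OF f n, of 1] unfolding \<phi>_def by simp
  finally show "(1 - (4 * real (Suc n) + 1) / ((real (Suc n) - 1)\<^sup>2 * (real (Suc n) + 1))) * spectral_gap 1 n * (LINT v|sph (Suc n). (f v)\<^sup>2) \<le> dirichlet_form 1 (Suc n) f"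
    unfolding F_def .
qed

subsection \<open>The case \<open>N = 2\<close>\<close>

text \<open>On the circle the rotation average is the mean, and the weight is constantly \<open>2\<close>.\<close>

definition circ :: "real \<Rightarrow> nat \<Rightarrow> real" where
  "circ a = (\<lambda>j\<in>{1..2}. if j = 1 then sqrt 2 * cos a else sqrt 2 * sin a)"

lemma circ_measurable: "circ \<in> measurable borel (bor 2)"
  unfolding circ_def by (rule measurable_restrict) auto

lemma circ_period: "circ (a + 2 * pi) = circ a"
  by (simp add: circ_def fun_eq_iff restrict_def)

lemma rot_circ: "rot 1 2 \<theta> (circ a) = circ (a - \<theta>)"
proof
  fix k show "rot 1 2 \<theta> (circ a) k = circ (a - \<theta>) k"
    by (auto simp: rot_def circ_def cos_diff sin_diff algebra_simps)
qed

lemma kac_circ: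
  assumes "v \<in> kac_sphere 2"
  obtains a where "0 \<le> a" "a < 2 * pi" "v = circ a"
proof -
  have I: "{1..2::nat} = {1, 2}" by auto
  have "(v 1)\<^sup>2 + (v 2)\<^sup>2 = 2" using assms unfolding kac_sphere_def I by simp
  then have "(v 1 / sqrt 2)\<^sup>2 + (v 2 / sqrt 2)\<^sup>2 = 1" by (simp add: power_divide flip: add_divide_distrib)
  then obtain a where a: "0 \<le> a" "a < 2 * pi" "v 1 / sqrt 2 = cos a" "v 2 / sqrt 2 = sin a"
    using sincos_total_2pi by metis
  have "v = circ a"
  proof
    fix k
    have "v k = undefined" if "k \<notin> {1..2}" using assms that by (auto simp: kac_sphere_def PiE_iff extensional_def)
    then show "v k = circ a k" using a(3,4) unfolding circ_def restrict_def I by (auto simp: field_simps)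
  qed
  then show ?thesis using that a by blast
qed

text \<open>Reflection turns the interval into [a - pi, a + pi], and the part beyond pi is shifted
  back by one period.\<close>

lemma nn_integral_periodic:
  fixes F :: "real \<Rightarrow> ennreal"
  assumes [measurable]: "F \<in> borel_measurable borel" and per: "\<And>x. F (x + 2 * pi) = F x" and a: "0 \<le> a" "a \<le> 2 * pi"
  shows "(\<integral>\<^sup>+\<theta>. indicator {-pi..pi} \<theta> * F (a - \<theta>) \<partial>lborel) = (\<integral>\<^sup>+\<theta>. indicator {-pi..pi} \<theta> * F \<theta> \<partial>lborel)"
proof -
  have ae: "AE x in lborel. x \<noteq> c" for c :: real by (rule AE_lborel_singleton)
  have "(\<integral>\<^sup>+\<theta>. indicator {-pi..pi} \<theta> * F (a - \<theta>) \<partial>lborel) = (\<integral>\<^sup>+\<theta>. indicator {-pi..pi} (a + (-1) * \<theta>) * F (a - (a + (-1) * \<theta>)) \<partial>lborel)"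
    by (subst nn_integral_real_affine[where c="-1" and t=a]) auto
  also have "\<dots> = (\<integral>\<^sup>+\<theta>. indicator {a-pi..pi} \<theta> * F \<theta> + indicator {pi..a+pi} \<theta> * F \<theta> \<partial>lborel)"
  proof (rule nn_integral_cong_AE)
    show "AE \<theta> in lborel. indicator {-pi..pi} (a + (-1) * \<theta>) * F (a - (a + (-1) * \<theta>)) = indicator {a-pi..pi} \<theta> * F \<theta> + indicator {pi..a+pi} \<theta> * F \<theta>"
      using ae[of pi]
    proof eventually_elim
      case (elim \<theta>)
      then show ?case using a by (cases "\<theta> < pi") (auto simp: indicator_def)
    qed
  qed
  also have "\<dots> = (\<integral>\<^sup>+\<theta>. indicator {a-pi..pi} \<theta> * F \<theta> \<partial>lborel) + (\<integral>\<^sup>+\<theta>. indicator {pi..a+pi} \<theta> * F \<theta> \<partial>lborel)"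
    by (rule nn_integral_add) auto
  also have "(\<integral>\<^sup>+\<theta>. indicator {pi..a+pi} \<theta> * F \<theta> \<partial>lborel) = (\<integral>\<^sup>+\<theta>. indicator {pi..a+pi} (2 * pi + 1 * \<theta>) * F (2 * pi + 1 * \<theta>) \<partial>lborel)"
    by (subst nn_integral_real_affine[where c=1 and t="2 * pi"]) auto
  also have "\<dots> = (\<integral>\<^sup>+\<theta>. indicator {-pi..a-pi} \<theta> * F \<theta> \<partial>lborel)"
    using per by (intro nn_integral_cong) (auto simp: indicator_def add.commute)
  also have "(\<integral>\<^sup>+\<theta>. indicator {a-pi..pi} \<theta> * F \<theta> \<partial>lborel) + \<dots> = (\<integral>\<^sup>+\<theta>. indicator {a-pi..pi} \<theta> * F \<theta> + indicator {-pi..a-pi} \<theta> * F \<theta> \<partial>lborel)"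
    by (rule nn_integral_add[symmetric]) auto
  also have "\<dots> = (\<integral>\<^sup>+\<theta>. indicator {-pi..pi} \<theta> * F \<theta> \<partial>lborel)"
  proof (rule nn_integral_cong_AE)
    show "AE \<theta> in lborel. indicator {a-pi..pi} \<theta> * F \<theta> + indicator {-pi..a-pi} \<theta> * F \<theta> = indicator {-pi..pi} \<theta> * F \<theta>"
      using ae[of "a - pi"]
    proof eventually_elim
      case (elim \<theta>)
      then show ?case using a by (cases "\<theta> < a - pi") (auto simp: indicator_def)
    qed
  qed
  finally show ?thesis .
qed

text \<open>The average at \<open>circ a\<close> is an integral of f against the image of the angle
  measure under a reflected and shifted parametrisation of the circle; by periodicity this image is
  the same for all a.\<close>

lemma rot_avg_circle:
  assumes f: "f \<in> borel_measurable (bor 2)"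
  shows "\<exists>C. \<forall>v\<in>kac_sphere 2. rot_avg 1 2 f v = C"
proof -
  define U where "U = density lborel (\<lambda>\<theta>. indicator {-pi..pi} \<theta> :: ennreal)"
  have m: "(\<lambda>\<theta>. circ (a - \<theta>)) \<in> measurable U (bor 2)" for a
  proof -
    have "(\<lambda>\<theta>. circ (a - \<theta>)) \<in> measurable borel (bor 2)"
      by (rule measurable_compose[OF _ circ_measurable]) simp
    then show ?thesis by (simp add: U_def cong: measurable_cong_sets)
  qed
  have m0: "circ \<in> measurable U (bor 2)"
    using circ_measurable by (simp add: U_def cong: measurable_cong_sets)
  have D: "distr U (bor 2) (\<lambda>\<theta>. circ (a - \<theta>)) = distr U (bor 2) circ" if a: "0 \<le> a" "a < 2 * pi" for a
  proof (rule measure_eqI)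
    fix A assume "A \<in> sets (distr U (bor 2) (\<lambda>\<theta>. circ (a - \<theta>)))"
    then have A [measurable]: "A \<in> sets (bor 2)" by simp
    have iA: "(indicator A :: _ \<Rightarrow> ennreal) \<in> borel_measurable (bor 2)" by simp
    have ic [measurable]: "(\<lambda>\<theta>. indicator A (circ \<theta>) :: ennreal) \<in> borel_measurable borel"
      by (rule measurable_compose[OF circ_measurable iA])
    have ica [measurable]: "(\<lambda>\<theta>. indicator A (circ (a - \<theta>)) :: ennreal) \<in> borel_measurable borel"
      by measurable
    have "emeasure (distr U (bor 2) (\<lambda>\<theta>. circ (a - \<theta>))) A = (\<integral>\<^sup>+v. indicator A v \<partial>distr U (bor 2) (\<lambda>\<theta>. circ (a - \<theta>)))" by simp
    also have "\<dots> = (\<integral>\<^sup>+\<theta>. indicator A (circ (a - \<theta>)) \<partial>U)" by (rule nn_integral_distr[OF m]) simp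
    also have "\<dots> = (\<integral>\<^sup>+\<theta>. indicator {-pi..pi} \<theta> * indicator A (circ (a - \<theta>)) \<partial>lborel)"
      unfolding U_def by (rule nn_integral_density) (simp_all add: ica)
    also have "\<dots> = (\<integral>\<^sup>+\<theta>. indicator {-pi..pi} \<theta> * indicator A (circ \<theta>) \<partial>lborel)"
      using a by (intro nn_integral_periodic) (simp_all add: circ_period ic)
    also have "\<dots> = (\<integral>\<^sup>+\<theta>. indicator A (circ \<theta>) \<partial>U)"
      unfolding U_def by (rule nn_integral_density[symmetric]) (simp_all add: ic)
    also have "\<dots> = (\<integral>\<^sup>+v. indicator A v \<partial>distr U (bor 2) circ)" by (rule nn_integral_distr[OF m0, symmetric]) simp
    also have "\<dots> = emeasure (distr U (bor 2) circ) A" by simp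
    finally show "emeasure (distr U (bor 2) (\<lambda>\<theta>. circ (a - \<theta>))) A = emeasure (distr U (bor 2) circ) A" .
  qed simp
  have "rot_avg 1 2 f v = 1 / (2 * pi) * (LINT v|distr U (bor 2) circ. f v)" if v: "v \<in> kac_sphere 2" for v
  proof -
    obtain a where a: "0 \<le> a" "a < 2 * pi" "v = circ a" using kac_circ[OF v] .
    have fa: "(\<lambda>\<theta>. f (circ (a - \<theta>))) \<in> borel_measurable lborel"
      using measurable_compose[OF m f] by (simp add: U_def cong: measurable_cong_sets)
    have "(LINT \<theta>|lborel. indicator {-pi..pi} \<theta> * f (circ (a - \<theta>))) = (LINT \<theta>|U. f (circ (a - \<theta>)))"
    proof -
      have U: "U = density lborel (\<lambda>\<theta>. ennreal (indicator {-pi..pi} \<theta>))" by (simp add: U_def ennreal_indicator)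
      show ?thesis unfolding U using fa by (subst integral_density) auto
    qed
    also have "\<dots> = (LINT v|distr U (bor 2) (\<lambda>\<theta>. circ (a - \<theta>)). f v)" by (rule integral_distr[OF m f, symmetric])
    finally show ?thesis unfolding rot_avg_eq a(3) rot_circ D[OF a(1,2)] by simp
  qed
  then show ?thesis by blast
qed

text \<open>The constant 4 is the prefactor N = 2 times the weight v_1^2 + v_2^2 = 2. Subtracting a
  constant from a function of mean zero does not decrease its second moment.\<close>

lemma gap_two: "4 \<le> spectral_gap 1 2"
proof (rule spectral_gap_geI)
  fix f assume f: "adm 2 f" and f0: "(LINT v|sph 2. f v) = 0"
  interpret S: prob_space "sph 2" by (rule prob_space_sph)
  have fm [measurable]: "f \<in> borel_measurable (bor 2)" and fs: "sqi (sph 2) f" using f by (auto simp: adm_def)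
  have ij: "1 \<in> {1..2::nat}" "2 \<in> {1..2::nat}" "1 \<noteq> (2::nat)" by auto
  obtain C where C: "\<And>v. v \<in> kac_sphere 2 \<Longrightarrow> rot_avg 1 2 f v = C" using rot_avg_circle[OF fm] by blast
  have I: "{1..2::nat} = {1, 2}" by auto
  have "(LINT v|sph 2. pair_term 1 1 2 f v) = (LINT v|sph 2. 2 * ((f v)\<^sup>2 - 2 * C * f v + C\<^sup>2))"
  proof (rule integral_cong_AE)
    show "AE v in sph 2. pair_term 1 1 2 f v = 2 * ((f v)\<^sup>2 - 2 * C * f v + C\<^sup>2)"
      using AE_sph_kac[of 2, simplified]
    proof eventually_elim
      case (elim v)
      then have "(v 1)\<^sup>2 + (v 2)\<^sup>2 = 2" unfolding kac_sphere_def I by simp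
      then show ?case unfolding pair_term_def C[OF elim] by (simp add: power2_diff)
    qed
    show "pair_term 1 1 2 f \<in> borel_measurable (sph 2)" using pair_term_measurable[OF ij fm] by (simp add: meas_sph)
  qed (simp add: meas_sph)
  also have "\<dots> = 2 * ((LINT v|sph 2. (f v)\<^sup>2) + C\<^sup>2)"
    using S.sqi_integrable[OF fs] sqiD(2)[OF fs] by (simp add: S.prob_space f0)
  finally have "dirichlet_form 1 2 f = 4 * ((LINT v|sph 2. (f v)\<^sup>2) + C\<^sup>2)"
    by (simp add: dirichlet_form_sym[OF f])
  then show "4 * (LINT v|sph 2. (f v)\<^sup>2) \<le> dirichlet_form 1 2 f" by simp
qed simp

subsection \<open>Numerical comparison of the constants\<close>

context
  fixes x :: real
  assumes x: "x \<ge> 5"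
begin

text \<open>\<open>r_poly x\<close> without one factor x - 1, where x^2 + 4x - 12 = (x + 6) (x - 2).
  Likewise p' and q' are the numerators divided by x^2.\<close>

private definition d :: real where "d = (x + 6) * (x - 2)\<^sup>2 * (x - 1)\<^sup>2 * (x + 1)"
private definition p' :: real where "p' = 5 * x^5 + 31 * x^4 + 15 * x^3 + 131 * x^2 + 256 * x - 102"
private definition q' :: real where "q' = 5 * x^5 - 5 * x^4 - 87 * x^3 - 211 * x^2 - 164 * x + 78"

text \<open>Polynomial inequalities for x >= 5 are certified by expanding the difference in u = x -
  5, where all coefficients come out nonnegative.\<close>

private lemma shift:
  obtains u where "u \<ge> 0" "x = u + 5"
  using x that[of "x - 5"] by simp

private lemma d_pos: "d > 0"
  using x unfolding d_def by (intro mult_pos_pos) auto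

private lemma r_eq: "r_poly x = (x - 1) * d" and p_eq: "p_poly x = x\<^sup>2 * p'" and q_eq: "q_poly x = x\<^sup>2 * q'"
  unfolding r_poly_def d_def p_poly_def p'_def q_poly_def q'_def by algebra+

text \<open>5 is the leading coefficient of p'. The numbers 22 and 160 are matched to
  \<open>K_bound\<close>: together with the contribution of 5 + 25/x they give the numerator 10 x^2
  + 42 x + 135.\<close>

private lemma p_bound: "5 / x + 22 / x ^ 2 + 160 / x ^ 3 \<le> p' / d"
proof -
  obtain u where u: "u \<ge> 0" "x = u + 5" using shift .
  have "p' * x ^ 3 - (5 * x ^ 2 + 22 * x + 160) * d = 1411920 * u ^ 0 + 1295592 * u ^ 1 + 452898 * u ^ 2 + 76282 * u ^ 3 + 7550 * u ^ 4 + 802 * u ^ 5 + 88 * u ^ 6 + 4 * u ^ 7"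
    unfolding p'_def d_def unfolding u(2) by algebra
  also have "\<dots> \<ge> 0" using u(1) by simp
  finally have "(5 * x ^ 2 + 22 * x + 160) / x ^ 3 \<le> p' / d"
    using d_pos x by (simp add: field_simps)
  moreover have "(5 * x ^ 2 + 22 * x + 160) / x ^ 3 = 5 / x + 22 / x ^ 2 + 160 / x ^ 3"
    using x by (simp add: add_divide_distrib power2_eq_square power3_eq_cube)
  ultimately show ?thesis by simp
qed

private lemma pq_bound: "10 / x \<le> (p' + q') / d"
proof -
  obtain u where u: "u \<ge> 0" "x = u + 5" using shift .
  have "(p' + q') * x - 10 * d = 89640 * u ^ 0 + 92286 * u ^ 1 + 36162 * u ^ 2 + 6650 * u ^ 3 + 558 * u ^ 4 + 16 * u ^ 5"
    unfolding p'_def q'_def d_def unfolding u(2) by algebra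
  also have "\<dots> \<ge> 0" using u(1) by simp
  finally show ?thesis using d_pos x by (simp add: field_simps)
qed

private lemma p'_nonneg: "p' \<ge> 0"
proof -
  obtain u where u: "u \<ge> 0" "x = u + 5" using shift .
  have "p' = 41328 * u ^ 0 + 33816 * u ^ 1 + 11256 * u ^ 2 + 1885 * u ^ 3 + 156 * u ^ 4 + 5 * u ^ 5" unfolding p'_def unfolding u(2) by algebra
  also have "\<dots> \<ge> 0" using u(1) by simp
  finally show ?thesis .
qed

private lemma pq'_nonneg: "p' + q' \<ge> 0"
proof -
  obtain u where u: "u \<ge> 0" "x = u + 5" using shift .
  have "p' + q' = 36936 * u ^ 0 + 38142 * u ^ 1 + 15240 * u ^ 2 + 2948 * u ^ 3 + 276 * u ^ 4 + 10 * u ^ 5" unfolding p'_def q'_def unfolding u(2) by algebra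
  also have "\<dots> \<ge> 0" using u(1) by simp
  finally show ?thesis .
qed

lemma A_numerator_bounds:
  "p_poly x / r_poly x \<ge> 0" "(p_poly x + q_poly x) / r_poly x \<ge> 0"
proof -
  have "(x - 1) * d > 0" using x d_pos by simp
  then show "p_poly x / r_poly x \<ge> 0" "(p_poly x + q_poly x) / r_poly x \<ge> 0"
    unfolding r_eq p_eq q_eq using p'_nonneg pq'_nonneg by (simp_all flip: distrib_left)
qed

text \<open>The case \<gamma> = 1 at the largest admissible t. Both sides are compared with 1 +
  10/x, where 10 is the leading coefficient of p' + q'.\<close>

lemma numeric_one:
  "x * (x + 4) / (x\<^sup>2 - 1) \<le> 1 + (x - 1) * ((p_poly x + q_poly x) / r_poly x) / x\<^sup>2"
proof -
  have "0 \<le> x * (6 * x - 1) - 10"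
  proof -
    have "5 * (6 * 5 - 1) \<le> x * (6 * x - 1)" using x by (intro mult_mono) auto
    then show ?thesis by simp
  qed
  then have "x * x * (x + 4) \<le> (x + 10) * (x\<^sup>2 - 1)" by (simp add: power2_eq_square algebra_simps)
  moreover have "x\<^sup>2 > 1" using x by (simp add: power2_eq_square less_1_mult)
  ultimately have "x * (x + 4) / (x\<^sup>2 - 1) \<le> (x + 10) / x" using x by (simp add: divide_simps mult_ac)
  also have "\<dots> = 1 + 10 / x" using x by (simp add: add_divide_distrib)
  also have "\<dots> \<le> 1 + (p' + q') / d" using pq_bound by simp
  also have "(p' + q') / d = (x - 1) * ((p_poly x + q_poly x) / r_poly x) / x\<^sup>2"
    using x by (simp add: r_eq p_eq q_eq flip: distrib_left)
  finally show ?thesis .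
qed

private lemma K_bound: "1 + (10 * x ^ 2 + 42 * x + 135) / x ^ 3 \<le> 1 + (x - 1) * (p_poly x / r_poly x + (5 + 25 / x)) / x\<^sup>2"
proof -
  have "(x - 1) * (p_poly x / r_poly x) / x\<^sup>2 = p' / d"
    using x by (simp add: r_eq p_eq)
  moreover have "(x - 1) * (5 + 25 / x) / x\<^sup>2 = (5 * x\<^sup>2 + 20 * x - 25) / x ^ 3"
    using x by (simp add: field_simps power2_eq_square power3_eq_cube)
  moreover have "(10 * x ^ 2 + 42 * x + 135) / x ^ 3 = (5 / x + 22 / x ^ 2 + 160 / x ^ 3) + (5 * x\<^sup>2 + 20 * x - 25) / x ^ 3"
    using x by (simp add: field_simps power2_eq_square power3_eq_cube)
  ultimately show ?thesis using p_bound by (simp add: distrib_left add_divide_distrib)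
qed

text \<open>The case \<gamma> = 0: relative to F the loss is affine in the rescaled t, with value Y
  at the lower end and the second expression at the upper end. Both lie below (x^3 + 10 x^2 + 42 x +
  135) / x^3, which lies below K.\<close>

lemma numeric_zero:
  defines "Y \<equiv> x / (x - 1) + 7 / x"
    and "K \<equiv> 1 + (x - 1) * (p_poly x / r_poly x + (5 + 25 / x)) / x\<^sup>2"
  shows "Y \<le> K"
    and "9 / (x + 1)\<^sup>2 * Y + (x + 4) / (x + 1) * (1 + (12 / ((x - 1) * (x + 1)) + 4 / x + 2 / (x - 1) * (1 + 3 / x) + 9 / (x + 1)\<^sup>2)) \<le> K"
proof -
  let ?k = "x ^ 3 + 10 * x ^ 2 + 42 * x + 135"
  have K: "?k / x ^ 3 \<le> K"
  proof -
    have "?k / x ^ 3 = 1 + (10 * x ^ 2 + 42 * x + 135) / x ^ 3" using x by (simp add: add_divide_distrib)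
    then show ?thesis unfolding K_def using K_bound by simp
  qed
  have nz: "x \<noteq> 0" "x - 1 \<noteq> 0" "x + 1 \<noteq> 0" "x > 0" "x - 1 > 0" "x + 1 > 0" using x by auto
  have Y: "Y = (x\<^sup>2 + 7 * (x - 1)) / (x * (x - 1))"
    unfolding Y_def using nz by (simp add: field_simps power2_eq_square)
  show "Y \<le> K"
  proof -
    obtain u where u: "u \<ge> 0" "x = u + 5" using shift .
    have "?k * (x - 1) - (x\<^sup>2 + 7 * (x - 1)) * x ^ 2 = 1555 * u ^ 0 + 633 * u ^ 1 + 69 * u ^ 2 + 2 * u ^ 3" unfolding u(2) by algebra
    also have "\<dots> \<ge> 0" using u(1) by simp
    finally have "(x\<^sup>2 + 7 * (x - 1)) * x ^ 2 / (x ^ 3 * (x - 1)) \<le> ?k * (x - 1) / (x ^ 3 * (x - 1))"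
      using nz by (intro divide_right_mono) auto
    also have "?k * (x - 1) / (x ^ 3 * (x - 1)) = ?k / x ^ 3" using nz by simp
    also have "(x\<^sup>2 + 7 * (x - 1)) * x ^ 2 / (x ^ 3 * (x - 1)) = Y" unfolding Y using nz by (simp add: power2_eq_square power3_eq_cube)
    finally show ?thesis using K by simp
  qed
  let ?m = "x ^ 3 * (x + 1) ^ 3 * (x - 1)"
  let ?a = "9 * (x\<^sup>2 + 7 * (x - 1)) * (x + 1) * x\<^sup>2"
  let ?b = "x ^ 3 * (x + 1)\<^sup>2 * (x - 1) + 12 * x ^ 3 * (x + 1) + 4 * x\<^sup>2 * (x + 1)\<^sup>2 * (x - 1) + 2 * (x + 3) * x\<^sup>2 * (x + 1)\<^sup>2 + 9 * x ^ 3 * (x - 1)"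
  have m: "?m > 0" using nz by simp
  have a: "9 / (x + 1)\<^sup>2 * Y = ?a / ?m"
    unfolding Y using nz by (simp add: power2_eq_square power3_eq_cube)
  have b: "1 + (12 / ((x - 1) * (x + 1)) + 4 / x + 2 / (x - 1) * (1 + 3 / x) + 9 / (x + 1)\<^sup>2) = ?b / (x ^ 3 * (x + 1)\<^sup>2 * (x - 1))"
  proof -
    have q: "a / b = y / z" if "b \<noteq> 0" "z \<noteq> 0" "a * z = y * b" for a b y z :: real
      using that by (simp add: frac_eq_eq)
    have e: "12 / ((x - 1) * (x + 1)) = 12 * x ^ 3 * (x + 1) / (x ^ 3 * (x + 1)\<^sup>2 * (x - 1))"
      "4 / x = 4 * x\<^sup>2 * (x + 1)\<^sup>2 * (x - 1) / (x ^ 3 * (x + 1)\<^sup>2 * (x - 1))"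
      "9 / (x + 1)\<^sup>2 = 9 * x ^ 3 * (x - 1) / (x ^ 3 * (x + 1)\<^sup>2 * (x - 1))"
      "1 = x ^ 3 * (x + 1)\<^sup>2 * (x - 1) / (x ^ 3 * (x + 1)\<^sup>2 * (x - 1))"
      by ((rule q, use nz in simp, use nz in simp, algebra)+, use nz in simp)
    have "1 + 3 / x = (x + 3) / x" using nz by (simp add: add_divide_distrib)
    then have f: "2 / (x - 1) * (1 + 3 / x) = 2 * (x + 3) * x\<^sup>2 * (x + 1)\<^sup>2 / (x ^ 3 * (x + 1)\<^sup>2 * (x - 1))"
      using nz by (simp add: power2_eq_square power3_eq_cube)
    show ?thesis unfolding f by (subst e(1), subst e(2), subst e(3), subst e(4)) (simp only: add_divide_distrib add.assoc)
  qed
  obtain u where u: "u \<ge> 0" "x = u + 5" using shift .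
  have "?k * ((x + 1) ^ 3 * (x - 1)) - (?a + (x + 4) * ?b) = 7830 * u ^ 0 + 3348 * u ^ 1 + 621 * u ^ 2 + 389 * u ^ 3 + 147 * u ^ 4 + 21 * u ^ 5 + 1 * u ^ 6" unfolding u(2) by algebra
  also have "\<dots> \<ge> 0" using u(1) by simp
  finally have "(?a + (x + 4) * ?b) / ?m \<le> ?k * ((x + 1) ^ 3 * (x - 1)) / ?m"
    using m by (intro divide_right_mono) auto
  also have "?k * ((x + 1) ^ 3 * (x - 1)) / ?m = ?k / x ^ 3" using nz by simp
  also have "\<dots> \<le> K" by (rule K)
  also have "(?a + (x + 4) * ?b) / ?m = ?a / ?m + (x + 4) / (x + 1) * (?b / (x ^ 3 * (x + 1)\<^sup>2 * (x - 1)))"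
  proof -
    have "?m = (x + 1) * (x ^ 3 * (x + 1)\<^sup>2 * (x - 1))" by algebra
    then have "(x + 4) / (x + 1) * (?b / (x ^ 3 * (x + 1)\<^sup>2 * (x - 1))) = (x + 4) * ?b / ?m"
      by (simp only: times_divide_times_eq)
    then show ?thesis by (simp only: add_divide_distrib[of ?a])
  qed
  finally show "9 / (x + 1)\<^sup>2 * Y + (x + 4) / (x + 1) * (1 + (12 / ((x - 1) * (x + 1)) + 4 / x + 2 / (x - 1) * (1 + 3 / x) + 9 / (x + 1)\<^sup>2)) \<le> K"
    unfolding a b .
qed

text \<open>The right-hand side tends to sqrt 30, so 5 leaves room. After squaring, 25 + 250/x +
  625/x^2 is compared with 30 (x/(x - 1))^5 plus a term of order 1/x; Bernoulli's inequality
  supplies 1 + 5/x for the fifth power, and the last factor is at least 1.\<close>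

lemma C_bound:
  "5 + 25 / x \<le> sqrt 15 * (1 / (x - 1)^2) * x powr (5/2) *
     (2 / (x - 1) + 8 * x / ((x - 2) * (x - 4)^2)) powr (1/2) *
     (1 - 15 / ((x + 1) * (x + 3))) powr (-1/2)"
proof -
  let ?K = "2 / (x - 1) + 8 * x / ((x - 2) * (x - 4)^2)"
  let ?b = "1 - 15 / ((x + 1) * (x + 3))"
  have pos: "x > 0" "x - 1 > 0" "x - 2 > 0" "x - 4 > 0" using x by auto
  have Kp: "?K > 0" using pos by (intro add_pos_pos divide_pos_pos mult_pos_pos) auto
  have "15 < (x + 1) * (x + 3)"
  proof -
    have "6 * 8 \<le> (x + 1) * (x + 3)" using x by (intro mult_mono) auto
    then show ?thesis by simp
  qed
  then have b: "0 < ?b" "?b \<le> 1" by simp_all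
  have "?b powr (1/2) \<le> 1" using b powr_mono2[of "1/2" ?b 1] by simp
  moreover have "?b powr (1/2) > 0" using b(1) by (simp only: powr_gt_zero)
  ultimately have "1 \<le> inverse (?b powr (1/2))" by (intro one_le_inverse)
  then have b1: "1 \<le> ?b powr (-1/2)" by (simp only: powr_minus[symmetric] minus_divide_left)
  have x5: "x powr (5/2) = sqrt (x ^ 5)"
    using pos by (simp add: powr_half_sqrt[symmetric] powr_powr flip: powr_numeral)
  have "sqrt 15 * (1 / (x - 1)^2) * x powr (5/2) * ?K powr (1/2) = sqrt (15 * x ^ 5 * ?K / (x - 1) ^ 4)"
  proof -
    have "(x - 1) ^ 4 = ((x - 1)\<^sup>2)\<^sup>2" by (simp flip: power_mult)
    then have "sqrt ((x - 1) ^ 4) = (x - 1)\<^sup>2" by (simp only: real_sqrt_abs abs_power2)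
    then show ?thesis using Kp by (simp add: real_sqrt_mult real_sqrt_divide x5 powr_half_sqrt)
  qed
  moreover have "5 + 25 / x \<le> sqrt (15 * x ^ 5 * ?K / (x - 1) ^ 4)"
  proof (rule real_le_rsqrt)
    have e: "15 * x ^ 5 * ?K / (x - 1) ^ 4 = 30 * (x / (x - 1)) ^ 5 + 120 * (x ^ 6 / ((x - 1) ^ 4 * ((x - 2) * (x - 4)\<^sup>2)))"
    proof -
      have "(x - 1) ^ 5 = (x - 1) * (x - 1) ^ 4" "x ^ 6 = x * x ^ 5" by (simp_all flip: power_Suc)
      then show ?thesis using pos by (simp add: distrib_left add_divide_distrib power_divide mult_ac)
    qed
    have 1: "1 + 5 / x \<le> (x / (x - 1)) ^ 5"
    proof -
      have "1 + 5 / x \<le> 1 + real 5 * (1 / (x - 1))" using pos by (simp add: frac_le)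
      also have "\<dots> \<le> (1 + 1 / (x - 1)) ^ 5" using pos by (intro Bernoulli_inequality) (simp add: order_trans[of _ 0])
      also have "1 + 1 / (x - 1) = x / (x - 1)" using pos by (simp add: field_simps)
      finally show ?thesis .
    qed
    have 2: "1 / x + 10 / x\<^sup>2 \<le> x ^ 6 / ((x - 1) ^ 4 * ((x - 2) * (x - 4)\<^sup>2))"
    proof -
      have q: "(x + 10) * ((x - 2) * (x - 4)\<^sup>2) \<le> x ^ 4"
      proof -
        obtain u where u: "u \<ge> 0" "x = u + 5" using shift .
        have "x ^ 4 - (x + 10) * ((x - 2) * (x - 4)\<^sup>2) = 580 + 392 * u + 68 * u\<^sup>2" unfolding u(2) by algebra
        also have "\<dots> \<ge> 0" using u(1) by simp
        finally show ?thesis by simp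
      qed
      have "1 / x + 10 / x\<^sup>2 = (x + 10) / x\<^sup>2" using pos by (simp add: add_divide_distrib power2_eq_square)
      also have "\<dots> \<le> x\<^sup>2 / ((x - 2) * (x - 4)\<^sup>2)"
        using q pos by (simp add: divide_simps power2_eq_square power4_eq_xxxx mult_ac)
      also have "\<dots> = x ^ 6 / (x ^ 4 * ((x - 2) * (x - 4)\<^sup>2))"
      proof -
        have e: "x ^ 6 = x ^ 4 * x\<^sup>2" by (simp flip: power_add)
        show ?thesis unfolding e by (rule mult_divide_mult_cancel_left[symmetric]) (use pos in simp)
      qed
      also have "\<dots> \<le> x ^ 6 / ((x - 1) ^ 4 * ((x - 2) * (x - 4)\<^sup>2))"
        using pos by (intro divide_left_mono mult_right_mono power_mono mult_pos_pos zero_less_power) auto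
      finally show ?thesis .
    qed
    have "(5 + 25 / x)\<^sup>2 = 25 + 250 / x + 625 / x\<^sup>2"
      using pos by (simp add: power2_sum power_divide)
    also have "\<dots> \<le> 30 * (1 + 5 / x) + 120 * (1 / x + 10 / x\<^sup>2)"
    proof -
      have "250 / x \<le> 270 / x" "625 / x\<^sup>2 \<le> 1200 / x\<^sup>2" by (intro divide_right_mono; use pos in simp)+
      then show ?thesis by (simp add: distrib_left)
    qed
    also have "\<dots> \<le> 15 * x ^ 5 * ?K / (x - 1) ^ 4" unfolding e by (intro add_mono mult_left_mono 1 2) simp_all
    finally show "(5 + 25 / x)\<^sup>2 \<le> 15 * x ^ 5 * ?K / (x - 1) ^ 4" .
  qed
  ultimately have 1: "5 + 25 / x \<le> sqrt 15 * (1 / (x - 1)^2) * x powr (5/2) * ?K powr (1/2)" by simp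
  also have "\<dots> \<le> sqrt 15 * (1 / (x - 1)^2) * x powr (5/2) * ?K powr (1/2) * ?b powr (-1/2)"
  proof -
    have m: "c \<le> c * ?b powr (-1/2)" if "0 \<le> c" for c :: real
      using mult_left_mono[OF b1 that] by (simp only: mult_1_right)
    show ?thesis by (rule m) simp
  qed
  finally show ?thesis .
qed

end

section \<open>The loss against the constants of the theorem\<close>

lemma A_const_convex:
  "A_const \<gamma> N = (1 - \<gamma>) * (p_poly (real N) / r_poly (real N)) + \<gamma> * ((p_poly (real N) + q_poly (real N)) / r_poly (real N))"
  by (simp add: A_const_def add_divide_distrib diff_divide_distrib left_diff_distrib distrib_left)

lemma C_const_nonneg: "\<gamma> \<le> 1 \<Longrightarrow> 0 \<le> C_const \<gamma> N"
  unfolding C_const_def by (intro mult_nonneg_nonneg divide_nonneg_nonneg) auto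

lemma A_const_nonneg:
  assumes "N \<ge> 5" "0 \<le> \<gamma>" "\<gamma> \<le> 1"
  shows "0 \<le> A_const \<gamma> N"
  unfolding A_const_convex using assms A_numerator_bounds[of "real N"]
  by (intro add_nonneg_nonneg mult_nonneg_nonneg) auto

lemma C_const_ge:
  assumes "N \<ge> 5" "\<gamma> \<le> 1"
  shows "(1 - \<gamma>) * (5 + 25 / real N) \<le> C_const \<gamma> N"
proof -
  have "real N \<ge> 5" using assms by simp
  from mult_left_mono[OF C_bound[OF this], of "1 - \<gamma>"] show ?thesis
    using assms unfolding C_const_def by (simp add: mult_ac)
qed

text \<open>
  The bound is affine in \<open>\<gamma>\<close>, so it suffices to treat \<open>\<gamma> = 1\<close> and \<open>\<gamma> = 0\<close>; both are affine
  in \<open>t\<close>, whose range is parametrised by \<open>T\<close> between \<open>0\<close> and \<open>F\<close>.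
\<close>

lemma loss_le:
  fixes x \<gamma> F t a :: real
  assumes x: "x = real N" "N \<ge> 5" and \<gamma>: "0 \<le> \<gamma>" "\<gamma> \<le> 1"
    and t: "0 \<le> t" "t \<le> (1 + 3 / (x + 1)) * F" and a: "a \<le> F - t + 3 / (x + 1) * t"
  shows "(1 + \<gamma> / (x - 1)) * t + (1 - \<gamma>) * ((x / (x - 1) + 7 / x) * a
       + (12 / ((x - 1) * (x + 1)) + 4 / x + 2 / (x - 1) * (1 + 3 / x) + 9 / (x + 1)\<^sup>2) * t)
    \<le> (1 + (x - 1) * ((A_const \<gamma> N + C_const \<gamma> N) / x\<^sup>2)) * F"
proof -
  have x5: "x \<ge> 5" using x by simp
  define Y where "Y = x / (x - 1) + 7 / x"
  define Q where "Q = 12 / ((x - 1) * (x + 1)) + 4 / x + 2 / (x - 1) * (1 + 3 / x) + 9 / (x + 1)\<^sup>2"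
  define A0 where "A0 = p_poly x / r_poly x"
  define A1 where "A1 = (p_poly x + q_poly x) / r_poly x"
  define K where "K = 1 + (x - 1) * (A0 + (5 + 25 / x)) / x\<^sup>2"
  define M where "M = 1 + (x - 1) * A1 / x\<^sup>2"
  \<comment> \<open>Dividing by the largest ratio t / F allowed makes F the upper end of the range
    of T.\<close>
  define T where "T = t * ((x + 1) / (x + 4))"
  have nz: "x \<noteq> 0" "x - 1 \<noteq> 0" "x + 1 \<noteq> 0" "x + 4 \<noteq> 0" using x5 by auto
  have tT: "t = (x + 4) / (x + 1) * T" unfolding T_def using nz by simp
  have c: "1 + 3 / (x + 1) = (x + 4) / (x + 1)" using nz by (simp add: field_simps)
  have "t * ((x + 1) / (x + 4)) \<le> (x + 4) / (x + 1) * F * ((x + 1) / (x + 4))"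
    using t(2) x5 unfolding c by (intro mult_right_mono) auto
  then have T: "0 \<le> T" "T \<le> F" unfolding T_def using t x5 nz by auto
  \<comment> \<open>Since 1 - 3/(x+1) and 1 + 3/(x+1) multiply to 1 - 9/(x+1)^2, the first-order
    correction cancels when t is expressed by T.\<close>
  have "F - t + 3 / (x + 1) * t = F - T + 9 / (x + 1)\<^sup>2 * T"
  proof -
    have "1 - 9 / (x + 1)\<^sup>2 = (1 - 3 / (x + 1)) * ((x + 4) / (x + 1))"
      unfolding c[symmetric] by (simp add: algebra_simps power2_eq_square)
    then have "T - 9 / (x + 1)\<^sup>2 * T = (1 - 3 / (x + 1)) * t"
      unfolding tT by (metis left_diff_distrib mult.assoc mult_1)
    then show ?thesis by (simp add: left_diff_distrib)
  qed
  with a have a': "a \<le> F - T + 9 / (x + 1)\<^sup>2 * T" by simp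
  have Y0: "Y \<ge> 0" unfolding Y_def using x5 by simp
  have one: "(1 + 1 / (x - 1)) * t \<le> M * F"
  proof -
    have "(1 + 1 / (x - 1)) * t = x * (x + 4) / (x\<^sup>2 - 1) * T"
    proof -
      have "1 + 1 / (x - 1) = x / (x - 1)" using nz by (simp add: field_simps)
      moreover have "x\<^sup>2 - 1 = (x - 1) * (x + 1)" by (simp add: algebra_simps power2_eq_square)
      ultimately show ?thesis unfolding tT by simp
    qed
    also have "\<dots> \<le> M * T"
      using numeric_one[OF x5] T(1) unfolding M_def A1_def by (intro mult_right_mono) auto
    also have "\<dots> \<le> M * F"
    proof (rule mult_left_mono[OF T(2)])
      show "0 \<le> M" unfolding M_def A1_def using x5
        by (intro add_nonneg_nonneg divide_nonneg_nonneg mult_nonneg_nonneg A_numerator_bounds) auto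
    qed
    finally show ?thesis .
  qed
  have zero: "t + Y * a + Q * t \<le> K * F"
  proof -
    have "t + Y * a + Q * t \<le> t + Y * (F - T + 9 / (x + 1)\<^sup>2 * T) + Q * t"
      using a' Y0 by (intro add_right_mono add_left_mono mult_left_mono)
    also have "\<dots> = Y * (F - T) + (9 / (x + 1)\<^sup>2 * Y + (x + 4) / (x + 1) * (1 + Q)) * T"
      unfolding tT by (simp only: distrib_left distrib_right mult_1_left mult_1_right mult_ac add_ac)
    also have "\<dots> \<le> K * (F - T) + K * T"
      using T by (intro add_mono mult_right_mono numeric_zero[OF x5, folded K_def[unfolded A0_def] Y_def Q_def]) auto
    finally show ?thesis by (simp add: right_diff_distrib)
  qed
  have F0: "F \<ge> 0" using T by simp
  have "(1 + \<gamma> / (x - 1)) * t + (1 - \<gamma>) * (Y * a + Q * t)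
      = \<gamma> * ((1 + 1 / (x - 1)) * t) + (1 - \<gamma>) * (t + Y * a + Q * t)"
    by (simp add: algebra_simps)
  also have "\<dots> \<le> \<gamma> * (M * F) + (1 - \<gamma>) * (K * F)"
    using one zero \<gamma> by (intro add_mono mult_left_mono) auto
  also have "\<dots> = (1 + (x - 1) * ((1 - \<gamma>) * A0 + \<gamma> * A1 + (1 - \<gamma>) * (5 + 25 / x)) / x\<^sup>2) * F"
  proof -
    define r where "r = (x - 1) / x\<^sup>2"
    define e where "e = 5 + 25 / x"
    have r: "(x - 1) * y / x\<^sup>2 = r * y" for y by (simp add: r_def)
    show ?thesis unfolding M_def K_def e_def[symmetric] r by (simp add: algebra_simps)
  qed
  also have "\<dots> \<le> (1 + (x - 1) * (A_const \<gamma> N + C_const \<gamma> N) / x\<^sup>2) * F"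
    using C_const_ge[OF x(2) \<gamma>(2)] x5 F0 unfolding A_const_convex x(1)[symmetric] A0_def[symmetric] A1_def[symmetric]
    by (intro mult_right_mono add_left_mono divide_right_mono mult_left_mono) auto
  finally show ?thesis unfolding Y_def Q_def by simp
qed

subsection \<open>The recursion and its consequences\<close>

text \<open>Out of N units of F the loss takes 1 + (N - 1) X, where X is the quotient in the claim.
  This leaves (N - 1) (1 - X), which the prefactor N / (N - 1) of the conditioned form turns into 1
  - X. The range N >= 5 is that of the numerical comparison.\<close>

lemma gap_recursion:
  assumes n: "n \<ge> 4" and \<gamma>: "0 \<le> \<gamma>" "\<gamma> \<le> 1"
  shows "(1 - (A_const \<gamma> (Suc n) + C_const \<gamma> (Suc n)) / (real (Suc n))\<^sup>2) * spectral_gap \<gamma> n \<le> spectral_gap \<gamma> (Suc n)"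
proof (rule spectral_gap_geI)
  have n2: "n \<ge> 2" and n3: "n \<ge> 3" and N5: "Suc n \<ge> 5" using n by auto
  show "Suc n \<ge> 2" using n by simp
  fix f assume f: "adm (Suc n) f" and f0: "(LINT v|sph (Suc n). f v) = 0"
  interpret mean_zero n f by unfold_locales (rule n2 f f0)+
  let ?E = "LINT v|sph (Suc n). wt n (v (Suc n)) powr \<gamma> * (f v - \<phi> (v (Suc n)))\<^sup>2"
  define x where "x = real (Suc n)"
  define X where "X = (A_const \<gamma> (Suc n) + C_const \<gamma> (Suc n)) / x\<^sup>2"
  have nx: "real n + 1 = x" "real n = x - 1" "real n + 2 = x + 1" by (simp_all add: x_def)
  have x1: "x - 1 > 0" using n by (simp add: x_def)
  have t': "t \<le> (1 + 3 / (x + 1)) * F" using t_le unfolding nx(3) .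
  have a': "(nr (sph (Suc n)) h)\<^sup>2 \<le> F - t + 3 / (x + 1) * t" using h_norm unfolding nx(3) .
  note loss = loss_le[OF x_def N5 \<gamma> t_nonneg t' a', folded X_def]
  have "x * F - (1 + (x - 1) * X) * F \<le> x * ?E"
    using conditional_bound[OF n3 \<gamma>] loss unfolding nx(1,3) unfolding nx(2) by linarith
  then have E: "(x - 1) * (1 - X) * F \<le> x * ?E" by (simp add: algebra_simps)
  have gap: "0 \<le> spectral_gap \<gamma> n" by (rule spectral_gap_nonneg[OF n2])
  have "(1 - X) * spectral_gap \<gamma> n * F = spectral_gap \<gamma> n / (x - 1) * ((x - 1) * (1 - X) * F)"
    using x1 by simp
  also have "\<dots> \<le> spectral_gap \<gamma> n / (x - 1) * (x * ?E)"
    using gap x1 by (intro mult_left_mono E) auto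
  also have "\<dots> = real (Suc n) / real n * spectral_gap \<gamma> n * ?E" unfolding nx(2) x_def[symmetric] by simp
  also have "\<dots> \<le> dirichlet_form \<gamma> (Suc n) f"
    using dirichlet_form_conditional[OF f n2 \<gamma>(1)] unfolding \<phi>_def .
  finally show "(1 - (A_const \<gamma> (Suc n) + C_const \<gamma> (Suc n)) / (real (Suc n))\<^sup>2) * spectral_gap \<gamma> n * (LINT v|sph (Suc n). (f v)\<^sup>2)
      \<le> dirichlet_form \<gamma> (Suc n) f"
    unfolding F_def X_def x_def .
qed

text \<open>For \<open>N = 3\<close> the factor is negative.\<close>

lemma gap_recursion_three:
  assumes \<gamma>: "0 \<le> \<gamma>" "\<gamma> \<le> 1"
  shows "(1 - (A_const \<gamma> 3 + C_const \<gamma> 3) / (real 3)\<^sup>2) * spectral_gap \<gamma> 2 \<le> spectral_gap \<gamma> 3"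
proof -
  have "A_const \<gamma> 3 = (53784 - 34668 * \<gamma>) / 288"
    by (simp add: A_const_def p_poly_def q_poly_def r_poly_def)
  also have "\<dots> \<ge> 9" using \<gamma> by simp
  finally have "1 - (A_const \<gamma> 3 + C_const \<gamma> 3) / (real 3)\<^sup>2 \<le> 0"
    using C_const_nonneg[OF \<gamma>(2), of 3] by simp
  then show ?thesis
    using mult_nonpos_nonneg[OF _ spectral_gap_nonneg[of 2 \<gamma>]] spectral_gap_nonneg[of 3 \<gamma>] by (smt (verit) numeral_le_iff semiring_norm)
qed

lemma gap_one_factor_pos:
  assumes "j \<ge> 3"
  shows "0 < 1 - (4 * real j + 1) / ((real j - 1)\<^sup>2 * (real j + 1))"
proof -
  obtain u where u: "u \<ge> 0" "real j = u + 3" using assms that[of "real j - 3"] by simp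
  have "(real j - 1)\<^sup>2 * (real j + 1) - (4 * real j + 1) = 3 + 16 * u + 8 * u ^ 2 + u ^ 3"
    unfolding u(2) by algebra
  also have "\<dots> > 0" using u(1) by (intro add_pos_nonneg) auto
  finally have "4 * real j + 1 < (real j - 1)\<^sup>2 * (real j + 1)" by simp
  moreover have "(real j - 1)\<^sup>2 * (real j + 1) > 0" using assms by (intro mult_pos_pos) auto
  ultimately show ?thesis by simp
qed

lemma gap_one_ge:
  assumes "N \<ge> 2"
  shows "4 * (\<Prod>j=3..N. 1 - (4 * real j + 1) / ((real j - 1)\<^sup>2 * (real j + 1))) \<le> spectral_gap 1 N"
  using assms
proof (induction N rule: dec_induct)
  case base
  then show ?case using gap_two by simp
next
  case (step m)
  let ?k = "\<lambda>j::nat. 1 - (4 * real j + 1) / ((real j - 1)\<^sup>2 * (real j + 1))"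
  have "4 * prod ?k {3..Suc m} = ?k (Suc m) * (4 * prod ?k {3..m})"
    using step.hyps by (simp add: prod.nat_ivl_Suc' del: of_nat_Suc)
  also have "\<dots> \<le> ?k (Suc m) * spectral_gap 1 m"
    using step gap_one_factor_pos[of "Suc m"] by (intro mult_left_mono) auto
  also have "\<dots> \<le> spectral_gap 1 (Suc m)" by (rule gap_recursion_one) (use step.hyps in simp)
  finally show ?case .
qed

lemma gap_ge_product:
  assumes \<gamma>: "0 \<le> \<gamma>" "\<gamma> \<le> 1" and N0: "N0 \<ge> 5"
    and small: "\<And>N. N \<ge> N0 \<Longrightarrow> A_const \<gamma> N + C_const \<gamma> N < (real N)\<^sup>2"
  defines "B \<equiv> 4 * real N0 powr (\<gamma> - 1) * (\<Prod>j=3..N0. 1 - (4 * real j + 1) / ((real j - 1)\<^sup>2 * (real j + 1)))"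
    and "c \<equiv> \<lambda>j. 1 - (A_const \<gamma> j + C_const \<gamma> j) / (real j)\<^sup>2"
  shows "B > 0" "\<And>j. j \<ge> N0 \<Longrightarrow> 0 < c j" "\<And>j. j \<ge> N0 \<Longrightarrow> c j \<le> 1"
    and "N \<ge> N0 \<Longrightarrow> B * (\<Prod>j=N0..N. c j) \<le> spectral_gap \<gamma> N"
proof -
  show B: "B > 0"
    unfolding B_def using N0 by (intro mult_pos_pos prod_pos gap_one_factor_pos) auto
  show c: "0 < c j" "c j \<le> 1" if "j \<ge> N0" for j
    using that N0 small[OF that] A_const_nonneg[OF _ \<gamma>, of j] C_const_nonneg[OF \<gamma>(2), of j] unfolding c_def by auto
  show "B * (\<Prod>j=N0..N. c j) \<le> spectral_gap \<gamma> N" if "N \<ge> N0"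
    using that
  proof (induction N rule: dec_induct)
    case base
    \<comment> \<open>The recursion starts contributing at N0 + 1; the extra factor
      \<open>c N0\<close> is at most 1 and only lowers the bound.\<close>
    have "B * c N0 \<le> B * 1" using B c[of N0] by (intro mult_left_mono) auto
    also have "B * 1 \<le> real N0 powr (\<gamma> - 1) * spectral_gap 1 N0"
      using mult_left_mono[OF gap_one_ge[of N0], of "real N0 powr (\<gamma> - 1)"] N0 by (simp add: B_def mult_ac)
    also have "\<dots> \<le> spectral_gap \<gamma> N0" using N0 by (intro spectral_gap_compare_one \<gamma>) simp
    finally show ?case by simp
  next
    case (step m)
    have "B * (\<Prod>j=N0..Suc m. c j) = c (Suc m) * (B * (\<Prod>j=N0..m. c j))"
      using step.hyps by (simp add: prod.nat_ivl_Suc')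
    also have "\<dots> \<le> c (Suc m) * spectral_gap \<gamma> m"
      using step c[of "Suc m"] by (intro mult_left_mono) auto
    also have "\<dots> \<le> spectral_gap \<gamma> (Suc m)"
      unfolding c_def using step.hyps N0 by (intro gap_recursion \<gamma>) simp
    finally show ?case .
  qed
qed

text \<open>A is a quotient of polynomials in which the numerator has degree at most 7 and the
  denominator degree 7, and C tends to (1 - \<gamma>) sqrt 30. Boundedness gives both A + C < N^2
  from some N on and the summability of (A + C) / N^2.\<close>

lemma constants_bounded:
  assumes \<gamma>: "0 \<le> \<gamma>" "\<gamma> \<le> 1"
  obtains K where "K > 0" "eventually (\<lambda>N. A_const \<gamma> N + C_const \<gamma> N \<le> K) sequentially"
proof -
  have "(\<lambda>N. A_const \<gamma> N) \<in> O(\<lambda>_. 1)"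
    unfolding A_const_def p_poly_def q_poly_def r_poly_def by real_asymp
  moreover have "(\<lambda>N. C_const \<gamma> N) \<in> O(\<lambda>_. 1)"
  proof -
    have "(\<lambda>N. (real N powr (5/2) / (real N - 1)^2 *
     (2 / (real N - 1) + 8 * real N / ((real N - 2) * (real N - 4)^2)) powr (1/2)) *
     (1 - 15 / ((real N + 1) * (real N + 3))) powr (-1/2)) \<in> O(\<lambda>_. 1)" by real_asymp
    then have "(\<lambda>N. sqrt 15 * (1 - \<gamma>) * ((real N powr (5/2) / (real N - 1)^2 *
     (2 / (real N - 1) + 8 * real N / ((real N - 2) * (real N - 4)^2)) powr (1/2)) *
     (1 - 15 / ((real N + 1) * (real N + 3))) powr (-1/2))) \<in> O(\<lambda>_. 1)"
      by (intro landau_o.big.mult_in_1[of "\<lambda>_. sqrt 15 * (1 - \<gamma>)"]) simp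
    then show ?thesis unfolding C_const_def by (simp add: mult_ac)
  qed
  ultimately have "(\<lambda>N. A_const \<gamma> N + C_const \<gamma> N) \<in> O(\<lambda>_. 1)" by (rule sum_in_bigo)
  then obtain K where K: "K > 0" "eventually (\<lambda>N. norm (A_const \<gamma> N + C_const \<gamma> N) \<le> K * norm (1 :: real)) sequentially"
    by (rule landau_o.bigE)
  show ?thesis by (rule that[OF K(1)]) (use K(2) in eventually_elim, simp)
qed

lemma constants_small:
  assumes \<gamma>: "0 \<le> \<gamma>" "\<gamma> \<le> 1"
  obtains M where "\<And>N. N \<ge> M \<Longrightarrow> A_const \<gamma> N + C_const \<gamma> N < (real N)\<^sup>2"
proof -
  obtain K where K: "eventually (\<lambda>N. A_const \<gamma> N + C_const \<gamma> N \<le> K) sequentially"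
    using constants_bounded[OF \<gamma>] by blast
  moreover have "eventually (\<lambda>N. K < (real N)\<^sup>2) sequentially" by real_asymp
  ultimately have "eventually (\<lambda>N. A_const \<gamma> N + C_const \<gamma> N < (real N)\<^sup>2) sequentially"
    by eventually_elim simp
  then show ?thesis using that unfolding eventually_sequentially by blast
qed

text \<open>With A + C <= K eventually, each factor differs from 1 by at most K / j^2 <= K / (j - 1)
  - K / j. This telescopes, and an N0 with K / (N0 - 1) <= 1/2 keeps every product at or above
  1/2.\<close>

lemma gap_liminf_pos:
  assumes \<gamma>: "0 \<le> \<gamma>" "\<gamma> \<le> 1"
  shows "liminf (\<lambda>N. ereal (spectral_gap \<gamma> N)) > 0"
proof -
  obtain K where K: "K > 0" "eventually (\<lambda>N. A_const \<gamma> N + C_const \<gamma> N \<le> K) sequentially"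
    using constants_bounded[OF \<gamma>] by blast
  then obtain M1 where M1: "\<And>N. N \<ge> M1 \<Longrightarrow> A_const \<gamma> N + C_const \<gamma> N \<le> K"
    unfolding eventually_sequentially by blast
  obtain M2 where M2: "\<And>N. N \<ge> M2 \<Longrightarrow> A_const \<gamma> N + C_const \<gamma> N < (real N)\<^sup>2"
    using constants_small[OF \<gamma>] by blast
  obtain M3 :: nat where M3: "2 * K \<le> real M3" using real_arch_simple by blast
  define N0 where "N0 = max (max M1 M2) (max 5 (M3 + 1))"
  have N0: "N0 \<ge> 5" "N0 \<ge> M1" "N0 \<ge> M2" "2 * K \<le> real N0 - 1" using M3 by (auto simp: N0_def)
  have small: "A_const \<gamma> N + C_const \<gamma> N < (real N)\<^sup>2" if "N \<ge> N0" for N using M2 N0 that by simp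
  define c where "c = (\<lambda>j. 1 - (A_const \<gamma> j + C_const \<gamma> j) / (real j)\<^sup>2)"
  define B where "B = 4 * real N0 powr (\<gamma> - 1) * (\<Prod>j=3..N0. 1 - (4 * real j + 1) / ((real j - 1)\<^sup>2 * (real j + 1)))"
  note B = gap_ge_product(1)[OF \<gamma> N0(1) small, folded B_def]
  have c: "0 < c j" "c j \<le> 1" if "j \<ge> N0" for j
    using gap_ge_product(2,3)[OF \<gamma> N0(1) small that] unfolding c_def by auto
  \<comment> \<open>The summand K / N carries the induction: since the product is at most 1, the
    next factor c lowers it by at most 1 - c, which is at most the decrease of K / N.\<close>
  have half: "1 - K / (real N0 - 1) + K / real N \<le> (\<Prod>j=N0..N. c j)" if "N \<ge> N0" for N
    using that
  proof (induction N rule: dec_induct)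
    have X: "1 - c (Suc m) \<le> K / real m - K / real (Suc m)" if "Suc m \<ge> N0" for m
    proof -
      have m: "real m > 0" using that N0(1) by simp
      have "1 - c (Suc m) \<le> K / (real (Suc m))\<^sup>2"
        unfolding c_def using M1[of "Suc m"] N0 that by (simp add: divide_right_mono)
      also have "\<dots> \<le> K / (real m * real (Suc m))"
        using K(1) m by (intro divide_left_mono) (auto simp: power2_eq_square)
      also have "\<dots> = K / real m - K / real (Suc m)" using m by (simp add: field_simps)
      finally show ?thesis .
    qed
    case base
    obtain m where m: "N0 = Suc m" using N0(1) by (cases N0) auto
    then have "real N0 - 1 = real m" by simp
    then show ?case using X[of m] m by simp
    case (step m)
    have "prod c {N0..m} \<le> 1" by (intro prod_le_1) (use c in \<open>auto intro: less_imp_le\<close>)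
    moreover have "0 \<le> 1 - c (Suc m)" using c(2)[of "Suc m"] step.hyps by simp
    ultimately have "prod c {N0..m} * (1 - c (Suc m)) \<le> 1 * (1 - c (Suc m))" by (intro mult_right_mono)
    then have "prod c {N0..m} - (1 - c (Suc m)) \<le> prod c {N0..m} * c (Suc m)" by (simp add: right_diff_distrib)
    also have "\<dots> = prod c {N0..Suc m}" using step.hyps by (simp add: prod.nat_ivl_Suc')
    finally show ?case using step.IH X[of m] step.hyps by simp
  qed
  have "eventually (\<lambda>N. ereal (B / 2) \<le> ereal (spectral_gap \<gamma> N)) sequentially"
    using eventually_ge_at_top[of N0]
  proof eventually_elim
    case (elim N)
    have "K / (real N0 - 1) \<le> 1 / 2" using N0 by (simp add: field_simps)
    moreover have "0 \<le> K / real N" using K(1) by simp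
    ultimately have "1 / 2 \<le> (\<Prod>j=N0..N. c j)" using half[OF elim] by linarith
    then have "B * (1 / 2) \<le> B * (\<Prod>j=N0..N. c j)" using B by (intro mult_left_mono) auto
    also have "\<dots> \<le> spectral_gap \<gamma> N" unfolding B_def c_def by (rule gap_ge_product(4)[OF \<gamma> N0(1) small elim])
    finally show ?case by simp
  qed
  then have "ereal (B / 2) \<le> liminf (\<lambda>N. ereal (spectral_gap \<gamma> N))" by (rule Liminf_bounded)
  moreover have "0 < ereal (B / 2)" using B by simp
  ultimately show ?thesis by (rule less_le_trans[rotated])
qed

theorem theorem1p4:
  fixes \<gamma> :: real
  assumes "0 \<le> \<gamma>" and "\<gamma> \<le> 1"
  shows
    "(\<forall>N::nat. N \<ge> 3 \<and> N \<noteq> 4 \<longrightarrow>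
        spectral_gap \<gamma> N \<ge>
          (1 - (A_const \<gamma> N + C_const \<gamma> N) / (real N)^2) * spectral_gap \<gamma> (N - 1)) \<and>
     (\<forall>N0::nat. N0 \<ge> 5 \<and> (\<forall>N\<ge>N0. A_const \<gamma> N + C_const \<gamma> N < (real N)^2) \<longrightarrow>
        (\<forall>N\<ge>N0.
           (let b = 4 * real N0 powr (\<gamma> - 1) *
                  (\<Prod>j=3..N0. 1 - (4 * real j + 1) / ((real j - 1)^2 * (real j + 1))) *
                  (\<Prod>j=N0..N. 1 - (A_const \<gamma> j + C_const \<gamma> j) / (real j)^2)
            in spectral_gap \<gamma> N \<ge> b \<and> b > 0))) \<and>
     (\<exists>M::nat. \<forall>N0\<ge>M. \<forall>N\<ge>N0. A_const \<gamma> N + C_const \<gamma> N < (real N)^2) \<and>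
     liminf (\<lambda>N. ereal (spectral_gap \<gamma> N)) > 0"
proof (intro conjI allI impI)
  fix N :: nat assume N: "N \<ge> 3 \<and> N \<noteq> 4"
  show "spectral_gap \<gamma> N \<ge> (1 - (A_const \<gamma> N + C_const \<gamma> N) / (real N)^2) * spectral_gap \<gamma> (N - 1)"
  proof (cases "N = 3")
    case True
    then show ?thesis using gap_recursion_three[OF assms] by simp
  next
    case False
    then obtain n where "N = Suc n" "n \<ge> 4" using N by (cases N) auto
    then show ?thesis using gap_recursion[OF _ assms, of n] by simp
  qed
next
  fix N0 N :: nat
  assume "N0 \<ge> 5 \<and> (\<forall>N\<ge>N0. A_const \<gamma> N + C_const \<gamma> N < (real N)^2)" and N: "N \<ge> N0"
  then have N0: "N0 \<ge> 5" and small: "\<And>N. N \<ge> N0 \<Longrightarrow> A_const \<gamma> N + C_const \<gamma> N < (real N)^2" by auto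
  note P = gap_ge_product[OF assms N0 small]
  show "let b = 4 * real N0 powr (\<gamma> - 1) *
                  (\<Prod>j=3..N0. 1 - (4 * real j + 1) / ((real j - 1)^2 * (real j + 1))) *
                  (\<Prod>j=N0..N. 1 - (A_const \<gamma> j + C_const \<gamma> j) / (real j)^2)
            in spectral_gap \<gamma> N \<ge> b \<and> b > 0"
    unfolding Let_def
  proof
    show "4 * real N0 powr (\<gamma> - 1) *
                  (\<Prod>j=3..N0. 1 - (4 * real j + 1) / ((real j - 1)^2 * (real j + 1))) *
                  (\<Prod>j=N0..N. 1 - (A_const \<gamma> j + C_const \<gamma> j) / (real j)^2) \<le> spectral_gap \<gamma> N"
      by (rule P(4)[OF _ N])
    show "0 < 4 * real N0 powr (\<gamma> - 1) *
                  (\<Prod>j=3..N0. 1 - (4 * real j + 1) / ((real j - 1)^2 * (real j + 1))) *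
                  (\<Prod>j=N0..N. 1 - (A_const \<gamma> j + C_const \<gamma> j) / (real j)^2)"
      by (intro mult_pos_pos[OF P(1)] prod_pos P(2)) auto
  qed
next
  show "\<exists>M::nat. \<forall>N0\<ge>M. \<forall>N\<ge>N0. A_const \<gamma> N + C_const \<gamma> N < (real N)^2"
    using constants_small[OF assms] by (meson order_trans)
  show "liminf (\<lambda>N. ereal (spectral_gap \<gamma> N)) > 0"
    by (rule gap_liminf_pos[OF assms])
qed

end
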